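(* Let $m\in\mathbb N_{\ge2}$ and let $r_m:=[\mathtt a,\mathtt b][\mathtt a,\mathtt b^{-m}]\in F(\{\mathtt a,\mathtt b\})$. Then $$\|G_{r_m}\|\le\frac{2m-4}{m-1}=4\cdot\Bigl(\operatorname{scl}_{\{\mathtt a,\mathtt b\}}(r_m)-\frac12\Bigr).$$ For $m\in\{2,3,4\}$, equality holds, i.e., $\|G_{r_2}\|=0$, $\|G_{r_3}\|=1$ and $\|G_{r_4}\|=\frac43$.
   Context: Here $[x,y]=xyx^{-1}y^{-1}$. For a set $S$, $F(S)$ is the free group on $S$, $F(S)'$ its commutator subgroup and $e$ the neutral element. For $r\in F(S)'\setminus\{e\}$ let $G_r:=\langle S\mid r\rangle$. Let $P_r$ be the presentation complex (one vertex, one $1$-cell for each element of $S$, one $2$-cell attached along $r$) and let $X_r$ be a classifying space of $G_r$ obtained from $P_r$ by attaching cells of dimension $\ge 3$, with inclusion $c_r\colon P_r\to X_r$. Since $r\in F(S)'$, the $2$-cell of $P_r$ defines a class $\widetilde\alpha_r\in H_2(P_r;\mathbb Z)$; the fundamental class is $\alpha_r:=H_2(c_r;\mathbb Z)(\widetilde\alpha_r)\in H_2(X_r;\mathbb Z)=H_2(G_r;\mathbb Z)$ (this group is infinite cyclic, generated by $\alpha_r$), and $\alpha_{r,\mathbb R}\in H_2(G_r;\mathbb R)$ is its image under change of coefficients. The simplicial volume of $G_r$ is $\|G_r\|:=\|\alpha_{r,\mathbb R}\|_1$, where $\|\alpha\|_1$ is the infimum of the $\ell^1$-norms (with respect to the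 basis of singular simplices) of all real singular cycles representing $\alpha$. For $w\in F(S)'$, $\operatorname{cl}_S(w)$ is the minimal $n\in\mathbb N$ such that $w$ is a product of $n$ commutators in $F(S)$, and $\operatorname{scl}_S(w):=\lim_{n\to\infty}\operatorname{cl}_S(w^n)/n$. *)

theory Defs
  imports "HOL-Algebra.Generated_Groups" "HOL-Analysis.Analysis" "HOL-Homology.Homology"
begin

section \<open>Free groups and commutators\<close>

text \<open>A letter \<open>(s, True)\<close> is the generator \<open>s\<close>, and \<open>(s, False)\<close> is its inverse.
  The elements of the free group are the reduced words.\<close>

type_synonym 's word = "('s \<times> bool) list"

definition inv_letter :: "'s \<times> bool \<Rightarrow> 's \<times> bool" where
  "inv_letter x = (fst x, \<not> snd x)"

definition reduced :: "'s word \<Rightarrow> bool" where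
  "reduced w \<longleftrightarrow> successively (\<lambda>x y. y \<noteq> inv_letter x) w"

definition cons_cancel :: "'s \<times> bool \<Rightarrow> 's word \<Rightarrow> 's word" where
  "cons_cancel x w = (if w \<noteq> [] \<and> hd w = inv_letter x then tl w else x # w)"

definition free_group :: "'s set \<Rightarrow> 's word monoid" where
  "free_group S = \<lparr>carrier = {w. reduced w \<and> fst ` set w \<subseteq> S},
     monoid.mult = foldr cons_cancel, one = []\<rparr>"

definition gen :: "'s \<Rightarrow> 's word" where
  "gen s = [(s, True)]"

definition commutator :: "('g, 'm) monoid_scheme \<Rightarrow> 'g \<Rightarrow> 'g \<Rightarrow> 'g" where
  "commutator G x y = x \<otimes>\<^bsub>G\<^esub> y \<otimes>\<^bsub>G\<^esub> inv\<^bsub>G\<^esub> x \<otimes>\<^bsub>G\<^esub> inv\<^bsub>G\<^esub> y"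

definition commutator_length :: "('g, 'm) monoid_scheme \<Rightarrow> 'g \<Rightarrow> nat" where
  "commutator_length G w =
     (LEAST n. \<exists>cs. length cs = n \<and>
        (\<forall>c \<in> set cs. \<exists>x \<in> carrier G. \<exists>y \<in> carrier G. c = commutator G x y) \<and>
        w = foldr (monoid.mult G) cs \<one>\<^bsub>G\<^esub>)"

definition scl :: "('g, 'm) monoid_scheme \<Rightarrow> 'g \<Rightarrow> real" where
  "scl G w = lim (\<lambda>n. real (commutator_length G (w [^]\<^bsub>G\<^esub> n)) / real n)"

text \<open>The laws of the free group.\<close>

lemma inv_letter_inv_letter [simp]: "inv_letter (inv_letter x) = x"
  by (simp add: inv_letter_def)

lemma inv_letter_neq [simp]: "inv_letter x \<noteq> x" "x \<noteq> inv_letter x"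
  by (auto simp: inv_letter_def prod_eq_iff)

lemma fst_inv_letter [simp]: "fst (inv_letter x) = fst x"
  by (simp add: inv_letter_def)

lemma reduced_Nil [simp]: "reduced []"
  by (simp add: reduced_def)

lemma reduced_Cons: "reduced (x # w) \<longleftrightarrow> (w = [] \<or> hd w \<noteq> inv_letter x) \<and> reduced w"
  by (cases w) (auto simp: reduced_def)

lemma reduced_cons_cancel: "reduced w \<Longrightarrow> reduced (cons_cancel x w)"
  by (cases w) (auto simp: cons_cancel_def reduced_Cons)

lemma set_cons_cancel: "fst ` set w \<subseteq> S \<Longrightarrow> fst x \<in> S \<Longrightarrow> fst ` set (cons_cancel x w) \<subseteq> S"
  by (cases w) (auto simp: cons_cancel_def)

lemma cons_cancel_inverse:
  "reduced w \<Longrightarrow> cons_cancel (inv_letter x) (cons_cancel x w) = w"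
  by (cases w; cases "tl w") (auto simp: cons_cancel_def reduced_Cons)

lemma cons_cancel_inverse':
  "reduced w \<Longrightarrow> cons_cancel x (cons_cancel (inv_letter x) w) = w"
  using cons_cancel_inverse[of w "inv_letter x"] by simp

lemma reduced_foldr: "reduced w \<Longrightarrow> reduced (foldr cons_cancel v w)"
  by (induction v) (auto intro: reduced_cons_cancel)

lemma set_foldr:
  "fst ` set w \<subseteq> S \<Longrightarrow> fst ` set v \<subseteq> S \<Longrightarrow> fst ` set (foldr cons_cancel v w) \<subseteq> S"
proof (induction v)
  case (Cons x v)
  then have "fst ` set (foldr cons_cancel v w) \<subseteq> S" "fst x \<in> S" by auto
  then show ?case using set_cons_cancel[of "foldr cons_cancel v w" S x] by simp
qed auto

lemma foldr_cons_cancel_step: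
  assumes "reduced w"
  shows "foldr cons_cancel (cons_cancel x v) w = cons_cancel x (foldr cons_cancel v w)"
proof (cases "v \<noteq> [] \<and> hd v = inv_letter x")
  case True
  then obtain v' where v: "v = inv_letter x # v'" by (cases v) auto
  show ?thesis
    by (simp add: v cons_cancel_def[of x "inv_letter x # v'"]
        cons_cancel_inverse'[OF reduced_foldr[OF assms]])
next
  case False
  then have "cons_cancel x v = x # v"
    unfolding cons_cancel_def by (rule if_not_P)
  then show ?thesis by simp
qed

lemma foldr_cons_cancel_assoc:
  "reduced w \<Longrightarrow>
     foldr cons_cancel (foldr cons_cancel u v) w = foldr cons_cancel u (foldr cons_cancel v w)"
  by (induction u) (auto simp: foldr_cons_cancel_step)

lemma foldr_cons_cancel_Nil: "reduced w \<Longrightarrow> foldr cons_cancel w [] = w"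
  by (induction w) (auto simp: reduced_Cons cons_cancel_def)

lemma reduced_rev_inv: "reduced w \<Longrightarrow> reduced (rev (map inv_letter w))"
  unfolding reduced_def successively_rev successively_map
  by (erule successively_mono) (metis inv_letter_inv_letter)

lemma foldr_cons_cancel_inverse:
  "reduced v \<Longrightarrow> foldr cons_cancel (rev (map inv_letter w)) (foldr cons_cancel w v) = v"
  by (induction w) (auto simp: cons_cancel_inverse reduced_foldr)

lemma group_free_group: "group (free_group S)"
proof (rule groupI)
  fix x assume x: "x \<in> carrier (free_group S)"
  let ?y = "rev (map inv_letter x)"
  have "?y \<in> carrier (free_group S)"
    using x by (auto simp: free_group_def reduced_rev_inv image_image)
  moreover have "?y \<otimes>\<^bsub>free_group S\<^esub> x = \<one>\<^bsub>free_group S\<^esub>"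
    using x foldr_cons_cancel_inverse[of "[]" x]
    by (simp add: free_group_def foldr_cons_cancel_Nil)
  ultimately show "\<exists>y \<in> carrier (free_group S). y \<otimes>\<^bsub>free_group S\<^esub> x = \<one>\<^bsub>free_group S\<^esub>" by blast
qed (simp_all add: free_group_def reduced_foldr foldr_cons_cancel_assoc set_foldr)


section \<open>One-relator groups and their presentation complexes\<close>

definition normal_closure :: "('g, 'm) monoid_scheme \<Rightarrow> 'g set \<Rightarrow> 'g set" where
  "normal_closure G R =
     generate G {g \<otimes>\<^bsub>G\<^esub> x \<otimes>\<^bsub>G\<^esub> inv\<^bsub>G\<^esub> g | g x. g \<in> carrier G \<and> x \<in> R}"

definition one_relator_group :: "'s set \<Rightarrow> 's word \<Rightarrow> 's word set monoid" where
  "one_relator_group S r = free_group S Mod normal_closure (free_group S) {r}"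

text \<open>The points of the presentation complex: the vertex, the points \<open>Edge s t\<close>
  (\<open>0 < t < 1\<close>) of the open 1-cells and the points \<open>Face z\<close> (\<open>norm z < 1\<close>) of the open
  2-cell.\<close>

datatype 's pc_point = Vertex | Edge 's real | Face complex

definition edge_map :: "'s \<Rightarrow> real \<Rightarrow> 's pc_point" where
  "edge_map s t = (if 0 < t \<and> t < 1 then Edge s t else Vertex)"

definition letter_path :: "'s \<times> bool \<Rightarrow> real \<Rightarrow> 's pc_point" where
  "letter_path x t = (if snd x then edge_map (fst x) t else edge_map (fst x) (1 - t))"

text \<open>The loop that runs through the letters of \<open>w\<close> one after the other, the \<open>i\<close>-th one on
  the interval from \<open>i / length w\<close> to \<open>(i + 1) / length w\<close>.\<close>

definition word_loop :: "'s word \<Rightarrow> real \<Rightarrow> 's pc_point" where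
  "word_loop w t =
     (if 0 \<le> t \<and> t < 1 \<and> w \<noteq> []
      then letter_path (w ! nat \<lfloor>t * real (length w)\<rfloor>) (frac (t * real (length w)))
      else Vertex)"

definition face_map :: "'s word \<Rightarrow> complex \<Rightarrow> 's pc_point" where
  "face_map r z = (if norm z < 1 then Face z else word_loop r (Arg2pi z / (2 * pi)))"

definition pc_skeleton :: "'s set \<Rightarrow> 's pc_point set" where
  "pc_skeleton S = {Vertex} \<union> {Edge s t | s t. s \<in> S \<and> 0 < t \<and> t < 1}"

definition pc_points :: "'s set \<Rightarrow> 's pc_point set" where
  "pc_points S = pc_skeleton S \<union> {Face z | z. norm z < 1}"

text \<open>The complex carries the final topology with respect to the characteristic maps of its
  cells.\<close>

definition presentation_complex :: "'s set \<Rightarrow> 's word \<Rightarrow> 's pc_point topology" where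
  "presentation_complex S r = topology (\<lambda>U. U \<subseteq> pc_points S \<and>
     (\<forall>s \<in> S. openin (top_of_set {0..1}) {t \<in> {0..1}. edge_map s t \<in> U}) \<and>
     openin (top_of_set (cball 0 1)) {z \<in> cball 0 1. face_map r z \<in> U})"

lemma istopology_preimage:
  "istopology (\<lambda>U. openin (top_of_set A) {x \<in> A. f x \<in> U})"
proof -
  have 1: "{x \<in> A. f x \<in> U \<inter> V} = {x \<in> A. f x \<in> U} \<inter> {x \<in> A. f x \<in> V}" for U V
    by auto
  have 2: "{x \<in> A. f x \<in> \<Union>K} = (\<Union>U \<in> K. {x \<in> A. f x \<in> U})" for K
    by auto
  show ?thesis
    unfolding istopology_def
  proof (intro conjI allI impI)
    fix U V
    assume "openin (top_of_set A) {x \<in> A. f x \<in> U}" "openin (top_of_set A) {x \<in> A. f x \<in> V}"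
    then show "openin (top_of_set A) {x \<in> A. f x \<in> U \<inter> V}"
      unfolding 1 by (rule openin_Int)
  next
    fix K
    assume "\<forall>U \<in> K. openin (top_of_set A) {x \<in> A. f x \<in> U}"
    then show "openin (top_of_set A) {x \<in> A. f x \<in> \<Union>K}"
      unfolding 2 by (intro openin_Union) blast
  qed
qed

lemma openin_presentation_complex:
  "openin (presentation_complex S r) U \<longleftrightarrow> U \<subseteq> pc_points S \<and>
     (\<forall>s \<in> S. openin (top_of_set {0..1}) {t \<in> {0..1}. edge_map s t \<in> U}) \<and>
     openin (top_of_set (cball 0 1)) {z \<in> cball 0 1. face_map r z \<in> U}"
proof -
  have *: "istopology (\<lambda>U. U \<subseteq> A \<and> (\<forall>s \<in> S. P s U) \<and> Q U)"
    if "\<And>s. istopology (P s)" "istopology Q" for A :: "'s pc_point set" and P Q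
    unfolding istopology_def
  proof (intro conjI allI impI)
    fix U V
    assume U: "U \<subseteq> A \<and> (\<forall>s \<in> S. P s U) \<and> Q U" and V: "V \<subseteq> A \<and> (\<forall>s \<in> S. P s V) \<and> Q V"
    show "U \<inter> V \<subseteq> A" using U by blast
    show "\<forall>s \<in> S. P s (U \<inter> V)" using U V that(1) unfolding istopology_def by blast
    show "Q (U \<inter> V)" using U V that(2) unfolding istopology_def by blast
  next
    fix K
    assume K: "\<forall>U \<in> K. U \<subseteq> A \<and> (\<forall>s \<in> S. P s U) \<and> Q U"
    show "\<Union>K \<subseteq> A" using K by blast
    show "\<forall>s \<in> S. P s (\<Union>K)" using K that(1) unfolding istopology_def by blast
    show "Q (\<Union>K)" using K that(2) unfolding istopology_def by blast
  qed
  have "istopology (\<lambda>U. U \<subseteq> pc_points S \<and>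
     (\<forall>s \<in> S. openin (top_of_set {0..1}) {t \<in> {0..1}. edge_map s t \<in> U}) \<and>
     openin (top_of_set (cball 0 1)) {z \<in> cball 0 1. face_map r z \<in> U})"
    by (intro * istopology_preimage)
  then show ?thesis
    by (simp only: presentation_complex_def topology_inverse')
qed

lemma edge_map_in_points: "s \<in> S \<Longrightarrow> edge_map s t \<in> pc_points S"
  by (auto simp: edge_map_def pc_points_def pc_skeleton_def)

lemma word_loop_in_points:
  assumes "fst ` set w \<subseteq> S"
  shows "word_loop w t \<in> pc_points S"
proof (cases "0 \<le> t \<and> t < 1 \<and> w \<noteq> []")
  case True
  then have "t * real (length w) < real (length w)" "0 \<le> t * real (length w)"
    by simp_all
  then have "nat \<lfloor>t * real (length w)\<rfloor> < length w"
    by linarith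
  then have "fst (w ! nat \<lfloor>t * real (length w)\<rfloor>) \<in> S"
    using assms nth_mem by blast
  then show ?thesis
    using True by (simp add: word_loop_def letter_path_def edge_map_in_points)
next
  case False
  then show ?thesis
    by (auto simp: word_loop_def pc_points_def pc_skeleton_def)
qed

lemma topspace_presentation_complex:
  assumes "r \<in> carrier (free_group S)"
  shows "topspace (presentation_complex S r) = pc_points S"
proof -
  have "face_map r z \<in> pc_points S" for z
    using assms word_loop_in_points[of r S]
    by (simp add: face_map_def free_group_def) (simp add: pc_points_def)
  then have "{z \<in> cball 0 1. face_map r z \<in> pc_points S} = cball 0 1"
    by auto
  moreover have "{t \<in> {0..1}. edge_map s t \<in> pc_points S} = {0..1}" if "s \<in> S" for s
    using that edge_map_in_points by auto
  ultimately have "openin (presentation_complex S r) (pc_points S)"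
    by (simp add: openin_presentation_complex)
  then show ?thesis
    using openin_subset[of "presentation_complex S r"] openin_topspace[of "presentation_complex S r"]
    unfolding openin_presentation_complex by (intro subset_antisym) blast+
qed


section \<open>Attaching cells and classifying spaces\<close>

definition disk :: "nat \<Rightarrow> (nat \<Rightarrow> real) topology" where
  "disk n = subtopology (Euclidean_space n) {x. (\<Sum>i<n. (x i)\<^sup>2) \<le> 1}"

definition open_disk :: "nat \<Rightarrow> (nat \<Rightarrow> real) set" where
  "open_disk n = {x \<in> topspace (Euclidean_space n). (\<Sum>i<n. (x i)\<^sup>2) < 1}"

text \<open>\<open>Z\<close> is obtained from \<open>Y\<close> by attaching (an arbitrary family of) \<open>n\<close>-cells, \<open>n \<ge> 1\<close>: it
  is the pushout along the restrictions to \<open>nsphere (n - 1)\<close> of the characteristic maps in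
  \<open>\<Phi>\<close>.\<close>

definition attaches_cells :: "nat \<Rightarrow> 'x topology \<Rightarrow> 'x topology \<Rightarrow> bool" where
  "attaches_cells n Y Z \<longleftrightarrow> (\<exists>\<Phi>.
     (\<forall>\<phi> \<in> \<Phi>. continuous_map (nsphere (n - 1)) Y \<phi> \<and> inj_on \<phi> (open_disk n) \<and>
        disjnt (\<phi> ` open_disk n) (topspace Y)) \<and>
     pairwise (\<lambda>\<phi> \<psi>. disjnt (\<phi> ` open_disk n) (\<psi> ` open_disk n)) \<Phi> \<and>
     topspace Z = topspace Y \<union> (\<Union>\<phi> \<in> \<Phi>. \<phi> ` open_disk n) \<and>
     (\<forall>C. closedin Z C \<longleftrightarrow> C \<subseteq> topspace Z \<and> closedin Y (C \<inter> topspace Y) \<and>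
        (\<forall>\<phi> \<in> \<Phi>. closedin (disk n) {x \<in> topspace (disk n). \<phi> x \<in> C})))"

text \<open>\<open>X\<close> is obtained from \<open>c(P)\<close>, a homeomorphic copy of \<open>P\<close>, by attaching cells of dimension
  greater than \<open>k\<close>, in the order of their dimensions; \<open>Y n\<close> is the \<open>n\<close>-skeleton.\<close>

definition attaches_cells_above :: "nat \<Rightarrow> 'p topology \<Rightarrow> 'x topology \<Rightarrow> ('p \<Rightarrow> 'x) \<Rightarrow> bool" where
  "attaches_cells_above k P X c \<longleftrightarrow> (\<exists>Y.
     homeomorphic_map P (Y k) c \<and>
     (\<forall>n \<ge> k. attaches_cells (Suc n) (Y n) (Y (Suc n))) \<and>
     topspace X = (\<Union>n \<in> {n. k \<le> n}. topspace (Y n)) \<and>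
     (\<forall>C. closedin X C \<longleftrightarrow>
        C \<subseteq> topspace X \<and> (\<forall>n \<ge> k. closedin (Y n) (C \<inter> topspace (Y n)))))"

definition loop_class :: "'x topology \<Rightarrow> 'x \<Rightarrow> (real \<Rightarrow> 'x) \<Rightarrow> (real \<Rightarrow> 'x) set" where
  "loop_class X x p =
     {q. homotopic_with (\<lambda>h. h 0 = x \<and> h 1 = x) (top_of_set {0..1}) X p q}"

definition concat_path :: "(real \<Rightarrow> 'x) \<Rightarrow> (real \<Rightarrow> 'x) \<Rightarrow> real \<Rightarrow> 'x" where
  "concat_path p q t = (if t \<le> 1/2 then p (2 * t) else q (2 * t - 1))"

definition fundamental_group :: "'x topology \<Rightarrow> 'x \<Rightarrow> (real \<Rightarrow> 'x) set monoid" where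
  "fundamental_group X x =
     \<lparr>carrier = {loop_class X x p | p. pathin X p \<and> p 0 = x \<and> p 1 = x},
      monoid.mult = (\<lambda>A B. \<Union>p \<in> A. \<Union>q \<in> B. loop_class X x (concat_path p q)),
      one = loop_class X x (\<lambda>_. x)\<rparr>"

definition trivial_higher_homotopy :: "'x topology \<Rightarrow> bool" where
  "trivial_higher_homotopy X \<longleftrightarrow> (\<forall>n \<ge> 2. \<forall>f. continuous_map (nsphere n) X f \<longrightarrow>
     (\<exists>x. homotopic_with (\<lambda>_. True) (nsphere n) X f (\<lambda>_. x)))"

text \<open>\<open>X\<close> is a classifying space of the one-relator group obtained from the presentation complex
  by attaching cells of dimension at least 3, with inclusion \<open>c\<close>. As usual, the fundamental
  group is identified with the one-relator group through the presentation: the class of the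
  generator \<open>s\<close> corresponds to the class of the 1-cell \<open>s\<close>.\<close>

definition one_relator_classifying_space ::
  "'s set \<Rightarrow> 's word \<Rightarrow> 'x topology \<Rightarrow> ('s pc_point \<Rightarrow> 'x) \<Rightarrow> bool" where
  "one_relator_classifying_space S r X c \<longleftrightarrow>
     attaches_cells_above 2 (presentation_complex S r) X c \<and>
     path_connected_space X \<and>
     (\<exists>\<phi> \<in> iso (one_relator_group S r) (fundamental_group X (c Vertex)).
        \<forall>s \<in> S. \<phi> (normal_closure (free_group S) {r} #>\<^bsub>free_group S\<^esub> gen s) =
          loop_class X (c Vertex) (c \<circ> edge_map s)) \<and>
     trivial_higher_homotopy X"


section \<open>The fundamental class\<close>

text \<open>A homeomorphism from the standard 2-simplex to the closed unit disk that maps the boundary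
  to the unit circle, with the vertices going to \<open>1, \<omega>, \<omega>\<^sup>2\<close> for \<open>\<omega> = cis (2 * pi / 3)\<close>: the
  affine map onto the triangle spanned by these points, followed by radial rescaling.\<close>

definition simplex_to_disk :: "(nat \<Rightarrow> real) \<Rightarrow> complex" where
  "simplex_to_disk x =
     (1 - 3 * Min {x 0, x 1, x 2}) *\<^sub>R
       sgn (\<Sum>j\<le>2. x j *\<^sub>R cis (2 * pi * real j / 3))"

definition face_simplex :: "'s word \<Rightarrow> (nat \<Rightarrow> real) \<Rightarrow> 's pc_point" where
  "face_simplex r = restrict (face_map r \<circ> simplex_to_disk) (standard_simplex 2)"

text \<open>The class in \<open>H\<^sub>2\<close> of the presentation complex defined by the 2-cell is the one that
  restricts to the relative class of the 2-cell modulo the 1-skeleton. It is unique because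
  \<open>H\<^sub>2\<close> of the 1-skeleton vanishes, and it exists because \<open>r\<close> lies in the commutator subgroup.\<close>

definition pc_fundamental_class :: "'s set \<Rightarrow> 's word \<Rightarrow> 's pc_point chain set" where
  "pc_fundamental_class S r =
     (let P = presentation_complex S r; P1 = pc_skeleton S in
      (THE \<alpha>. \<alpha> \<in> carrier (homology_group 2 P) \<and>
         hom_induced 2 P {} P P1 id \<alpha> = homologous_rel_set 2 P P1 (frag_of (face_simplex r))))"

definition fundamental_class ::
  "'s set \<Rightarrow> 's word \<Rightarrow> 'x topology \<Rightarrow> ('s pc_point \<Rightarrow> 'x) \<Rightarrow> 'x chain set" where
  "fundamental_class S r X c =
     hom_induced 2 (presentation_complex S r) {} X {} c (pc_fundamental_class S r)"


section \<open>Real singular chains and simplicial volume\<close>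

type_synonym 'x real_chain = "((nat \<Rightarrow> real) \<Rightarrow> 'x) \<Rightarrow>\<^sub>0 real"

definition real_singular_chain :: "nat \<Rightarrow> 'x topology \<Rightarrow> 'x real_chain \<Rightarrow> bool" where
  "real_singular_chain p X c \<longleftrightarrow> Poly_Mapping.keys c \<subseteq> singular_simplex_set p X"

text \<open>The real-linear extension of the integral boundary operator.\<close>

definition real_chain_boundary :: "nat \<Rightarrow> 'x real_chain \<Rightarrow> 'x real_chain" where
  "real_chain_boundary p c =
     (\<Sum>f \<in> Poly_Mapping.keys c. Poly_Mapping.map
        (\<lambda>k. Poly_Mapping.lookup c f * real_of_int k) (chain_boundary p (frag_of f)))"

definition l1_norm :: "'x real_chain \<Rightarrow> real" where
  "l1_norm c = (\<Sum>f \<in> Poly_Mapping.keys c. \<bar>Poly_Mapping.lookup c f\<bar>)"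

text \<open>As in the library, a homology class is the set of the cycles that represent it. The
  following is the set of real cycles that represent the image of the integral class \<open>\<alpha>\<close>.\<close>

definition change_of_coefficients :: "nat \<Rightarrow> 'x topology \<Rightarrow> 'x chain set \<Rightarrow> 'x real_chain set" where
  "change_of_coefficients p X \<alpha> =
     {d. real_singular_chain p X d \<and> real_chain_boundary p d = 0 \<and>
        (\<exists>z \<in> \<alpha>. \<exists>e. real_singular_chain (Suc p) X e \<and>
           d - Poly_Mapping.map real_of_int z = real_chain_boundary (Suc p) e)}"

definition l1_seminorm :: "'x real_chain set \<Rightarrow> real" where
  "l1_seminorm \<alpha> = (INF d \<in> \<alpha>. l1_norm d)"

text \<open>The simplicial volume of the one-relator group, computed in the classifying space \<open>X\<close>.\<close>

definition simplicial_volume ::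
  "'s set \<Rightarrow> 's word \<Rightarrow> 'x topology \<Rightarrow> ('s pc_point \<Rightarrow> 'x) \<Rightarrow> real" where
  "simplicial_volume S r X c =
     l1_seminorm (change_of_coefficients 2 X (fundamental_class S r X c))"

end

theory Submission
  imports Defs "HOL-Combinatorics.Orbits"
begin

text \<open>Let \<open>d = m - 1\<close>. For the upper bounds, \<open>r\<close> is rewritten so that for suitable \<open>U, V, g\<close> the word
  \<open>U\<^sup>g V\<close> is a product of \<open>2 d\<close> conjugates of \<open>r\<close>, while \<open>(U\<^sup>g)\<^sup>k V\<^sup>k\<close> is a product of only
  \<open>k (m - 2) + 5\<close> commutators, because three blocks \<open>x\<^sup>i y\<^sup>j\<close> merge into one at the cost of a single
  commutator. A relation that is a product of \<open>N\<close> conjugates of \<open>r\<close> (with sign) and of \<open>n\<close> commutators gives an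
  integral cycle with \<open>4 n + 2\<close> simplices in the class \<open>N \<alpha>\<close>, where the disc over the relation is obtained by filling horns.

  For the lower bounds, a gluing of faces labelled by \<open>r\<close> along a noncrossing matching is a surface; its
  Euler characteristic is computed from mod 2 cocycles and compared with the number of cycles of
  \<open>a\<close>-edges along which the exponents of \<open>b\<close> cancel, which a small linear program bounds. Applied to one face \<open>r\<^sup>k\<close> this
  gives the lower bound for the stable commutator length. Applied to triangles whose edges carry words it
  bounds the norm of every real cycle by its degree, which is read off from the Heisenberg group. The edges of
  singular simplices in \<open>X\<close> are labelled through the fundamental group, and the cup product of the
  exponent cocycles shows that the degree of a fundamental cycle is \<open>\<plusminus>1\<close>.\<close>

section \<open>Mod 2 cocycles on glued surfaces\<close>

text \<open>The upper and the lower bound for the simplicial volume meet for every m \<ge> 2, so the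
  values 2, 3 and 4 of m are not treated separately. The obstacle of the lower bound is the sign of
  the faces: a real cycle leads to surfaces with faces labelled by r and faces labelled by its
  inverse, and the degree controls only the signed number of faces, whereas the Euler characteristic
  sees all of them. The linear program therefore charges 1 / (m - 1) to a positive face and 2 - 1 /
  (m - 1) to a negative one. With these two prices the total number of faces turns into the signed
  number, with the factor 1 - 1 / (m - 1). The prices are valid only if no positive face is glued to
  a negative one along corresponding letters; hence such pairs of faces are first cancelled, which
  keeps the signed number. Coefficients mod 2 suffice because only numbers of vertices, edges and
  faces are compared; dimensions become cardinalities of finite sets.\<close>

definition wval :: "'s word \<Rightarrow> 's word" where
 "wval w = foldr cons_cancel w []"

definition winv :: "'s word \<Rightarrow> 's word" where
 "winv w = rev (map inv_letter w)"

lemma wval_Nil [simp]: "wval [] = []"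
 by (simp add: wval_def)

lemma reduced_wval [simp]: "reduced (wval w)"
 by (simp add: wval_def reduced_foldr)

lemma wval_append: "wval (u @ v) = foldr cons_cancel u (wval v)"
 by (simp add: wval_def)

lemma wval_reduced: "reduced w \<Longrightarrow> wval w = w"
 by (simp add: wval_def foldr_cons_cancel_Nil)

lemma wval_cancel: "wval (u @ x # inv_letter x # v) = wval (u @ v)"
 by (simp add: wval_append) (simp add: wval_def cons_cancel_inverse' reduced_foldr)

lemma trivial_word_cancels:
 assumes "wval w = []" "w \<noteq> []"
 obtains u x v where "w = u @ x # inv_letter x # v"
proof -
 have "\<not> reduced w" using assms wval_reduced by metis
 then obtain i where i: "Suc i < length w" "w ! Suc i = inv_letter (w ! i)"
  unfolding reduced_def successively_conv_nth by auto
 have "w = take i w @ w ! i # w ! Suc i # drop (Suc (Suc i)) w"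
  using i(1) by (metis Cons_nth_drop_Suc Suc_lessD id_take_nth_drop)
 then show ?thesis using that i(2) by metis
qed

text \<open>\<open>bool\<close> stands for the field with two elements and \<open>\<noteq>\<close>
  for its addition. A map from darts, that is directed edges, to \<open>bool\<close> is a 1-cochain,
  and \<open>psum\<close> is its sum over a set of darts.\<close>

definition psum :: "('d \<Rightarrow> bool) \<Rightarrow> 'd set \<Rightarrow> bool" where
 "psum x A = odd (card {d \<in> A. x d})"

lemma psum_empty [simp]: "psum x {} = False"
 by (simp add: psum_def)

lemma psum_insert:
 assumes "finite A" "d \<notin> A"
 shows "psum x (insert d A) = (x d \<noteq> psum x A)"
proof -
 have "{e \<in> insert d A. x e} = (if x d then insert d {e \<in> A. x e} else {e \<in> A. x e})" by auto
 then show ?thesis using assms by (auto simp: psum_def)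
qed

lemma psum_xor: "finite A \<Longrightarrow> psum (\<lambda>d. x d \<noteq> y d) A = (psum x A \<noteq> psum y A)"
 by (induction A rule: finite_induct) (auto simp: psum_insert)

lemma psum_cong: "A = B \<Longrightarrow> (\<And>d. d \<in> B \<Longrightarrow> x d = y d) \<Longrightarrow> psum x A = psum y B"
 unfolding psum_def by (metis (mono_tags, lifting) Collect_cong)

lemma psum_reindex:
 assumes "inj_on f A" "\<And>d. d \<in> A \<Longrightarrow> x (f d) = y d"
 shows "psum x (f ` A) = psum y A"
proof -
 have "{d \<in> f ` A. x d} = f ` {d \<in> A. y d}" using assms by auto
 moreover have "inj_on f {d \<in> A. y d}" using assms(1) by (rule inj_on_subset) auto
 ultimately show ?thesis by (simp add: psum_def card_image)
qed

text \<open>\<open>S d\<close> is the value of a vertex potential at the source of the dart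
  \<open>d\<close>. A walk says that the potential starts with \<open>c\<close>, changes by
  \<open>x d\<close> along each dart \<open>d\<close>, and ends with \<open>c'\<close>.\<close>

fun walk :: "('d \<Rightarrow> bool) \<Rightarrow> ('d \<Rightarrow> bool) \<Rightarrow> bool \<Rightarrow> 'd list \<Rightarrow> bool \<Rightarrow> bool" where
 "walk S x c [] c' = (c = c')"
| "walk S x c (d # ds) c' = (S d = c \<and> walk S x (c \<noteq> x d) ds c')"

lemma walk_append: "walk S x c (us @ vs) c' = (\<exists>k. walk S x c us k \<and> walk S x k vs c')"
 by (induction us arbitrary: c) auto

lemma walk_cong: "(\<And>d. d \<in> set ds \<Longrightarrow> S d = S' d \<and> x d = x' d) \<Longrightarrow> walk S x c ds c' = walk S' x' c ds c'"
 by (induction ds arbitrary: c) auto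

lemma walk_end: "distinct ds \<Longrightarrow> walk S x c ds c' \<Longrightarrow> c' = (c \<noteq> psum x (set ds))"
 by (induction ds arbitrary: c) (auto simp: psum_insert)

text \<open>\<open>g\<close> records the potential at the cut points between consecutive
  blocks.\<close>

lemma walk_concat:
 "walk S x c (concat (map bs [i..<n])) c' \<Longrightarrow> i \<le> n \<Longrightarrow>
   \<exists>g. g i = c \<and> g n = c' \<and> (\<forall>k \<in> {i..<n}. walk S x (g k) (bs k) (g (Suc k)))"
proof (induction n arbitrary: c')
 case 0
 then show ?case by (auto intro!: exI[of _ "\<lambda>_. c"])
next
 case (Suc n)
 show ?case
 proof (cases "i = Suc n")
  case True
  then show ?thesis using Suc.prems by (auto intro!: exI[of _ "\<lambda>_. c"])
 next
  case False
  then have "i \<le> n" using Suc.prems by auto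
  then obtain k where k: "walk S x c (concat (map bs [i..<n])) k" "walk S x k (bs n) c'"
   using Suc.prems(1) by (auto simp: walk_append)
  obtain g where g: "g i = c" "g n = k" "\<forall>k \<in> {i..<n}. walk S x (g k) (bs k) (g (Suc k))"
   using Suc.IH[OF k(1) \<open>i \<le> n\<close>] by auto
  show ?thesis
   using g k(2) \<open>i \<le> n\<close> by (intro exI[of _ "g(Suc n := c')"]) (auto simp: less_Suc_eq)
 qed
qed

text \<open>The way back along the mirror images undoes every change of the potential, so both ways
  pass through the same values.\<close>

lemma walk_reverse:
 assumes "walk S x c ds k" "walk S x k (rev (map \<kappa> ds)) c'" "\<forall>d \<in> set ds. x (\<kappa> d) = x d"
 shows "c' = c \<and> (\<forall>d \<in> set ds. S (\<kappa> d) = (S d \<noteq> x d))"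
 using assms
proof (induction ds arbitrary: c c')
 case (Cons d ds)
 then obtain l where l: "walk S x k (rev (map \<kappa> ds)) l" "walk S x l [\<kappa> d] c'"
  by (auto simp: walk_append)
 have "l = (c \<noteq> x d) \<and> (\<forall>d \<in> set ds. S (\<kappa> d) = (S d \<noteq> x d))"
  using Cons l by auto
 then show ?case using l Cons.prems by auto
qed auto

definition matching :: "'d set \<Rightarrow> ('d \<Rightarrow> 's \<times> bool) \<Rightarrow> ('d \<Rightarrow> 'd) \<Rightarrow> bool" where
 "matching D lab M \<longleftrightarrow>
   (\<forall>d \<in> D. M d \<in> D \<and> M (M d) = d \<and> M d \<noteq> d \<and> lab (M d) = inv_letter (lab d))"

text \<open>Gluing \<open>d\<close> to \<open>M d\<close> identifies the target of \<open>d\<close>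
  with the source of \<open>M d\<close>, and a potential with coboundary \<open>x\<close> has to
  respect this. The same predicate is used with the successor on a face in place of
  \<open>M\<close>.\<close>

definition compat :: "'d set \<Rightarrow> ('d \<Rightarrow> 'd) \<Rightarrow> ('d \<Rightarrow> bool) \<Rightarrow> ('d \<Rightarrow> bool) \<Rightarrow> bool" where
 "compat D M x S \<longleftrightarrow> (\<forall>d \<in> D. S (M d) = (S d \<noteq> x d))"

text \<open>Cancelling adjacent inverse letters one pair after the other glues the boundary of a
  polygon to a tree. On a tree every cochain that is symmetric under the gluing is a coboundary;
  \<open>S\<close> is its potential, whose initial value is free.\<close>

lemma noncrossing_matching:
 assumes "distinct ds" "wval (map lab ds) = []"
 shows "\<exists>M. matching (set ds) lab M \<and>
   (\<forall>x c. (\<forall>d \<in> set ds. x (M d) = x d) \<longrightarrow> (\<exists>S. walk S x c ds c \<and> compat (set ds) M x S))"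
 using assms
proof (induction "length ds" arbitrary: ds rule: less_induct)
 case less
 show ?case
 proof (cases "ds = []")
  case True
  then show ?thesis by (auto simp: matching_def compat_def)
 next
  case False
  then obtain u x v where uxv: "map lab ds = u @ x # inv_letter x # v"
   using trivial_word_cancels[OF less.prems(2)] False by (metis map_is_Nil_conv)
  obtain us ws where 1: "ds = us @ ws" "map lab us = u" "map lab ws = x # inv_letter x # v"
   using uxv by (auto simp: map_eq_append_conv)
  obtain d d' vs where 2: "ws = d # d' # vs" "lab d = x" "lab d' = inv_letter x" "map lab vs = v"
   using 1(3) by auto
  have ds: "ds = us @ d # d' # vs" using 1 2 by simp
  have "wval (map lab (us @ vs)) = []"
   using less.prems(2) uxv 1 2 by (simp add: wval_cancel)
  moreover have dis: "distinct (us @ vs)" "d \<notin> set (us @ vs)" "d' \<notin> set (us @ vs)" "d \<noteq> d'"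
   using less.prems(1) ds by auto
  ultimately obtain M where M: "matching (set (us @ vs)) lab M"
   "\<And>x c. (\<forall>e \<in> set (us @ vs). x (M e) = x e) \<Longrightarrow>
     \<exists>S. walk S x c (us @ vs) c \<and> compat (set (us @ vs)) M x S"
   using less.hyps[of "us @ vs"] ds by auto
  define M' where "M' = M(d := d', d' := d)"
  have M'1: "matching (set ds) lab M'"
   unfolding matching_def
  proof
   fix e assume "e \<in> set ds"
   then consider "e = d" | "e = d'" | "e \<in> set (us @ vs)" using ds by auto
   then show "M' e \<in> set ds \<and> M' (M' e) = e \<and> M' e \<noteq> e \<and> lab (M' e) = inv_letter (lab e)"
   proof cases
    case 3
    then have "M e \<in> set (us @ vs)" "M (M e) = e" "M e \<noteq> e" "lab (M e) = inv_letter (lab e)"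
     using M(1) by (auto simp: matching_def)
    moreover have "e \<noteq> d" "e \<noteq> d'" "M e \<noteq> d" "M e \<noteq> d'" using 3 dis calculation by auto
    ultimately show ?thesis using ds by (auto simp: M'_def)
   qed (use dis ds 2 in \<open>auto simp: M'_def\<close>)
  qed
  moreover have "\<exists>S. walk S x c ds c \<and> compat (set ds) M' x S"
   if x: "\<forall>e \<in> set ds. x (M' e) = x e" for x c
  proof -
   have "\<forall>e \<in> set (us @ vs). x (M e) = x e"
   proof
    fix e assume e: "e \<in> set (us @ vs)"
    then have "M' e = M e" using dis by (auto simp: M'_def)
    then show "x (M e) = x e" using bspec[OF x, of e] e ds by simp
   qed
   then obtain S where S: "walk S x c (us @ vs) c" "compat (set (us @ vs)) M x S"
    using M(2) by blast
   then obtain k where k: "walk S x c us k" "walk S x k vs c" by (auto simp: walk_append)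
   \<comment> \<open>The new pair of darts hangs at the vertex between \<open>us\<close> and
     \<open>vs\<close>, where the potential is \<open>k\<close>.\<close>
   define S' where "S' = S(d := k, d' := (k \<noteq> x d))"
   have eq: "S' e = S e" if "e \<in> set (us @ vs)" for e using that dis by (auto simp: S'_def)
   have xd: "x d' = x d" using bspec[OF x, of d] ds dis(4) by (simp add: M'_def)
   have "walk S' x c us k" using k(1) by (subst walk_cong[of _ S' S x x]) (auto simp: eq)
   moreover have "walk S' x k vs c" using k(2) by (subst walk_cong[of _ S' S x x]) (auto simp: eq)
   ultimately have "walk S' x c ds c"
    unfolding ds walk_append using xd dis by (intro exI[of _ k]) (auto simp: S'_def)
   moreover have "compat (set ds) M' x S'"
    unfolding compat_def
   proof
    fix e assume "e \<in> set ds"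
    then consider "e = d" | "e = d'" | "e \<in> set (us @ vs)" using ds by auto
    then show "S' (M' e) = (S' e \<noteq> x e)"
    proof cases
     case 3
     then have "M e \<in> set (us @ vs)" using M(1) by (auto simp: matching_def)
     moreover have "M' e = M e" using 3 dis by (auto simp: M'_def)
     ultimately show ?thesis using S(2) 3 eq by (auto simp: compat_def)
    qed (use dis xd in \<open>auto simp: M'_def S'_def\<close>)
   qed
   ultimately show ?thesis by blast
  qed
  ultimately show ?thesis by blast
 qed
qed

section \<open>Elimination of auxiliary darts\<close>

definition additive :: "(('d \<Rightarrow> bool) \<Rightarrow> bool) \<Rightarrow> bool" where
 "additive X \<longleftrightarrow> (\<forall>x y. X (\<lambda>d. x d \<noteq> y d) = (X x \<noteq> X y))"

text \<open>Mod 2 cocycles on a surface that is glued from the faces in \<open>\<F>\<close> along \<open>M\<close>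
 (and whose auxiliary darts \<open>A\<close> are glued along \<open>\<kappa>\<close>) are coboundaries as soon as the functionals
 \<open>X e\<close> vanish on them; so the first Betti number is at most the number of functionals.\<close>

definition betti_bound :: "'d set \<Rightarrow> ('d \<Rightarrow> 'd) \<Rightarrow> ('d \<Rightarrow> 'd) \<Rightarrow> ('d \<Rightarrow> 'd) \<Rightarrow> 'd set set \<Rightarrow>
  'e set \<Rightarrow> ('e \<Rightarrow> ('d \<Rightarrow> bool) \<Rightarrow> bool) \<Rightarrow> bool" where
 "betti_bound A \<kappa> M nx \<F> \<Xi> X \<longleftrightarrow> (\<forall>e \<in> \<Xi>. additive (X e)) \<and>
  (\<forall>x. (\<forall>d \<in> A \<union> \<Union>\<F>. x (M d) = x d) \<and> (\<forall>d \<in> A. x (\<kappa> d) = x d) \<and>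
    (\<forall>B \<in> \<F>. \<not> psum x B) \<and> (\<forall>e \<in> \<Xi>. \<not> X e x) \<longrightarrow>
    (\<exists>S. compat (A \<union> \<Union>\<F>) M x S \<and> compat A \<kappa> x S \<and> compat (\<Union>\<F>) nx x S))"

lemma compat_mono:
 assumes "compat D M x S" "D' \<subseteq> D" "\<And>e. e \<in> D' \<Longrightarrow> x' e = x e"
 shows "compat D' M x' S"
 unfolding compat_def
proof
 fix e assume "e \<in> D'"
 then have "S (M e) = (S e \<noteq> x e)" "x' e = x e" using assms by (auto simp: compat_def)
 then show "S (M e) = (S e \<noteq> x' e)" by simp
qed

lemma betti_boundD:
 assumes "betti_bound A \<kappa> M nx \<F> \<Xi> X" "\<forall>d \<in> A \<union> \<Union>\<F>. x (M d) = x d" "\<forall>d \<in> A. x (\<kappa> d) = x d"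
  "\<forall>B \<in> \<F>. \<not> psum x B" "\<forall>e \<in> \<Xi>. \<not> X e x"
 shows "\<exists>S. compat (A \<union> \<Union>\<F>) M x S \<and> compat A \<kappa> x S \<and> compat (\<Union>\<F>) nx x S"
 using assms unfolding betti_bound_def by simp

lemma eliminate_pair:
 assumes bb: "betti_bound A \<kappa> M nx \<F> \<Xi> X"
  and M: "matching (A \<union> \<Union>\<F>) lab M" and K: "matching A lab \<kappa>"
  and disj: "A \<inter> \<Union>\<F> = {}" and d: "d \<in> A"
 shows "\<exists>M' X'. betti_bound (A - {d, \<kappa> d}) \<kappa> M' nx \<F> \<Xi> X' \<and>
   matching (A - {d, \<kappa> d} \<union> \<Union>\<F>) lab M' \<and> matching (A - {d, \<kappa> d}) lab \<kappa>"
proof -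
 define d' where "d' = \<kappa> d"
 define D where "D = A \<union> \<Union>\<F>"
 define D' where "D' = A - {d, d'} \<union> \<Union>\<F>"
 have d': "d' \<in> A" "\<kappa> d' = d" "d' \<noteq> d" "lab d' = inv_letter (lab d)"
  using K d by (auto simp: matching_def d'_def)
 have D': "D' = D - {d, d'}" using disj d d' by (auto simp: D_def D'_def)
 have dD: "d \<in> D" "d' \<in> D" using d d' by (auto simp: D_def)
 have MD: "M e \<in> D" "M (M e) = e" "M e \<noteq> e" "lab (M e) = inv_letter (lab e)" if "e \<in> D" for e
  using M that by (auto simp: matching_def D_def)
 have K': "matching (A - {d, d'}) lab \<kappa>"
  unfolding matching_def
 proof
  fix e assume e: "e \<in> A - {d, d'}"
  have "\<kappa> e \<noteq> d" "\<kappa> e \<noteq> d'" using e K d' unfolding matching_def by (metis DiffD1 DiffD2 insertCI d'_def)+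
  then show "\<kappa> e \<in> A - {d, d'} \<and> \<kappa> (\<kappa> e) = e \<and> \<kappa> e \<noteq> e \<and> lab (\<kappa> e) = inv_letter (lab e)"
   using e K by (auto simp: matching_def)
 qed
 show ?thesis
 proof (cases "M d = d'")
  case True
  then have Md': "M d' = d" using MD dD by metis
  have stay: "M e \<in> D'" if "e \<in> D'" for e
   using that MD[of e] True Md' unfolding D' by (metis Diff_iff insert_iff empty_iff)
  have M': "matching D' lab M" using stay MD unfolding matching_def D' by auto
  \<comment> \<open>The pair is glued to itself by \<open>M\<close> as well, so its value is
    independent of all other darts and may be set to 0.\<close>
  define ext where "ext x = (\<lambda>e. if e = d \<or> e = d' then False else x e)" for x :: "'a \<Rightarrow> bool"
  have "betti_bound (A - {d, d'}) \<kappa> M nx \<F> \<Xi> (\<lambda>e x. X e (ext x))"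
   unfolding betti_bound_def
  proof (intro conjI ballI allI impI)
   fix e assume "e \<in> \<Xi>"
   then have "additive (X e)" using bb by (auto simp: betti_bound_def)
   moreover have "ext (\<lambda>d. x d \<noteq> y d) = (\<lambda>d. ext x d \<noteq> ext y d)" for x y by (auto simp: ext_def)
   ultimately show "additive (\<lambda>x. X e (ext x))" by (simp add: additive_def)
  next
   fix x assume x: "(\<forall>e \<in> A - {d, d'} \<union> \<Union>\<F>. x (M e) = x e) \<and> (\<forall>e \<in> A - {d, d'}. x (\<kappa> e) = x e) \<and>
    (\<forall>B \<in> \<F>. \<not> psum x B) \<and> (\<forall>e \<in> \<Xi>. \<not> X e (ext x))"
   have e1: "ext x e = x e" if "e \<in> D'" for e using that by (auto simp: ext_def D')
   have e2: "\<forall>e \<in> A \<union> \<Union>\<F>. ext x (M e) = ext x e"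
   proof
    fix e assume "e \<in> A \<union> \<Union>\<F>"
    then consider "e = d" | "e = d'" | "e \<in> D'" by (auto simp: D'_def)
    then show "ext x (M e) = ext x e"
     by cases (use True Md' stay e1 x in \<open>auto simp: ext_def D'_def\<close>)
   qed
   have e3: "\<forall>e \<in> A. ext x (\<kappa> e) = ext x e"
   proof
    fix e assume "e \<in> A"
    then consider "e = d" | "e = d'" | "e \<in> A - {d, d'}" by auto
    then show "ext x (\<kappa> e) = ext x e"
    proof cases
     case 3
     then have "\<kappa> e \<in> A - {d, d'}" using K' by (auto simp: matching_def)
     then show ?thesis using 3 x e1 by (auto simp: D'_def)
    qed (use d' in \<open>auto simp: ext_def d'_def\<close>)
   qed
   have "\<forall>B \<in> \<F>. \<not> psum (ext x) B"
   proof
    fix B assume "B \<in> \<F>"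
    then have "psum (ext x) B = psum x B" using e1 by (intro psum_cong[OF refl]) (auto simp: D'_def)
    then show "\<not> psum (ext x) B" using x \<open>B \<in> \<F>\<close> by auto
   qed
   then obtain S where S: "compat (A \<union> \<Union>\<F>) M (ext x) S" "compat A \<kappa> (ext x) S" "compat (\<Union>\<F>) nx (ext x) S"
    using betti_boundD[OF bb e2 e3] x by meson
   show "\<exists>S. compat (A - {d, d'} \<union> \<Union>\<F>) M x S \<and> compat (A - {d, d'}) \<kappa> x S \<and> compat (\<Union>\<F>) nx x S"
   proof (intro exI conjI)
    show "compat (A - {d, d'} \<union> \<Union>\<F>) M x S" by (rule compat_mono[OF S(1)]) (use e1 in \<open>auto simp: D'_def\<close>)
    show "compat (A - {d, d'}) \<kappa> x S"
     by (rule compat_mono[OF S(2)]) (use e1 in \<open>auto simp: D'_def\<close>)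
    show "compat (\<Union>\<F>) nx x S"
     by (rule compat_mono[OF S(3)]) (use e1 in \<open>auto simp: D'_def\<close>)
   qed
  qed
  then have bb': "betti_bound (A - {d, \<kappa> d}) \<kappa> M nx \<F> \<Xi> (\<lambda>e x. X e (ext x))"
   unfolding d'_def .
  show ?thesis
   by (rule exI[of _ M], rule exI[of _ "\<lambda>e x. X e (ext x)"])
    (intro conjI bb' M'[unfolded D'_def d'_def] K'[unfolded d'_def])
 next
  case False
  define u where "u = M d"
  define v where "v = M d'"
  have Mu: "M u = d" "M v = d'" using MD dD by (auto simp: u_def v_def)
  have uD: "u \<in> D'" "v \<in> D'" "u \<noteq> v"
   using MD dD False d'(3) Mu unfolding D' u_def v_def by (metis Diff_iff insert_iff empty_iff)+
  have Mdd: "M d = u" "M d' = v" by (simp_all add: u_def v_def)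
  have une: "u \<noteq> d" "u \<noteq> d'" "v \<noteq> d" "v \<noteq> d'" using uD by (auto simp: D')
  define M' where "M' = M(u := v, v := u)"
  have stay: "M e \<in> D'" if "e \<in> D'" "e \<noteq> u" "e \<noteq> v" for e
   using that MD[of e] unfolding D' u_def v_def by (metis Diff_iff insert_iff empty_iff)
  have M': "matching D' lab M'"
   unfolding matching_def
  proof
   fix e assume e: "e \<in> D'"
   have lv: "lab v = inv_letter (lab u)" "lab u = inv_letter (lab v)"
    using MD(4) dD d' by (auto simp: u_def v_def)
   show "M' e \<in> D' \<and> M' (M' e) = e \<and> M' e \<noteq> e \<and> lab (M' e) = inv_letter (lab e)"
   proof (cases "e = u \<or> e = v")
    case True
    then show ?thesis using uD lv by (auto simp: M'_def)
   next
    case F: False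
    then have "M e \<noteq> u" "M e \<noteq> v" using MD e Mu D' by (metis Diff_iff insertCI)+
    then show ?thesis using F stay[OF e] MD[of e] e by (auto simp: M'_def D')
   qed
  qed
  \<comment> \<open>The darts \<open>u\<close>, \<open>d\<close>, \<open>d'\<close> and
    \<open>v\<close> are identified to one edge, so the extension takes the value of that
    edge.\<close>
  define ext where "ext x = (\<lambda>e. if e = d \<or> e = d' then x u else x e)" for x :: "'a \<Rightarrow> bool"
  have "betti_bound (A - {d, d'}) \<kappa> M' nx \<F> \<Xi> (\<lambda>e x. X e (ext x))"
   unfolding betti_bound_def
  proof (intro conjI ballI allI impI)
   fix e assume "e \<in> \<Xi>"
   then have "additive (X e)" using bb by (auto simp: betti_bound_def)
   moreover have "ext (\<lambda>d. x d \<noteq> y d) = (\<lambda>d. ext x d \<noteq> ext y d)" for x y by (auto simp: ext_def)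
   ultimately show "additive (\<lambda>x. X e (ext x))" by (simp add: additive_def)
  next
   fix x assume x: "(\<forall>e \<in> A - {d, d'} \<union> \<Union>\<F>. x (M' e) = x e) \<and> (\<forall>e \<in> A - {d, d'}. x (\<kappa> e) = x e) \<and>
    (\<forall>B \<in> \<F>. \<not> psum x B) \<and> (\<forall>e \<in> \<Xi>. \<not> X e (ext x))"
   have xuv: "x v = x u" using x uD by (auto simp: M'_def D'_def)
   have e1: "ext x e = x e" if "e \<in> D'" for e using that by (auto simp: ext_def D')
   have e2: "\<forall>e \<in> A \<union> \<Union>\<F>. ext x (M e) = ext x e"
   proof
    fix e assume "e \<in> A \<union> \<Union>\<F>"
    then consider "e = d" | "e = d'" | "e = u" | "e = v" | "e \<in> D'" "e \<noteq> u" "e \<noteq> v" by (auto simp: D'_def)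
    then show "ext x (M e) = ext x e"
    proof cases
     case 1
     then show ?thesis by (simp add: Mdd une ext_def)
    next
     case 2
     then show ?thesis by (simp add: Mdd une xuv ext_def)
    next
     case 3
     then show ?thesis by (simp add: Mu une ext_def)
    next
     case 4
     then show ?thesis by (simp add: Mu une xuv ext_def)
    next
     case 5
     then have "M' e = M e" by (simp add: M'_def)
     moreover have "x (M' e) = x e" using conjunct1[OF x] 5(1) unfolding D'_def by blast
     ultimately show ?thesis using e1[OF 5(1)] e1[OF stay[OF 5]] by simp
    qed
   qed
   have e3: "\<forall>e \<in> A. ext x (\<kappa> e) = ext x e"
   proof
    fix e assume "e \<in> A"
    then consider "e = d" | "e = d'" | "e \<in> A - {d, d'}" by auto
    then show "ext x (\<kappa> e) = ext x e"
    proof cases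
     case 3
     then have "\<kappa> e \<in> A - {d, d'}" using K' by (auto simp: matching_def)
     then show ?thesis using 3 x e1 by (auto simp: D'_def)
    qed (use d' in \<open>auto simp: ext_def d'_def\<close>)
   qed
   have "\<forall>B \<in> \<F>. \<not> psum (ext x) B"
   proof
    fix B assume "B \<in> \<F>"
    then have "psum (ext x) B = psum x B" using e1 by (intro psum_cong[OF refl]) (auto simp: D'_def)
    then show "\<not> psum (ext x) B" using x \<open>B \<in> \<F>\<close> by auto
   qed
   then obtain S where S: "compat (A \<union> \<Union>\<F>) M (ext x) S" "compat A \<kappa> (ext x) S" "compat (\<Union>\<F>) nx (ext x) S"
    using betti_boundD[OF bb e2 e3] x by meson
   have c1: "S (M e) = (S e \<noteq> ext x e)" if "e \<in> D" for e using S(1) that by (simp add: compat_def D_def)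
   have c2: "S d' = (S d \<noteq> x u)" using S(2) d by (simp add: compat_def d'_def ext_def)
   have uu: "u \<in> D" "v \<in> D" using uD by (simp_all add: D')
   have s1: "S d = (S u \<noteq> x u)" using c1[OF uu(1)] Mu(1) e1[OF uD(1)] by simp
   have s2: "S d' = (S v \<noteq> x u)" using c1[OF uu(2)] Mu(2) e1[OF uD(2)] xuv by simp
   have s3: "S v = (S u \<noteq> x u)" "S u = (S v \<noteq> x v)" unfolding xuv using c2 s1 s2 by argo+
   have Snew: "compat D' M' x S"
    unfolding compat_def
   proof
    fix e assume e: "e \<in> D'"
    show "S (M' e) = (S e \<noteq> x e)"
    proof (cases "e = u \<or> e = v")
     case True
     then show ?thesis using s3 uD(3) by (elim disjE) (simp_all add: M'_def)
    next
     case F: False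
     then have "M' e = M e" by (simp add: M'_def)
     then show ?thesis using c1[of e] e1[OF e] e by (simp add: D')
    qed
   qed
   show "\<exists>S. compat (A - {d, d'} \<union> \<Union>\<F>) M' x S \<and> compat (A - {d, d'}) \<kappa> x S \<and> compat (\<Union>\<F>) nx x S"
   proof (intro exI conjI)
    show "compat (A - {d, d'} \<union> \<Union>\<F>) M' x S" using Snew by (simp add: D'_def)
    show "compat (A - {d, d'}) \<kappa> x S"
     by (rule compat_mono[OF S(2)]) (use e1 in \<open>auto simp: D'_def\<close>)
    show "compat (\<Union>\<F>) nx x S"
     by (rule compat_mono[OF S(3)]) (use e1 in \<open>auto simp: D'_def\<close>)
   qed
  qed
  then have bb': "betti_bound (A - {d, \<kappa> d}) \<kappa> M' nx \<F> \<Xi> (\<lambda>e x. X e (ext x))"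
   unfolding d'_def .
  show ?thesis
   by (rule exI[of _ M'], rule exI[of _ "\<lambda>e x. X e (ext x)"])
    (intro conjI bb' M'[unfolded D'_def d'_def] K'[unfolded d'_def])
 qed
qed

lemma eliminate_all:
 assumes "finite A" "betti_bound A \<kappa> M nx \<F> \<Xi> X"
  "matching (A \<union> \<Union>\<F>) lab M" "matching A lab \<kappa>" "A \<inter> \<Union>\<F> = {}"
 shows "\<exists>M' X'. betti_bound {} \<kappa> M' nx \<F> \<Xi> X' \<and> matching (\<Union>\<F>) lab M'"
 using assms
proof (induction "card A" arbitrary: A M X rule: less_induct)
 case less
 show ?case
 proof (cases "A = {}")
  case True
  then show ?thesis using less.prems by auto
 next
  case False
  then obtain d where d: "d \<in> A" by auto
  obtain M' X' where *: "betti_bound (A - {d, \<kappa> d}) \<kappa> M' nx \<F> \<Xi> X'"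
   "matching (A - {d, \<kappa> d} \<union> \<Union>\<F>) lab M'" "matching (A - {d, \<kappa> d}) lab \<kappa>"
   using eliminate_pair[OF less.prems(2-5) d] by blast
  have "card (A - {d, \<kappa> d}) < card A"
   using d less.prems(1) by (intro psubset_card_mono) auto
  then show ?thesis
   using less.hyps[OF _ _ *] less.prems(1,5) by blast
 qed
qed

text \<open>Gaussian elimination: an equation that involves the unknown \<open>w\<close> serves to
  eliminate it. The unknowns will be the vertices of a surface, whose number is thereby bounded by
  the number of equations.\<close>

lemma nonzero_solution:
 fixes a :: "'c \<Rightarrow> 'v \<Rightarrow> real"
 assumes "finite C" "finite V" "card C < card V"
 shows "\<exists>h. (\<exists>v \<in> V. h v \<noteq> 0) \<and> (\<forall>c \<in> C. (\<Sum>v\<in>V. a c v * h v) = 0)"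
 using assms
proof (induction C arbitrary: V a rule: finite_induct)
 case empty
 then obtain v where "v \<in> V" by fastforce
 then show ?case by (intro exI[of _ "\<lambda>_. 1"]) auto
next
 case (insert c C)
 show ?case
 proof (cases "\<forall>v \<in> V. a c v = 0")
  case True
  obtain h where "\<exists>v \<in> V. h v \<noteq> 0" "\<forall>c \<in> C. (\<Sum>v\<in>V. a c v * h v) = 0"
   using insert.IH[of V a] insert.prems insert.hyps by auto
  then show ?thesis using True by (intro exI[of _ h]) auto
 next
  case False
  then obtain w where w: "w \<in> V" "a c w \<noteq> 0" by auto
  define a' where "a' e v = a e v - a e w * a c v / a c w" for e v
  have "card C < card (V - {w})" using insert.prems insert.hyps w(1) by auto
  then obtain h where h: "\<exists>v \<in> V - {w}. h v \<noteq> 0" "\<And>e. e \<in> C \<Longrightarrow> (\<Sum>v\<in>V - {w}. a' e v * h v) = 0"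
   using insert.IH[of "V - {w}" a'] insert.prems(1) by auto
  define h' where "h' = h(w := - (\<Sum>v\<in>V - {w}. a c v * h v) / a c w)"
  have s: "(\<Sum>v\<in>V. a e v * h' v) = a e w * h' w + (\<Sum>v\<in>V - {w}. a e v * h v)" for e
   using w(1) insert.prems(1) by (simp add: sum.remove h'_def)
  have "(\<Sum>v\<in>V. a c v * h' v) = 0"
   unfolding s using w by (simp add: h'_def)
  moreover have "(\<Sum>v\<in>V. a e v * h' v) = 0" if "e \<in> C" for e
  proof -
   have "(\<Sum>v\<in>V - {w}. a e v * h v) - a e w / a c w * (\<Sum>v\<in>V - {w}. a c v * h v) = 0"
    using h(2)[OF that] by (simp add: a'_def sum_subtractf sum_distrib_left algebra_simps)
   then show ?thesis unfolding s by (simp add: h'_def)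
  qed
  moreover have "\<exists>v \<in> V. h' v \<noteq> 0" using h(1) by (auto simp: h'_def)
  ultimately show ?thesis by (intro exI[of _ h']) auto
 qed
qed

text \<open>The dual solution of the linear program: \<open>s\<close> and \<open>t\<close> are the source and target types of the
 edges of a cycle, and the types \<open>0, 1, 2, 3\<close> have the values \<open>1, -m, -1, m\<close>.\<close>

lemma cycle_weight:
 fixes s t :: "'e \<Rightarrow> nat" and m :: nat
 assumes fin: "finite C" "C \<noteq> {}" and m: "m \<ge> 2"
  and types: "\<And>y. y \<in> C \<Longrightarrow> s y < 4" "\<And>y. y \<in> C \<Longrightarrow> t y < 4"
  and bal: "\<And>i. card {y \<in> C. s y = i} = card {y \<in> C. t y = i}"
  and cross: "\<And>i y y'. y \<in> C \<Longrightarrow> s y = i \<Longrightarrow> y' \<in> C \<Longrightarrow> s y' \<noteq> i \<Longrightarrow>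
    (\<exists>y \<in> C. s y = i \<and> t y \<noteq> i) \<and> (\<exists>y \<in> C. s y \<noteq> i \<and> t y = i)"
  and excl: "\<And>y. y \<in> C \<Longrightarrow> s y = 0 \<Longrightarrow> t y \<noteq> 2" "\<And>y. y \<in> C \<Longrightarrow> s y = 1 \<Longrightarrow> t y \<noteq> 3"
  and zero: "card {y \<in> C. s y = 0} + m * card {y \<in> C. s y = 3} =
    m * card {y \<in> C. s y = 1} + card {y \<in> C. s y = 2}"
 shows "1 \<le> (\<Sum>y\<in>C. if s y = 0 \<and> t y = 0 then 1 / (real m - 1)
   else if s y = 0 \<and> t y = 3 then 1 else if s y = 2 \<and> t y = 3 then 1 else 0)"
  (is "1 \<le> sum ?w C")
proof -
 have w0: "0 \<le> ?w y" for y using m by auto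
 define N where "N i = card {y \<in> C. s y = i}" for i
 note s4 = types(1)
 have N0: "N i = 0 \<longleftrightarrow> (\<forall>y \<in> C. s y \<noteq> i)" for i using fin(1) by (auto simp: N_def)
 show ?thesis
 \<comment> \<open>If type 3 occurs, so does another type, since edges of type 3 alone have a
   nonzero total value. Then some edge enters type 3 from outside. Type 1 is excluded as its source,
   and the sources 0 and 2 give weight 1.\<close>
 proof (cases "N 3 = 0")
  case False
  then obtain y3 where y3: "y3 \<in> C" "s y3 = 3" using N0 by auto
  have "\<exists>y \<in> C. s y \<noteq> 3"
  proof (rule ccontr)
   assume "\<not> ?thesis"
   then have "N 0 = 0" "N 1 = 0" "N 2 = 0" unfolding N0 by auto
   then show False using zero False m by (simp add: N_def[symmetric])
  qed
  then obtain y where y: "y \<in> C" "s y \<noteq> 3" "t y = 3" using cross[OF y3] by blast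
  have "s y \<noteq> 1" using excl(2)[OF y(1)] y(3) by blast
  then have "s y = 0 \<or> s y = 2" using y(2) s4[OF y(1)] by arith
  then have "?w y = 1" using y by auto
  moreover have "?w y \<le> sum ?w C" by (rule member_le_sum) (use y fin w0 in auto)
  ultimately show ?thesis by linarith
 next
  case N3: True
  have z: "N 0 = m * N 1 + N 2" using zero N3 by (simp add: N_def)
  \<comment> \<open>Without type 3 every edge from type 0 ends in type 0 or 1, and at most
    \<open>N 1\<close> of them end in type 1. As the values cancel, at least
    \<open>(m - 1) * N 1\<close> edges run from type 0 to itself.\<close>
  define Z where "Z = {y \<in> C. s y = 0 \<and> t y = 0}"
  have t: "t y = 0 \<or> t y = 1" if "y \<in> C" "s y = 0" for y
  proof -
   have "card {y \<in> C. t y = 3} = 0" using N3 bal[of 3] by (simp add: N_def)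
   then have "t y \<noteq> 3" using that fin(1) by auto
   then show ?thesis using excl(1)[OF that] types(2)[OF that(1)] by linarith
  qed
  have "N 0 = card (Z \<union> {y \<in> C. s y = 0 \<and> t y = 1})"
   unfolding N_def Z_def by (rule arg_cong[of _ _ card]) (use t in auto)
  also have "\<dots> \<le> card Z + card {y \<in> C. s y = 0 \<and> t y = 1}" by (rule card_Un_le)
  also have "card {y \<in> C. s y = 0 \<and> t y = 1} \<le> N 1"
   unfolding N_def bal[of 1] by (rule card_mono) (use fin in auto)
  finally have Z: "N 0 \<le> card Z + N 1" by simp
  have "(\<Sum>y\<in>C. ?w y) \<ge> sum ?w Z"
   by (rule sum_mono2) (use fin w0 in \<open>auto simp: Z_def\<close>)
  moreover have "sum ?w Z = card Z * (1 / (real m - 1))"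
   by (simp add: Z_def)
  ultimately have ge: "card Z / (real m - 1) \<le> sum ?w C" by simp
  show ?thesis
  proof (cases "N 1 = 0")
   case False
   have "m * N 1 \<le> card Z + N 1" using Z z by linarith
   then have "real m * real (N 1) \<le> card Z + real (N 1)"
    by (metis of_nat_add of_nat_le_iff of_nat_mult)
   then have "(real m - 1) * real (N 1) \<le> card Z" by (simp add: algebra_simps)
   moreover have "(real m - 1) * 1 \<le> (real m - 1) * real (N 1)"
    using False m by (intro mult_left_mono) auto
   ultimately have "1 \<le> card Z / (real m - 1)" using m by (simp add: field_simps)
   then show ?thesis using ge by linarith
  next
   \<comment> \<open>This case is impossible: types 0 and 2 would both occur, but an edge that
     leaves type 0 would have to end in type 1.\<close>
   case N1: True
   have e: "N 0 = N 2" using z N1 by simp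
   obtain y where y: "y \<in> C" using fin by auto
   have "N 0 \<noteq> 0 \<and> N 2 \<noteq> 0"
   proof (rule ccontr)
    assume "\<not> ?thesis"
    then have "N 0 = 0" "N 2 = 0" using e by auto
    then show False using N1 N3 s4[OF y] y unfolding N0 by (auto simp: less_Suc_eq numeral_eq_Suc)
   qed
   then obtain y0 y2 where "y0 \<in> C" "s y0 = 0" "y2 \<in> C" "s y2 = 2" unfolding N0 by auto
   then obtain y where y: "y \<in> C" "s y = 0" "t y \<noteq> 0" using cross[of y0 0 y2] by auto
   then have "t y = 1" using t[OF y(1,2)] y(3) by blast
   then have "card {y \<in> C. t y = 1} \<noteq> 0" using y fin by auto
   then show ?thesis using N1 bal[of 1] by (simp add: N_def)
  qed
 qed
qed

lemma cycle_types:
 fixes f :: "'e \<Rightarrow> 'e" and tp :: "'e \<Rightarrow> nat" and m :: nat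
 assumes cyc: "cyclic_on f C" and inj: "inj_on f C" and m: "m \<ge> 2"
  and types: "\<And>y. y \<in> C \<Longrightarrow> tp y < 4"
 shows cycle_bal: "card {y \<in> C. tp y = i} = card {y \<in> C. tp (f y) = i}"
  and cycle_cross: "y \<in> C \<Longrightarrow> tp y = i \<Longrightarrow> y' \<in> C \<Longrightarrow> tp y' \<noteq> i \<Longrightarrow>
    (\<exists>y \<in> C. tp y = i \<and> tp (f y) \<noteq> i) \<and> (\<exists>y \<in> C. tp y \<noteq> i \<and> tp (f y) = i)"
proof -
 have fin: "finite C" using cyc by (rule finite_cyclic_on)
 have fC: "f y \<in> C" if "y \<in> C" for y using cyc that by (rule cyclic_on_inI)
 have im: "f ` C = C" using fin inj fC by (intro card_subset_eq) (auto simp: card_image)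
 have "{y \<in> C. tp y = i} = f ` {y \<in> C. tp (f y) = i}"
  using im fC by auto
 then show bal: "card {y \<in> C. tp y = i} = card {y \<in> C. tp (f y) = i}"
  using inj by (simp add: card_image inj_on_def)
 \<comment> \<open>A cycle has no proper nonempty invariant subset, so it enters and leaves every
   type of which it does not consist entirely.\<close>
 have closed: "B = C" if B: "B \<subseteq> C" "y \<in> B" "\<And>z. z \<in> B \<Longrightarrow> f z \<in> B" for B y
 proof -
  have "(f ^^ n) y \<in> B" for n by (induction n) (use B in auto)
  moreover have "C = orbit f y" using orbit_cyclic_eq3[OF cyc] B by auto
  ultimately show ?thesis using B(1) unfolding orbit_altdef by auto
 qed
 assume y: "y \<in> C" "tp y = i" "y' \<in> C" "tp y' \<noteq> i"
 show "(\<exists>y \<in> C. tp y = i \<and> tp (f y) \<noteq> i) \<and> (\<exists>y \<in> C. tp y \<noteq> i \<and> tp (f y) = i)"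
 proof
  show "\<exists>y \<in> C. tp y = i \<and> tp (f y) \<noteq> i"
   using closed[of "{y \<in> C. tp y = i}" y] y fC by auto
  show "\<exists>y \<in> C. tp y \<noteq> i \<and> tp (f y) = i"
   using closed[of "{y \<in> C. tp y \<noteq> i}" y'] y fC by auto
 qed
qed

text \<open>Adding a fixed element outside the kernel maps the complement of the kernel injectively
  into the kernel.\<close>

lemma card_kernel:
 fixes X :: "('d \<Rightarrow> bool) \<Rightarrow> bool"
 assumes "finite W" "\<And>x y. x \<in> W \<Longrightarrow> y \<in> W \<Longrightarrow> (\<lambda>d. x d \<noteq> y d) \<in> W" "additive X"
 shows "card W \<le> 2 * card {x \<in> W. \<not> X x}"
proof (cases "\<exists>w \<in> W. X w")
 case True
 then obtain w where w: "w \<in> W" "X w" by auto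
 have "card {x \<in> W. X x} \<le> card {x \<in> W. \<not> X x}"
 proof (rule card_inj_on_le)
  show "inj_on (\<lambda>x d. x d \<noteq> w d) {x \<in> W. X x}"
  proof (rule inj_onI)
   fix x y assume "(\<lambda>d. x d \<noteq> w d) = (\<lambda>d. y d \<noteq> w d)"
   then have *: "(x d \<noteq> w d) = (y d \<noteq> w d)" for d by (rule fun_cong)
   have "x d = y d" for d using *[of d] by argo
   then show "x = y" by (rule ext)
  qed
  show "(\<lambda>x d. x d \<noteq> w d) ` {x \<in> W. X x} \<subseteq> {x \<in> W. \<not> X x}"
   using assms w by (auto simp: additive_def)
 qed (use assms in auto)
 moreover have "card W = card {x \<in> W. X x} + card {x \<in> W. \<not> X x}"
  using assms(1) by (subst card_Un_disjoint[symmetric]) (auto intro!: arg_cong[of _ _ card])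
 ultimately show ?thesis by simp
next
 case False
 then have "{x \<in> W. \<not> X x} = W" by auto
 then show ?thesis by simp
qed

lemma card_kernels:
 fixes X :: "'e \<Rightarrow> ('d \<Rightarrow> bool) \<Rightarrow> bool"
 assumes "finite \<Xi>" "finite W" "\<And>x y. x \<in> W \<Longrightarrow> y \<in> W \<Longrightarrow> (\<lambda>d. x d \<noteq> y d) \<in> W"
  "\<forall>e \<in> \<Xi>. additive (X e)"
 shows "card W \<le> 2 ^ card \<Xi> * card {x \<in> W. \<forall>e \<in> \<Xi>. \<not> X e x}"
 using assms(1,4)
proof (induction \<Xi> rule: finite_induct)
 case (insert e \<Xi>)
 let ?W = "{x \<in> W. \<forall>e \<in> \<Xi>. \<not> X e x}"
 have "card ?W \<le> 2 * card {x \<in> ?W. \<not> X e x}"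
 proof (rule card_kernel)
  fix x y assume "x \<in> ?W" "y \<in> ?W"
  then show "(\<lambda>d. x d \<noteq> y d) \<in> ?W" using assms(3)[of x y] insert.prems by (simp add: additive_def)
 qed (use assms insert.prems in auto)
 also have "{x \<in> ?W. \<not> X e x} = {x \<in> W. \<forall>e \<in> insert e \<Xi>. \<not> X e x}" by auto
 finally show ?case using insert by (auto simp: field_simps intro: order_trans)
qed auto

text \<open>An Euler characteristic estimate: the vertices of the surface are the orbits of \<open>nx \<circ> M\<close>.\<close>

lemma euler_estimate:
 fixes X :: "'e \<Rightarrow> ('d \<Rightarrow> bool) \<Rightarrow> bool"
 assumes D: "finite D" "D \<noteq> {}" and M: "matching D lab M"
  and perm: "(nx \<circ> M) permutes D"
  and \<Xi>: "finite \<Xi>" "\<forall>e \<in> \<Xi>. additive (X e)"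
  and cob: "\<And>x. \<forall>d \<in> D. x (M d) = x d \<Longrightarrow> \<forall>e \<in> \<Xi>. \<not> X e x \<Longrightarrow>
    \<exists>S. compat D M x S \<and> compat D nx x S"
 shows "card {d \<in> D. snd (lab d)} + 1 \<le> card \<Xi> + card ((\<lambda>d. orbit (nx \<circ> M) d) ` D)"
proof -
 define T where "T = {d \<in> D. snd (lab d)}"
 \<comment> \<open>\<open>W\<close> is the space of cochains on the edges of the surface. Every edge
   has exactly one dart with a positive letter, so its dimension is \<open>card T\<close>.\<close>
 define W where "W = {x. (\<forall>d. d \<notin> D \<longrightarrow> \<not> x d) \<and> (\<forall>d \<in> D. x (M d) = x d)}"
 define V where "V = (\<lambda>d. orbit (nx \<circ> M) d) ` D"
 have MD: "M e \<in> D" "M (M e) = e" "snd (lab (M e)) \<longleftrightarrow> \<not> snd (lab e)" if "e \<in> D" for e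
  using M that by (auto simp: matching_def inv_letter_def)
 have bij: "bij_betw (\<lambda>x. {d \<in> T. x d}) W (Pow T)"
 proof (rule bij_betw_byWitness[where f' = "\<lambda>B d. d \<in> D \<and> (d \<in> B \<or> M d \<in> B)"])
  show "\<forall>x \<in> W. (\<lambda>d. d \<in> D \<and> (d \<in> {d \<in> T. x d} \<or> M d \<in> {d \<in> T. x d})) = x"
  proof (intro ballI ext)
   fix x d assume x: "x \<in> W"
   show "(d \<in> D \<and> (d \<in> {d \<in> T. x d} \<or> M d \<in> {d \<in> T. x d})) = x d"
   proof (cases "d \<in> D")
    case True
    then have "x (M d) = x d" using x by (simp add: W_def)
    then show ?thesis using MD[OF True] True by (auto simp: T_def)
   next
    case False
    then show ?thesis using x by (simp add: W_def)
   qed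
  qed
  show "\<forall>B \<in> Pow T. {d \<in> T. d \<in> D \<and> (d \<in> B \<or> M d \<in> B)} = B"
   using MD by (auto simp: T_def)
  show "(\<lambda>B d. d \<in> D \<and> (d \<in> B \<or> M d \<in> B)) ` Pow T \<subseteq> W"
   using MD by (auto simp: W_def T_def)
 qed auto
 have finT: "finite T" using D by (simp add: T_def)
 have cW: "card W = 2 ^ card T" using bij_betw_same_card[OF bij] finT by (simp add: card_Pow)
 have finW: "finite W" using bij_betw_finite[OF bij] finT by simp
 define Q where "Q = {x \<in> W. \<forall>e \<in> \<Xi>. \<not> X e x}"
 have "card W \<le> 2 ^ card \<Xi> * card Q"
  unfolding Q_def
 proof (rule card_kernels)
  fix x y assume "x \<in> W" "y \<in> W"
  then show "(\<lambda>d. x d \<noteq> y d) \<in> W" by (simp add: W_def)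
 qed (use \<Xi> finW in auto)
 \<comment> \<open>A cochain in \<open>Q\<close> together with an additive constant determines a
   potential, which is a set of vertices, and can be recovered from it. So the dimension of
   \<open>Q\<close> plus 1 is at most the number of vertices.\<close>
 moreover have "card (Q \<times> (UNIV :: bool set)) \<le> card (Pow V)"
 proof -
  have ex: "\<forall>x \<in> Q. \<exists>S. compat D M x S \<and> compat D nx x S"
  proof
   fix x assume "x \<in> Q"
   then show "\<exists>S. compat D M x S \<and> compat D nx x S"
    by (intro cob) (simp_all add: Q_def W_def)
  qed
  obtain S where S: "\<And>x. x \<in> Q \<Longrightarrow> compat D M x (S x) \<and> compat D nx x (S x)"
   using bchoice[OF ex] by blast
  have inv: "S x d = S x e" if x: "x \<in> Q" and d: "d \<in> D" and e: "e \<in> orbit (nx \<circ> M) d" for x d e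
   using e
  proof (induction rule: orbit.induct)
   case base
   show ?case using S[OF x] d MD[OF d] x by (simp add: compat_def Q_def W_def) argo
  next
   case (step e)
   then have e: "e \<in> D" using permutes_orbit_subset[OF perm d] by blast
   then have "S x ((nx \<circ> M) e) = S x e" using S[OF x] MD[OF e] x by (simp add: compat_def Q_def W_def) argo
   then show ?case using step by simp
  qed
  have self: "d \<in> orbit (nx \<circ> M) d" for d
   using perm D(1) by (meson permutation_permutes permutation_self_in_orbit)
  define G where "G = (\<lambda>(x, c). {v \<in> V. \<exists>d \<in> v. S x d \<noteq> c})"
  have G: "orbit (nx \<circ> M) d \<in> G (x, c) \<longleftrightarrow> S x d \<noteq> c" if "x \<in> Q" "d \<in> D" for x c d
  proof -
   have "orbit (nx \<circ> M) d \<in> V" using that by (auto simp: V_def)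
   moreover have "(\<exists>e \<in> orbit (nx \<circ> M) d. S x e \<noteq> c) \<longleftrightarrow> S x d \<noteq> c"
    using inv[OF that] self[of d] by metis
   ultimately show ?thesis by (simp add: G_def)
  qed
  have "inj_on G (Q \<times> UNIV)"
  proof (rule inj_onI, clarify)
   fix x c y c' assume x: "x \<in> Q" and y: "y \<in> Q" and eq: "G (x, c) = G (y, c')"
   have 1: "(S x d \<noteq> c) = (S y d \<noteq> c')" if "d \<in> D" for d
    using G[OF x that, of c] G[OF y that, of c'] unfolding eq by argo
   have xd: "x d = (S x d \<noteq> S x (nx d))" "nx d \<in> D" if "x \<in> Q" "d \<in> D" for x d
   proof -
    have "S x (nx d) = (S x d \<noteq> x d)" using S[OF that(1)] that(2) by (simp add: compat_def)
    then show "x d = (S x d \<noteq> S x (nx d))" by argo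
    have "nx d = (nx \<circ> M) (M d)" using MD that by simp
    then show "nx d \<in> D" using MD that permutes_in_image[OF perm] by metis
   qed
   have "x d = y d" if "d \<in> D" for d
    using 1[OF that] 1[OF xd(2)[OF x that]] unfolding xd(1)[OF x that] xd(1)[OF y that] by argo
   moreover have "x d = y d" if "d \<notin> D" for d using x y that by (simp add: Q_def W_def)
   ultimately have "x = y" by (intro ext) blast
   moreover obtain d where "d \<in> D" using D by auto
   ultimately show "x = y \<and> c = c'" using 1[of d] by auto
  qed
  moreover have "G ` (Q \<times> UNIV) \<subseteq> Pow V" by (auto simp: G_def)
  moreover have "finite (Pow V)" using D by (simp add: V_def)
  ultimately show ?thesis by (rule card_inj_on_le)
 qed
 moreover have "card (Pow V) = 2 ^ card V" using D by (simp add: V_def card_Pow)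
 moreover have "card (Q \<times> (UNIV :: bool set)) = card Q * 2" by (simp add: card_cartesian_product)
 ultimately have "2 ^ card T * 2 \<le> 2 ^ card \<Xi> * (card Q * 2)" "card Q * 2 \<le> 2 ^ card V"
  using cW by auto
 then have "2 ^ card T * 2 \<le> 2 ^ card \<Xi> * (2 ^ card V :: nat)"
  by (meson le_trans mult_le_mono2)
 then have "(2::nat) ^ (card T + 1) \<le> 2 ^ (card \<Xi> + card V)" by (simp add: power_add)
 then have "card T + 1 \<le> card \<Xi> + card V" by (rule power_le_imp_le_exp[rotated]) simp
 then show ?thesis by (simp add: T_def V_def)
qed

text \<open>The solutions \<open>H\<close> are the sections of a local system on the graph of the \<open>b\<close>-edges whose
 monodromy along a \<open>b\<close>-edge is the multiplication by 2; on each component they form a space of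
 dimension at most 1, which vanishes if some closed path has nonzero exponent.\<close>

lemma potential_count:
 fixes e :: "'d \<Rightarrow> int"
 assumes D: "finite D" and perm: "(nx \<circ> M) permutes D" and nxD: "\<And>d. d \<in> D \<Longrightarrow> nx d \<in> D"
  and Y: "Y \<subseteq> D" and E: "E \<subseteq> D" and \<Psi>: "\<Psi> permutes Y"
  and trans: "\<And>H :: 'd \<Rightarrow> real. \<forall>d \<in> D. H (nx (M d)) = H d \<Longrightarrow> \<forall>d \<in> E. H (nx d) = 2 * H d \<Longrightarrow>
   (\<forall>y \<in> Y. H (nx (\<Psi> y)) = 2 powi e y * H (nx y)) \<and>
   ((\<forall>y \<in> Y. H (nx y) = 0) \<longrightarrow> (\<forall>d \<in> D. H d = 0))"
 shows "card ((\<lambda>d. orbit (nx \<circ> M) d) ` D) \<le> card E + card {C. (\<exists>y \<in> Y. C = orbit \<Psi> y) \<and> sum e C = 0}"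
proof (rule ccontr)
 define orb where "orb d = orbit (nx \<circ> M) d" for d
 define V where "V = orb ` D"
 define T where "T = {C. (\<exists>y \<in> Y. C = orbit \<Psi> y) \<and> sum e C = 0}"
 assume "\<not> ?thesis"
 then have less: "card E + card T < card V" by (simp add: V_def T_def orb_def)
 have finY: "finite Y" using D Y finite_subset by blast
 have finT: "finite T" by (rule finite_subset[of _ "orbit \<Psi> ` Y"]) (use finY in \<open>auto simp: T_def\<close>)
 have finE: "finite E" using D E finite_subset by blast
 \<comment> \<open>There is one equation for every edge in \<open>E\<close>, which expresses the
   monodromy, and one for every cycle in \<open>T\<close>, which lets the section vanish at a chosen
   place of the cycle. A nonzero solution is refuted below.\<close>
 define a :: "'d + 'd set \<Rightarrow> 'd set \<Rightarrow> real" where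
  "a c v = (case c of Inl d \<Rightarrow> of_bool (v = orb (nx d)) - 2 * of_bool (v = orb d)
    | Inr C \<Rightarrow> of_bool (v = orb (nx (SOME y. y \<in> C))))" for c v
 have "card (E <+> T) < card V" using less finE finT by (simp add: card_Plus)
 then obtain h where h: "\<exists>v \<in> V. h v \<noteq> 0" "\<forall>c \<in> E <+> T. (\<Sum>v\<in>V. a c v * h v) = 0"
  using nonzero_solution[of "E <+> T" V a] finE finT D by (auto simp: V_def)
 define H where "H d = h (orb d)" for d
 have pick: "(\<Sum>v\<in>V. of_bool (v = orb d) * h v) = H d" if "d \<in> D" for d
  using that D by (subst sum.remove[of _ "orb d"]) (auto simp: V_def H_def)
 have H1: "\<forall>d \<in> D. H (nx (M d)) = H d"
 proof
  fix d assume "d \<in> D"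
  have "permutation (nx \<circ> M)" using perm D permutation_permutes by blast
  then have "orb ((nx \<circ> M) d) = orb d" unfolding orb_def by (rule permutation_orbit_step)
  then show "H (nx (M d)) = H d" by (simp add: H_def)
 qed
 have H2: "\<forall>d \<in> E. H (nx d) = 2 * H d"
 proof
  fix d assume d: "d \<in> E"
  have "0 = (\<Sum>v\<in>V. a (Inl d) v * h v)" using h(2) d by auto
  also have "\<dots> = (\<Sum>v\<in>V. of_bool (v = orb (nx d)) * h v - 2 * (of_bool (v = orb d) * h v))"
   by (simp add: a_def algebra_simps)
  also have "\<dots> = H (nx d) - 2 * H d"
  proof -
   have "d \<in> D" "nx d \<in> D" using d E nxD by auto
   then show ?thesis by (simp add: sum_subtractf pick flip: sum_distrib_left)
  qed
  finally show "H (nx d) = 2 * H d" by simp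
 qed
 note tr = trans[OF H1 H2]
 have perm\<Psi>: "permutation \<Psi>" using \<Psi> finY permutation_permutes by blast
 have "H (nx y) = 0" if y: "y \<in> Y" for y
 proof (rule ccontr)
  assume nz: "H (nx y) \<noteq> 0"
  define C where "C = orbit \<Psi> y"
  have cyc: "cyclic_on \<Psi> C" unfolding C_def using perm\<Psi> by (rule cyclic_on_orbit')
  have CY: "C \<subseteq> Y" unfolding C_def using permutes_orbit_subset[OF \<Psi> y] .
  have finC: "finite C" using CY finY finite_subset by blast
  have nzC: "H (nx z) \<noteq> 0" if "z \<in> C" for z
   using that unfolding C_def
  proof (induction rule: orbit.induct)
   case base
   then show ?case using tr y nz by simp
  next
   case (step z)
   then have "z \<in> Y" using CY by (auto simp: C_def)
   then show ?case using tr step by simp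
  qed
  have inj: "inj_on \<Psi> C" using permutes_inj[OF \<Psi>] inj_on_subset by blast
  have "\<Psi> ` C = C"
   using finC inj cyclic_on_inI[OF cyc] by (intro card_subset_eq) (auto simp: card_image)
  \<comment> \<open>Going once around the cycle multiplies a nonzero section by
    \<open>2 powi sum e C\<close>, so the exponents cancel. Then \<open>C\<close> is in
    \<open>T\<close>, and the second kind of equation makes the section vanish somewhere on
    \<open>C\<close>.\<close>
  then have "(\<Prod>z\<in>C. H (nx z)) = (\<Prod>z\<in>C. H (nx (\<Psi> z)))"
   using prod.reindex[OF inj, of "\<lambda>z. H (nx z)"] by simp
  also have "\<dots> = (\<Prod>z\<in>C. 2 powi e z * H (nx z))"
   by (rule prod.cong) (use tr CY in auto)
  also have "\<dots> = (\<Prod>z\<in>C. 2 powi e z) * (\<Prod>z\<in>C. H (nx z))"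
   by (rule prod.distrib)
  finally have "(\<Prod>z\<in>C. 2 powi e z :: real) = 1" using nzC finC by simp
  moreover have "(\<Prod>z\<in>C. 2 powi e z :: real) = 2 powi sum e C"
   using finC by (induction C rule: finite_induct) (auto simp: power_int_add)
  ultimately have p1: "2 powi sum e C = (1::real)" by simp
  have "sum e C = 0"
  proof (rule ccontr)
   assume "sum e C \<noteq> 0"
   then consider "sum e C \<ge> 1" | "sum e C \<le> -1" by linarith
   then show False
   proof cases
    case 1
    then have "2 powi 1 \<le> (2 powi sum e C :: real)" by (intro power_int_increasing) auto
    then show False using p1 by simp
   next
    case 2
    then have "(2 powi sum e C :: real) \<le> 2 powi (-1)" by (intro power_int_increasing) auto
    then show False using p1 by (simp add: power_int_minus)
   qed
  qed
  then have "C \<in> T" using y by (auto simp: T_def C_def)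
  then have "0 = (\<Sum>v\<in>V. a (Inr C) v * h v)" using h(2) by auto
  also have "\<dots> = H (nx (SOME y. y \<in> C))"
  proof -
   have "(SOME y. y \<in> C) \<in> C" using orbit_nonempty[of \<Psi> y] unfolding C_def by (simp add: some_in_eq)
   then have "nx (SOME y. y \<in> C) \<in> D" using CY Y nxD by blast
   then show ?thesis using pick by (simp add: a_def)
  qed
  finally have "H (nx (SOME y. y \<in> C)) = 0" by simp
  moreover have "(SOME y. y \<in> C) \<in> C" using orbit_nonempty[of \<Psi> y] unfolding C_def by (simp add: some_in_eq)
  ultimately show False using nzC by blast
 qed
 then have "\<forall>d \<in> D. H d = 0" using tr by blast
 then show False using h(1) by (auto simp: V_def H_def)
qed

section \<open>The faces of a surface over the relator\<close>

definition rword :: "'s \<Rightarrow> 's \<Rightarrow> nat \<Rightarrow> 's word" where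
 "rword a b m = [(a, True), (b, True), (a, False), (b, False), (a, True)] @
   replicate m (b, False) @ [(a, False)] @ replicate m (b, True)"

lemma length_rword [simp]: "length (rword a b m) = 2 * m + 6"
 by (simp add: rword_def)

lemma length_winv [simp]: "length (winv w) = length w"
 by (simp add: winv_def)

lemma nth_winv: "i < length w \<Longrightarrow> winv w ! i = inv_letter (w ! (length w - Suc i))"
 by (simp add: winv_def rev_nth)

lemma rword_nth:
 assumes "t < 2 * m + 6"
 shows "rword a b m ! t =
  (if t \<in> {0, 4} then (a, True) else if t \<in> {2, m + 5} then (a, False)
   else if t = 1 \<or> t > m + 5 then (b, True) else (b, False))"
proof -
 consider "t = 0" | "t = 1" | "t = 2" | "t = 3" | "t = 4" | i where "t = 5 + i" "i < m" | "t = m + 5"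
  | i where "t = m + 6 + i" "i < m"
 proof -
  have "t < 5 \<or> (\<exists>i. t = 5 + i \<and> i < m) \<or> t = m + 5 \<or> (\<exists>i. t = m + 6 + i \<and> i < m)"
   using assms by presburger
  moreover have "t < 5 \<Longrightarrow> t = 0 \<or> t = 1 \<or> t = 2 \<or> t = 3 \<or> t = 4" by arith
  ultimately show ?thesis using that by blast
 qed
 then show ?thesis
  by cases (simp_all add: rword_def nth_append)
qed

lemma winv_rword_nth:
 assumes "t < 2 * m + 6"
 shows "winv (rword a b m) ! t =
  (if t \<in> {m, 2 * m + 3} then (a, True) else if t \<in> {2 * m + 1, 2 * m + 5} then (a, False)
   else if m < t \<and> t \<le> 2 * m + 2 then (b, True) else (b, False))"
proof -
 have e: "2 * m + 6 - Suc t \<in> {0, 4} \<longleftrightarrow> t = 2 * m + 5 \<or> t = 2 * m + 1"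
  "2 * m + 6 - Suc t \<in> {2, m + 5} \<longleftrightarrow> t = 2 * m + 3 \<or> t = m"
  "2 * m + 6 - Suc t = 1 \<longleftrightarrow> t = 2 * m + 4" "2 * m + 6 - Suc t > m + 5 \<longleftrightarrow> t < m"
  using assms by auto
 have i: "inv_letter (if P then x else y) = (if P then inv_letter x else inv_letter y)"
  for P :: bool and x y :: "'a \<times> bool" by simp
 have j: "inv_letter (x, c) = (x, \<not> c)" for x :: 'a and c by (simp add: inv_letter_def)
 have "winv (rword a b m) ! t = inv_letter (rword a b m ! (2 * m + 6 - Suc t))"
  using assms by (simp add: nth_winv)
 also have "\<dots> = (if t = 2 * m + 5 \<or> t = 2 * m + 1 then (a, False) else if t = 2 * m + 3 \<or> t = m
   then (a, True) else if t = 2 * m + 4 \<or> t < m then (b, False) else (b, True))"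
  using assms unfolding rword_nth[of "2 * m + 6 - Suc t" m, simplified] by (subst rword_nth) (simp_all only: e i j diff_less, simp_all)
 also have "\<dots> = (if t \<in> {m, 2 * m + 3} then (a, True) else if t \<in> {2 * m + 1, 2 * m + 5} then (a, False)
   else if m < t \<and> t \<le> 2 * m + 2 then (b, True) else (b, False))"
  using assms by auto
 finally show ?thesis .
qed

text \<open>\<open>s\<close> is the orientation of a face. Position \<open>t\<close> of a positive
  face and position \<open>2 * m + 5 - t\<close> of a negative one are mirror images.\<close>

definition letter_at :: "'s \<Rightarrow> 's \<Rightarrow> nat \<Rightarrow> bool \<Rightarrow> nat \<Rightarrow> 's \<times> bool" where
 "letter_at a b m s t = (if s then rword a b m else winv (rword a b m)) ! t"

lemma letter_at_eq:
 assumes "t < 2 * m + 6"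
 shows "letter_at a b m s t = (if s
  then (if t = 0 \<or> t = 4 then (a, True) else if t = 2 \<or> t = m + 5 then (a, False)
   else if t = 1 \<or> t > m + 5 then (b, True) else (b, False))
  else (if t = m \<or> t = 2 * m + 3 then (a, True) else if t = 2 * m + 1 \<or> t = 2 * m + 5 then (a, False)
   else if m < t \<and> t \<le> 2 * m + 2 then (b, True) else (b, False)))"
 using assms by (simp add: letter_at_def rword_nth winv_rword_nth)

text \<open>The length and the exponent of the power of \<open>b\<close> that follows an occurrence of \<open>a\<^sup>\<plusminus>\<^sup>1\<close>.\<close>

definition run :: "nat \<Rightarrow> bool \<Rightarrow> nat \<Rightarrow> nat" where
 "run m s t = (if t \<in> (if s then {0, 2} else {2 * m + 1, 2 * m + 3}) then 1 else m)"

definition run_sign :: "nat \<Rightarrow> bool \<Rightarrow> nat \<Rightarrow> bool" where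
 "run_sign m s t = (if s then t = 0 \<or> t = m + 5 else t = m \<or> t = 2 * m + 1)"

lemma a_positions:
 assumes "a \<noteq> b" "t < 2 * m + 6"
 shows "letter_at a b m s t = (a, True) \<longleftrightarrow> (if s then t = 0 \<or> t = 4 else t = m \<or> t = 2 * m + 3)"
  and "letter_at a b m s t = (a, False) \<longleftrightarrow> (if s then t = 2 \<or> t = m + 5 else t = 2 * m + 1 \<or> t = 2 * m + 5)"
  and "fst (letter_at a b m s t) \<in> {a, b}"
 unfolding letter_at_eq[OF assms(2)] using assms(1) by (cases s; simp; arith)+

text \<open>Read cyclically, the relator alternates between single \<open>a\<close>-letters and
  nonempty runs of one \<open>b\<close>-letter, and the signs of consecutive
  \<open>a\<close>-letters differ.\<close>

lemma run_letters:
 assumes "a \<noteq> b" "m \<ge> 2" "t < 2 * m + 6" "fst (letter_at a b m s t) = a"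
 shows "i < run m s t \<Longrightarrow> letter_at a b m s ((t + 1 + i) mod (2 * m + 6)) = (b, run_sign m s t)"
  and "letter_at a b m s ((t + 1 + run m s t) mod (2 * m + 6)) = (a, \<not> snd (letter_at a b m s t))"
proof -
 have "s \<and> (t = 0 \<or> t = 2 \<or> t = 4 \<or> t = m + 5) \<or>
   \<not> s \<and> (t = m \<or> t = 2 * m + 1 \<or> t = 2 * m + 3 \<or> t = 2 * m + 5)"
  using assms(1,4) unfolding letter_at_eq[OF assms(3)] by (cases s; simp split: if_splits; arith)
 then consider "s" "t = 0" | "s" "t = 2" | "s" "t = 4" | "s" "t = m + 5"
  | "\<not> s" "t = m" | "\<not> s" "t = 2 * m + 1" | "\<not> s" "t = 2 * m + 3" | "\<not> s" "t = 2 * m + 5"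
  by blast
 note t = this
 have md: "(t + 1 + k) mod (2 * m + 6) = (if t + 1 + k < 2 * m + 6 then t + 1 + k else t + 1 + k - (2 * m + 6))"
  if "k \<le> m" for k using that assms(3) by (simp add: mod_if)
 have le: "run m s t \<le> m" using assms(2) by (simp add: run_def)
 show "letter_at a b m s ((t + 1 + i) mod (2 * m + 6)) = (b, run_sign m s t)" if i: "i < run m s t"
 proof -
  have "i \<le> m" using le i by simp
  then show ?thesis
   unfolding md[OF \<open>i \<le> m\<close>]
   by (cases rule: t) (use i assms(2) in \<open>simp_all add: letter_at_eq run_def run_sign_def\<close>)
 qed
 show "letter_at a b m s ((t + 1 + run m s t) mod (2 * m + 6)) = (a, \<not> snd (letter_at a b m s t))"
  unfolding md[OF le]
  by (cases rule: t) (use assms(2) in \<open>simp_all add: letter_at_eq run_def\<close>)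
qed

lemma funpow_mod_run:
 assumes "\<And>d. d \<in> D \<Longrightarrow> nx d \<in> D \<and> ps (nx d) = (ps d + 1) mod L \<and> sg (nx d) = sg d"
  and "\<And>d. d \<in> D \<Longrightarrow> ps d < (L :: nat)" and "d \<in> D"
 shows "(nx ^^ k) d \<in> D \<and> ps ((nx ^^ k) d) = (ps d + k) mod L \<and> sg ((nx ^^ k) d) = sg d"
proof (induction k)
 case 0
 then show ?case using assms by auto
next
 case (Suc k)
 then show ?case using assms(1)[of "(nx ^^ k) d"] by (simp add: mod_Suc_eq)
qed

text \<open>The constraints in \<open>\<Xi>\<close> cut the mod 2 cocycles down to coboundaries, and the linear program bounds the number of cycles of exponent 0.\<close>

lemma surface_bound:
 fixes X :: "'e \<Rightarrow> ('d \<Rightarrow> bool) \<Rightarrow> bool" and ps :: "'d \<Rightarrow> nat" and a b :: 's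
 assumes m: "m \<ge> 2" and ab: "a \<noteq> b" and D: "finite D" "D \<noteq> {}"
  and M: "matching D (\<lambda>d. letter_at a b m (sg d) (ps d)) M" "M permutes D"
  and nxp: "nx permutes D"
  and nx: "\<And>d. d \<in> D \<Longrightarrow> ps (nx d) = (ps d + 1) mod (2 * m + 6) \<and> sg (nx d) = sg d"
  and ps: "\<And>d. d \<in> D \<Longrightarrow> ps d < 2 * m + 6"
  and red: "\<And>d. d \<in> D \<Longrightarrow> sg d \<Longrightarrow> ps d + ps (M d) = 2 * m + 5 \<Longrightarrow> sg (M d)"
  and \<Xi>: "finite \<Xi>" "\<forall>e \<in> \<Xi>. additive (X e)"
  and cob: "\<And>x. \<forall>d \<in> D. x (M d) = x d \<Longrightarrow> \<forall>e \<in> \<Xi>. \<not> X e x \<Longrightarrow>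
    \<exists>S. compat D M x S \<and> compat D nx x S"
 defines "Fp \<equiv> card {d \<in> D. sg d \<and> ps d = 0}" and "Fn \<equiv> card {d \<in> D. \<not> sg d \<and> ps d = 0}"
 shows "2 * (real Fp + real Fn) + 1 \<le> card \<Xi> + Fp / (real m - 1) + (2 - 1 / (real m - 1)) * Fn"
proof -
 define L where "L = 2 * m + 6"
 define lab where "lab d = letter_at a b m (sg d) (ps d)" for d
 define Y where "Y = {d \<in> D. fst (lab d) = a}"
 define E where "E = {d \<in> D. lab d = (b, True)}"
 define rn where "rn d = run m (sg d) (ps d)" for d
 define rs where "rs d = run_sign m (sg d) (ps d)" for d
 \<comment> \<open>\<open>su y\<close> is the next \<open>a\<close>-letter on the same face and
   \<open>\<Psi> y\<close> is its partner. Both steps invert the sign of the letter, so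
   \<open>\<Psi>\<close> keeps it. The orbits of \<open>\<Psi>\<close> are the cycles to which the
   linear program applies, and \<open>e y\<close> is the exponent of \<open>b\<close> on the way
   from \<open>y\<close> to \<open>su y\<close>.\<close>
 define su where "su y = (nx ^^ (rn y + 1)) y" for y
 define e where "e y = (if rs y then int (rn y) else - int (rn y))" for y
 define \<Psi> where "\<Psi> y = (if y \<in> Y then M (su y) else y)" for y
 have nxD: "nx d \<in> D" if "d \<in> D" for d using permutes_in_image[OF nxp] that by simp
 have MD: "M d \<in> D" "M (M d) = d" "M d \<noteq> d" "lab (M d) = inv_letter (lab d)" if "d \<in> D" for d
  using M(1) that by (auto simp: matching_def lab_def)
 have step: "(nx ^^ k) d \<in> D" "ps ((nx ^^ k) d) = (ps d + k) mod L" "sg ((nx ^^ k) d) = sg d"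
  if "d \<in> D" for k d
  using funpow_mod_run[of D nx ps L sg d k] nx nxD ps that by (auto simp: L_def)
 have YD: "Y \<subseteq> D" by (auto simp: Y_def)
 have finY: "finite Y" using YD D finite_subset by blast
 have labab: "fst (lab d) = a \<or> fst (lab d) = b" if "d \<in> D" for d
  using a_positions(3)[OF ab ps[OF that], of "sg d"] by (simp add: lab_def)
 have run1: "lab ((nx ^^ (Suc i)) y) = (b, rs y)" if "y \<in> Y" "i < rn y" for y i
 proof -
  have y: "y \<in> D" "fst (lab y) = a" using that by (auto simp: Y_def)
  show ?thesis
   using run_letters(1)[OF ab m ps[OF y(1)], of "sg y" i] that(2) y(2) step[OF y(1), of "Suc i"]
   by (simp add: lab_def L_def rn_def rs_def)
 qed
 have suY: "su y \<in> Y" "snd (lab (su y)) \<longleftrightarrow> \<not> snd (lab y)" "sg (su y) = sg y"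
  "ps (su y) = (ps y + 1 + rn y) mod L" if "y \<in> Y" for y
 proof -
  have y: "y \<in> D" "fst (lab y) = a" using that by (auto simp: Y_def)
  have "lab (su y) = (a, \<not> snd (lab y))"
   using run_letters(2)[OF ab m ps[OF y(1)], of "sg y"] y(2) step[OF y(1), of "rn y + 1"]
   by (simp add: lab_def L_def rn_def su_def)
  then show "su y \<in> Y" "snd (lab (su y)) \<longleftrightarrow> \<not> snd (lab y)"
   using step[OF y(1), of "rn y + 1"] by (auto simp: Y_def su_def)
  show "sg (su y) = sg y" "ps (su y) = (ps y + 1 + rn y) mod L"
   using step[OF y(1), of "rn y + 1"] by (simp_all add: su_def)
 qed
 have cls: "(sg y \<and> ps y = 0 \<and> snd (lab y)) \<or> (sg y \<and> ps y = 4 \<and> snd (lab y)) \<or>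
   (\<not> sg y \<and> ps y = m \<and> snd (lab y)) \<or> (\<not> sg y \<and> ps y = 2 * m + 3 \<and> snd (lab y)) \<or>
   (sg y \<and> ps y = 2 \<and> \<not> snd (lab y)) \<or> (sg y \<and> ps y = m + 5 \<and> \<not> snd (lab y)) \<or>
   (\<not> sg y \<and> ps y = 2 * m + 1 \<and> \<not> snd (lab y)) \<or> (\<not> sg y \<and> ps y = 2 * m + 5 \<and> \<not> snd (lab y))"
  if "y \<in> Y" for y
 proof -
  have y: "y \<in> D" "fst (lab y) = a" using that by (auto simp: Y_def)
  then have "lab y = (a, True) \<or> lab y = (a, False)" by (metis prod.collapse)
  then show ?thesis
   using a_positions(1,2)[OF ab ps[OF y(1)], of "sg y"] unfolding lab_def by (auto split: if_splits)
 qed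
 have sups: "(ps y = 0 \<longrightarrow> sg y \<longrightarrow> ps (su y) = 2) \<and> (ps y = 4 \<longrightarrow> sg y \<longrightarrow> ps (su y) = m + 5) \<and>
   (ps y = 2 \<longrightarrow> sg y \<longrightarrow> ps (su y) = 4) \<and> (ps y = m + 5 \<longrightarrow> sg y \<longrightarrow> ps (su y) = 0) \<and>
   (ps y = m \<longrightarrow> \<not> sg y \<longrightarrow> ps (su y) = 2 * m + 1) \<and> (ps y = 2 * m + 3 \<longrightarrow> \<not> sg y \<longrightarrow> ps (su y) = 2 * m + 5) \<and>
   (ps y = 2 * m + 1 \<longrightarrow> \<not> sg y \<longrightarrow> ps (su y) = 2 * m + 3) \<and> (ps y = 2 * m + 5 \<longrightarrow> \<not> sg y \<longrightarrow> ps (su y) = m)"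
  if "y \<in> Y" for y
  using suY(4)[OF that] m by (simp add: rn_def run_def L_def mod_if)
 have inj_su: "inj_on su Y"
 proof (rule inj_onI)
  fix y y' assume y: "y \<in> Y" "y' \<in> Y" "su y = su y'"
  then have s: "sg y = sg y'" "ps (su y) = ps (su y')" "snd (lab y) = snd (lab y')"
   using suY by metis+
  have "ps y = ps y'"
   using cls[OF y(1)] cls[OF y(2)] sups[OF y(1)] sups[OF y(2)] s m by (elim disjE) simp_all
  then have "rn y = rn y'" using s by (simp add: rn_def)
  then have "(nx ^^ (rn y + 1)) y = (nx ^^ (rn y + 1)) y'" using y(3) by (simp add: su_def)
  moreover have "inj (nx ^^ (rn y + 1))" using permutes_inj[OF nxp] by (rule inj_fn)
  ultimately show "y = y'" by (rule injD[rotated])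
 qed
 have MY: "M y \<in> Y" "snd (lab (M y)) \<longleftrightarrow> \<not> snd (lab y)" if "y \<in> Y" for y
  using MD[of y] that by (auto simp: Y_def inv_letter_def)
 have \<Psi>: "\<Psi> permutes Y"
 proof (rule bij_imp_permutes)
  have "inj_on \<Psi> Y"
  proof (rule inj_onI)
   fix y y' assume y: "y \<in> Y" "y' \<in> Y" "\<Psi> y = \<Psi> y'"
   then have "M (su y) = M (su y')" by (simp add: \<Psi>_def)
   then have "su y = su y'" using permutes_inj[OF M(2)] by (simp add: inj_eq)
   then show "y = y'" using inj_su y by (auto dest: inj_onD)
  qed
  moreover have "\<Psi> ` Y \<subseteq> Y" using suY MY by (auto simp: \<Psi>_def)
  ultimately show "bij_betw \<Psi> Y Y"
   using endo_inj_surj[OF finY] by (simp add: bij_betw_def)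
 qed (simp add: \<Psi>_def)
 have \<Psi>Y: "\<Psi> y \<in> Y" "snd (lab (\<Psi> y)) \<longleftrightarrow> snd (lab y)" if "y \<in> Y" for y
  using suY MY that by (auto simp: \<Psi>_def)
 define T where "T = {C. (\<exists>y \<in> Y. C = orbit \<Psi> y) \<and> sum e C = 0}"
 have perm: "(nx \<circ> M) permutes D" using permutes_compose[OF M(2) nxp] .
 \<comment> \<open>Thus all vertices are paid for by \<open>b\<close>-edges and by the cycles of
   \<open>\<Psi>\<close> along which the exponents of \<open>b\<close> cancel.\<close>
 have "card ((\<lambda>d. orbit (nx \<circ> M) d) ` D) \<le> card E + card T"
  unfolding T_def
 proof (rule potential_count[OF D(1) perm nxD YD _ \<Psi>])
  show "E \<subseteq> D" by (auto simp: E_def)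
  fix H :: "'d \<Rightarrow> real"
  assume H1: "\<forall>d \<in> D. H (nx (M d)) = H d" and H2: "\<forall>d \<in> E. H (nx d) = 2 * H d"
  have Hb: "H (nx d) = (if snd (lab d) then 2 else 1 / 2) * H d" if "d \<in> D" "fst (lab d) = b" for d
  proof (cases "snd (lab d)")
   case True
   then have "d \<in> E" using that by (simp add: E_def prod_eq_iff)
   then show ?thesis using H2 True by simp
  next
   case False
   then have "M d \<in> E" using that MD[OF that(1)] by (simp add: E_def prod_eq_iff inv_letter_def)
   then have "H (nx (M d)) = 2 * H (M d)" using H2 by blast
   moreover have "H (nx (M d)) = H d" using H1 that by blast
   moreover have "H (nx d) = H (M d)" using bspec[OF H1 MD(1)[OF that(1)]] MD(2)[OF that(1)] by simp
   ultimately show ?thesis using False by simp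
  qed
  have run: "H ((nx ^^ (Suc k)) y) = (if rs y then 2 else 1 / 2) ^ k * H (nx y)" if "y \<in> Y" "k \<le> rn y" for y k
   using that(2)
  proof (induction k)
   case (Suc k)
   have "y \<in> D" using that YD by auto
   moreover have "lab ((nx ^^ (Suc k)) y) = (b, rs y)" using run1[OF that(1)] Suc.prems by simp
   ultimately have "H (nx ((nx ^^ (Suc k)) y)) = (if rs y then 2 else 1 / 2) * H ((nx ^^ (Suc k)) y)"
    using Hb[of "(nx ^^ (Suc k)) y"] step(1)[of y "Suc k"] by simp
   then show ?case using Suc by (simp del: funpow.simps add: funpow.simps(2)[of "Suc k"])
  qed simp
  have A: "\<forall>y \<in> Y. H (nx (\<Psi> y)) = 2 powi e y * H (nx y)"
  proof
   fix y assume y: "y \<in> Y"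
   have "su y \<in> D" using suY[OF y] YD by auto
   then have "H (nx (\<Psi> y)) = H (su y)" using H1 y by (simp add: \<Psi>_def)
   also have "\<dots> = (if rs y then 2 else 1 / 2) ^ rn y * H (nx y)"
    using run[OF y, of "rn y"] by (simp add: su_def)
   also have "(if rs y then 2 else 1 / 2) ^ rn y = (2 powi e y :: real)"
    by (simp add: e_def power_int_minus power_one_over inverse_eq_divide)
   finally show "H (nx (\<Psi> y)) = 2 powi e y * H (nx y)" .
  qed
  have B: "H d = 0" if van: "\<forall>y \<in> Y. H (nx y) = 0" and d: "d \<in> D" for d
  proof -
   have Y0: "H y = 0" if "y \<in> Y" for y
   proof -
    have "M y \<in> D" "M (M y) = y" using that YD MD by auto
    then have "H y = H (nx (M y))" using H1 that YD by (metis subsetD)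
    then show ?thesis using van MY[OF that] by simp
   qed
   have ind: "H d = 0" if "d \<in> D" "(nx ^^ k) d \<in> Y" for k d
    using that
   proof (induction k arbitrary: d)
    case 0
    then show ?case using Y0 by simp
   next
    case (Suc k)
    show ?case
    proof (cases "d \<in> Y")
     case True
     then show ?thesis using Y0 by simp
    next
     case False
     then have "fst (lab d) = b" using labab Suc.prems(1) by (auto simp: Y_def)
     moreover have "H (nx d) = 0" using Suc.IH[of "nx d"] Suc.prems nxD by (simp add: funpow_swap1)
     ultimately show ?thesis using Hb Suc.prems(1) by (auto split: if_splits)
    qed
   qed
   \<comment> \<open>Position 0 of the relator and the last position of its inverse carry an
     \<open>a\<close>-letter, so every dart reaches such a letter along its face.\<close>
   define k where "k = (if sg d then L - ps d else L - 1 - ps d)"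
   have "ps ((nx ^^ k) d) = (if sg d then 0 else L - 1)"
    using step(2)[OF d, of k] ps[OF d] by (simp add: k_def L_def)
   then have "lab ((nx ^^ k) d) = (a, sg d)"
    using step(3)[OF d, of k] m by (auto simp: lab_def letter_at_eq L_def)
   then have "(nx ^^ k) d \<in> Y" using step(1)[OF d, of k] by (simp add: Y_def)
   then show ?thesis using ind d by blast
  qed
  from A B show "(\<forall>y \<in> Y. H (nx (\<Psi> y)) = 2 powi e y * H (nx y)) \<and>
   ((\<forall>y \<in> Y. H (nx y) = 0) \<longrightarrow> (\<forall>d \<in> D. H d = 0))" by blast
 qed
 moreover have "card {d \<in> D. snd (lab d)} + 1 \<le> card \<Xi> + card ((\<lambda>d. orbit (nx \<circ> M) d) ` D)"
  by (rule euler_estimate[OF D _ perm \<Xi> cob]) (use M in \<open>simp_all add: lab_def\<close>)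
 moreover define Yp where "Yp = {y \<in> Y. snd (lab y)}"
 moreover have "card {d \<in> D. snd (lab d)} = card Yp + card E"
 proof -
  have "{d \<in> D. snd (lab d)} = Yp \<union> E" "Yp \<inter> E = {}"
   using labab ab by (auto simp: Yp_def Y_def E_def prod_eq_iff)
  then show ?thesis using D finY by (simp add: card_Un_disjoint Yp_def E_def)
 qed
 \<comment> \<open>The \<open>b\<close>-edges cancel between the Euler characteristic estimate and
   the count of vertices. What remains on the left are the \<open>a\<close>-edges, represented by
   \<open>Yp\<close>.\<close>
 ultimately have main: "card Yp + 1 \<le> card \<Xi> + card T" by linarith
 define J where "J s t = {d \<in> D. sg d = s \<and> ps d = t}" for s t
 have rot: "card (J s t) = card (J s 0)" if "t < L" for s t
  using that
 proof (induction t)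
  case (Suc t)
  have "nx ` J s t = J s (Suc t)"
  proof (intro equalityI subsetI)
   fix d assume "d \<in> nx ` J s t"
   then show "d \<in> J s (Suc t)" using nx nxD Suc.prems by (auto simp: J_def L_def)
  next
   fix d assume d: "d \<in> J s (Suc t)"
   then obtain d' where d': "d' \<in> D" "d = nx d'" using permutes_image[OF nxp] by (auto simp: J_def)
   have "ps d' = t" using nx[OF d'(1)] ps[OF d'(1)] d d' by (auto simp: J_def mod_Suc split: if_splits)
   then show "d \<in> nx ` J s t" using d d' nx by (auto simp: J_def)
  qed
  moreover have "inj_on nx (J s t)" using permutes_inj[OF nxp] inj_on_subset by blast
  ultimately show ?case using Suc by (metis Suc_lessD card_image)
 qed simp
 have cJ: "card (J s t) = (if s then Fp else Fn)" if "t < L" for s t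
  using rot[OF that, of s] by (cases s) (simp_all add: J_def Fp_def Fn_def)
 have Fp: "card {d \<in> D. sg d \<and> ps d = t} = Fp" and Fn: "card {d \<in> D. \<not> sg d \<and> ps d = t} = Fn" if "t < L" for t
  using cJ[OF that, of True] cJ[OF that, of False] by (simp_all add: J_def)
 have cYp: "card Yp = 2 * (Fp + Fn)"
 proof -
  have "Yp = (J True 0 \<union> J True 4) \<union> (J False m \<union> J False (2 * m + 3))"
  proof (intro equalityI subsetI)
   fix y assume "y \<in> Yp"
   then show "y \<in> (J True 0 \<union> J True 4) \<union> (J False m \<union> J False (2 * m + 3))"
    using cls[of y] by (auto simp: Yp_def Y_def J_def)
  next
   fix y assume y: "y \<in> (J True 0 \<union> J True 4) \<union> (J False m \<union> J False (2 * m + 3))"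
   then have "y \<in> D" by (auto simp: J_def)
   then have "lab y = (a, True)"
    unfolding lab_def using a_positions(1)[OF ab ps[OF \<open>y \<in> D\<close>], of "sg y"] y by (auto simp: J_def)
   then show "y \<in> Yp" using \<open>y \<in> D\<close> by (simp add: Yp_def Y_def)
  qed
  moreover have "finite (J s t)" for s t using D(1) by (simp add: J_def)
  moreover have "J s t \<inter> J s' t' = {}" if "s \<noteq> s' \<or> t \<noteq> t'" for s t s' t' using that by (auto simp: J_def)
  ultimately show ?thesis
   using cJ[of 0 True] cJ[of 4 True] cJ[of m False] cJ[of "2 * m + 3" False]
   by (simp add: card_Un_disjoint Int_Un_distrib Int_Un_distrib2 L_def)
 qed
 \<comment> \<open>The type of an \<open>a\<close>-letter records the sign of its face and the run
   of \<open>b\<close>-letters after it: 0 and 1 stand for length 1 and length \<open>m\<close> on a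
   positive face, 2 and 3 for the same on a negative face.\<close>
 define tp :: "'d \<Rightarrow> nat" where
  "tp y = (if sg y then (if ps y = 0 \<or> ps y = 2 then 0 else 1)
   else if ps y = 2 * m + 3 \<or> ps y = 2 * m + 1 then 2 else 3)" for y
 define w :: "nat \<Rightarrow> nat \<Rightarrow> real" where
  "w s t = (if s = 0 \<and> t = 0 then 1 / (real m - 1)
   else if s = 0 \<and> t = 3 then 1 else if s = 2 \<and> t = 3 then 1 else 0)" for s t
 have w0: "0 \<le> w s t" for s t using m by (simp add: w_def)
 \<comment> \<open>For inverse letters all exponents change sign and the cycle is read backwards, so
   that the same linear program applies.\<close>
 define wt where "wt y = (if snd (lab y) then w (tp y) (tp (\<Psi> y)) else w (tp (\<Psi> y)) (tp y))" for y
 have finT: "finite T" by (rule finite_subset[of _ "orbit \<Psi> ` Y"]) (use finY in \<open>auto simp: T_def\<close>)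
 have perm\<Psi>: "permutation \<Psi>" using \<Psi> finY permutation_permutes by blast
 have tp4: "tp y < 4" for y by (simp add: tp_def)
 have tpc: "(tp y = 0 \<longleftrightarrow> sg y \<and> (ps y = 0 \<or> ps y = 2)) \<and> (tp y = 1 \<longleftrightarrow> sg y \<and> (ps y = 4 \<or> ps y = m + 5)) \<and>
   (tp y = 2 \<longleftrightarrow> \<not> sg y \<and> (ps y = 2 * m + 3 \<or> ps y = 2 * m + 1)) \<and>
   (tp y = 3 \<longleftrightarrow> \<not> sg y \<and> (ps y = m \<or> ps y = 2 * m + 5))" if "y \<in> Y" for y
  using cls[OF that] m by (elim disjE conjE) (simp_all add: tp_def)
 have ev: "e y = (if snd (lab y) then 1 else -1) * (of_bool (tp y = 0) - int m * of_bool (tp y = 1)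
   - of_bool (tp y = 2) + int m * of_bool (tp y = 3))" if "y \<in> Y" for y
  using cls[OF that] m by (elim disjE conjE) (simp_all add: tp_def e_def rn_def rs_def run_def run_sign_def)
 have key: "(tp y = 0 \<longrightarrow> sg y \<and> ps y = 0 \<and> ps (su y) = 2) \<and> (tp y = 1 \<longrightarrow> sg y \<and> ps y = 4 \<and> ps (su y) = m + 5) \<and>
   (tp y = 2 \<longrightarrow> \<not> sg y \<and> ps y = 2 * m + 3 \<and> ps (su y) = 2 * m + 5) \<and> (tp y = 3 \<longrightarrow> \<not> sg y \<and> ps y = m \<and> ps (su y) = 2 * m + 1)"
  if "y \<in> Y" "snd (lab y)" for y
  using cls[OF that(1)] sups[OF that(1)] that(2) m by (elim disjE conjE) (simp_all add: tp_def)
 have key': "(tp y = 0 \<longrightarrow> sg y \<and> ps y = 2 \<and> ps (su y) = 4) \<and> (tp y = 1 \<longrightarrow> sg y \<and> ps y = m + 5 \<and> ps (su y) = 0) \<and>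
   (tp y = 2 \<longrightarrow> \<not> sg y \<and> ps y = 2 * m + 1 \<and> ps (su y) = 2 * m + 3) \<and> (tp y = 3 \<longrightarrow> \<not> sg y \<and> ps y = 2 * m + 5 \<and> ps (su y) = m)"
  if "y \<in> Y" "\<not> snd (lab y)" for y
  using cls[OF that(1)] sups[OF that(1)] that(2) m by (elim disjE conjE) (simp_all add: tp_def)
 have M\<Psi>: "M (\<Psi> y) = su y" if "y \<in> Y" for y
  using MD(2)[of "su y"] suY(1)[OF that] YD that by (auto simp: \<Psi>_def)
 \<comment> \<open>By \<open>red\<close>, corresponding letters of a positive and a negative face
   are not glued to each other. This is what excludes the transitions from 0 to 2 and from 1 to
   3.\<close>
 have ex1: "\<not> (sg z \<and> \<not> sg (M z) \<and> ps z + ps (M z) = 2 * m + 5)"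
  "\<not> (\<not> sg z \<and> sg (M z) \<and> ps z + ps (M z) = 2 * m + 5)" if "z \<in> Y" for z
  using red[of z] red[of "M z"] MD[of z] that YD by (auto simp: add.commute)
 have one: "1 \<le> sum wt C" if C: "C \<in> T" for C
 proof -
  obtain y0 where y0: "y0 \<in> Y" "C = orbit \<Psi> y0" and e0: "sum e C = 0" using C by (auto simp: T_def)
  have cyc: "cyclic_on \<Psi> C" unfolding y0(2) using perm\<Psi> by (rule cyclic_on_orbit')
  have CY: "C \<subseteq> Y" unfolding y0 using permutes_orbit_subset[OF \<Psi> y0(1)] .
  have finC: "finite C" using CY finY finite_subset by blast
  have inj: "inj_on \<Psi> C" using permutes_inj[OF \<Psi>] inj_on_subset by blast
  have neC: "C \<noteq> {}" unfolding y0(2) by (rule orbit_nonempty)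
  have side: "snd (lab y) \<longleftrightarrow> snd (lab y0)" if "y \<in> C" for y
   using that unfolding y0(2)
  proof (induction rule: orbit.induct)
   case base
   then show ?case using \<Psi>Y y0 by simp
  next
   case (step y)
   then show ?case using \<Psi>Y CY y0 by auto
  qed
  have cd: "(\<Sum>y\<in>C. of_bool (tp y = i)) = int (card {y \<in> C. tp y = i})" for i
   using finC by (simp add: sum.If_cases of_bool_def Int_def)
  have "sum e C = (\<Sum>y\<in>C. (if snd (lab y0) then 1 else -1) * (of_bool (tp y = 0) - int m * of_bool (tp y = 1)
   - of_bool (tp y = 2) + int m * of_bool (tp y = 3)))"
   by (rule sum.cong[OF refl]) (use ev CY side in auto)
  also have "\<dots> = (if snd (lab y0) then 1 else -1) * ((\<Sum>y\<in>C. of_bool (tp y = 0)) - int m * (\<Sum>y\<in>C. of_bool (tp y = 1))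
   - (\<Sum>y\<in>C. of_bool (tp y = 2)) + int m * (\<Sum>y\<in>C. of_bool (tp y = 3)))"
   by (simp add: sum_distrib_left sum.distrib sum_subtractf flip: sum_distrib_left)
  finally have "int (card {y \<in> C. tp y = 0}) + int m * int (card {y \<in> C. tp y = 3})
    = int m * int (card {y \<in> C. tp y = 1}) + int (card {y \<in> C. tp y = 2})"
   using e0 unfolding cd by (auto split: if_splits)
  then have zero: "card {y \<in> C. tp y = 0} + m * card {y \<in> C. tp y = 3}
    = m * card {y \<in> C. tp y = 1} + card {y \<in> C. tp y = 2}"
   by (simp only: of_nat_mult[symmetric] of_nat_add[symmetric] of_nat_eq_iff)
  note bal = cycle_bal[where tp = tp, OF cyc inj m tp4]
  have zero': "card {y \<in> C. tp (\<Psi> y) = 0} + m * card {y \<in> C. tp (\<Psi> y) = 3}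
    = m * card {y \<in> C. tp (\<Psi> y) = 1} + card {y \<in> C. tp (\<Psi> y) = 2}"
   using zero by (simp only: bal[where i = 0, symmetric] bal[where i = 1, symmetric] bal[where i = 2, symmetric] bal[where i = 3, symmetric])
  note cr = cycle_cross[where tp = tp, OF cyc inj m tp4]
  show ?thesis
  proof (cases "snd (lab y0)")
   case True
   have "1 \<le> (\<Sum>y\<in>C. if tp y = 0 \<and> tp (\<Psi> y) = 0 then 1 / (real m - 1)
     else if tp y = 0 \<and> tp (\<Psi> y) = 3 then 1 else if tp y = 2 \<and> tp (\<Psi> y) = 3 then 1 else 0)"
   proof (rule cycle_weight[where s = tp and t = "\<lambda>y. tp (\<Psi> y)", OF finC neC m tp4 tp4 bal _ _ _ zero])
    fix i y y' assume "y \<in> C" "tp y = i" "y' \<in> C" "tp y' \<noteq> i"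
    then show "(\<exists>y \<in> C. tp y = i \<and> tp (\<Psi> y) \<noteq> i) \<and> (\<exists>y \<in> C. tp y \<noteq> i \<and> tp (\<Psi> y) = i)"
     by (rule cr)
   next
    fix y assume y: "y \<in> C"
    have yY: "y \<in> Y" "\<Psi> y \<in> Y" "su y \<in> Y" using y CY suY \<Psi>Y by auto
    have sn: "snd (lab y)" "snd (lab (\<Psi> y))" using side[OF y] \<Psi>Y(2)[OF yY(1)] True by auto
    have Ms: "M (su y) = \<Psi> y" using yY by (simp add: \<Psi>_def)
    note k = key[OF yY(1) sn(1)] key[OF yY(2) sn(2)] ex1(1)[OF yY(3)] suY(3)[OF yY(1)]
    show "tp (\<Psi> y) \<noteq> 2" if "tp y = 0" using k that by (auto simp: Ms)
    show "tp (\<Psi> y) \<noteq> 3" if "tp y = 1" using k that by (auto simp: Ms)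
   qed
   also have "\<dots> = sum wt C"
    by (rule sum.cong) (use side True in \<open>auto simp: wt_def w_def\<close>)
   finally show ?thesis .
  next
   case False
   have "1 \<le> (\<Sum>y\<in>C. if tp (\<Psi> y) = 0 \<and> tp y = 0 then 1 / (real m - 1)
     else if tp (\<Psi> y) = 0 \<and> tp y = 3 then 1 else if tp (\<Psi> y) = 2 \<and> tp y = 3 then 1 else 0)"
   proof (rule cycle_weight[where s = "\<lambda>y. tp (\<Psi> y)" and t = tp, OF finC neC m tp4 tp4 bal[symmetric] _ _ _ zero'])
    fix i y y' assume "y \<in> C" "tp (\<Psi> y) = i" "y' \<in> C" "tp (\<Psi> y') \<noteq> i"
    then show "(\<exists>y \<in> C. tp (\<Psi> y) = i \<and> tp y \<noteq> i) \<and> (\<exists>y \<in> C. tp (\<Psi> y) \<noteq> i \<and> tp y = i)"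
     using cr[of "\<Psi> y" i "\<Psi> y'"] cyclic_on_inI[OF cyc] by metis
   next
    fix y assume y: "y \<in> C"
    have yY: "y \<in> Y" "\<Psi> y \<in> Y" "su y \<in> Y" using y CY suY \<Psi>Y by auto
    have sn: "\<not> snd (lab y)" "\<not> snd (lab (\<Psi> y))" using side[OF y] \<Psi>Y(2)[OF yY(1)] False by auto
    have Ms: "M (su y) = \<Psi> y" using yY by (simp add: \<Psi>_def)
    note k = key'[OF yY(1) sn(1)] key'[OF yY(2) sn(2)] ex1(2)[OF yY(3)] suY(3)[OF yY(1)]
    show "tp y \<noteq> 2" if "tp (\<Psi> y) = 0" using k that by (auto simp: Ms)
    show "tp y \<noteq> 3" if "tp (\<Psi> y) = 1" using k that by (auto simp: Ms)
   qed
   also have "\<dots> = sum wt C"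
    by (rule sum.cong) (use side False in \<open>auto simp: wt_def w_def\<close>)
   finally show ?thesis .
  qed
 qed
 have "real (card T) \<le> (\<Sum>C\<in>T. sum wt C)"
  using sum_mono[of T "\<lambda>_. 1" "sum wt"] one by simp
 also have "\<dots> = sum wt (\<Union>T)"
 proof (rule sum.Union_disjoint[symmetric, unfolded comp_def])
  show "\<forall>C \<in> T. finite C"
   using permutes_orbit_subset[OF \<Psi>] finY by (auto simp: T_def intro: finite_subset)
  show "\<forall>A \<in> T. \<forall>B \<in> T. A \<noteq> B \<longrightarrow> A \<inter> B = {}"
  proof (intro ballI impI)
   fix A B assume AB: "A \<in> T" "B \<in> T" "A \<noteq> B"
   have "orbit \<Psi> z = C" if "C \<in> T" "z \<in> C" for z C
    using orbit_cyclic_eq3[OF cyclic_on_orbit'[OF perm\<Psi>]] that by (auto simp: T_def)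
   then show "A \<inter> B = {}" using AB by blast
  qed
 qed
 also have "\<dots> \<le> sum wt Y"
  by (rule sum_mono2) (use finY permutes_orbit_subset[OF \<Psi>] w0 in \<open>auto simp: T_def wt_def\<close>)
 also have "sum wt Y \<le> Fp / (real m - 1) + (2 - 1 / (real m - 1)) * Fn"
 proof -
  define Yn where "Yn = {y \<in> Y. \<not> snd (lab y)}"
  define P where "P s t z \<longleftrightarrow> (sg z \<longleftrightarrow> s) \<and> ps z = t" for s t z
  \<comment> \<open>The weight of a transition is charged to the \<open>a\<close>-edge that it
    crosses, represented by its dart \<open>z\<close> with an inverse letter: \<open>wa\<close>
    collects the charges from cycles of positive letters, \<open>wA\<close> those from cycles of
    inverse letters.\<close>
  define wa where "wa z = (if P True 2 z \<and> P True 0 (M z) then 1 / (real m - 1)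
   else if P True 2 z \<and> P False m (M z) then 1
   else if P False (2 * m + 5) z \<and> P False m (M z) then 1 else 0)" for z
  define wA where "wA z = (if P True 2 z \<and> P True 4 (M z) then 1 / (real m - 1)
   else if P True 2 z \<and> P False m (M z) then 1
   else if P False (2 * m + 1) z \<and> P False m (M z) then 1 else 0)" for z
  have w1: "wt y \<le> wa (su y)" if "y \<in> Yp" for y
  proof -
   have y: "y \<in> Y" "snd (lab y)" "\<Psi> y \<in> Y" "snd (lab (\<Psi> y))" using that \<Psi>Y by (auto simp: Yp_def)
   have Ms: "M (su y) = \<Psi> y" using y by (simp add: \<Psi>_def)
   note k = key[OF y(1,2)] key[OF y(3,4)] suY(3)[OF y(1)]
   have "0 \<le> wa (su y)" using m by (simp add: wa_def)
   then show ?thesis using k m y(2) by (auto simp: wt_def w_def wa_def P_def Ms)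
  qed
  have w2: "wt y \<le> wA (\<Psi> y)" if "y \<in> Yn" for y
  proof -
   have y: "y \<in> Y" "\<not> snd (lab y)" "\<Psi> y \<in> Y" "\<not> snd (lab (\<Psi> y))" using that \<Psi>Y by (auto simp: Yn_def)
   note k = key'[OF y(1,2)] key'[OF y(3,4)] suY(3)[OF y(1)] M\<Psi>[OF y(1)]
   have "0 \<le> wA (\<Psi> y)" using m by (simp add: wA_def)
   then show ?thesis using k m y(2) by (auto simp: wt_def w_def wA_def P_def)
  qed
  have "sum wt Y = sum wt Yp + sum wt Yn"
  proof -
   have "Y = Yp \<union> Yn" "Yp \<inter> Yn = {}" by (auto simp: Yp_def Yn_def)
   moreover have "finite Yp" "finite Yn" using finY by (auto simp: Yp_def Yn_def)
   ultimately show ?thesis by (simp add: sum.union_disjoint)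
  qed
  also have "sum wt Yp \<le> sum (\<lambda>y. wa (su y)) Yp" by (rule sum_mono) (rule w1)
  also have "\<dots> = sum wa (su ` Yp)"
   using inj_on_subset[OF inj_su, of Yp] by (subst sum.reindex) (auto simp: Yp_def)
  also have "\<dots> \<le> sum wa Yn"
   by (rule sum_mono2) (use finY suY m in \<open>auto simp: Yp_def Yn_def wa_def\<close>)
  also have "sum wt Yn \<le> sum (\<lambda>y. wA (\<Psi> y)) Yn" by (rule sum_mono) (rule w2)
  also have "\<dots> = sum wA (\<Psi> ` Yn)"
   using permutes_inj_on[OF \<Psi>, of Yn] by (subst sum.reindex) auto
  also have "\<dots> \<le> sum wA Yn"
   by (rule sum_mono2) (use finY \<Psi>Y m in \<open>auto simp: Yn_def wA_def\<close>)
  also have "sum wa Yn + sum wA Yn = (\<Sum>z\<in>Yn. wa z + wA z)" by (rule sum.distrib[symmetric])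
  \<comment> \<open>An \<open>a\<close>-edge is charged only if its inverse letter is at position 2
    of a positive face or its positive letter is at position \<open>m\<close> of a negative face.
    Every face has one such position, whence the prices \<open>1 / (m - 1)\<close> and
    \<open>2 - 1 / (m - 1)\<close>; an edge with both properties carries both charges, which add up
    to 2.\<close>
  also have "\<dots> \<le> (\<Sum>z\<in>Yn. of_bool (P True 2 z) * (1 / (real m - 1)) + (2 - 1 / (real m - 1)) * of_bool (P False m (M z)))"
  proof (rule sum_mono)
   fix z assume "z \<in> Yn"
   define \<delta> where "\<delta> = 1 / (real m - 1)"
   have d: "\<delta> \<le> 1" "0 \<le> \<delta>" using m by (auto simp: \<delta>_def)
   show "wa z + wA z \<le> of_bool (P True 2 z) * (1 / (real m - 1)) + (2 - 1 / (real m - 1)) * of_bool (P False m (M z))"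
    unfolding wa_def wA_def P_def \<delta>_def[symmetric] using d m by (auto simp: of_bool_def)
  qed
  also have "\<dots> = card {z \<in> Yn. P True 2 z} * (1 / (real m - 1)) + (2 - 1 / (real m - 1)) * card {z \<in> Yn. P False m (M z)}"
  proof -
   have "finite Yn" using finY by (simp add: Yn_def)
   then have c: "(\<Sum>z\<in>Yn. of_bool (Q z)) = real (card {z \<in> Yn. Q z})" for Q
    by (simp add: of_bool_def sum.If_cases Int_def)
   show ?thesis
    unfolding sum.distrib sum_distrib_left[symmetric] sum_distrib_right[symmetric] c ..
  qed
  also have "\<dots> \<le> Fp * (1 / (real m - 1)) + (2 - 1 / (real m - 1)) * Fn"
  proof (intro add_mono mult_right_mono mult_left_mono)
   have "card {z \<in> Yn. P True 2 z} \<le> card {d \<in> D. sg d \<and> ps d = 2}"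
    by (rule card_mono) (use D YD in \<open>auto simp: Yn_def P_def\<close>)
   then show "real (card {z \<in> Yn. P True 2 z}) \<le> real Fp" using Fp[of 2] by (simp add: L_def)
   have "card {z \<in> Yn. P False m (M z)} \<le> card {d \<in> D. \<not> sg d \<and> ps d = m}"
    by (rule card_inj_on_le[where f = M])
     (use D YD MD permutes_inj_on[OF M(2)] in \<open>auto simp: Yn_def P_def\<close>)
   then show "real (card {z \<in> Yn. P False m (M z)}) \<le> real Fn" using Fn[of m] by (simp add: L_def)
   have "1 / (real m - 1) \<le> 1" using m by auto
   then show "0 \<le> 2 - 1 / (real m - 1)" by linarith
  qed (use m in auto)
  finally show ?thesis by simp
 qed
 finally show ?thesis using main cYp by (simp add: algebra_simps)
qed

section \<open>Surfaces from trivial products of words\<close>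

lemma walk_nth:
 assumes "walk S x c ds c'" "t < length ds"
 shows "(if Suc t < length ds then S (ds ! Suc t) else c') = (S (ds ! t) \<noteq> x (ds ! t))"
 using assms
proof (induction ds arbitrary: c t)
 case (Cons d ds)
 show ?case
 proof (cases t)
  case 0
  then show ?thesis using Cons.prems by (cases ds) auto
 next
  case (Suc t')
  then show ?thesis using Cons.IH[of _ t'] Cons.prems by auto
 qed
qed simp

lemma walk_cyclic:
 assumes "walk S x c ds c" "t < length ds"
 shows "S (ds ! (Suc t mod length ds)) = (S (ds ! t) \<noteq> x (ds ! t))"
proof (cases "Suc t < length ds")
 case True
 then show ?thesis using walk_nth[OF assms] by simp
next
 case False
 then have "Suc t = length ds" using assms by simp
 moreover have "S (ds ! 0) = c" using assms by (cases ds) auto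
 ultimately show ?thesis using walk_nth[OF assms] by simp
qed

definition darts :: "(nat \<Rightarrow> 's word) \<Rightarrow> nat \<Rightarrow> (nat \<times> nat) set" where
 "darts wd k = Pair k ` {..<length (wd k)}"

definition dart_label :: "(nat \<Rightarrow> 's word) \<Rightarrow> nat \<times> nat \<Rightarrow> 's \<times> bool" where
 "dart_label wd d = wd (fst d) ! snd d"

definition dart_next :: "(nat \<Rightarrow> 's word) \<Rightarrow> nat \<times> nat \<Rightarrow> nat \<times> nat" where
 "dart_next wd d = (fst d, Suc (snd d) mod length (wd (fst d)))"

definition dart_opp :: "(nat \<Rightarrow> 's word) \<Rightarrow> (nat \<Rightarrow> nat) \<Rightarrow> nat \<times> nat \<Rightarrow> nat \<times> nat" where
 "dart_opp wd \<rho> d = (\<rho> (fst d), length (wd (fst d)) - Suc (snd d))"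

text \<open>The product of all words \<open>wd k\<close> is trivial, so its boundary is glued to a
  tree. The words in \<open>Dk\<close> become faces, and the others occur in inverse pairs, which
  are glued by \<open>\<kappa>\<close>. \<open>g k\<close> is the potential at the cut point in
  front of \<open>wd k\<close>; the last hypothesis says that vanishing sums over the faces and over
  the words in \<open>\<Xi>\<close> already make the ends of paired words agree.\<close>

lemma initial_configuration:
 fixes wd :: "nat \<Rightarrow> 's word"
 assumes Dk: "Dk \<subseteq> {..<n}"
  and \<rho>: "\<And>k. k \<in> {..<n} - Dk \<Longrightarrow> \<rho> k \<in> {..<n} - Dk \<and> \<rho> (\<rho> k) = k \<and> \<rho> k \<noteq> k \<and> wd (\<rho> k) = winv (wd k)"
  and triv: "wval (concat (map wd [0..<n])) = []"
  and \<Xi>: "\<Xi> \<subseteq> {..<n} - Dk"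
  and g: "\<And>g :: nat \<Rightarrow> bool. \<forall>k \<in> Dk \<union> \<Xi> \<union> \<rho> ` \<Xi>. g (Suc k) = g k \<Longrightarrow>
    \<forall>k \<in> {..<n} - Dk. k < \<rho> k \<longrightarrow> g (Suc k) = g (\<rho> k)"
 shows "\<exists>M X. matching (\<Union>(darts wd ` Dk)) (dart_label wd) M \<and>
  betti_bound {} (dart_opp wd \<rho>) M (dart_next wd) (darts wd ` Dk) \<Xi> X"
proof -
 define A where "A = \<Union>(darts wd ` ({..<n} - Dk))"
 define bs where "bs k = map (Pair k) [0..<length (wd k)]" for k
 define \<kappa> where "\<kappa> = dart_opp wd \<rho>"
 define ds where "ds = concat (map bs [0..<n])"
 have bs: "set (bs k) = darts wd k" "distinct (bs k)" "map (dart_label wd) (bs k) = wd k"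
   "length (bs k) = length (wd k)" for k
  by (auto simp: bs_def darts_def dart_label_def distinct_map inj_on_def comp_def intro: nth_equalityI)
 have lab: "map (dart_label wd) ds = concat (map wd [0..<n])"
  by (simp add: ds_def map_concat comp_def bs)
 have "distinct (concat (map bs [0..<j]))" for j
 proof (induction j)
  case (Suc j)
  have "set (concat (map bs [0..<j])) \<inter> set (bs j) = {}" by (auto simp: bs_def)
  then show ?case using Suc bs(2) by simp
 qed simp
 then have dis: "distinct ds" by (simp add: ds_def)
 have sd: "set ds = A \<union> \<Union>(darts wd ` Dk)"
 proof -
  have "set ds = \<Union>(darts wd ` {..<n})" by (auto simp: ds_def bs lessThan_atLeast0)
  also have "\<dots> = \<Union>(darts wd ` (({..<n} - Dk) \<union> Dk))" using Dk by (simp add: Un_absorb2)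
  finally show ?thesis unfolding A_def image_Un Union_Un_distrib .
 qed
 obtain M where M: "matching (set ds) (dart_label wd) M"
  and Mx: "\<And>x c. (\<forall>d \<in> set ds. x (M d) = x d) \<Longrightarrow> \<exists>S. walk S x c ds c \<and> compat (set ds) M x S"
  using noncrossing_matching[OF dis, of "dart_label wd"] triv[folded lab] by blast
 have K: "matching A (dart_label wd) \<kappa>"
  unfolding matching_def
 proof
  fix d assume "d \<in> A"
  then obtain k t where kt: "k \<in> {..<n} - Dk" "t < length (wd k)" "d = (k, t)"
   by (auto simp: A_def darts_def)
  note r = \<rho>[OF kt(1)]
  show "\<kappa> d \<in> A \<and> \<kappa> (\<kappa> d) = d \<and> \<kappa> d \<noteq> d \<and> dart_label wd (\<kappa> d) = inv_letter (dart_label wd d)"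
  proof -
   have "(\<rho> k, length (wd k) - Suc t) \<in> darts wd (\<rho> k)" using kt r by (auto simp: darts_def)
   then have "\<kappa> d \<in> A" using kt r by (auto simp: A_def \<kappa>_def dart_opp_def)
   then show ?thesis using kt r by (simp add: \<kappa>_def dart_opp_def dart_label_def nth_winv)
  qed
 qed
 have \<kappa>bs: "rev (map \<kappa> (bs k)) = bs (\<rho> k)" if "k \<in> {..<n} - Dk" for k
  using \<rho>[OF that] by (intro nth_equalityI) (auto simp: bs_def \<kappa>_def dart_opp_def rev_nth)
 have bb: "betti_bound A \<kappa> M (dart_next wd) (darts wd ` Dk) \<Xi> (\<lambda>k x. psum x (darts wd k))"
  unfolding betti_bound_def
 proof (intro conjI ballI allI impI)
  fix e
  show "additive (\<lambda>x. psum x (darts wd e))"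
   unfolding additive_def by (intro allI psum_xor) (simp add: darts_def)
 next
  fix x assume "(\<forall>d \<in> A \<union> \<Union>(darts wd ` Dk). x (M d) = x d) \<and> (\<forall>d \<in> A. x (\<kappa> d) = x d) \<and>
   (\<forall>B \<in> darts wd ` Dk. \<not> psum x B) \<and> (\<forall>e \<in> \<Xi>. \<not> psum x (darts wd e))"
  then have x: "\<And>d. d \<in> set ds \<Longrightarrow> x (M d) = x d" "\<And>d. d \<in> A \<Longrightarrow> x (\<kappa> d) = x d"
   "\<And>k. k \<in> Dk \<Longrightarrow> \<not> psum x (darts wd k)" "\<And>k. k \<in> \<Xi> \<Longrightarrow> \<not> psum x (darts wd k)"
   unfolding sd by blast+
  obtain S where S: "walk S x False ds False" "compat (set ds) M x S"
   using Mx[of x False] x(1) by blast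
  obtain h where h: "\<And>k. k < n \<Longrightarrow> walk S x (h k) (bs k) (h (Suc k))"
   using walk_concat[of S x False bs 0 n False] S(1) unfolding ds_def
   by (metis atLeastLessThan_iff zero_le)
  have inA: "darts wd k \<subseteq> A" if "k \<in> {..<n} - Dk" for k using that by (auto simp: A_def)
  have im: "\<kappa> ` darts wd k = darts wd (\<rho> k)" if "k \<in> {..<n} - Dk" for k
  proof -
   have "set (rev (map \<kappa> (bs k))) = set (bs (\<rho> k))" by (simp only: \<kappa>bs[OF that])
   then show ?thesis by (simp add: bs)
  qed
  have inj: "inj_on \<kappa> (darts wd k)" if "k \<in> {..<n} - Dk" for k
  proof (rule inj_on_inverseI[where g = \<kappa>])
   fix d assume "d \<in> darts wd k"
   then have "d \<in> A" using inA[OF that] by blast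
   then show "\<kappa> (\<kappa> d) = d" using K by (simp add: matching_def)
  qed
  have "\<forall>k \<in> Dk \<union> \<Xi> \<union> \<rho> ` \<Xi>. h (Suc k) = h k"
  proof
   fix k assume k: "k \<in> Dk \<union> \<Xi> \<union> \<rho> ` \<Xi>"
   have "k < n \<and> \<not> psum x (darts wd k)"
   proof -
    consider "k \<in> Dk" | "k \<in> \<Xi>" | j where "j \<in> \<Xi>" "k = \<rho> j" using k by blast
    then show ?thesis
    proof cases
     case 3
     have j: "j \<in> {..<n} - Dk" using 3 \<Xi> by blast
     have "psum x (\<kappa> ` darts wd j) = psum x (darts wd j)"
     proof (rule psum_reindex[OF inj[OF j]])
      fix d assume "d \<in> darts wd j"
      then show "x (\<kappa> d) = x d" using x(2) inA[OF j] by blast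
     qed
     then show ?thesis using im[OF j] x(4) 3 \<rho>[OF j] by simp
    qed (use x Dk \<Xi> in auto)
   qed
   then show "h (Suc k) = h k" using walk_end[OF bs(2) h] by (simp add: bs)
  qed
  note hk = g[OF this]
  \<comment> \<open>A word and its partner join the same two values of the potential in opposite
    directions, so \<open>walk_reverse\<close> applies.\<close>
  have c2: "S (\<kappa> d) = (S d \<noteq> x d)" if "k \<in> {..<n} - Dk" "k < \<rho> k" "d \<in> darts wd k" for k d
  proof -
   note r = \<rho>[OF that(1)]
   have 1: "walk S x (h k) (bs k) (h (\<rho> k))" using hk that(1,2) h[of k] by simp
   have 2: "walk S x (h (\<rho> k)) (rev (map \<kappa> (bs k))) (h (Suc (\<rho> k)))"
    unfolding \<kappa>bs[OF that(1)] using h[of "\<rho> k"] r by simp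
   have 3: "\<forall>d \<in> set (bs k). x (\<kappa> d) = x d" using x(2) inA[OF that(1)] by (auto simp: bs)
   show ?thesis using walk_reverse[OF 1 2 3] that(3) by (simp add: bs)
  qed
  have C1: "compat (A \<union> \<Union>(darts wd ` Dk)) M x S" using S(2) by (simp add: sd)
  have C2: "compat A \<kappa> x S"
   unfolding compat_def
  proof
   fix d assume "d \<in> A"
   then obtain k where k: "k \<in> {..<n} - Dk" "d \<in> darts wd k" by (auto simp: A_def)
   show "S (\<kappa> d) = (S d \<noteq> x d)"
   proof (cases "k < \<rho> k")
    case True
    then show ?thesis using c2 k by blast
   next
    case False
    have "\<kappa> d \<in> darts wd (\<rho> k)" using im[OF k(1)] k(2) by blast
    moreover have "\<rho> k < \<rho> (\<rho> k)" "\<rho> k \<in> {..<n} - Dk" using False \<rho>[OF k(1)] by auto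
    ultimately have "S (\<kappa> (\<kappa> d)) = (S (\<kappa> d) \<noteq> x (\<kappa> d))" using c2 by blast
    moreover have "\<kappa> (\<kappa> d) = d" using K \<open>d \<in> A\<close> by (simp add: matching_def)
    ultimately show ?thesis using x(2)[OF \<open>d \<in> A\<close>] by simp argo
   qed
  qed
  have C3: "compat (\<Union>(darts wd ` Dk)) (dart_next wd) x S"
   unfolding compat_def
  proof
   fix d assume "d \<in> \<Union>(darts wd ` Dk)"
   then obtain k t where k: "k \<in> Dk" "t < length (wd k)" "d = (k, t)" by (auto simp: darts_def)
   have "k < n" using k Dk by auto
   then have "walk S x (h k) (bs k) (h k)"
    using h[of k] walk_end[OF bs(2) h[of k]] x(3)[OF k(1)] by (simp add: bs)
   then have "S (bs k ! (Suc t mod length (wd k))) = (S (bs k ! t) \<noteq> x (bs k ! t))"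
    using walk_cyclic[of S x "h k" "bs k" t] k by (simp add: bs)
   moreover have "Suc t mod length (wd k) < length (wd k)" using k by (intro mod_less_divisor) auto
   ultimately show "S (dart_next wd d) = (S d \<noteq> x d)" using k by (simp add: bs_def dart_next_def)
  qed
  show "\<exists>S. compat (A \<union> \<Union>(darts wd ` Dk)) M x S \<and> compat A \<kappa> x S \<and> compat (\<Union>(darts wd ` Dk)) (dart_next wd) x S"
   using C1 C2 C3 by blast
 qed
 have "finite A" by (auto simp: A_def darts_def)
 moreover have "A \<inter> \<Union>(darts wd ` Dk) = {}" by (auto simp: A_def darts_def)
 ultimately obtain M' X' where "betti_bound {} \<kappa> M' (dart_next wd) (darts wd ` Dk) \<Xi> X'"
  "matching (\<Union>(darts wd ` Dk)) (dart_label wd) M'"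
  using eliminate_all[OF _ bb M[unfolded sd] K] by blast
 then show ?thesis unfolding \<kappa>_def by blast
qed

section \<open>Cancelling faces\<close>

definition face :: "nat \<Rightarrow> nat \<Rightarrow> (nat \<times> nat) set" where
 "face L i = Pair i ` {..<L}"

definition face_next :: "nat \<Rightarrow> nat \<times> nat \<Rightarrow> nat \<times> nat" where
 "face_next L d = (fst d, Suc (snd d) mod L)"

text \<open>Two faces of opposite orientation are cancelled: they are glued along the mirror image.\<close>

lemma cancel_faces:
 fixes L :: nat
 assumes L: "L > 0" and bb: "betti_bound {} \<kappa>0 M (face_next L) (face L ` I) \<Xi> X"
  and M: "matching (\<Union>(face L ` I)) lab M"
  and ij: "i \<in> I" "j \<in> I" "i \<noteq> j" and t0: "t0 < L" "M (i, t0) = (j, L - Suc t0)"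
  and lab: "\<And>t. t < L \<Longrightarrow> lab (j, L - Suc t) = inv_letter (lab (i, t))"
 shows "\<exists>\<kappa> M' X'. betti_bound {} \<kappa> M' (face_next L) (face L ` (I - {i, j})) \<Xi> X' \<and>
   matching (\<Union>(face L ` (I - {i, j}))) lab M'"
proof -
 define mi where "mi d = (if fst d = i then j else i, L - Suc (snd d))" for d :: "nat \<times> nat"
 define d0 where "d0 = (i, t0)"
 define d1 where "d1 = (j, L - Suc t0)"
 define I' where "I' = I - {i, j}"
 define R where "R = \<Union>(face L ` I')"
 define A0 where "A0 = face L i \<union> face L j"
 \<comment> \<open>Joining two discs along the edge of \<open>d0\<close> and \<open>d1\<close> gives
   a disc. The remaining darts on its boundary become auxiliary and are zipped up by the mirror map
   \<open>mi\<close>.\<close>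
 define A where "A = A0 - {d0, d1}"
 have M01: "M d0 = d1" "M d1 = d0" "d0 \<noteq> d1" "d0 \<in> A0" "d1 \<in> A0"
 proof -
  show "M d0 = d1" using t0 by (simp add: d0_def d1_def)
  have "d0 \<in> \<Union>(face L ` I)" using ij t0 by (auto simp: face_def d0_def)
  then show "M d1 = d0" using M \<open>M d0 = d1\<close> unfolding matching_def by metis
 qed (use ij t0 in \<open>auto simp: d0_def d1_def A0_def face_def\<close>)
 have all: "\<Union>(face L ` I) = A0 \<union> R" using ij by (auto simp: A0_def R_def I'_def)
 have AR: "A \<inter> R = {}" "A0 \<inter> R = {}" by (auto simp: A_def A0_def R_def I'_def face_def)
 have all': "A \<union> R = \<Union>(face L ` I) - {d0, d1}" using all AR M01 by (auto simp: A_def)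
 have mi: "mi d \<in> A0" "mi (mi d) = d" "mi d \<noteq> d" "lab (mi d) = inv_letter (lab d)"
   "fst (mi d) \<noteq> fst d" if "d \<in> A0" for d
 proof -
  consider t where "d = (i, t)" "t < L" | t where "d = (j, t)" "t < L" using \<open>d \<in> A0\<close> by (auto simp: A0_def face_def)
  then have "mi d \<in> A0 \<and> mi (mi d) = d \<and> mi d \<noteq> d \<and> lab (mi d) = inv_letter (lab d) \<and> fst (mi d) \<noteq> fst d"
  proof cases
   case 1
   then show ?thesis using ij(3) lab[of t] by (auto simp: mi_def A0_def face_def)
  next
   case 2
   then show ?thesis using ij(3) lab[of "L - Suc t"] by (auto simp: mi_def A0_def face_def)
  qed
  then show "mi d \<in> A0" "mi (mi d) = d" "mi d \<noteq> d" "lab (mi d) = inv_letter (lab d)" "fst (mi d) \<noteq> fst d" by blast+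
 qed
 have mi0: "mi d0 = d1" "mi d1 = d0" using ij(3) t0 by (auto simp: mi_def d0_def d1_def)
 have K: "matching A lab mi"
  unfolding matching_def
 proof
  fix d assume "d \<in> A"
  then have d: "d \<in> A0" "d \<noteq> d0" "d \<noteq> d1" by (auto simp: A_def)
  then have "mi d \<noteq> d0" "mi d \<noteq> d1" using mi(2)[OF d(1)] mi0 by metis+
  then show "mi d \<in> A \<and> mi (mi d) = d \<and> mi d \<noteq> d \<and> lab (mi d) = inv_letter (lab d)"
   using mi[OF d(1)] by (simp add: A_def)
 qed
 have M1: "matching (A \<union> R) lab M"
  unfolding matching_def all'
 proof
  fix d assume d: "d \<in> \<Union>(face L ` I) - {d0, d1}"
  have *: "M d \<in> \<Union>(face L ` I) \<and> M (M d) = d \<and> M d \<noteq> d \<and> lab (M d) = inv_letter (lab d)"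
   using bspec[OF M[unfolded matching_def], of d] d by blast
  then have "M d \<noteq> d0" "M d \<noteq> d1" using M01 d by auto
  then show "M d \<in> \<Union>(face L ` I) - {d0, d1} \<and> M (M d) = d \<and> M d \<noteq> d \<and> lab (M d) = inv_letter (lab d)"
   using * by blast
 qed
 \<comment> \<open>The value on the deleted edge is forced, because the cochain has to sum to 0 over
   face \<open>i\<close>.\<close>
 define c where "c x = psum x (face L i - {d0})" for x :: "nat \<times> nat \<Rightarrow> bool"
 define ext where "ext x d = (if d = d0 \<or> d = d1 then c x else x d)" for x d
 have finf: "finite (face L k)" for k by (simp add: face_def)
 have bb': "betti_bound A mi M (face_next L) (face L ` I') \<Xi> (\<lambda>e x. X e (ext x))"
  unfolding betti_bound_def
 proof (intro conjI ballI allI impI)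
  fix e assume "e \<in> \<Xi>"
  then have "additive (X e)" using bb by (simp add: betti_bound_def)
  moreover have "c (\<lambda>d. x d \<noteq> y d) = (c x \<noteq> c y)" for x y
   unfolding c_def by (rule psum_xor) (simp add: finf)
  then have "ext (\<lambda>d. x d \<noteq> y d) = (\<lambda>d. ext x d \<noteq> ext y d)" for x y
   by (intro HOL.ext) (simp add: ext_def)
  ultimately show "additive (\<lambda>x. X e (ext x))" by (simp add: additive_def)
 next
  fix x assume x: "(\<forall>d \<in> A \<union> \<Union>(face L ` I'). x (M d) = x d) \<and> (\<forall>d \<in> A. x (mi d) = x d) \<and>
   (\<forall>B \<in> face L ` I'. \<not> psum x B) \<and> (\<forall>e \<in> \<Xi>. \<not> X e (ext x))"
  have xM: "x (M d) = x d" if "d \<in> A \<union> R" for d using x that unfolding R_def by blast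
  have xmi: "x (mi d) = x d" if "d \<in> A" for d using x that by blast
  have e1: "ext x d = x d" if "d \<noteq> d0" "d \<noteq> d1" for d using that by (simp add: ext_def)
  have e2: "\<forall>d \<in> {} \<union> \<Union>(face L ` I). ext x (M d) = ext x d"
  proof
   fix d assume d: "d \<in> {} \<union> \<Union>(face L ` I)"
   show "ext x (M d) = ext x d"
   proof (cases "d = d0 \<or> d = d1")
    case True
    then show ?thesis using M01 by (auto simp: ext_def)
   next
    case False
    then have dA: "d \<in> A \<union> R" using d all' by blast
    then have "M d \<in> A \<union> R" using M1 by (simp add: matching_def)
    then have "M d \<noteq> d0" "M d \<noteq> d1" unfolding all' by blast+
    then show ?thesis using xM[OF dA] False e1 by simp
   qed
  qed
  have emi: "ext x (mi d) = ext x d" if "d \<in> A0" for d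
  proof (cases "d = d0 \<or> d = d1")
   case True
   then show ?thesis using mi0 by (auto simp: ext_def)
  next
   case False
   then have "d \<in> A" using that by (simp add: A_def)
   then have "mi d \<in> A" using K by (simp add: matching_def)
   then have "mi d \<noteq> d0" "mi d \<noteq> d1" by (simp_all add: A_def)
   then show ?thesis using xmi[OF \<open>d \<in> A\<close>] False e1 by simp
  qed
  have pi: "\<not> psum (ext x) (face L i)"
  proof -
   have "face L i = insert d0 (face L i - {d0})" using t0 by (auto simp: face_def d0_def)
   then have "psum (ext x) (face L i) = (ext x d0 \<noteq> psum (ext x) (face L i - {d0}))"
    using psum_insert[of "face L i - {d0}" d0 "ext x"] finf[of i] by simp
   moreover have "psum (ext x) (face L i - {d0}) = psum x (face L i - {d0})"
    by (rule psum_cong[OF refl], rule e1) (use ij in \<open>auto simp: face_def d1_def\<close>)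
   ultimately show ?thesis by (simp add: ext_def c_def)
  qed
  have pj: "\<not> psum (ext x) (face L j)"
  proof -
   have sub: "face L i \<subseteq> A0" by (simp add: A0_def)
   have "face L j = mi ` face L i"
   proof (intro equalityI subsetI)
    fix d assume d: "d \<in> face L j"
    then have "mi d \<in> face L i" "d \<in> A0" using ij by (auto simp: mi_def face_def A0_def)
    then show "d \<in> mi ` face L i" using mi(2) by (metis imageI)
   qed (auto simp: mi_def face_def)
   moreover have "psum (ext x) (mi ` face L i) = psum (ext x) (face L i)"
   proof (rule psum_reindex)
    show "inj_on mi (face L i)"
     by (rule inj_on_inverseI[where g = mi]) (use mi(2) sub in blast)
   qed (use emi sub in blast)
   ultimately show ?thesis using pi by simp
  qed
  have e4: "\<forall>B \<in> face L ` I. \<not> psum (ext x) B"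
  proof
   fix B assume "B \<in> face L ` I"
   then obtain k where k: "k \<in> I" "B = face L k" by blast
   show "\<not> psum (ext x) B"
   proof (cases "k = i \<or> k = j")
    case True
    then show ?thesis using pi pj k by blast
   next
    case False
    have "psum (ext x) B = psum x B"
     by (rule psum_cong[OF refl], rule e1) (use False k in \<open>auto simp: face_def d0_def d1_def\<close>)
    moreover have "B \<in> face L ` I'" using k False by (simp add: I'_def)
    ultimately show ?thesis using x by blast
   qed
  qed
  have e5: "\<forall>e \<in> \<Xi>. \<not> X e (ext x)" using x by blast
  obtain S where S: "compat ({} \<union> \<Union>(face L ` I)) M (ext x) S" "compat (\<Union>(face L ` I)) (face_next L) (ext x) S"
   using betti_boundD[OF bb e2 _ e4 e5] by blast
  define u where "u t = (i, t mod L)" for t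
  define v where "v t = (j, L - Suc (t mod L))" for t
  have uv: "u t \<in> \<Union>(face L ` I)" "v t \<in> \<Union>(face L ` I)" "u t \<in> A0" "v t = mi (u t)" for t
  proof -
   have "u t \<in> face L i" "v t \<in> face L j" using L by (auto simp: u_def v_def face_def)
   then show "u t \<in> \<Union>(face L ` I)" "v t \<in> \<Union>(face L ` I)" "u t \<in> A0" using ij by (auto simp: A0_def)
   show "v t = mi (u t)" by (simp add: u_def v_def mi_def)
  qed
  have nu: "face_next L (u t) = u (Suc t)" for t by (simp add: u_def face_next_def mod_Suc_eq)
  have nv: "face_next L (v (Suc t)) = v t" for t
  proof (cases "Suc (t mod L) = L")
   case True
   then have "Suc t mod L = 0" by (simp add: mod_Suc)
   then show ?thesis using True L by (simp add: v_def face_next_def)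
  next
   case False
   then have a: "Suc t mod L = Suc (t mod L)" by (simp add: mod_Suc)
   have "Suc (t mod L) < L" using False L mod_less_divisor[of L t] by linarith
   then have "Suc (L - Suc (Suc (t mod L))) = L - Suc (t mod L)" by linarith
   then show ?thesis unfolding v_def face_next_def by (simp add: a L)
  qed
  have snx: "S (face_next L d) = (S d \<noteq> ext x d)" if "d \<in> \<Union>(face L ` I)" for d
   using S(2) that unfolding compat_def by (rule bspec)
  \<comment> \<open>Starting from the common edge, the boundary of face \<open>i\<close> is followed
    forwards and that of face \<open>j\<close> backwards; the cochain is symmetric under
    \<open>mi\<close>, so the relation between the potentials propagates.\<close>
  have main: "S (v (t0 + k)) = (S (u (t0 + k)) \<noteq> ext x (u (t0 + k)))" for k
  proof (induction k)
   case 0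
   have "M (u t0) = v t0" "u t0 = d0" using t0 by (simp_all add: u_def v_def d0_def)
   then show ?case using bspec[OF S(1)[unfolded compat_def], of "u t0"] uv(1)[of t0] by simp
  next
   case (Suc k)
   have 1: "S (u (t0 + Suc k)) = (S (u (t0 + k)) \<noteq> ext x (u (t0 + k)))"
    using snx[OF uv(1)[of "t0 + k"]] nu[of "t0 + k"] by simp
   have 2: "S (v (t0 + k)) = (S (v (t0 + Suc k)) \<noteq> ext x (v (t0 + Suc k)))"
    using snx[OF uv(2)[of "t0 + Suc k"]] nv[of "t0 + k"] by simp
   have 3: "ext x (v (t0 + Suc k)) = ext x (u (t0 + Suc k))"
    using emi[OF uv(3)] uv(4) by simp
   show ?case using 1 2 3 Suc by argo
  qed
  have smi: "S (mi d) = (S d \<noteq> ext x d)" if d: "d \<in> face L i" for d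
  proof -
   obtain t where t: "d = (i, t)" "t < L" using d by (auto simp: face_def)
   have "u (t0 + (t + (L - t0))) = d" using t t0 by (simp add: u_def)
   then show ?thesis using main[of "t + (L - t0)"] uv(4) by metis
  qed
  have C2: "compat A mi x S"
   unfolding compat_def
  proof
   fix d assume d: "d \<in> A"
   then have d': "d \<in> A0" "ext x d = x d" by (auto simp: A_def ext_def)
   show "S (mi d) = (S d \<noteq> x d)"
   proof (cases "d \<in> face L i")
    case True
    then show ?thesis using smi d' by simp
   next
    case False
    then have "mi d \<in> face L i" using d' by (auto simp: A0_def face_def mi_def)
    then have "S (mi (mi d)) = (S (mi d) \<noteq> ext x (mi d))" by (rule smi)
    then show ?thesis using mi(2)[OF d'(1)] emi[OF d'(1)] d'(2) by simp argo
   qed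
  qed
  have C1: "compat (A \<union> \<Union>(face L ` I')) M x S"
   by (rule compat_mono[OF S(1)]) (use all' in \<open>auto simp: R_def ext_def\<close>)
  have C3: "compat (\<Union>(face L ` I')) (face_next L) x S"
  proof (rule compat_mono[OF S(2)])
   show "\<Union>(face L ` I') \<subseteq> \<Union>(face L ` I)" by (auto simp: I'_def)
   fix d assume "d \<in> \<Union>(face L ` I')"
   then have "d \<in> A \<union> R" by (simp add: R_def)
   then show "x d = ext x d" unfolding all' by (simp add: ext_def)
  qed
  show "\<exists>S. compat (A \<union> \<Union>(face L ` I')) M x S \<and> compat A mi x S \<and> compat (\<Union>(face L ` I')) (face_next L) x S"
   using C1 C2 C3 by blast
 qed
 have "finite A" by (simp add: A_def A0_def finf)
 then show ?thesis
  using eliminate_all[OF _ bb' M1[unfolded R_def] K] AR(1) unfolding R_def I'_def by blast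
qed

lemma permutes_If:
 assumes "finite D" "inj_on f D" "f ` D \<subseteq> D"
 shows "(\<lambda>d. if d \<in> D then f d else d) permutes D"
proof (rule bij_imp_permutes)
 have "f ` D = D" using endo_inj_surj[OF assms(1,3,2)] .
 then have "bij_betw f D D" using assms(2) by (simp add: bij_betw_def)
 then show "bij_betw (\<lambda>d. if d \<in> D then f d else d) D D"
  by (subst bij_betw_cong[where g = f]) auto
qed simp

lemma compat_cong: "(\<And>d. d \<in> D \<Longrightarrow> M d = M' d) \<Longrightarrow> compat D M x S = compat D M' x S"
 unfolding compat_def by auto

lemma matching_inj:
 assumes "matching D lab M"
 shows "inj_on M D" "M ` D \<subseteq> D"
proof -
 show "inj_on M D"
  by (rule inj_on_inverseI[where g = M]) (use assms in \<open>auto simp: matching_def\<close>)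
qed (use assms in \<open>auto simp: matching_def\<close>)

text \<open>The condition that a cochain sums to 0 over a face is counted as one more functional.
  This is how the number of faces enters the Euler characteristic estimate of
  \<open>surface_bound\<close>.\<close>

lemma configuration_bound:
 fixes a b :: 's and X :: "'e \<Rightarrow> (nat \<times> nat \<Rightarrow> bool) \<Rightarrow> bool"
 assumes m: "m \<ge> 2" and ab: "a \<noteq> b"
  and D: "finite D" "D \<noteq> {}"
  and M: "matching D (\<lambda>d. letter_at a b m (sg d) (ps d)) M"
  and nx: "\<And>d. d \<in> D \<Longrightarrow> nx d \<in> D \<and> ps (nx d) = (ps d + 1) mod (2 * m + 6) \<and> sg (nx d) = sg d" "inj_on nx D"
  and ps: "\<And>d. d \<in> D \<Longrightarrow> ps d < 2 * m + 6"
  and red: "\<And>d. d \<in> D \<Longrightarrow> sg d \<Longrightarrow> ps d + ps (M d) = 2 * m + 5 \<Longrightarrow> sg (M d)"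
  and fin: "finite \<Xi>" "finite \<F>" and \<F>: "\<Union>\<F> = D"
  and bb: "betti_bound {} \<kappa> M nx \<F> \<Xi> X"
 defines "Fp \<equiv> card {d \<in> D. sg d \<and> ps d = 0}" and "Fn \<equiv> card {d \<in> D. \<not> sg d \<and> ps d = 0}"
 shows "2 * (real Fp + real Fn) + 1 \<le> card \<Xi> + card \<F> + Fp / (real m - 1) + (2 - 1 / (real m - 1)) * Fn"
proof -
 define M' where "M' d = (if d \<in> D then M d else d)" for d
 define nx' where "nx' d = (if d \<in> D then nx d else d)" for d
 define Y where "Y e = (case e of Inl e \<Rightarrow> X e | Inr B \<Rightarrow> (\<lambda>x. psum x B))" for e
 have finB: "finite B" if "B \<in> \<F>" for B using that D \<F> by (metis Sup_upper finite_subset)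
 have "card (\<Xi> <+> \<F>) = card \<Xi> + card \<F>" using fin by (rule card_Plus)
 moreover have "2 * (real Fp + real Fn) + 1 \<le> card (\<Xi> <+> \<F>) + Fp / (real m - 1) + (2 - 1 / (real m - 1)) * Fn"
  unfolding Fp_def Fn_def
 proof (rule surface_bound[OF m ab D, where M = M' and nx = nx' and X = Y])
  show "matching D (\<lambda>d. letter_at a b m (sg d) (ps d)) M'"
   using M unfolding matching_def by (simp add: M'_def)
  show "M' permutes D" unfolding M'_def by (rule permutes_If[OF D(1) matching_inj[OF M]])
  show "nx' permutes D" unfolding nx'_def by (rule permutes_If[OF D(1) nx(2)]) (use nx in auto)
  show "finite (\<Xi> <+> \<F>)" using fin by simp
  show "\<forall>e \<in> \<Xi> <+> \<F>. additive (Y e)"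
  proof
   fix e assume "e \<in> \<Xi> <+> \<F>"
   then consider i where "e = Inl i" "i \<in> \<Xi>" | B where "e = Inr B" "B \<in> \<F>" by auto
   then show "additive (Y e)"
   proof cases
    case 1
    then show ?thesis using bb by (simp add: Y_def betti_bound_def)
   next
    case 2
    then show ?thesis unfolding Y_def additive_def using psum_xor[OF finB] by simp
   qed
  qed
  fix x assume x: "\<forall>d \<in> D. x (M' d) = x d" "\<forall>e \<in> \<Xi> <+> \<F>. \<not> Y e x"
  have "\<exists>S. compat ({} \<union> \<Union>\<F>) M x S \<and> compat {} \<kappa> x S \<and> compat (\<Union>\<F>) nx x S"
  proof (rule betti_boundD[OF bb])
   show "\<forall>d \<in> {} \<union> \<Union>\<F>. x (M d) = x d" using x(1) \<F> by (simp add: M'_def)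
   show "\<forall>B \<in> \<F>. \<not> psum x B"
   proof
    fix B assume "B \<in> \<F>"
    then have "\<not> Y (Inr B) x" using x(2) by blast
    then show "\<not> psum x B" by (simp add: Y_def)
   qed
   show "\<forall>e \<in> \<Xi>. \<not> X e x"
   proof
    fix e assume "e \<in> \<Xi>"
    then have "\<not> Y (Inl e) x" using x(2) by blast
    then show "\<not> X e x" by (simp add: Y_def)
   qed
  qed simp
  then obtain S where S: "compat D M x S" "compat D nx x S" unfolding \<F> by auto
  then have "compat D M' x S" "compat D nx' x S" by (simp_all add: compat_def M'_def nx'_def)
  then show "\<exists>S. compat D M' x S \<and> compat D nx' x S" by blast
 qed (use nx ps red in \<open>auto simp: M'_def nx'_def\<close>)
 ultimately show ?thesis by simp
qed

text \<open>Cancelling a positive face against its mirror image keeps the signed number of faces and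
  the functionals in number. When no such pair is left, the hypothesis \<open>red\<close> holds, and
  subtracting the number of faces from the bound of \<open>configuration_bound\<close> leaves a
  multiple of the signed number.\<close>

lemma faces_bound:
 fixes a b :: 's and X :: "'e \<Rightarrow> (nat \<times> nat \<Rightarrow> bool) \<Rightarrow> bool"
 assumes m: "m \<ge> 2" and ab: "a \<noteq> b" and \<Xi>: "finite \<Xi>" "\<Xi> \<noteq> {}"
 defines "L \<equiv> 2 * m + 6"
 assumes I: "finite I" and bb: "betti_bound {} \<kappa> M (face_next L) (face L ` I) \<Xi> X"
  and M: "matching (\<Union>(face L ` I)) (\<lambda>d. letter_at a b m (sg (fst d)) (snd d)) M"
 shows "(1 - 1 / (real m - 1)) * (\<Sum>i\<in>I. if sg i then 1 else -1) \<le> real (card \<Xi>) - 1"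
 using I bb M
proof (induction "card I" arbitrary: I M \<kappa> X rule: less_induct)
 case less
 note I = less.prems(1) and bb = less.prems(2) and M = less.prems(3)
 let ?s = "\<lambda>i. if sg i then 1 else -1 :: real"
 have L0: "L > 0" by (simp add: L_def)
 define D where "D = \<Union>(face L ` I)"
 have D: "(i, t) \<in> D \<longleftrightarrow> i \<in> I \<and> t < L" for i t by (auto simp: D_def face_def)
 have finD: "finite D" using I by (auto simp: D_def face_def)
 show ?case
 proof (cases "\<exists>i \<in> I. \<exists>j \<in> I. \<exists>t < L. sg i \<and> \<not> sg j \<and> M (i, t) = (j, L - Suc t)")
  case True
  then obtain i j t where ij: "i \<in> I" "j \<in> I" "t < L" "sg i" "\<not> sg j" "M (i, t) = (j, L - Suc t)" by blast
  have "i \<noteq> j" using ij by auto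
  obtain \<kappa>' M' X' where *: "betti_bound {} \<kappa>' M' (face_next L) (face L ` (I - {i, j})) \<Xi> X'"
   "matching (\<Union>(face L ` (I - {i, j}))) (\<lambda>d. letter_at a b m (sg (fst d)) (snd d)) M'"
   using cancel_faces[OF L0 bb M ij(1,2) \<open>i \<noteq> j\<close> ij(3,6)] ij(4,5)
   by (auto simp: letter_at_def nth_winv L_def)
  have "card (I - {i, j}) < card I" using ij I by (intro psubset_card_mono) auto
  then have "(1 - 1 / (real m - 1)) * sum ?s (I - {i, j}) \<le> real (card \<Xi>) - 1"
   using less.hyps[OF _ _ *] I by simp
  moreover have "sum ?s I = sum ?s (I - {i, j}) + sum ?s {i, j}"
   using ij I by (subst sum.subset_diff[of "{i, j}"]) auto
  moreover have "sum ?s {i, j} = 0" using ij \<open>i \<noteq> j\<close> by simp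
  ultimately show ?thesis by simp
 next
  case False
  show ?thesis
  proof (cases "I = {}")
   case True
   then show ?thesis using \<Xi> by (simp add: card_gt_0_iff Suc_leI)
  next
   case ne: False
   define Fp where "Fp = card {d \<in> D. sg (fst d) \<and> snd d = 0}"
   define Fn where "Fn = card {d \<in> D. \<not> sg (fst d) \<and> snd d = 0}"
   have e: "{d \<in> D. sg (fst d) \<and> snd d = 0} = (\<lambda>i. (i, 0)) ` {i \<in> I. sg i}"
    "{d \<in> D. \<not> sg (fst d) \<and> snd d = 0} = (\<lambda>i. (i, 0)) ` {i \<in> I. \<not> sg i}"
    using L0 by (auto simp: D)
   have F: "Fp = card {i \<in> I. sg i}" "Fn = card {i \<in> I. \<not> sg i}"
    unfolding Fp_def Fn_def e by (auto simp: card_image inj_on_def)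
   have cI: "card I = Fp + Fn"
    unfolding F using I by (subst card_Un_disjoint[symmetric]) (auto intro: arg_cong[of _ _ card])
   have sI: "sum ?s I = real Fp - real Fn"
    unfolding F using I by (simp add: sum.If_cases Int_def)
   have cF: "card (face L ` I) = card I"
    using L0 by (intro card_image inj_onI) (auto simp: face_def set_eq_iff image_iff)
   have "2 * (real Fp + real Fn) + 1 \<le> card \<Xi> + card (face L ` I) + Fp / (real m - 1) + (2 - 1 / (real m - 1)) * Fn"
    unfolding Fp_def Fn_def
   proof (rule configuration_bound[OF m ab finD, where nx = "face_next L" and M = M and \<kappa> = \<kappa> and X = X])
    show "D \<noteq> {}" using ne L0 D by blast
    show "matching D (\<lambda>d. letter_at a b m (sg (fst d)) (snd d)) M" using M by (simp add: D_def)
    show "betti_bound {} \<kappa> M (face_next L) (face L ` I) \<Xi> X" by (rule bb)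
    show "inj_on (face_next L) D"
    proof (rule inj_onI, clarify)
     fix i t j t' assume d: "(i, t) \<in> D" "(j, t') \<in> D" "face_next L (i, t) = face_next L (j, t')"
     then have "t < L" "t' < L" "i = j" "Suc t mod L = Suc t' mod L" by (auto simp: D face_next_def)
     then show "i = j \<and> t = t'" by (auto simp: mod_Suc split: if_splits)
    qed
    fix d assume "d \<in> D"
    then obtain i t where d: "d = (i, t)" "i \<in> I" "t < L" using D by (cases d) auto
    show "snd d < 2 * m + 6" using d by (simp add: L_def)
    show "face_next L d \<in> D \<and> snd (face_next L d) = (snd d + 1) mod (2 * m + 6) \<and> sg (fst (face_next L d)) = sg (fst d)"
     using d L0 by (auto simp: face_next_def D) (simp add: L_def)
    assume s: "sg (fst d)" "snd d + snd (M d) = 2 * m + 5"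
    have "M d \<in> D" using M d D unfolding matching_def D_def[symmetric] by blast
    then obtain j where "j \<in> I" "M d = (j, snd (M d))" using D by (cases "M d") auto
    moreover have "snd (M d) = L - Suc t" using s d by (simp add: L_def)
    ultimately show "sg (fst (M d))" using False d s by (metis fst_conv)
   qed (use \<Xi> I in \<open>auto simp: D_def\<close>)
   then show ?thesis using cF cI unfolding sI by (simp add: algebra_simps diff_divide_distrib)
  qed
 qed
qed

text \<open>Every face is a single relator or its inverse, so the surface of
  \<open>initial_configuration\<close> is one to which \<open>faces_bound\<close> applies.\<close>

lemma quadratic_bound:
 fixes wd :: "nat \<Rightarrow> 's word" and a b :: 's
 assumes m: "m \<ge> 2" and ab: "a \<noteq> b" and Dk: "Dk \<subseteq> {..<n}"
  and \<rho>: "\<And>k. k \<in> {..<n} - Dk \<Longrightarrow> \<rho> k \<in> {..<n} - Dk \<and> \<rho> (\<rho> k) = k \<and> \<rho> k \<noteq> k \<and> wd (\<rho> k) = winv (wd k)"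
  and faces: "\<And>k. k \<in> Dk \<Longrightarrow> wd k = (if sg k then rword a b m else winv (rword a b m))"
  and triv: "wval (concat (map wd [0..<n])) = []"
  and \<Xi>: "\<Xi> \<subseteq> {..<n} - Dk" "\<Xi> \<noteq> {}"
  and g: "\<And>g :: nat \<Rightarrow> bool. \<forall>k \<in> Dk \<union> \<Xi> \<union> \<rho> ` \<Xi>. g (Suc k) = g k \<Longrightarrow>
    \<forall>k \<in> {..<n} - Dk. k < \<rho> k \<longrightarrow> g (Suc k) = g (\<rho> k)"
 shows "(1 - 1 / (real m - 1)) * (\<Sum>k\<in>Dk. if sg k then 1 else -1) \<le> real (card \<Xi>) - 1"
proof -
 define L where "L = 2 * m + 6"
 have len: "length (wd k) = L" if "k \<in> Dk" for k using faces[OF that] by (simp add: L_def)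
 then have im: "darts wd ` Dk = face L ` Dk" by (auto simp: darts_def face_def)
 obtain M X where M: "matching (\<Union>(face L ` Dk)) (dart_label wd) M"
  and bb: "betti_bound {} (dart_opp wd \<rho>) M (dart_next wd) (face L ` Dk) \<Xi> X"
  using initial_configuration[OF Dk \<rho> triv \<Xi>(1) g] unfolding im by blast
 have "betti_bound {} (dart_opp wd \<rho>) M (face_next L) (face L ` Dk) \<Xi> X"
 proof -
  have "compat (\<Union>(face L ` Dk)) (dart_next wd) x S = compat (\<Union>(face L ` Dk)) (face_next L) x S" for x S
   by (rule compat_cong) (auto simp: dart_next_def face_next_def face_def len)
  then show ?thesis using bb by (simp add: betti_bound_def)
 qed
 moreover have "matching (\<Union>(face L ` Dk)) (\<lambda>d. letter_at a b m (sg (fst d)) (snd d)) M"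
 proof -
  have "dart_label wd d = letter_at a b m (sg (fst d)) (snd d)" if "d \<in> \<Union>(face L ` Dk)" for d
   using that faces by (auto simp: face_def dart_label_def letter_at_def)
  then show ?thesis using M unfolding matching_def by (metis (no_types, lifting))
 qed
 moreover have "finite Dk" "finite \<Xi>" using Dk \<Xi> by (auto intro: finite_subset)
 ultimately show ?thesis using faces_bound[OF m ab _ \<Xi>(2)] unfolding L_def by blast
qed

section \<open>Products of commutators\<close>

lemma nth_concat_replicate:
 "t < k * length w \<Longrightarrow> concat (replicate k w) ! t = w ! (t mod length w)"
proof (induction k arbitrary: t)
 case (Suc k)
 show ?case
 proof (cases "t < length w")
  case False
  then have "t - length w < k * length w" using Suc.prems by auto
  then show ?thesis using Suc.IH False by (simp add: nth_append le_mod_geq)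
 qed (simp add: nth_append)
qed simp

text \<open>The whole power of the relator is one face, and each commutator contributes two pairs of
  words and two functionals. As all letters lie on a positive face, nothing has to be cancelled; the
  linear program counts \<open>k\<close> relators, but only one face enters the Euler
  characteristic.\<close>

lemma commutator_bound:
 fixes a b :: 's and cs :: "('s word \<times> 's word) list"
 assumes m: "m \<ge> 2" and ab: "a \<noteq> b"
  and triv: "wval (concat (map (\<lambda>(x, y). y @ x @ winv y @ winv x) cs) @ concat (replicate k (rword a b m))) = []"
 shows "k * (2 - 1 / (real m - 1)) \<le> 2 * length cs"
proof (cases "k = 0")
 case False
 define l where "l = length cs"
 define R where "R = concat (replicate k (rword a b m))"
 define L where "L = 2 * m + 6"
 define q where "q j = (let (x, y) = cs ! (j div 4) in
  if j mod 4 = 0 then y else if j mod 4 = 1 then x else if j mod 4 = 2 then winv y else winv x)" for j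
 define wd where "wd j = (if j = 4 * l then R else q j)" for j
 define \<rho> where "\<rho> j = (if j mod 4 < 2 then j + 2 else j - (2::nat))" for j
 have lenR: "length R = k * L" by (simp add: R_def L_def length_concat sum_list_replicate)
 have L0: "L > 0" by (simp add: L_def)
 have conc: "concat (map q [0..<4 * j]) = concat (map (\<lambda>(x, y). y @ x @ winv y @ winv x) (take j cs))"
  if "j \<le> l" for j
  using that
 proof (induction j)
  case (Suc j)
  have "[0..<4 * Suc j] = [0..<4 * j] @ [4 * j, 4 * j + 1, 4 * j + 2, 4 * j + 3]"
  proof -
   have "4 * Suc j = Suc (Suc (Suc (Suc (4 * j))))" by simp
   then show ?thesis by (simp only: upt_Suc_append append_assoc append_Cons append_Nil zero_le) simp
  qed
  moreover have "take (Suc j) cs = take j cs @ [cs ! j]"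
   using Suc.prems by (simp add: l_def take_Suc_conv_app_nth)
  moreover have "(4 * j + 1) mod 4 = 1" "(4 * j + 2) mod 4 = 2" "(4 * j + 3) mod 4 = 3" by presburger+
  moreover have "(4 * j + 1) div 4 = j" "(4 * j + 2) div 4 = j" "(4 * j + 3) div 4 = j" by presburger+
  ultimately show ?case using Suc by (simp add: q_def split: prod.split)
 qed simp
 have "wval (concat (map wd [0..<4 * l + 1])) = []"
 proof -
  have "map wd [0..<4 * l] = map q [0..<4 * l]" by (rule map_cong[OF refl]) (simp add: wd_def)
  moreover have "[0..<4 * l + 1] = [0..<4 * l] @ [4 * l]"
   unfolding Suc_eq_plus1[symmetric] by (rule upt_Suc_append) simp
  moreover have "map wd [4 * l] = [R]" by (simp add: wd_def)
  ultimately have "concat (map wd [0..<4 * l + 1]) = concat (map q [0..<4 * l]) @ R"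
   by (simp only: map_append concat_append concat.simps append_Nil2)
  also have "concat (map q [0..<4 * l]) = concat (map (\<lambda>(x, y). y @ x @ winv y @ winv x) cs)"
   using conc[of l] by (simp only: l_def take_all order_refl)
  finally show ?thesis using triv by (simp only: R_def)
 qed
 moreover have "\<rho> j \<in> {..<4 * l + 1} - {4 * l} \<and> \<rho> (\<rho> j) = j \<and> \<rho> j \<noteq> j \<and> wd (\<rho> j) = winv (wd j)"
  if "j \<in> {..<4 * l + 1} - {4 * l}" for j
 proof -
  have j: "j < 4 * l" using that by auto
  define i where "i = j div 4"
  have i: "i < l" using j by (simp add: i_def)
  have inv: "winv (winv w) = w" for w :: "'s word" by (simp add: winv_def rev_map comp_def)
  have "j = 4 * i \<or> j = 4 * i + 1 \<or> j = 4 * i + 2 \<or> j = 4 * i + 3" unfolding i_def by presburger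
  moreover have "(4 * i + 1) mod 4 = 1" "(4 * i + 2) mod 4 = 2" "(4 * i + 3) mod 4 = 3" by presburger+
  moreover have "(4 * i + 1) div 4 = i" "(4 * i + 2) div 4 = i" "(4 * i + 3) div 4 = i" by presburger+
  moreover have "4 * i + 3 < 4 * l" using i by linarith
  ultimately show ?thesis
   by (elim disjE) (simp_all add: \<rho>_def wd_def q_def inv split: prod.split)
 qed
 moreover define \<Xi> where "\<Xi> = {j. j < 4 * l \<and> j mod 4 < 2}"
 moreover have "\<Xi> \<subseteq> {..<4 * l + 1} - {4 * l}" by (auto simp: \<Xi>_def)
 \<comment> \<open>All four words of a commutator have sum 0, so the potential is the same at all
   cut points next to them.\<close>
 moreover have "\<forall>k \<in> {..<4 * l + 1} - {4 * l}. k < \<rho> k \<longrightarrow> g (Suc k) = g (\<rho> k)"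
  if g: "\<forall>k \<in> {4 * l} \<union> \<Xi> \<union> \<rho> ` \<Xi>. g (Suc k) = g k" for g :: "nat \<Rightarrow> bool"
 proof (intro ballI impI)
  fix j assume j: "j \<in> {..<4 * l + 1} - {4 * l}" "j < \<rho> j"
  then have jX: "j \<in> \<Xi>" "\<rho> j = j + 2" by (auto simp: \<Xi>_def \<rho>_def split: if_splits)
  show "g (Suc j) = g (\<rho> j)"
  proof (cases "j mod 4 = 0")
   case True
   then have 1: "Suc j mod 4 = 1" by (simp add: mod_Suc)
   have "j < 4 * l" using jX(1) by (simp add: \<Xi>_def)
   have "j = 4 * (j div 4)" using True div_mult_mod_eq[of j 4] by linarith
   moreover have "j div 4 < l" using \<open>j < 4 * l\<close> by (simp add: less_mult_imp_div_less)
   ultimately have "Suc j < 4 * l" by linarith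
   then have "Suc j \<in> \<Xi>" using 1 by (simp add: \<Xi>_def)
   then show ?thesis using g jX by auto
  next
   case False
   then have "j mod 4 = 1" using jX by (auto simp: \<Xi>_def)
   then obtain i where i: "j = 4 * i + 1" using div_mult_mod_eq[of j 4] by (metis mult.commute)
   have "j - 1 \<in> \<Xi>" "\<rho> (j - 1) = Suc j" using jX(1) by (simp_all add: \<Xi>_def \<rho>_def i)
   then have "Suc j \<in> \<rho> ` \<Xi>" by (metis imageI)
   then show ?thesis using g jX by auto
  qed
 qed
 ultimately obtain M X where M: "matching (\<Union>(darts wd ` {4 * l})) (dart_label wd) M"
  and bb: "betti_bound {} (dart_opp wd \<rho>) M (dart_next wd) (darts wd ` {4 * l}) \<Xi> X"
  using initial_configuration[of "{4 * l}" "4 * l + 1" \<rho> wd \<Xi>] by auto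
 define D where "D = darts wd (4 * l)"
 have D: "d \<in> D \<longleftrightarrow> fst d = 4 * l \<and> snd d < k * L" for d
  by (cases d) (auto simp: D_def darts_def wd_def lenR)
 define ps where "ps d = snd d mod L" for d :: "nat \<times> nat"
 have lab: "dart_label wd d = letter_at a b m True (ps d)" if "d \<in> D" for d
  using that by (simp add: D dart_label_def wd_def letter_at_def R_def L_def ps_def nth_concat_replicate)
 have nx: "dart_next wd d = (4 * l, Suc (snd d) mod (k * L))" if "d \<in> D" for d
  using that by (simp add: D dart_next_def wd_def lenR)
 have "2 * (real (card {d \<in> D. True \<and> ps d = 0}) + real (card {d \<in> D. \<not> True \<and> ps d = 0})) + 1
   \<le> card \<Xi> + card {D} + card {d \<in> D. True \<and> ps d = 0} / (real m - 1)
    + (2 - 1 / (real m - 1)) * card {d \<in> D. \<not> True \<and> ps d = 0}"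
 proof (rule configuration_bound[OF m ab, where sg = "\<lambda>_. True" and nx = "dart_next wd" and M = M and X = X and \<kappa> = "dart_opp wd \<rho>"])
  show "finite D" by (simp add: D_def darts_def)
  have "(4 * l, 0) \<in> D" using False L0 by (simp add: D)
  then show "D \<noteq> {}" by blast
  show "matching D (\<lambda>d. letter_at a b m True (ps d)) M"
  proof -
   have M': "matching D (dart_label wd) M" using M by (simp add: D_def)
   show ?thesis
    unfolding matching_def
   proof
    fix d assume d: "d \<in> D"
    have *: "M d \<in> D \<and> M (M d) = d \<and> M d \<noteq> d \<and> dart_label wd (M d) = inv_letter (dart_label wd d)"
     using M' d unfolding matching_def by (rule bspec)
    then have "letter_at a b m True (ps (M d)) = inv_letter (letter_at a b m True (ps d))"
     using lab[OF d] lab[of "M d"] by simp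
    then show "M d \<in> D \<and> M (M d) = d \<and> M d \<noteq> d \<and> letter_at a b m True (ps (M d)) = inv_letter (letter_at a b m True (ps d))"
     using * by blast
   qed
  qed
  show "inj_on (dart_next wd) D"
  proof (rule inj_onI)
   fix d d' assume d: "d \<in> D" "d' \<in> D" "dart_next wd d = dart_next wd d'"
   then have "Suc (snd d) mod (k * L) = Suc (snd d') mod (k * L)" by (simp add: nx)
   then have "snd d = snd d'" using d(1,2) by (auto simp: D mod_Suc split: if_splits)
   then show "d = d'" using d(1,2) by (simp add: D prod_eq_iff)
  qed
  show "\<Union>{D} = D" by simp
  show "betti_bound {} (dart_opp wd \<rho>) M (dart_next wd) {D} \<Xi> X" using bb by (simp add: D_def)
  fix d assume d: "d \<in> D"
  show "ps d < 2 * m + 6" using L0 by (simp add: ps_def L_def)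
  have "Suc (snd d) mod (k * L) mod L = Suc (snd d) mod L" by (simp add: mod_mod_cancel)
  then show "dart_next wd d \<in> D \<and> ps (dart_next wd d) = (ps d + 1) mod (2 * m + 6) \<and> True = True"
   using nx[OF d] False L0 unfolding D by (simp add: ps_def L_def[symmetric] mod_Suc_eq)
 qed (auto simp: \<Xi>_def)
 moreover have "card {d \<in> D. ps d = 0} = k"
 proof -
  have "{d \<in> D. ps d = 0} = (\<lambda>i. (4 * l, i * L)) ` {..<k}"
   using L0 by (auto simp: D ps_def image_iff elim!: dvdE simp flip: mod_eq_0_iff_dvd)
  then show ?thesis using L0 by (simp add: card_image inj_on_def)
 qed
 moreover have "card \<Xi> = 2 * l"
 proof -
  have "\<Xi> = (\<lambda>i. 4 * i) ` {..<l} \<union> (\<lambda>i. 4 * i + 1) ` {..<l}"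
  proof (intro equalityI subsetI)
   fix j assume j: "j \<in> \<Xi>"
   then have "j = 4 * (j div 4) \<or> j = 4 * (j div 4) + 1" "j div 4 < l" unfolding \<Xi>_def by (simp, presburger, simp add: less_mult_imp_div_less)
   then show "j \<in> (\<lambda>i. 4 * i) ` {..<l} \<union> (\<lambda>i. 4 * i + 1) ` {..<l}" by blast
  next
   fix j assume "j \<in> (\<lambda>i. 4 * i) ` {..<l} \<union> (\<lambda>i. 4 * i + 1) ` {..<l}"
   then obtain i where i: "i < l" "j = 4 * i \<or> j = 4 * i + 1" by auto
   then have "j mod 4 < 2" "j < 4 * l" by presburger+
   then show "j \<in> \<Xi>" by (simp add: \<Xi>_def)
  qed
  moreover have "(\<lambda>i. 4 * i) ` {..<l} \<inter> (\<lambda>i. 4 * i + 1) ` {..<l} = ({} :: nat set)"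
  proof -
   have "4 * i \<noteq> 4 * i' + (1::nat)" for i i' by presburger
   then show ?thesis by blast
  qed
  ultimately show ?thesis by (simp add: card_Un_disjoint card_image inj_on_def)
 qed
 ultimately show ?thesis by (simp add: l_def algebra_simps)
qed simp

section \<open>Consequences of the relator\<close>

lemma wval_append_cong: "wval u = wval u' \<Longrightarrow> wval v = wval v' \<Longrightarrow> wval (u @ v) = wval (u' @ v')"
proof -
 have *: "foldr cons_cancel u w = foldr cons_cancel (wval u) w" if "reduced w" for u w :: "'s word"
  using foldr_cons_cancel_assoc[OF that, of u "[]"] that by (simp add: wval_def)
 assume "wval u = wval u'" "wval v = wval v'"
 then show ?thesis using *[of "wval v" u] *[of "wval v" u'] by (simp add: wval_append)
qed

lemma wval_wval [simp]: "wval (wval w) = wval w"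
 by (rule wval_reduced) simp

lemma winv_append: "winv (u @ v) = winv v @ winv u"
 by (simp add: winv_def)

lemma winv_winv [simp]: "winv (winv w) = w"
 by (simp add: winv_def rev_map comp_def)

lemma winv_Nil [simp]: "winv [] = []"
 by (simp add: winv_def)

lemma winv_Cons: "winv (x # w) = winv w @ [inv_letter x]"
 by (simp add: winv_def)

lemma wval_winv_cancel: "wval (u @ winv u @ v) = wval v"
proof (induction u arbitrary: v)
 case (Cons x u)
 have "wval ((x # u) @ winv (x # u) @ v) = wval ([x] @ (u @ winv u @ (inv_letter x # v)))"
  by (simp add: winv_Cons)
 also have "\<dots> = wval ([x] @ (inv_letter x # v))"
  by (rule wval_append_cong[OF refl Cons.IH])
 also have "\<dots> = wval v" using wval_cancel[of "[]" x v] by simp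
 finally show ?case .
qed simp

lemma wval_winv_cancel': "wval (winv u @ u @ v) = wval v"
 using wval_winv_cancel[of "winv u" v] by simp

lemma wval_winv_cancel0: "wval (u @ winv u) = []" "wval (winv u @ u) = []"
 using wval_winv_cancel[of u "[]"] wval_winv_cancel'[of u "[]"] by simp_all

lemma wval_mid: "wval v = wval v' \<Longrightarrow> wval (u @ v @ w) = wval (u @ v' @ w)"
 by (intro wval_append_cong) auto

lemma wval_winv_cong:
 assumes "wval u = wval v"
 shows "wval (winv u) = wval (winv v)"
proof -
 have "wval (winv u) = wval (winv v @ v @ winv u)" by (rule wval_winv_cancel'[symmetric])
 also have "\<dots> = wval (winv v @ u @ winv u)" by (rule wval_mid) (simp add: assms)
 also have "\<dots> = wval (winv v @ [])" by (intro wval_append_cong refl) (simp add: wval_winv_cancel0)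
 finally show ?thesis by simp
qed

definition conj_word :: "'s word \<Rightarrow> 's word \<times> bool \<Rightarrow> 's word" where
 "conj_word r q = fst q @ (if snd q then r else winv r) @ winv (fst q)"

definition degree :: "('s word \<times> bool) list \<Rightarrow> int" where
 "degree qs = (\<Sum>q\<leftarrow>qs. if snd q then 1 else -1)"

text \<open>A priori a word may have several degrees \<open>n\<close>. For the relator at hand
  \<open>rel_expo\<close> shows that \<open>w\<close> determines \<open>n\<close> as soon as m \<ge>
  2.\<close>

definition rel :: "'s word \<Rightarrow> int \<Rightarrow> 's word \<Rightarrow> bool" where
 "rel r n w \<longleftrightarrow> (\<exists>qs. wval w = wval (concat (map (conj_word r) qs)) \<and> n = degree qs)"

lemma rel_cong: "wval u = wval v \<Longrightarrow> rel r n u = rel r n v"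
 by (simp add: rel_def)

lemma rel_Nil: "wval u = [] \<Longrightarrow> rel r 0 u"
 unfolding rel_def by (intro exI[of _ "[]"]) (simp add: degree_def)

lemma rel_append: "rel r n u \<Longrightarrow> rel r k v \<Longrightarrow> rel r (n + k) (u @ v)"
 unfolding rel_def
proof (elim exE conjE)
 fix qs qs'
 assume qs: "wval u = wval (concat (map (conj_word r) qs))" "n = degree qs"
  "wval v = wval (concat (map (conj_word r) qs'))" "k = degree qs'"
 show "\<exists>ps. wval (u @ v) = wval (concat (map (conj_word r) ps)) \<and> n + k = degree ps"
  using wval_append_cong[OF qs(1,3)] qs(2,4) by (intro exI[of _ "qs @ qs'"]) (simp add: degree_def)
qed

lemma rel_conj: "rel r n u \<Longrightarrow> rel r n (p @ u @ winv p)"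
 unfolding rel_def
proof (elim exE conjE)
 fix qs
 assume qs: "wval u = wval (concat (map (conj_word r) qs))" "n = degree qs"
 have "wval (p @ concat (map (conj_word r) qs) @ winv p)
   = wval (concat (map (conj_word r) (map (\<lambda>(q, s). (p @ q, s)) qs)))" for qs
 proof (induction qs)
  case Nil
  then show ?case by (simp add: wval_winv_cancel0)
 next
  case (Cons q qs)
  have "wval (p @ conj_word r q @ concat (map (conj_word r) qs) @ winv p) =
    wval ((p @ conj_word r q) @ (winv p @ p @ (concat (map (conj_word r) qs) @ winv p)))"
   using wval_mid[of "[]" "winv p @ p" "p @ conj_word r q" "concat (map (conj_word r) qs) @ winv p"]
   by (simp add: wval_winv_cancel0)
  also have "\<dots> = wval (((p @ conj_word r q) @ winv p) @ (p @ concat (map (conj_word r) qs) @ winv p))" by simp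
  also have "\<dots> = wval (conj_word r (p @ fst q, snd q) @ concat (map (conj_word r) (map (\<lambda>(q, s). (p @ q, s)) qs)))"
  proof (rule wval_append_cong)
   show "wval ((p @ conj_word r q) @ winv p) = wval (conj_word r (p @ fst q, snd q))"
    by (simp add: conj_word_def winv_append)
  qed (rule Cons.IH)
  finally show ?case by (cases q) simp
 qed
 moreover have "degree (map (\<lambda>(q, s). (p @ q, s)) qs) = degree qs"
  by (simp add: degree_def comp_def case_prod_beta)
 ultimately show "\<exists>qs. wval (p @ u @ winv p) = wval (concat (map (conj_word r) qs)) \<and> n = degree qs"
  using wval_mid[OF qs(1), of p "winv p"] qs(2) by metis
qed

lemma winv_conj_word: "winv (conj_word r q) = conj_word r (fst q, \<not> snd q)"
 by (simp add: conj_word_def winv_append)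

lemma rel_winv: "rel r n u \<Longrightarrow> rel r (- n) (winv u)"
 unfolding rel_def
proof (elim exE conjE)
 fix qs
 assume qs: "wval u = wval (concat (map (conj_word r) qs))" "n = degree qs"
 have 1: "winv (concat (map (conj_word r) qs)) = concat (map (conj_word r) (rev (map (\<lambda>q. (fst q, \<not> snd q)) qs)))" for qs
  by (induction qs) (simp_all add: winv_append winv_conj_word)
 have 2: "degree (rev (map (\<lambda>q. (fst q, \<not> snd q)) qs)) = - degree qs" for qs :: "('a word \<times> bool) list"
  by (induction qs) (simp_all add: degree_def)
 show "\<exists>qs. wval (winv u) = wval (concat (map (conj_word r) qs)) \<and> - n = degree qs"
  by (rule exI[of _ "rev (map (\<lambda>q. (fst q, \<not> snd q)) qs)"])
   (simp only: wval_winv_cong[OF qs(1)] qs(2) 1 2)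
qed

lemma rel_relator: "rel r 1 r" "rel r (-1) (winv r)"
 unfolding rel_def by (rule exI[of _ "[([], True)]"], simp add: conj_word_def degree_def)
  (rule exI[of _ "[([], False)]"], simp add: conj_word_def degree_def)

lemma rel_cyclic: "rel r n (u @ v) \<Longrightarrow> rel r n (v @ u)"
proof -
 assume "rel r n (u @ v)"
 then have "rel r n (winv u @ (u @ v) @ winv (winv u))" by (rule rel_conj)
 moreover have "wval (winv u @ (u @ v) @ winv (winv u)) = wval (v @ u)"
  using wval_winv_cancel'[of u "v @ u"] by simp
 ultimately show ?thesis using rel_cong by metis
qed

definition expo :: "'s \<Rightarrow> 's word \<Rightarrow> int" where
 "expo s w = (\<Sum>x\<leftarrow>w. if fst x = s then (if snd x then 1 else -1) else 0)"

text \<open>The upper right entry of the image in the Heisenberg group.\<close>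

fun heis :: "'s \<Rightarrow> 's \<Rightarrow> 's word \<Rightarrow> int" where
 "heis a b [] = 0"
| "heis a b (x # w) = heis a b w + (if fst x = a then (if snd x then expo b w else - expo b w) else 0)"

lemma expo_simps [simp]: "expo s [] = 0" "expo s (u @ v) = expo s u + expo s v"
 "expo s (x # w) = (if fst x = s then (if snd x then 1 else -1) else 0) + expo s w"
 by (simp_all add: expo_def)

lemma expo_winv [simp]: "expo s (winv w) = - expo s w"
 by (induction w) (simp_all add: winv_Cons inv_letter_def)

lemma expo_cons_cancel: "expo s (cons_cancel x w) = expo s (x # w)"
 by (cases w) (auto simp: cons_cancel_def inv_letter_def)

lemma expo_wval [simp]: "expo s (wval w) = expo s w"
 by (induction w) (simp_all add: wval_def expo_cons_cancel)

lemma heis_append: "heis a b (u @ v) = heis a b u + heis a b v + expo a u * expo b v"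
 by (induction u) (simp_all add: algebra_simps)

lemma heis_cons_cancel: "a \<noteq> b \<Longrightarrow> heis a b (cons_cancel x w) = heis a b (x # w)"
 by (cases w) (auto simp: cons_cancel_def inv_letter_def)

lemma heis_wval:
 assumes "a \<noteq> b"
 shows "heis a b (wval w) = heis a b w"
proof (induction w)
 case (Cons x w)
 have "heis a b (wval (x # w)) = heis a b (x # wval w)"
  using heis_cons_cancel[OF assms, of x "wval w"] by (simp add: wval_def)
 then show ?case using Cons by simp
qed simp

lemma heis_winv:
 assumes "a \<noteq> b"
 shows "heis a b (winv w) = expo a w * expo b w - heis a b w"
proof -
 have "heis a b (w @ winv w) = 0"
  using heis_wval[OF assms, of "w @ winv w"] by (simp add: wval_winv_cancel0)
 then show ?thesis by (simp add: heis_append)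
qed

text \<open>The two commutators of the relator are central in the Heisenberg group and contribute 1
  and - m.\<close>

lemma rword_expo:
 assumes "a \<noteq> b"
 shows "expo a (rword a b m) = 0" "expo b (rword a b m) = 0" "heis a b (rword a b m) = 1 - int m"
proof -
 have e: "expo a (replicate k (b, s)) = 0" "heis a b (replicate k (b, s)) = 0"
  "expo b (replicate k (b, s)) = (if s then int k else - int k)" for k s
  using assms by (induction k) auto
 show "expo a (rword a b m) = 0" "expo b (rword a b m) = 0" "heis a b (rword a b m) = 1 - int m"
  using assms by (simp_all add: rword_def e heis_append)
qed

text \<open>On words with exponents 0 the entry \<open>heis\<close> is additive and invariant under
  conjugation, and it changes sign under inversion. So it counts conjugates of the relator with
  sign.\<close>

lemma rel_expo:
 assumes ab: "a \<noteq> b" and rel: "rel (rword a b m) n w"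
 shows "expo a w = 0" "expo b w = 0" "heis a b w = (1 - int m) * n"
proof -
 obtain qs where qs: "wval w = wval (concat (map (conj_word (rword a b m)) qs))" "n = degree qs"
  using rel by (auto simp: rel_def)
 define v where "v = concat (map (conj_word (rword a b m)) qs)"
 have c: "expo a (conj_word (rword a b m) q) = 0" "expo b (conj_word (rword a b m) q) = 0"
  "heis a b (conj_word (rword a b m) q) = (1 - int m) * (if snd q then 1 else -1)" for q
  by (simp_all add: conj_word_def rword_expo[OF ab] heis_append heis_winv[OF ab])
 have "expo a v = 0 \<and> expo b v = 0 \<and> heis a b v = (1 - int m) * degree qs"
  unfolding v_def by (induction qs) (simp_all add: c heis_append degree_def algebra_simps)
 moreover have "expo a w = expo a v" "expo b w = expo b v" "heis a b w = heis a b v"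
  using qs(1) expo_wval heis_wval[OF ab] unfolding v_def by metis+
 ultimately show "expo a w = 0" "expo b w = 0" "heis a b w = (1 - int m) * n" using qs(2) by simp_all
qed

text \<open>Up to the factor \<open>1 - m\<close>, the degree of a triangle is the coboundary of
  \<open>heis\<close> plus the cup product of the exponents. This makes the degree of a cycle
  computable.\<close>

lemma rel_triangle:
 assumes ab: "a \<noteq> b" and rel: "rel (rword a b m) n (u @ v @ winv w)"
 shows "(1 - int m) * n = heis a b u + heis a b v - heis a b w + expo a u * expo b v"
proof -
 have e: "expo a w = expo a u + expo a v" "expo b w = expo b u + expo b v"
  using rel_expo(1,2)[OF assms] by simp_all
 show ?thesis
  using rel_expo(3)[OF assms] by (simp add: heis_append heis_winv[OF ab] e algebra_simps)
qed

section \<open>Bounding polygons and real cycles\<close>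

text \<open>A pair \<open>(e, True)\<close> is the edge \<open>e\<close> traversed forwards.
  Polygons are lists of such oriented edges, and a map \<open>f\<close> labels edges by
  words.\<close>

definition opp :: "'e \<times> bool \<Rightarrow> 'e \<times> bool" where
 "opp x = (fst x, \<not> snd x)"

definition ep :: "('e \<Rightarrow> 's word) \<Rightarrow> 'e \<times> bool \<Rightarrow> 's word" where
 "ep f x = (if snd x then f (fst x) else winv (f (fst x)))"

definition boundary_word :: "('e \<Rightarrow> 's word) \<Rightarrow> ('e \<times> bool) list \<Rightarrow> 's word" where
 "boundary_word f ws = concat (map (ep f) ws)"

text \<open>This is the condition under which the sides of a polygon can be glued in pairs to a
  closed surface.\<close>

definition balanced :: "('e \<times> bool) list \<Rightarrow> bool" where
 "balanced ws \<longleftrightarrow> (\<forall>x. count_list ws x = count_list ws (opp x))"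

lemma opp_simps [simp]: "opp (opp x) = x" "opp x \<noteq> x" "x \<noteq> opp x" "snd (opp x) = (\<not> snd x)" "fst (opp x) = fst x"
 by (auto simp: opp_def prod_eq_iff)

lemma ep_opp: "ep f (opp x) = winv (ep f x)"
 by (simp add: ep_def)

lemma boundary_word_simps [simp]: "boundary_word f [] = []"
 "boundary_word f (x # ws) = ep f x @ boundary_word f ws"
 "boundary_word f (us @ ws) = boundary_word f us @ boundary_word f ws"
 by (simp_all add: boundary_word_def)

lemma winv_boundary_word: "winv (boundary_word f ws) = boundary_word f (rev (map opp ws))"
 by (induction ws) (simp_all add: winv_append ep_opp)

lemma count_list_positions: "count_list ws x = card {k. k < length ws \<and> ws ! k = x}"
 by (simp add: count_list_eq_length_filter length_filter_conv_card eq_commute[of x])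

lemma balanced_pairing:
 assumes "balanced ws"
 shows "\<exists>\<sigma>. \<forall>k < length ws. \<sigma> k < length ws \<and> \<sigma> (\<sigma> k) = k \<and> ws ! \<sigma> k = opp (ws ! k)"
proof -
 define A where "A x = {k. k < length ws \<and> ws ! k = x}" for x
 have "\<exists>h. bij_betw h (A x) (A (opp x))" for x
 proof (rule finite_same_card_bij)
  show "card (A x) = card (A (opp x))"
   using assms unfolding A_def balanced_def count_list_positions by (rule spec)
 qed (simp_all add: A_def)
 then obtain h where h: "\<And>x. bij_betw (h x) (A x) (A (opp x))" by metis
 \<comment> \<open>The chosen bijection is used on forward edges and its inverse on backward ones,
   which makes \<open>\<sigma>\<close> an involution.\<close>
 define \<sigma> where "\<sigma> k = (let x = ws ! k in if snd x then h x k else the_inv_into (A (opp x)) (h (opp x)) k)" for k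
 have "\<sigma> k < length ws \<and> \<sigma> (\<sigma> k) = k \<and> ws ! \<sigma> k = opp (ws ! k)" if k: "k < length ws" for k
 proof (cases "snd (ws ! k)")
  case True
  have "k \<in> A (ws ! k)" using k by (simp add: A_def)
  then have "\<sigma> k \<in> A (opp (ws ! k))" using h[of "ws ! k"] True by (auto simp: \<sigma>_def bij_betw_def)
  then have 1: "\<sigma> k < length ws" "ws ! \<sigma> k = opp (ws ! k)" by (auto simp: A_def)
  have "\<sigma> (\<sigma> k) = the_inv_into (A (ws ! k)) (h (ws ! k)) (h (ws ! k) k)"
   using True 1 by (simp add: \<sigma>_def Let_def)
  also have "\<dots> = k" using h[of "ws ! k"] \<open>k \<in> A (ws ! k)\<close> by (intro the_inv_into_f_f) (auto simp: bij_betw_def)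
  finally show ?thesis using 1 by simp
 next
  case False
  let ?y = "opp (ws ! k)"
  have kA: "k \<in> h ?y ` A ?y" using h[of ?y] k by (simp add: A_def bij_betw_def)
  have inj: "inj_on (h ?y) (A ?y)" using h[of ?y] by (simp add: bij_betw_def)
  have s: "\<sigma> k = the_inv_into (A ?y) (h ?y) k" using False by (simp add: \<sigma>_def Let_def)
  have "\<sigma> k \<in> A ?y" unfolding s using the_inv_into_into[OF inj kA subset_refl] .
  then have 1: "\<sigma> k < length ws" "ws ! \<sigma> k = ?y" by (auto simp: A_def)
  have "\<sigma> (\<sigma> k) = h ?y (\<sigma> k)" unfolding \<sigma>_def[of "\<sigma> k"] using 1 False by (simp add: Let_def)
  also have "\<dots> = k" unfolding s by (rule f_the_inv_into_f[OF inj kA])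
  finally show ?thesis using 1 by simp
 qed
 then show ?thesis by blast
qed

text \<open>The inverse of the boundary word, followed by the conjugates of the relator to which
  that word is equal, is trivial. Its sides are paired by balance and its conjugators by
  construction, so \<open>quadratic_bound\<close> applies. One functional for each pair of sides
  suffices, hence the half of the length.\<close>

lemma balanced_bound:
 fixes a b :: 's
 assumes m: "m \<ge> 2" and ab: "a \<noteq> b" and bal: "balanced ws" "ws \<noteq> []"
  and rel: "rel (rword a b m) n (boundary_word f ws)"
 shows "(1 - 1 / (real m - 1)) * n \<le> real (length ws) / 2 - 1"
proof -
 define r where "r = rword a b m"
 obtain qs where qs: "wval (boundary_word f ws) = wval (concat (map (conj_word r) qs))" "n = degree qs"
  using rel by (auto simp: rel_def r_def)
 define K where "K = length ws"
 define F where "F = length qs"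
 define ws' where "ws' = rev (map opp ws)"
 have len: "length ws' = K" by (simp add: ws'_def K_def)
 have "count_list ws' x = count_list ws (opp x)" for x
 proof -
  have "count_list (map opp ws) x = count_list ws (opp x)"
   by (induction ws) auto
  then show ?thesis by (simp add: ws'_def)
 qed
 then have "balanced ws'" using bal by (simp add: balanced_def)
 then obtain \<sigma> where \<sigma>: "\<And>k. k < K \<Longrightarrow> \<sigma> k < K \<and> \<sigma> (\<sigma> k) = k \<and> ws' ! \<sigma> k = opp (ws' ! k)"
  using balanced_pairing[of ws'] len by auto
 \<comment> \<open>After the \<open>K\<close> sides, each conjugate occupies three consecutive
   indices: the conjugator, the relator or its inverse, and the inverse of the conjugator.\<close>
 define qw where "qw k = (let q = qs ! (k div 3) in if k mod 3 = 0 then fst q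
   else if k mod 3 = 1 then (if snd q then r else winv r) else winv (fst q))" for k
 define wd where "wd k = (if k < K then ep f (ws' ! k) else qw (k - K))" for k
 define \<rho> where "\<rho> k = (if k < K then \<sigma> k else if (k - K) mod 3 = 0 then k + 2 else k - 2)" for k
 define Dk where "Dk = (\<lambda>i. K + 3 * i + 1) ` {..<F}"
 define sg where "sg k = snd (qs ! ((k - K) div 3))" for k
 define \<Xi> where "\<Xi> = {k. k < K \<and> snd (ws' ! k)}"
 have arith: "(3 * i + 1) mod 3 = 1" "(3 * i + 2) mod 3 = 2" "(3 * i + 1) div 3 = i" "(3 * i + 2) div 3 = i" for i :: nat
  by presburger+
 have qw3: "qw (3 * i) = fst (qs ! i)" "qw (3 * i + 1) = (if snd (qs ! i) then r else winv r)"
  "qw (3 * i + 2) = winv (fst (qs ! i))" for i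
  unfolding qw_def arith by simp_all
 have conc: "concat (map qw [0..<3 * j]) = concat (map (conj_word r) (take j qs))" if "j \<le> F" for j
  using that
 proof (induction j)
  case (Suc j)
  have "[0..<3 * Suc j] = [0..<3 * j] @ [3 * j, 3 * j + 1, 3 * j + 2]"
  proof -
   have "3 * Suc j = Suc (Suc (Suc (3 * j)))" by simp
   then show ?thesis by (simp only: upt_Suc_append append_assoc append_Cons append_Nil zero_le) simp
  qed
  moreover have "take (Suc j) qs = take j qs @ [qs ! j]"
   using Suc.prems by (simp add: F_def take_Suc_conv_app_nth)
  ultimately show ?case using Suc by (simp add: qw3 conj_word_def del: add_2_eq_Suc' One_nat_def)
 qed simp
 have aux: "(k < K) \<or> (\<exists>i < F. k = K + 3 * i) \<or> (\<exists>i < F. k = K + 3 * i + 2)"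
  if "k \<in> {..<K + 3 * F} - Dk" for k
 proof (rule ccontr)
  assume n: "\<not> ?thesis"
  define j where "j = k - K"
  have k: "k = K + j" "j < 3 * F" using n that by (auto simp: j_def)
  have "j div 3 < F" using k(2) by (simp add: less_mult_imp_div_less mult.commute)
  moreover have "j = 3 * (j div 3) \<or> j = 3 * (j div 3) + 1 \<or> j = 3 * (j div 3) + 2" by presburger
  ultimately have "k = K + 3 * (j div 3) + 1" using n k by (metis add.assoc)
  then have "k \<in> Dk" using \<open>j div 3 < F\<close> by (auto simp: Dk_def)
  then show False using that by blast
 qed
 have nD: "K + 3 * i \<notin> Dk" "K + 3 * i + 2 \<notin> Dk" "i < K \<Longrightarrow> i \<notin> Dk" for i
 proof -
  have "3 * i \<noteq> 3 * j + (1::nat)" "3 * i + 2 \<noteq> 3 * j + (1::nat)" for j by presburger+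
  then show "K + 3 * i \<notin> Dk" "K + 3 * i + 2 \<notin> Dk" by (auto simp: Dk_def)
 qed (auto simp: Dk_def)
 have \<rho>3: "\<rho> (K + 3 * i) = K + 3 * i + 2" "\<rho> (K + 3 * i + 2) = K + 3 * i" for i
  using arith[of i] by (simp_all add: \<rho>_def)
 have wd3: "wd (K + 3 * i) = fst (qs ! i)" "wd (K + 3 * i + 1) = (if snd (qs ! i) then r else winv r)"
  "wd (K + 3 * i + 2) = winv (fst (qs ! i))" for i
  using qw3[of i] by (simp_all add: wd_def)
 have sg3: "sg (K + 3 * i + 1) = snd (qs ! i)" for i
  using arith[of i] by (simp add: sg_def)
 have "(1 - 1 / (real m - 1)) * (\<Sum>k\<in>Dk. if sg k then 1 else -1) \<le> real (card \<Xi>) - 1"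
 proof (rule quadratic_bound[OF m ab, where n = "K + 3 * F" and \<rho> = \<rho> and wd = wd])
  show "Dk \<subseteq> {..<K + 3 * F}" by (auto simp: Dk_def)
  show "\<Xi> \<subseteq> {..<K + 3 * F} - Dk" using nD(3) by (auto simp: \<Xi>_def)
  show "\<Xi> \<noteq> {}"
  proof -
   have "0 < K" using bal by (simp add: K_def)
   then have "0 \<in> \<Xi> \<or> \<sigma> 0 \<in> \<Xi>" using \<sigma>[of 0] by (auto simp: \<Xi>_def)
   then show ?thesis by blast
  qed
  show "wval (concat (map wd [0..<K + 3 * F])) = []"
  proof -
   have "[0..<K + 3 * F] = [0..<K] @ map (\<lambda>j. j + K) [0..<3 * F]"
    using upt_add_eq_append[of 0 K "3 * F"] map_add_upt[of K "3 * F"] by (simp add: add.commute)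
   moreover have "map wd [0..<K] = map (ep f) ws'"
    by (rule nth_equalityI) (simp_all add: len wd_def)
   moreover have "map wd (map (\<lambda>j. j + K) [0..<3 * F]) = map qw [0..<3 * F]"
    by (simp add: wd_def)
   ultimately have "concat (map wd [0..<K + 3 * F]) = boundary_word f ws' @ concat (map (conj_word r) qs)"
    using conc[of F] by (simp only: map_append concat_append boundary_word_def F_def take_all order_refl)
   also have "boundary_word f ws' = winv (boundary_word f ws)" by (simp add: ws'_def winv_boundary_word)
   also have "wval (winv (boundary_word f ws) @ concat (map (conj_word r) qs)) =
     wval (winv (boundary_word f ws) @ boundary_word f ws)"
    by (rule wval_append_cong[OF refl qs(1)[symmetric]])
   finally show ?thesis by (simp add: wval_winv_cancel0)
  qed
  fix k
  show "wd k = (if sg k then rword a b m else winv (rword a b m))" if "k \<in> Dk"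
   using that wd3(2) sg3 by (auto simp: Dk_def r_def)
  show "\<rho> k \<in> {..<K + 3 * F} - Dk \<and> \<rho> (\<rho> k) = k \<and> \<rho> k \<noteq> k \<and> wd (\<rho> k) = winv (wd k)"
   if k: "k \<in> {..<K + 3 * F} - Dk"
  proof -
   consider "k < K" | i where "i < F" "k = K + 3 * i" | i where "i < F" "k = K + 3 * i + 2" using aux[OF k] by blast
   then show ?thesis
   proof cases
    case 1
    have "\<sigma> k \<noteq> k" using \<sigma>[OF 1] opp_simps(2) by metis
    then show ?thesis using \<sigma>[OF 1] 1 nD(3) by (simp add: \<rho>_def wd_def ep_opp)
   next
    case 2
    then show ?thesis using \<rho>3[of i] wd3[of i] nD[of i] by simp
   next
    case 3
    then show ?thesis using \<rho>3[of i] wd3[of i] nD[of i] by simp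
   qed
  qed
 next
  fix g :: "nat \<Rightarrow> bool"
  assume g: "\<forall>k \<in> Dk \<union> \<Xi> \<union> \<rho> ` \<Xi>. g (Suc k) = g k"
  have step: "g (Suc k) = g k" if "k < K" for k
  proof (cases "snd (ws' ! k)")
   case True
   then show ?thesis using g that by (simp add: \<Xi>_def)
  next
   case False
   then have "\<sigma> k \<in> \<Xi>" "\<rho> (\<sigma> k) = k" using \<sigma>[OF that] by (simp_all add: \<Xi>_def \<rho>_def)
   then have "k \<in> \<rho> ` \<Xi>" by (metis imageI)
   then show ?thesis using g by blast
  qed
  \<comment> \<open>All corners of the polygon have the same potential. A conjugator needs no
    functional: the face behind it returns to its starting value, and the inverse word follows at
    once.\<close>
  have const: "g k = g 0" if "k \<le> K" for k
   using that by (induction k) (simp_all add: step)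
  show "\<forall>k \<in> {..<K + 3 * F} - Dk. k < \<rho> k \<longrightarrow> g (Suc k) = g (\<rho> k)"
  proof (intro ballI impI)
   fix k assume k: "k \<in> {..<K + 3 * F} - Dk" "k < \<rho> k"
   consider "k < K" | i where "i < F" "k = K + 3 * i" | i where "i < F" "k = K + 3 * i + 2" using aux[OF k(1)] by blast
   then show "g (Suc k) = g (\<rho> k)"
   proof cases
    case 1
    then show ?thesis using const[of "Suc k"] const[of "\<rho> k"] \<sigma>[OF 1] by (simp add: \<rho>_def)
   next
    case 2
    then have "K + 3 * i + 1 \<in> Dk" by (auto simp: Dk_def)
    then have "g (Suc (K + 3 * i + 1)) = g (K + 3 * i + 1)" using g by blast
    then show ?thesis using 2 \<rho>3[of i] by simp
   next
    case 3
    then show ?thesis using \<rho>3[of i] k(2) by simp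
   qed
  qed
 qed
 moreover have "(\<Sum>k\<in>Dk. if sg k then 1 else -1) = real_of_int n"
 proof -
  have "(\<Sum>k\<in>Dk. if sg k then 1 else -1 :: real) = (\<Sum>i<F. if snd (qs ! i) then 1 else -1)"
   unfolding Dk_def by (subst sum.reindex) (simp_all add: inj_on_def sg3 del: One_nat_def add_Suc_right)
  also have "\<dots> = real_of_int (degree qs)"
   by (simp add: degree_def sum_list_sum_nth F_def lessThan_atLeast0 if_distrib cong: if_cong)
  finally show ?thesis using qs(2) by simp
 qed
 moreover have "2 * card \<Xi> = K"
 proof -
  have "{..<K} = \<Xi> \<union> \<sigma> ` \<Xi>"
  proof (intro equalityI subsetI)
   fix k assume "k \<in> {..<K}"
   then have k: "k < K" by simp
   show "k \<in> \<Xi> \<union> \<sigma> ` \<Xi>"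
   proof (cases "snd (ws' ! k)")
    case False
    then have "\<sigma> k \<in> \<Xi>" "k = \<sigma> (\<sigma> k)" using \<sigma>[OF k] by (simp_all add: \<Xi>_def)
    then show ?thesis by blast
   qed (use k in \<open>simp add: \<Xi>_def\<close>)
  next
   fix k assume "k \<in> \<Xi> \<union> \<sigma> ` \<Xi>"
   then obtain j where j: "j \<in> \<Xi>" "k = j \<or> k = \<sigma> j" by blast
   then have "j < K" by (simp add: \<Xi>_def)
   then show "k \<in> {..<K}" using j(2) \<sigma>[of j] by auto
  qed
  moreover have "\<Xi> \<inter> \<sigma> ` \<Xi> = {}"
  proof -
   have "\<sigma> k \<notin> \<Xi>" if "k \<in> \<Xi>" for k
   proof -
    have "k < K" "snd (ws' ! k)" using that by (simp_all add: \<Xi>_def)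
    then show ?thesis using \<sigma>[of k] by (simp add: \<Xi>_def)
   qed
   then show ?thesis by blast
  qed
  moreover have "inj_on \<sigma> \<Xi>"
  proof (rule inj_on_inverseI[where g = \<sigma>])
   fix k assume "k \<in> \<Xi>"
   then have "k < K" by (simp add: \<Xi>_def)
   then show "\<sigma> (\<sigma> k) = k" using \<sigma> by blast
  qed
  moreover have "finite \<Xi>" by (simp add: \<Xi>_def)
  ultimately have "card {..<K} = card \<Xi> + card \<Xi>" by (simp add: card_Un_disjoint card_image)
  then show ?thesis by simp
 qed
 then have "real (length ws) / 2 = card \<Xi>" by (simp add: K_def)
 ultimately show ?thesis by simp
qed

text \<open>Two polygons are joined along the edge \<open>x\<close>, which disappears from both. The
  degrees add because the second boundary word is rotated and conjugated into place, which keeps its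
  degree.\<close>

lemma rel_merge:
 assumes "rel r n (boundary_word f (u @ x # v))" "rel r k (boundary_word f (u' @ opp x # v'))"
 shows "rel r (n + k) (boundary_word f (u @ v' @ u' @ v))"
proof -
 let ?b = "boundary_word f"
 have "rel r k (ep f (opp x) @ ?b v' @ ?b u')"
  using rel_cyclic[of r k "?b u'" "ep f (opp x) @ ?b v'"] assms(2) by simp
 then have "rel r k (winv (?b v) @ (ep f (opp x) @ ?b v' @ ?b u') @ winv (winv (?b v)))" by (rule rel_conj)
 then have R: "rel r (n + k) ((?b u @ ep f x @ ?b v) @ (winv (?b v) @ (ep f (opp x) @ ?b v' @ ?b u') @ winv (winv (?b v))))"
  using assms(1) by (intro rel_append) simp_all
 moreover have "wval ((?b u @ ep f x @ ?b v) @ (winv (?b v) @ (ep f (opp x) @ ?b v' @ ?b u') @ winv (winv (?b v))))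
   = wval (?b u @ (ep f x @ winv (ep f x) @ (?b v' @ ?b u' @ ?b v)))"
  using wval_append_cong[OF refl wval_winv_cancel, of "?b u @ ep f x" "?b v" "winv (ep f x) @ ?b v' @ ?b u' @ ?b v"]
  by (simp only: ep_opp append_assoc winv_winv)
 moreover have "\<dots> = wval (?b u @ (?b v' @ ?b u' @ ?b v))"
  by (rule wval_append_cong[OF refl wval_winv_cancel])
 ultimately have E: "wval ((?b u @ ep f x @ ?b v) @ (winv (?b v) @ (ep f (opp x) @ ?b v' @ ?b u') @ winv (winv (?b v))))
   = wval (?b (u @ v' @ u' @ v))" by (simp only: boundary_word_simps append_assoc)
 show ?thesis using R unfolding rel_cong[OF E] .
qed

text \<open>The quantity \<open>length w / 2 - 1\<close> is additive under joining two polygons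
  along a side. An unbalanced polygon has a surplus edge, whose opposite must lie on another
  polygon, so joining continues until balanced polygons are split off.\<close>

lemma polygons_bound:
 fixes a b :: 's and Ps :: "(('e \<times> bool) list \<times> int) list"
 assumes m: "m \<ge> 2" and ab: "a \<noteq> b"
  and Ps: "\<forall>(w, n) \<in> set Ps. length w \<ge> 2 \<and> rel (rword a b m) n (boundary_word f w)"
  and bal: "balanced (concat (map fst Ps))"
 shows "(1 - 1 / (real m - 1)) * (\<Sum>(w, n)\<leftarrow>Ps. real_of_int n) \<le> (\<Sum>(w, n)\<leftarrow>Ps. real (length w) / 2 - 1)"
 using Ps bal
proof (induction "length Ps" arbitrary: Ps rule: less_induct)
 case less
 define \<kappa> where "\<kappa> = 1 - 1 / (real m - 1)"
 show ?case
 proof (cases Ps)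
  case (Cons P Qs)
  obtain w n where P: "P = (w, n)" by (cases P)
  have w: "length w \<ge> 2" "rel (rword a b m) n (boundary_word f w)" using less.prems(1) Cons P by auto
  show ?thesis
  proof (cases "balanced w")
   case True
   then have "balanced (concat (map fst Qs))"
    using less.prems(2) by (simp add: Cons P balanced_def count_list_append)
   moreover have "\<forall>(w, n) \<in> set Qs. length w \<ge> 2 \<and> rel (rword a b m) n (boundary_word f w)"
    using less.prems(1) by (simp add: Cons)
   ultimately have "\<kappa> * (\<Sum>(w, n)\<leftarrow>Qs. real_of_int n) \<le> (\<Sum>(w, n)\<leftarrow>Qs. real (length w) / 2 - 1)"
    unfolding \<kappa>_def using less.hyps[of Qs] Cons by simp
   moreover have "\<kappa> * n \<le> real (length w) / 2 - 1"
    unfolding \<kappa>_def by (rule balanced_bound[OF m ab True _ w(2)]) (use w in auto)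
   ultimately show ?thesis unfolding \<kappa>_def[symmetric] by (simp add: Cons P algebra_simps)
  next
   case False
   then obtain y where y: "count_list w y \<noteq> count_list w (opp y)" by (auto simp: balanced_def)
   obtain x where x: "count_list w (opp x) < count_list w x"
   proof (cases "count_list w (opp y) < count_list w y")
    case False
    then show ?thesis using that[of "opp y"] y by simp
   qed (rule that)
   have "count_list w z + count_list (concat (map fst Qs)) z = count_list w (opp z) + count_list (concat (map fst Qs)) (opp z)" for z
   proof -
    have "count_list (concat (map fst Ps)) z = count_list (concat (map fst Ps)) (opp z)"
     using less.prems(2) unfolding balanced_def by (rule spec)
    then show ?thesis by (simp add: Cons P count_list_append)
   qed
   from this[of x] have "count_list (concat (map fst Qs)) (opp x) \<noteq> 0" using x by linarith
   then have "opp x \<in> set (concat (map fst Qs))" by (metis count_notin)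
   then obtain Q where Q: "Q \<in> set Qs" "opp x \<in> set (fst Q)" by auto
   obtain w' n' where Q': "Q = (w', n')" by (cases Q)
   obtain A B where AB: "Qs = A @ (w', n') # B" using Q(1) Q' by (metis split_list)
   have "x \<in> set w" using x by (metis count_notin less_nat_zero_code)
   then obtain u v where uv: "w = u @ x # v" by (metis split_list)
   obtain u' v' where uv': "w' = u' @ opp x # v'" using Q Q' by (metis fst_conv split_list)
   have w': "length w' \<ge> 2" "rel (rword a b m) n' (boundary_word f w')" using less.prems(1) Cons P AB by auto
   define Rs where "Rs = (u @ v' @ u' @ v, n + n') # A @ B"
   have "balanced (concat (map fst Rs))"
    unfolding balanced_def
   proof
    fix z
    have "count_list (concat (map fst Ps)) z = count_list (concat (map fst Rs)) z
      + (if z = x then 1 else 0) + (if z = opp x then 1 else 0)" for z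
     by (simp add: Cons P AB uv uv' Rs_def count_list_append)
    moreover have "count_list (concat (map fst Ps)) z = count_list (concat (map fst Ps)) (opp z)"
     using less.prems(2) unfolding balanced_def by (rule spec)
    moreover have "(z = opp x) = (opp z = x)" "(opp z = opp x) = (z = x)" by (metis opp_simps(1))+
    ultimately show "count_list (concat (map fst Rs)) z = count_list (concat (map fst Rs)) (opp z)"
     by (auto split: if_splits)
   qed
   moreover have "length Rs < length Ps" by (simp add: Rs_def Cons AB)
   moreover have "\<forall>(w, n) \<in> set Rs. length w \<ge> 2 \<and> rel (rword a b m) n (boundary_word f w)"
    using less.prems(1) rel_merge[OF w(2)[unfolded uv] w'(2)[unfolded uv']] w(1) w'(1)
    by (simp add: Rs_def Cons AB uv uv')
   ultimately have "\<kappa> * (\<Sum>(w, n)\<leftarrow>Rs. real_of_int n) \<le> (\<Sum>(w, n)\<leftarrow>Rs. real (length w) / 2 - 1)"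
    unfolding \<kappa>_def by (intro less.hyps)
   moreover have "(\<Sum>(w, n)\<leftarrow>Rs. real_of_int n) = (\<Sum>(w, n)\<leftarrow>Ps. real_of_int n)"
    by (simp add: Rs_def Cons P AB)
   moreover have "(\<Sum>(w, n)\<leftarrow>Rs. real (length w) / 2 - 1) = (\<Sum>(w, n)\<leftarrow>Ps. real (length w) / 2 - 1)"
    by (simp add: Rs_def Cons P AB uv uv' field_simps)
   ultimately show ?thesis unfolding \<kappa>_def by simp
  qed
 qed simp
qed

text \<open>Each triangle is repeated as often as the absolute value of its coefficient says, and
  reversed if the coefficient is negative. The cycle condition makes the collection balanced, and a
  triangle contributes 3 / 2 - 1 = 1 / 2.\<close>

lemma integral_cycle_bound:
 fixes a b :: 's and l :: "'t \<Rightarrow> int" and e0 e1 e2 :: "'t \<Rightarrow> 'e"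
 assumes m: "m \<ge> 2" and ab: "a \<noteq> b" and T: "finite T"
  and rel: "\<And>t. t \<in> T \<Longrightarrow> rel (rword a b m) (n t) (f (e2 t) @ f (e0 t) @ winv (f (e1 t)))"
  and cyc: "\<And>e. (\<Sum>t\<in>T. l t * (of_bool (e0 t = e) - of_bool (e1 t = e) + of_bool (e2 t = e))) = 0"
 shows "2 * (1 - 1 / (real m - 1)) * (\<Sum>t\<in>T. real_of_int (l t * n t)) \<le> (\<Sum>t\<in>T. \<bar>real_of_int (l t)\<bar>)"
proof -
 define \<kappa> where "\<kappa> = 1 - 1 / (real m - 1)"
 obtain ts where ts: "set ts = T" "distinct ts" using finite_distinct_list[OF T] by blast
 define P where "P t = (if l t \<ge> 0 then ([(e2 t, True), (e0 t, True), (e1 t, False)], n t)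
  else ([(e1 t, True), (e0 t, False), (e2 t, False)], - n t))" for t
 define Ps where "Ps = concat (map (\<lambda>t. replicate (nat \<bar>l t\<bar>) (P t)) ts)"
 have setPs: "\<exists>t \<in> T. p = P t" if "p \<in> set Ps" for p using that ts by (auto simp: Ps_def)
 have "\<forall>(w, n) \<in> set Ps. length w \<ge> 2 \<and> rel (rword a b m) n (boundary_word f w)"
 proof (clarify)
  fix w k assume "(w, k) \<in> set Ps"
  then obtain t where t: "t \<in> T" "(w, k) = P t" using setPs by blast
  have "rel (rword a b m) (- n t) (winv (f (e2 t) @ f (e0 t) @ winv (f (e1 t))))"
   by (rule rel_winv[OF rel[OF t(1)]])
  then show "length w \<ge> 2 \<and> rel (rword a b m) k (boundary_word f w)"
   using t rel[OF t(1)] by (auto simp: P_def ep_def winv_append split: if_splits)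
 qed
 moreover have cnt: "int (count_list (concat (map fst Ps)) x) =
   (\<Sum>t\<in>T. \<bar>l t\<bar> * int (count_list (fst (P t)) x))" for x
 proof -
  have r: "count_list (concat (replicate k w)) x = k * count_list w x" for k and w :: "('e \<times> bool) list"
   by (induction k) simp_all
  have "int (count_list (concat (map fst Ps)) x) = (\<Sum>t\<leftarrow>ts. \<bar>l t\<bar> * int (count_list (fst (P t)) x))"
   unfolding Ps_def by (induction ts) (simp_all add: r)
  then show ?thesis using ts by (simp add: sum_list_distinct_conv_sum_set)
 qed
 have "balanced (concat (map fst Ps))"
  unfolding balanced_def
 proof (intro allI)
  fix x :: "'e \<times> bool"
  obtain e s where x: "x = (e, s)" by (cases x)
  have one: "\<bar>l t\<bar> * int (count_list (fst (P t)) (e, True)) - \<bar>l t\<bar> * int (count_list (fst (P t)) (e, False))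
    = l t * (of_bool (e0 t = e) - of_bool (e1 t = e) + of_bool (e2 t = e))" for t
   by (simp add: P_def algebra_simps)
  have "int (count_list (concat (map fst Ps)) (e, True)) - int (count_list (concat (map fst Ps)) (e, False)) = 0"
   unfolding cnt sum_subtractf[symmetric] one by (rule cyc)
  then show "count_list (concat (map fst Ps)) x = count_list (concat (map fst Ps)) (opp x)"
   by (cases s) (simp_all add: x opp_def)
 qed
 ultimately have "(1 - 1 / (real m - 1)) * (\<Sum>(w, n)\<leftarrow>Ps. real_of_int n) \<le> (\<Sum>(w, n)\<leftarrow>Ps. real (length w) / 2 - 1)"
  by (intro polygons_bound[OF m ab]) auto
 moreover have g: "(\<Sum>p\<leftarrow>Ps. g p) = (\<Sum>t\<in>T. \<bar>real_of_int (l t)\<bar> * g (P t))" for g :: "('e \<times> bool) list \<times> int \<Rightarrow> real"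
 proof -
  have "(\<Sum>p\<leftarrow>Ps. g p) = (\<Sum>t\<leftarrow>ts. \<bar>real_of_int (l t)\<bar> * g (P t))"
   unfolding Ps_def by (induction ts) (simp_all add: sum_list_replicate)
  then show ?thesis using ts by (simp add: sum_list_distinct_conv_sum_set)
 qed
 have "(\<Sum>(w, n)\<leftarrow>Ps. real_of_int n) = (\<Sum>t\<in>T. real_of_int (l t * n t))"
  unfolding case_prod_beta g by (rule sum.cong) (auto simp: P_def)
 moreover have "(\<Sum>(w, n)\<leftarrow>Ps. real (length w) / 2 - 1) = (\<Sum>t\<in>T. \<bar>real_of_int (l t)\<bar> / 2)"
  unfolding case_prod_beta g by (rule sum.cong) (auto simp: P_def)
 ultimately have *: "\<kappa> * (\<Sum>t\<in>T. real_of_int (l t * n t)) \<le> (\<Sum>t\<in>T. \<bar>real_of_int (l t)\<bar>) / 2"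
  by (simp only: \<kappa>_def sum_divide_distrib)
 have "2 * \<kappa> * x \<le> y" if "\<kappa> * x \<le> y / 2" for x y :: real using that by simp
 from this[OF *] show ?thesis unfolding \<kappa>_def .
qed

text \<open>After Gaussian elimination over the rationals the free unknowns can be approximated by
  rational numbers, and the eliminated ones follow by continuity.\<close>

lemma rational_solutions_dense:
 fixes A :: "'c \<Rightarrow> 'v \<Rightarrow> real"
 assumes "finite C" "finite V" "\<And>c v. A c v \<in> \<rat>" "\<And>c. c \<in> C \<Longrightarrow> (\<Sum>v\<in>V. A c v * x v) = 0"
 shows "\<exists>y. (\<forall>k v. y k v \<in> \<rat>) \<and> (\<forall>k. \<forall>c \<in> C. (\<Sum>v\<in>V. A c v * y k v) = 0) \<and>
  (\<forall>v \<in> V. (\<lambda>k. y k v) \<longlonglongrightarrow> x v)"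
 using assms
proof (induction C arbitrary: V A rule: finite_induct)
 case empty
 define y where "y k v = real_of_int \<lfloor>x v * real (Suc k)\<rfloor> / real (Suc k)" for k v
 have "(\<lambda>k. y k v) \<longlonglongrightarrow> x v" for v
 proof (rule tendsto_sandwich)
  show "\<forall>\<^sub>F k in sequentially. x v - 1 / real (Suc k) \<le> y k v"
  proof (intro always_eventually allI)
   fix k
   have "x v * real (Suc k) - 1 \<le> real_of_int \<lfloor>x v * real (Suc k)\<rfloor>" by linarith
   then have "(x v * real (Suc k) - 1) / real (Suc k) \<le> y k v" unfolding y_def by (rule divide_right_mono) simp
   then show "x v - 1 / real (Suc k) \<le> y k v" by (simp add: diff_divide_distrib)
  qed
  show "\<forall>\<^sub>F k in sequentially. y k v \<le> x v"
  proof (intro always_eventually allI)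
   fix k
   have "y k v \<le> x v * real (Suc k) / real (Suc k)" unfolding y_def by (rule divide_right_mono) auto
   then show "y k v \<le> x v" by simp
  qed
  show "(\<lambda>k. x v - 1 / real (Suc k)) \<longlonglongrightarrow> x v"
   using tendsto_diff[OF tendsto_const LIMSEQ_inverse_real_of_nat, of "x v"] by (simp add: inverse_eq_divide)
 qed simp
 then show ?case by (intro exI[of _ y]) (simp add: y_def)
next
 case (insert c C)
 show ?case
 proof (cases "\<forall>v \<in> V. A c v = 0")
  case True
  obtain y where "\<forall>k v. y k v \<in> \<rat>" "\<forall>k. \<forall>c \<in> C. (\<Sum>v\<in>V. A c v * y k v) = 0" "\<forall>v \<in> V. (\<lambda>k. y k v) \<longlonglongrightarrow> x v"
   using insert.IH[of V A] insert.prems by auto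
  then show ?thesis using True by (intro exI[of _ y]) auto
 next
  case False
  then obtain w where w: "w \<in> V" "A c w \<noteq> 0" by auto
  define A' where "A' e v = A e v - A e w * A c v / A c w" for e v
  have split: "(\<Sum>v\<in>V. A e v * h v) = A e w * h w + (\<Sum>v\<in>V - {w}. A e v * h v)" for e and h :: "'v \<Rightarrow> real"
   using w(1) insert.prems(1) by (simp add: sum.remove)
  have xw: "x w = - (\<Sum>v\<in>V - {w}. A c v * x v) / A c w"
   using insert.prems(3)[of c] w(2) unfolding split by (simp add: field_simps)
  have A'_sum: "(\<Sum>v\<in>V - {w}. A' e v * h v) = (\<Sum>v\<in>V - {w}. A e v * h v) - A e w / A c w * (\<Sum>v\<in>V - {w}. A c v * h v)" for e h
   by (simp add: A'_def sum_subtractf sum_distrib_left algebra_simps)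
  have "(\<Sum>v\<in>V - {w}. A' e v * x v) = 0" if "e \<in> C" for e
   using insert.prems(3)[of e] that w(2) unfolding split A'_sum xw by (simp add: field_simps)
  then obtain y where y: "\<forall>k v. y k v \<in> \<rat>" "\<forall>k. \<forall>e \<in> C. (\<Sum>v\<in>V - {w}. A' e v * y k v) = 0"
   "\<forall>v \<in> V - {w}. (\<lambda>k. y k v) \<longlonglongrightarrow> x v"
   using insert.IH[of "V - {w}" A'] insert.prems(1,2) by (auto simp: A'_def)
  define z where "z k = (y k)(w := - (\<Sum>v\<in>V - {w}. A c v * y k v) / A c w)" for k
  have z: "(\<Sum>v\<in>V. A e v * z k v) = A e w * z k w + (\<Sum>v\<in>V - {w}. A e v * y k v)" for e k
   unfolding split by (simp add: z_def)
  have zw: "z k w = - (\<Sum>v\<in>V - {w}. A c v * y k v) / A c w" for k by (simp add: z_def)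
  have "(\<Sum>v\<in>V. A e v * z k v) = 0" if "e \<in> insert c C" for e k
  proof (cases "e = c")
   case True
   then show ?thesis unfolding z zw using w by simp
  next
   case False
   then have "(\<Sum>v\<in>V - {w}. A' e v * y k v) = 0" using that y(2) by simp
   then show ?thesis unfolding z zw A'_sum by simp
  qed
  moreover have "z k v \<in> \<rat>" for k v
   using y(1) insert.prems(2) by (auto simp: z_def intro!: Rats_divide Rats_sum)
  moreover have "(\<lambda>k. z k v) \<longlonglongrightarrow> x v" if "v \<in> V" for v
  proof (cases "v = w")
   case True
   have "(\<lambda>k. - (\<Sum>v\<in>V - {w}. A c v * y k v) / A c w) \<longlonglongrightarrow> - (\<Sum>v\<in>V - {w}. A c v * x v) / A c w"
    using y(3) w(2) by (intro tendsto_intros) auto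
   then show ?thesis using True xw by (simp add: z_def)
  next
   case False
   then show ?thesis using y(3) that by (simp add: z_def)
  qed
  ultimately show ?thesis by blast
 qed
qed

lemma common_denominator:
 assumes "finite V" "\<And>v. v \<in> V \<Longrightarrow> y v \<in> \<rat>"
 shows "\<exists>q :: nat. q > 0 \<and> (\<forall>v \<in> V. real q * y v \<in> \<int>)"
 using assms
proof (induction V rule: finite_induct)
 case (insert v V)
 then obtain q where q: "q > 0" "\<forall>v \<in> V. real q * y v \<in> \<int>" by auto
 obtain i j :: int where ij: "y v = i / j" "j > 0"
  using Rats_cases'[of "y v"] insert.prems[of v] by (metis insertI1)
 have "real (q * nat j) * y u \<in> \<int>" if "u \<in> insert v V" for u
 proof (cases "u = v")
  case True
  have "real (q * nat j) * y u = real_of_int (int q * i)" using ij True by simp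
  then show ?thesis by (simp only: Ints_of_int)
 next
  case False
  then have "real (nat j) * (real q * y u) \<in> \<int>" using q(2) that by (intro Ints_mult[of "real (nat j)"]) simp_all
  then show ?thesis by (simp add: mult_ac)
 qed
 then show ?case using q(1) ij(2) by (intro exI[of _ "q * nat j"]) auto
qed (auto intro: exI[of _ 1])

text \<open>The cycle condition has rational coefficients, so a real cycle is a limit of rational
  ones with the same support, and those become integral after clearing denominators. The absolute
  value arises from the bound for the negative cycle.\<close>

lemma real_cycle_bound:
 fixes a b :: 's and l :: "'t \<Rightarrow> real" and e0 e1 e2 :: "'t \<Rightarrow> 'e"
 assumes m: "m \<ge> 2" and ab: "a \<noteq> b" and T: "finite T"
  and rel: "\<And>t. t \<in> T \<Longrightarrow> rel (rword a b m) (n t) (f (e2 t) @ f (e0 t) @ winv (f (e1 t)))"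
  and cyc: "\<And>e. (\<Sum>t\<in>T. l t * (of_bool (e0 t = e) - of_bool (e1 t = e) + of_bool (e2 t = e))) = 0"
 shows "2 * (1 - 1 / (real m - 1)) * \<bar>\<Sum>t\<in>T. l t * n t\<bar> \<le> (\<Sum>t\<in>T. \<bar>l t\<bar>)"
proof -
 define \<kappa> where "\<kappa> = 2 * (1 - 1 / (real m - 1))"
 define A where "A e t = of_bool (e0 t = e) - of_bool (e1 t = e) + (of_bool (e2 t = e) :: real)" for e t
 define E where "E = e0 ` T \<union> e1 ` T \<union> e2 ` T"
 have cyc': "(\<Sum>t\<in>T. A e t * l t) = 0" for e
  using cyc[of e] by (simp add: A_def mult.commute)
 have "finite E" using T by (simp add: E_def)
 then obtain y where y: "\<And>k t. y k t \<in> \<rat>" "\<And>k e. e \<in> E \<Longrightarrow> (\<Sum>t\<in>T. A e t * y k t) = 0"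
   "\<And>t. t \<in> T \<Longrightarrow> (\<lambda>k. y k t) \<longlonglongrightarrow> l t"
 proof -
  have "A e t \<in> \<rat>" for e t by (simp add: A_def)
  then show ?thesis using rational_solutions_dense[OF \<open>finite E\<close> T, of A l] cyc' that by blast
 qed
 have main: "\<kappa> * (\<Sum>t\<in>T. x t * n t) \<le> (\<Sum>t\<in>T. \<bar>x t\<bar>)"
  if x: "\<And>t. x t \<in> \<rat>" "\<And>e. e \<in> E \<Longrightarrow> (\<Sum>t\<in>T. A e t * x t) = 0" for x
 proof -
  obtain q :: nat where q: "q > 0" "\<forall>t \<in> T. real q * x t \<in> \<int>"
   using common_denominator[OF T] x(1) by blast
  define i where "i t = \<lfloor>real q * x t\<rfloor>" for t
  have i: "real_of_int (i t) = real q * x t" if "t \<in> T" for t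
   using q that by (auto simp: i_def elim!: Ints_cases)
  have "\<kappa> * (\<Sum>t\<in>T. real_of_int (i t * n t)) \<le> (\<Sum>t\<in>T. \<bar>real_of_int (i t)\<bar>)"
   unfolding \<kappa>_def
  proof (rule integral_cycle_bound[where f = f and ?e0.0 = e0 and ?e1.0 = e1 and ?e2.0 = e2, OF m ab T rel])
   fix e
   have "real_of_int (\<Sum>t\<in>T. i t * (of_bool (e0 t = e) - of_bool (e1 t = e) + of_bool (e2 t = e)))
     = (\<Sum>t\<in>T. real q * (A e t * x t))"
    by (simp add: A_def i algebra_simps)
   also have "\<dots> = real q * (\<Sum>t\<in>T. A e t * x t)" by (simp add: sum_distrib_left)
   also have "(\<Sum>t\<in>T. A e t * x t) = 0"
   proof (cases "e \<in> E")
    case False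
    then have "A e t = 0" if "t \<in> T" for t using that by (auto simp: A_def E_def)
    then show ?thesis by simp
   qed (rule x(2))
   finally show "(\<Sum>t\<in>T. i t * (of_bool (e0 t = e) - of_bool (e1 t = e) + of_bool (e2 t = e))) = 0"
    by (simp only: mult_zero_right of_int_eq_0_iff)
  qed
  moreover have "(\<Sum>t\<in>T. real_of_int (i t * n t)) = real q * (\<Sum>t\<in>T. x t * n t)"
   by (simp add: i sum_distrib_left algebra_simps)
  moreover have "(\<Sum>t\<in>T. \<bar>real_of_int (i t)\<bar>) = real q * (\<Sum>t\<in>T. \<bar>x t\<bar>)"
   by (simp add: i sum_distrib_left abs_mult)
  ultimately have "real q * (\<kappa> * (\<Sum>t\<in>T. x t * n t)) \<le> real q * (\<Sum>t\<in>T. \<bar>x t\<bar>)"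
   by (simp add: algebra_simps)
  then show ?thesis using q(1) by simp
 qed
 have "\<kappa> * \<bar>\<Sum>t\<in>T. y k t * n t\<bar> \<le> (\<Sum>t\<in>T. \<bar>y k t\<bar>)" for k
 proof -
  have "\<kappa> * (\<Sum>t\<in>T. y k t * n t) \<le> (\<Sum>t\<in>T. \<bar>y k t\<bar>)" by (rule main[OF y(1,2)])
  moreover have "\<kappa> * (\<Sum>t\<in>T. - y k t * n t) \<le> (\<Sum>t\<in>T. \<bar>- y k t\<bar>)"
   by (rule main) (use y in \<open>auto simp: sum_negf\<close>)
  ultimately show ?thesis
   by (cases "0 \<le> (\<Sum>t\<in>T. y k t * n t)") (simp_all add: sum_negf)
 qed
 moreover have "(\<lambda>k. \<kappa> * \<bar>\<Sum>t\<in>T. y k t * n t\<bar>) \<longlonglongrightarrow> \<kappa> * \<bar>\<Sum>t\<in>T. l t * n t\<bar>"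
  by (intro tendsto_intros y(3))
 moreover have "(\<lambda>k. \<Sum>t\<in>T. \<bar>y k t\<bar>) \<longlonglongrightarrow> (\<Sum>t\<in>T. \<bar>l t\<bar>)"
  by (intro tendsto_intros y(3))
 ultimately show ?thesis unfolding \<kappa>_def by (meson LIMSEQ_le)
qed

section \<open>Upper bounds by merging blocks\<close>

text \<open>Groups are written additively here although they are not commutative;
  \<open>gp x n\<close> is the n-th power of \<open>x\<close>.\<close>

primrec gp :: "'g::group_add \<Rightarrow> nat \<Rightarrow> 'g" where
 "gp x 0 = 0"
| "gp x (Suc n) = x + gp x n"

lemmas gs = add.assoc minus_add

lemma gp_add: "gp x (n + k) = gp x n + gp x k"
 by (induction n) (simp_all add: gs)

lemma gp_Suc2: "gp x (Suc n) = gp x n + x"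
 using gp_add[of x n 1] by simp

lemma gp_comm: "gp x n + gp x k = gp x k + gp x n"
 by (simp add: gp_add[symmetric] add.commute)

lemma gp_mult: "gp x (n * k) = gp (gp x n) k"
 by (induction k) (simp_all add: gp_add)

lemma gp_conj: "gp (c + x + - c) n = c + gp x n + - c"
 by (induction n) (simp_all add: gs del: add_uminus_conv_diff)

lemma gp_uminus: "gp (- x) n = - gp x n"
proof (induction n)
 case (Suc n)
 then show ?case unfolding gp_Suc2[of x] by (simp add: gs del: add_uminus_conv_diff)
qed simp

lemma gp_zero [simp]: "gp 0 n = (0 :: 'g::group_add)"
 by (induction n) simp_all

section \<open>Products of commutators and products of conjugates\<close>

definition cmt :: "'g::group_add \<Rightarrow> 'g \<Rightarrow> 'g" where
 "cmt x y = x + y + - x + - y"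

definition clle :: "nat \<Rightarrow> 'g::group_add \<Rightarrow> bool" where
 "clle n w \<longleftrightarrow> (\<exists>cs. length cs \<le> n \<and> w = (\<Sum>(x, y)\<leftarrow>cs. cmt x y))"

lemma clle_0 [simp]: "clle n 0"
 unfolding clle_def by (intro exI[of _ "[]"]) simp

lemma clle_mono: "clle n w \<Longrightarrow> n \<le> k \<Longrightarrow> clle k w"
 unfolding clle_def using le_trans by blast

lemma clle_cmt: "clle (Suc 0) (cmt x y)"
 unfolding clle_def by (intro exI[of _ "[(x, y)]"]) simp

lemma clle_add: "clle n u \<Longrightarrow> clle k v \<Longrightarrow> clle (n + k) (u + v)"
 unfolding clle_def
proof (elim exE conjE)
 fix cs cs' :: "('a \<times> 'a) list"
 assume "length cs \<le> n" "u = (\<Sum>(x, y)\<leftarrow>cs. cmt x y)" "length cs' \<le> k" "v = (\<Sum>(x, y)\<leftarrow>cs'. cmt x y)"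
 then show "\<exists>cs. length cs \<le> n + k \<and> u + v = (\<Sum>(x, y)\<leftarrow>cs. cmt x y)"
  by (intro exI[of _ "cs @ cs'"]) simp
qed

lemma clle_induct [consumes 1]:
 assumes "clle n w" "P 0 0" "\<And>k x y w. P k w \<Longrightarrow> P (Suc k) (cmt x y + w)" "\<And>k l w. P k w \<Longrightarrow> k \<le> l \<Longrightarrow> P l w"
 shows "P n w"
proof -
 obtain cs where cs: "length cs \<le> n" "w = (\<Sum>(x, y)\<leftarrow>cs. cmt x y)" using assms(1) by (auto simp: clle_def)
 have "P (length cs) (\<Sum>(x, y)\<leftarrow>cs. cmt x y)"
  using assms(2,3) by (induction cs) auto
 then show ?thesis using assms(4) cs by blast
qed

lemma clle_conj: "clle n w \<Longrightarrow> clle n (c + w + - c)"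
proof (induction rule: clle_induct)
 case (2 k x y w)
 have "cmt (c + x + - c) (c + y + - c) + (c + w + - c) = c + (cmt x y + w) + - c"
  by (simp add: cmt_def gs del: add_uminus_conv_diff)
 then show ?case using clle_add[OF clle_cmt 2, of "c + x + - c" "c + y + - c"] by simp
qed (auto intro: clle_mono)

lemma clle_uminus: "clle n w \<Longrightarrow> clle n (- w)"
proof (induction rule: clle_induct)
 case (2 k x y w)
 have "- (cmt x y + w) = - w + cmt y x" by (simp add: cmt_def gs del: add_uminus_conv_diff)
 then show ?case using clle_add[OF 2 clle_cmt, of y x] by simp
qed (auto intro: clle_mono)

text \<open>A metric in all but name: conjugates and inverses of commutators are commutators, so it
  is symmetric and invariant under multiplication from both sides.\<close>

definition cdist :: "nat \<Rightarrow> 'g::group_add \<Rightarrow> 'g \<Rightarrow> bool" where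
 "cdist n u v \<longleftrightarrow> clle n (u + - v)"

lemma cdist_refl [simp]: "cdist n u u"
 by (simp add: cdist_def)

lemma cdist_sym: "cdist n u v \<Longrightarrow> cdist n v u"
 unfolding cdist_def using clle_uminus[of n "u + - v"] by (simp add: gs del: add_uminus_conv_diff)

lemma cdist_trans: "cdist n u v \<Longrightarrow> cdist k v w \<Longrightarrow> cdist (n + k) u w"
 unfolding cdist_def using clle_add[of n "u + - v" k "v + - w"] by (simp add: gs del: add_uminus_conv_diff)

lemma cdist_mult: "cdist n u v \<Longrightarrow> cdist n (p + u + q) (p + v + q)"
 unfolding cdist_def using clle_conj[of n "u + - v" p] by (simp add: gs del: add_uminus_conv_diff)

lemma cdist_add: "cdist n u v \<Longrightarrow> cdist k u' v' \<Longrightarrow> cdist (n + k) (u + u') (v + v')"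
 using cdist_trans[of n "u + u'" "v + u'" k "v + v'"] cdist_mult[of n u v 0 u'] cdist_mult[of k u' v' v 0] by simp

lemma cdist_swap: "cdist (Suc 0) (u + v) (v + u)"
 unfolding cdist_def using clle_cmt[of u v] by (simp add: cmt_def gs del: add_uminus_conv_diff)

lemma cdist_conj: "cdist (Suc 0) (c + u + - c) u"
 using cdist_swap[of "c + u" "- c"] by (simp add: gs del: add_uminus_conv_diff)

text \<open>\<open>x y z x\<^sup>-\<^sup>1 y\<^sup>-\<^sup>1 z\<^sup>-\<^sup>1 = [x y, z x\<^sup>-\<^sup>1]\<close>\<close>

lemma cdist_hexagon: "cdist (Suc 0) (x + y + z + - x + - y) z"
 unfolding cdist_def using clle_cmt[of "x + y" "z + - x"] by (simp add: cmt_def gs del: add_uminus_conv_diff)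

text \<open>By \<open>cdist_hexagon\<close> one commutator merges three consecutive blocks into one,
  so it removes two blocks; two remaining blocks are merged by one swap.\<close>

lemma merge_blocks:
 "cdist (length ps div 2) (\<Sum>(i, j)\<leftarrow>ps. gp x i + gp y j) (gp x (sum_list (map fst ps)) + gp y (sum_list (map snd ps)))"
proof (induction "length ps" arbitrary: ps rule: less_induct)
 case less
 consider "ps = []" | p where "ps = [p]" | p q where "ps = [p, q]" | p q s qs where "ps = p # q # s # qs"
  by (metis list.exhaust)
 then show ?case
 proof cases
  case (3 p q)
  obtain i j k l where [simp]: "p = (i, j)" "q = (k, l)" by (cases p; cases q)
  have "cdist (Suc 0) (gp x i + (gp y j + gp x k) + gp y l) (gp x i + (gp x k + gp y j) + gp y l)"
   by (rule cdist_mult[OF cdist_swap])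
  then show ?thesis using 3 by (simp add: gp_add gs)
 next
  case (4 p q s qs)
  obtain i j k l u v where [simp]: "p = (i, j)" "q = (k, l)" "s = (u, v)" by (cases p; cases q; cases s)
  define R where "R = (\<Sum>(i, j)\<leftarrow>qs. gp x i + gp y j)"
  \<comment> \<open>The middle block plays the role of \<open>z\<close> in
    \<open>cdist_hexagon\<close>, with \<open>- gp x u\<close> and \<open>gp y j\<close> in the
    roles of \<open>x\<close> and \<open>y\<close>.\<close>
  have e: "gp x i + gp y j + (gp x k + gp y l) + (gp x u + gp y v) =
    gp x (i + u) + (- gp x u + gp y j + (gp x k + gp y l) + - (- gp x u) + - gp y j) + gp y (j + v)"
   by (simp add: gp_add gs del: add_uminus_conv_diff)
  have "cdist (Suc 0) (gp x (i + u) + (- gp x u + gp y j + (gp x k + gp y l) + - (- gp x u) + - gp y j) + (gp y (j + v) + R))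
    (gp x (i + u) + (gp x k + gp y l) + (gp y (j + v) + R))"
   by (rule cdist_mult[OF cdist_hexagon])
  also have "gp x (i + u) + (gp x k + gp y l) + (gp y (j + v) + R) =
    gp x (i + k + u) + gp y (j + l + v) + R"
  proof -
   have "gp x (i + u) + gp x k = gp x (i + k + u)" "gp y l + gp y (j + v) = gp y (j + l + v)"
    unfolding gp_add[symmetric] by (simp_all add: ac_simps)
   then show ?thesis by (simp add: add.assoc[symmetric]) (simp add: add.assoc)
  qed
  finally have 1: "cdist (Suc 0) (\<Sum>(i, j)\<leftarrow>ps. gp x i + gp y j)
    (\<Sum>(i, j)\<leftarrow>(i + k + u, j + l + v) # qs. gp x i + gp y j)"
   using e by (simp add: 4 R_def add.assoc[symmetric])
  have 2: "cdist (length ((i + k + u, j + l + v) # qs) div 2) (\<Sum>(i, j)\<leftarrow>(i + k + u, j + l + v) # qs. gp x i + gp y j)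
   (gp x (sum_list (map fst ((i + k + u, j + l + v) # qs))) + gp y (sum_list (map snd ((i + k + u, j + l + v) # qs))))"
   by (rule less) (simp add: 4)
  have "cdist (Suc 0 + length ((i + k + u, j + l + v) # qs) div 2) (\<Sum>(i, j)\<leftarrow>ps. gp x i + gp y j)
   (gp x (sum_list (map fst ((i + k + u, j + l + v) # qs))) + gp y (sum_list (map snd ((i + k + u, j + l + v) # qs))))"
   by (rule cdist_trans[OF 1 2])
  then show ?thesis by (simp add: 4 add.assoc)
 qed auto
qed

lemma sum_list_replicate_gp: "sum_list (replicate k x) = gp x k"
 by (induction k) simp_all

text \<open>The power consists of \<open>k\<close> blocks with exponents 1.\<close>

lemma cdist_power_add: "cdist (k div 2) (gp (u + v) k) (gp u k + gp v k)"
 using merge_blocks[of "replicate k (1, 1)" u v]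
 by (simp add: sum_list_replicate_gp map_replicate sum_list_replicate)

lemma gp_sum_list: "gp (sum_list (map f ps)) k = sum_list (map f (concat (replicate k ps)))"
 by (induction k) simp_all

text \<open>The trailing power of \<open>y\<close> is absorbed into the last block of each copy, so
  that it does not add to the number of blocks.\<close>

lemma merge_power:
 "cdist (k * length ps div 2) (gp ((\<Sum>(i, j)\<leftarrow>ps. gp x i + gp y j) + gp y c) k)
   (gp x (k * sum_list (map fst ps)) + gp y (k * (sum_list (map snd ps) + c)))"
proof (cases ps rule: rev_cases)
 case Nil
 then show ?thesis by (simp add: gp_mult[symmetric] mult.commute)
next
 case (snoc qs p)
 obtain i j where p: "p = (i, j)" by (cases p)
 define f where "f = (\<lambda>(i, j). gp x i + gp y j)"
 define ps' where "ps' = qs @ [(i, j + c)]"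
 have "sum_list (map f ps) + gp y c = sum_list (map f ps')"
  by (simp add: snoc p f_def ps'_def gp_add gs)
 then have "gp (sum_list (map f ps) + gp y c) k = sum_list (map f (concat (replicate k ps')))"
  by (simp only: gp_sum_list)
 moreover have "cdist (length (concat (replicate k ps')) div 2) (sum_list (map f (concat (replicate k ps'))))
   (gp x (sum_list (map fst (concat (replicate k ps')))) + gp y (sum_list (map snd (concat (replicate k ps')))))"
  unfolding f_def by (rule merge_blocks)
 moreover have "length (concat (replicate k ps')) = k * length ps"
  by (simp add: length_concat sum_list_replicate ps'_def snoc)
 moreover have "sum_list (map fst (concat (replicate k ps'))) = k * sum_list (map fst ps)"
  "sum_list (map snd (concat (replicate k ps'))) = k * (sum_list (map snd ps) + c)"
  by (induction k) (simp_all add: ps'_def snoc p algebra_simps)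
 ultimately show ?thesis by (simp add: f_def)
qed

definition pos :: "'g::group_add \<Rightarrow> nat \<Rightarrow> 'g \<Rightarrow> bool" where
 "pos \<rho> n w \<longleftrightarrow> (\<exists>cs. length cs = n \<and> w = (\<Sum>c\<leftarrow>cs. c + \<rho> + - c))"

lemma pos_0: "pos \<rho> 0 0"
 by (simp add: pos_def)

lemma pos_add: "pos \<rho> n u \<Longrightarrow> pos \<rho> k v \<Longrightarrow> pos \<rho> (n + k) (u + v)"
 unfolding pos_def
proof (elim exE conjE)
 fix cs cs' assume "length cs = n" "u = (\<Sum>c\<leftarrow>cs. c + \<rho> + - c)" "length cs' = k" "v = (\<Sum>c\<leftarrow>cs'. c + \<rho> + - c)"
 then show "\<exists>cs. length cs = n + k \<and> u + v = (\<Sum>c\<leftarrow>cs. c + \<rho> + - c)"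
  by (intro exI[of _ "cs @ cs'"]) simp
qed

lemma pos_conj1: "pos \<rho> (Suc 0) (c + \<rho> + - c)"
 unfolding pos_def by (intro exI[of _ "[c]"]) simp

lemma pos_conj: "pos \<rho> n u \<Longrightarrow> pos \<rho> n (p + u + - p)"
 unfolding pos_def
proof (elim exE conjE)
 fix cs assume cs: "length cs = n" "u = (\<Sum>c\<leftarrow>cs. c + \<rho> + - c)"
 have "p + (\<Sum>c\<leftarrow>cs. c + \<rho> + - c) + - p = (\<Sum>c\<leftarrow>map ((+) p) cs. c + \<rho> + - c)" for cs
 proof (induction cs)
  case (Cons c cs)
  have "p + ((c + \<rho> + - c) + s) + - p = (p + c + \<rho> + - (p + c)) + (p + s + - p)" for s
   by (simp add: gs del: add_uminus_conv_diff)
  then show ?case using Cons by (simp del: add_uminus_conv_diff)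
 qed simp
 then show "\<exists>cs. length cs = n \<and> p + u + - p = (\<Sum>c\<leftarrow>cs. c + \<rho> + - c)"
  using cs by (intro exI[of _ "map ((+) p) cs"]) simp
qed

lemma pos_mid: "pos \<rho> n u \<Longrightarrow> pos \<rho> k (p + q) \<Longrightarrow> pos \<rho> (n + k) (p + u + q)"
 using pos_add[OF pos_conj[of \<rho> n u p], of k "p + q"] by (simp add: gs del: add_uminus_conv_diff)

lemma pos_power_mult: "pos \<rho> n (p + q) \<Longrightarrow> pos \<rho> (k * n) (gp p k + gp q k)"
proof (induction k)
 case (Suc k)
 have "gp p (Suc k) + gp q (Suc k) = gp p k + (p + q) + gp q k"
  unfolding gp_Suc2[of p] by (simp add: add.assoc)
 then show ?case using pos_mid[OF Suc.prems Suc.IH[OF Suc.prems]] by simp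
qed (simp add: pos_0)

text \<open>The conjugates are moved to the front past powers of \<open>z\<close>, which only
  changes the conjugators.\<close>

lemma pos_power: "\<exists>u. pos \<rho> k u \<and> gp (c + \<rho> + - c + z) k = u + gp z k"
proof (induction k)
 case (Suc k)
 then obtain u where u: "pos \<rho> k u" "gp (c + \<rho> + - c + z) k = u + gp z k" by blast
 have "gp (c + \<rho> + - c + z) (Suc k) = ((c + \<rho> + - c) + (z + u + - z)) + gp z (Suc k)"
  using u(2) by (simp add: gs del: add_uminus_conv_diff)
 moreover have "pos \<rho> (Suc k) ((c + \<rho> + - c) + (z + u + - z))"
  using pos_add[OF pos_conj1 pos_conj[OF u(1)], of c z] by simp
 ultimately show ?case by blast
qed (use pos_0 in auto)

text \<open>Distributing the power over \<open>Suc n\<close> factors takes \<open>n\<close>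
  applications of \<open>cdist_power_add\<close>. Afterwards a single commutator removes the
  conjugation from a whole power.\<close>

lemma pos_power_cdist:
 assumes "pos \<rho> (Suc n) w"
 shows "cdist (n * (k div 2) + Suc n) (gp w k) (gp \<rho> (k * Suc n))"
proof -
 obtain cs where cs: "length cs = Suc n" "w = (\<Sum>c\<leftarrow>cs. c + \<rho> + - c)" using assms by (auto simp: pos_def)
 have "cdist (length cs * (k div 2) + Suc (length cs)) (gp (\<Sum>c\<leftarrow>c # cs. c + \<rho> + - c) k) (gp \<rho> (k * Suc (length cs)))" for c and cs :: "'a list"
 proof (induction cs arbitrary: c)
  case Nil
  have "cdist (Suc 0) (c + gp \<rho> k + - c) (gp \<rho> k)" by (rule cdist_conj)
  then show ?case by (simp add: gp_conj del: add_uminus_conv_diff)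
 next
  case (Cons c' cs)
  let ?w = "\<Sum>c\<leftarrow>c' # cs. c + \<rho> + - c"
  have 1: "cdist (k div 2) (gp (c + \<rho> + - c + ?w) k) (gp (c + \<rho> + - c) k + gp ?w k)"
   by (rule cdist_power_add)
  have 2: "cdist (Suc 0 + (length cs * (k div 2) + Suc (length cs))) (gp (c + \<rho> + - c) k + gp ?w k)
    (gp \<rho> k + gp \<rho> (k * Suc (length cs)))"
   unfolding gp_conj by (rule cdist_add[OF cdist_conj Cons])
  show ?case using cdist_trans[OF 1 2] by (simp add: gp_add[symmetric] algebra_simps del: add_uminus_conv_diff)
 qed
 then show ?thesis using cs by (cases cs) auto
qed

lemma gp_shift: "q + gp (p + q) n = gp (q + p) n + q"
 by (induction n) (simp_all add: add.assoc)

section \<open>The words U and V over the relator\<close>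

context
 fixes a b :: "'g::group_add" and m :: nat
begin

definition "ux = a + b + - a"
text \<open>With x for \<open>ux\<close>, a conjugate of b, the relator is x b^-1 x^-m b^m. Hence
  b^-m x^m equals x b^-1 up to one inverse relator, which is the only rewriting rule used
  below.\<close>

definition "rr = ux + - b + - gp ux m + gp b m"
text \<open>\<open>uU\<close> and \<open>uV\<close> are the words U and V of the overview, and
  \<open>uP\<close> is the conjugate of U by b x^-m. Up to conjugation and inversion of b, both
  words are products of \<open>m - 2\<close> blocks with an extra power at the end, which is the
  shape required by \<open>merge_power\<close>.\<close>

definition "uU = gp (- b) m + gp (gp ux m + gp (- b) (m - 1)) (m - 2)"
definition "uV = gp (- ux + gp (- b) m + gp ux m) (m - 2) + gp ux m"
definition "uP = (b + - gp ux m) + uU + - (b + - gp ux m)"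

lemma pos_PV:
 assumes m: "m \<ge> 2"
 shows "pos (- rr) (2 * (m - 1)) (uP + uV)"
proof -
 define d where "d = m - 1"
 have md: "m = Suc d" "d = Suc (m - 2)" using m by (auto simp: d_def)
 define x where "x = ux"
 define B where "B = - b"
 \<comment> \<open>Conjugating \<open>uV\<close> by \<open>B\<close> and removing
   \<open>m - 2\<close> inverse relators will leave \<open>V0\<close>.\<close>
 define V0 where "V0 = gp B d + gp x m + b"
 have rb: "gp B m + gp x m = - rr + x + B"
  by (simp add: rr_def x_def B_def gp_uminus gs del: add_uminus_conv_diff)
 \<comment> \<open>Thus \<open>gp B m + gp x m + b\<close> is \<open>x\<close> up to one inverse
   relator, and its m-th power is \<open>gp x m\<close> up to \<open>m\<close> of them.\<close>
 have c: "gp B m + gp x m + b = 0 + - rr + - 0 + x"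
  unfolding rb by (simp add: B_def gs del: add_uminus_conv_diff)
 obtain u where u: "pos (- rr) m u" "gp (gp B m + gp x m + b) m = u + gp x m"
  unfolding c using pos_power[of "- rr" m 0 x] by blast
 \<comment> \<open>Regrouping with \<open>gp_shift\<close> exhibits this word as the m-th power of
   \<open>gp B m + gp x m + b\<close>.\<close>
 have "uU + gp x m + V0 = gp B m + gp (gp x m + gp B d) d + gp x m + b"
 proof -
  have "gp (gp x m + gp B d) d = gp (gp x m + gp B d) (m - 2) + (gp x m + gp B d)"
   by (subst md(2)) (rule gp_Suc2)
  then show ?thesis by (simp add: uU_def V0_def x_def B_def d_def add.assoc)
 qed
 also have "gp B m = B + gp B d" by (simp add: md(1))
 also have "B + gp B d + gp (gp x m + gp B d) d + gp x m + b = B + (gp (gp B d + gp x m) d + (gp B d + gp x m)) + - B"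
  using gp_shift[of "gp B d" "gp x m" d] by (simp add: add.assoc[symmetric] B_def) (simp add: add.assoc)
 also have "\<dots> = gp (B + (gp B d + gp x m) + - B) m"
  unfolding gp_conj md(1) gp_Suc2[symmetric] ..
 also have "B + (gp B d + gp x m) + - B = gp B m + gp x m + b"
  by (simp add: md(1) B_def add.assoc)
 finally have 1: "uU + gp x m + V0 = u + gp x m" using u(2) by simp
 \<comment> \<open>Each of the \<open>m - 2\<close> factors of the power in \<open>uV\<close> is
   \<open>B\<close> up to one inverse relator. Together with the \<open>m\<close> from above this
   makes \<open>2 * (m - 1)\<close>.\<close>
 have e: "- x + gp B m + gp x m = - x + - rr + - (- x) + B"
  using rb by (simp add: gs del: add_uminus_conv_diff)
 obtain v where v: "pos (- rr) (m - 2) v" "gp (- x + gp B m + gp x m) (m - 2) = v + gp B (m - 2)"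
  unfolding e using pos_power[of "- rr" "m - 2" "- x" B] by blast
 have V: "B + uV + b = (B + v + - B) + V0"
 proof -
  have "gp B d = B + gp B (m - 2)" by (subst md(2)) simp
  then show ?thesis using v(2) by (simp add: uV_def V0_def x_def B_def add.assoc)
 qed
 have "- gp x m + uU + gp x m + V0 = - gp x m + u + - (- gp x m)" using 1 by (simp add: add.assoc)
 then have "pos (- rr) m (- gp x m + uU + gp x m + V0)" using pos_conj[OF u(1)] by metis
 then have "pos (- rr) ((m - 2) + m) ((- gp x m + uU + gp x m) + (B + v + - B) + V0)"
  by (intro pos_mid pos_conj v(1)) (simp add: add.assoc)
 then have "pos (- rr) ((m - 2) + m) (b + ((- gp x m + uU + gp x m) + (B + v + - B) + V0) + - b)"
  by (rule pos_conj)
 moreover have "b + ((- gp x m + uU + gp x m) + (B + v + - B) + V0) + - b = uP + uV"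
 proof -
  have "b + ((- gp x m + uU + gp x m) + (B + v + - B) + V0) + - b = b + ((- gp x m + uU + gp x m) + (B + uV + b)) + - b"
   unfolding V by (simp only: add.assoc)
  also have "\<dots> = uP + uV" by (simp add: uP_def x_def B_def gs del: add_uminus_conv_diff)
  finally show ?thesis .
 qed
 moreover have "(m - 2) + m = 2 * (m - 1)" using m by simp
 ultimately show ?thesis by simp
qed

text \<open>With B for the inverse of b, the two powers merge to x^p B^q and B^p x^q, where p and q
  are the exponent sums over \<open>k\<close> copies. After one more swap the product is x^(p+q)
  B^(p+q), and this is a commutator because x is the conjugate of b by a.\<close>

lemma clle_PV:
 assumes m: "m \<ge> 2"
 shows "clle (k * (m - 2) + 5) (gp uP k + gp uV k)"
proof -
 define d where "d = m - 1"
 have md: "m = Suc d" using m by (auto simp: d_def)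
 define x where "x = ux"
 define B where "B = - b"
 define K where "K = k * (m - 2)"
 define p where "p = k * ((m - 2) * m)"
 define q where "q = k * ((m - 2) * d + m)"
 define S where "S = gp (gp x m + gp B d) (m - 2)"
 have S: "S = (\<Sum>(i, j)\<leftarrow>replicate (m - 2) (m, d). gp x i + gp B j)"
  by (simp add: S_def sum_list_replicate_gp)
 define W where "W = gp (gp B m + gp x d) (m - 2)"
 have W: "W = (\<Sum>(i, j)\<leftarrow>replicate (m - 2) (m, d). gp B i + gp x j)"
  by (simp add: W_def sum_list_replicate_gp)
 have l: "sum_list (map fst (replicate (m - 2) (m, d))) = (m - 2) * m"
  "sum_list (map snd (replicate (m - 2) (m, d))) = (m - 2) * d"
  by (simp_all add: sum_list_replicate)
 have U1: "cdist (K div 2) (gp (S + gp B m) k) (gp x p + gp B q)"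
  using merge_power[of k "replicate (m - 2) (m, d)" x B m] unfolding S[symmetric] l
  by (simp add: K_def p_def q_def)
 have V1: "cdist (K div 2) (gp (W + gp x m) k) (gp B p + gp x q)"
  using merge_power[of k "replicate (m - 2) (m, d)" B x m] unfolding W[symmetric] l
  by (simp add: K_def p_def q_def)
 have "uU = gp B m + (S + gp B m) + - gp B m"
  by (simp add: uU_def S_def x_def B_def d_def gs del: add_uminus_conv_diff)
 then have "uP = (b + - gp x m + gp B m) + (S + gp B m) + - (b + - gp x m + gp B m)"
  by (simp add: uP_def x_def gs del: add_uminus_conv_diff)
 then have U2: "cdist (Suc 0) (gp uP k) (gp (S + gp B m) k)"
  by (simp only: gp_conj cdist_conj)
 have "- x + gp B m + gp x m = - x + (gp B m + gp x d) + - (- x)"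
  unfolding md gp_Suc2[of x] by (simp add: add.assoc)
 then have "gp (- x + gp B m + gp x m) (m - 2) = - x + W + - (- x)"
  by (simp only: gp_conj W_def)
 then have "uV = - x + (W + gp x m) + - (- x)"
  using gp_comm[of x 1 m] by (simp add: uV_def x_def B_def add.assoc)
 then have V2: "cdist (Suc 0) (gp uV k) (gp (W + gp x m) k)"
  by (simp only: gp_conj cdist_conj)
 have "cdist ((Suc 0 + K div 2) + (Suc 0 + K div 2)) (gp uP k + gp uV k) ((gp x p + gp B q) + (gp B p + gp x q))"
  by (rule cdist_add[OF cdist_trans[OF U2 U1] cdist_trans[OF V2 V1]])
 moreover have "cdist (Suc 0) ((gp x p + gp B q) + (gp B p + gp x q)) (gp x q + ((gp x p + gp B q) + gp B p))"
  using cdist_swap[of "(gp x p + gp B q) + gp B p" "gp x q"] by (simp add: add.assoc)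
 moreover have "gp x q + ((gp x p + gp B q) + gp B p) = cmt a (gp b (q + p))"
 proof -
  have "gp x q + ((gp x p + gp B q) + gp B p) = gp x (q + p) + gp B (q + p)" by (simp add: gp_add add.assoc)
  also have "gp x (q + p) = a + gp b (q + p) + - a" unfolding x_def ux_def by (rule gp_conj)
  finally show ?thesis by (simp add: cmt_def B_def gp_uminus)
 qed
 ultimately have "cdist ((Suc 0 + K div 2) + (Suc 0 + K div 2) + Suc 0) (gp uP k + gp uV k) (cmt a (gp b (q + p)))"
  using cdist_trans by metis
 moreover have "cdist (Suc 0) (cmt a (gp b (q + p))) 0" using clle_cmt by (simp add: cdist_def)
 ultimately have "cdist ((Suc 0 + K div 2) + (Suc 0 + K div 2) + Suc 0 + Suc 0) (gp uP k + gp uV k) 0"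
  by (rule cdist_trans)
 then have "clle ((Suc 0 + K div 2) + (Suc 0 + K div 2) + Suc 0 + Suc 0) (gp uP k + gp uV k)" by (simp add: cdist_def)
 then show ?thesis by (rule clle_mono) (simp add: K_def[symmetric])
qed

lemma pos_clle:
 assumes m: "m \<ge> 2"
 shows "\<exists>w. clle (k * (m - 2) + 5) w \<and> pos (- rr) (k * (2 * (m - 1))) w"
 using clle_PV[OF m] pos_power_mult[OF pos_PV[OF m]] by blast

text \<open>The k-th power of \<open>uP + uV\<close> is compared with a power of the relator, at the
  cost of about k / 2 for each of its \<open>2 * m - 3\<close> splittings, and with
  \<open>gp uP k + gp uV k\<close>, at the cost of another k / 2. With the
  \<open>k * (m - 2)\<close> from \<open>clle_PV\<close> this adds up to
  \<open>k * (2 * m - 3)\<close> and a constant.\<close>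

lemma clle_rr_power:
 assumes m: "m \<ge> 2"
 shows "clle (k * (2 * m - 3) + 2 * m + 5) (gp rr (k * (2 * (m - 1))))"
proof -
 define n where "n = 2 * m - 3"
 have n: "2 * (m - 1) = Suc n" using m by (simp add: n_def)
 have 1: "cdist (n * (k div 2) + Suc n) (gp (uP + uV) k) (gp (- rr) (k * Suc n))"
  by (rule pos_power_cdist) (use pos_PV[OF m] n in simp)
 have 2: "cdist (k div 2) (gp (uP + uV) k) (gp uP k + gp uV k)" by (rule cdist_power_add)
 have 3: "cdist (k * (m - 2) + 5) (gp uP k + gp uV k) 0" using clle_PV[OF m] by (simp add: cdist_def)
 have "cdist ((n * (k div 2) + Suc n) + (k div 2) + (k * (m - 2) + 5)) (gp (- rr) (k * Suc n)) 0"
  by (rule cdist_trans[OF cdist_trans[OF cdist_sym[OF 1] 2] 3])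
 then have "clle ((n * (k div 2) + Suc n) + (k div 2) + (k * (m - 2) + 5)) (gp (- rr) (k * Suc n))"
  by (simp add: cdist_def)
 then have 4: "clle ((n * (k div 2) + Suc n) + (k div 2) + (k * (m - 2) + 5)) (gp rr (k * Suc n))"
  using clle_uminus gp_uminus[of rr] by force
 have "(n * (k div 2) + Suc n) + (k div 2) + (k * (m - 2) + 5) \<le> k * (2 * m - 3) + 2 * m + 5"
 proof -
  have "Suc n * (k div 2) = (m - 1) * (2 * (k div 2))"
   by (simp only: n[symmetric] mult_ac)
  also have "\<dots> \<le> (m - 1) * k" by (intro mult_left_mono) auto
  finally have "n * (k div 2) + k div 2 \<le> (m - 1) * k" by simp
  moreover have "(m - 1) * k + k * (m - 2) = k * (2 * m - 3)"
  proof -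
   obtain j where "m = j + 2" using m by (metis le_add_diff_inverse2)
   then show ?thesis by (simp add: algebra_simps)
  qed
  ultimately show ?thesis using m by (simp add: n_def)
 qed
 then show ?thesis unfolding n by (rule clle_mono[OF 4])
qed

end

section \<open>The stable commutator length\<close>

abbreviation "over S w \<equiv> fst ` set w \<subseteq> S"

text \<open>The free group on all letters of the type, made an instance of \<open>group_add\<close>
  so that the results of the previous section apply to words. Letters outside of a given alphabet
  are removed afterwards by \<open>wval_filter\<close>.\<close>

typedef 's fg = "{w :: 's word. reduced w}"
 morphisms fg_word Abs_fg
 by (rule exI[of _ "[]"]) simp

definition fg :: "'s word \<Rightarrow> 's fg" where
 "fg w = Abs_fg (wval w)"

lemma fg_word_fg [simp]: "fg_word (fg w) = wval w"
 by (simp add: fg_def Abs_fg_inverse)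

lemma fg_fg_word [simp]: "fg (fg_word g) = g"
 using fg_word[of g] by (simp add: fg_def wval_reduced fg_word_inverse)

lemma fg_eq_iff: "fg u = fg v \<longleftrightarrow> wval u = wval v"
 by (metis fg_def fg_word_fg)

instantiation fg :: (type) group_add
begin

definition "0 = fg []"
definition "g + h = fg (fg_word g @ fg_word h)"
definition "- g = fg (winv (fg_word g))"
definition "g - (h :: 'a fg) = g + - h"

lemma fg_append: "fg (u @ v) = fg u + fg v"
 unfolding plus_fg_def fg_word_fg fg_eq_iff by (intro wval_append_cong) simp_all

lemma fg_winv: "fg (winv u) = - fg u"
 unfolding uminus_fg_def fg_word_fg fg_eq_iff by (rule wval_winv_cong) simp

instance
proof
 fix g h k :: "'a fg"
 obtain u v w where e: "g = fg u" "h = fg v" "k = fg w" by (metis fg_fg_word)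
 show "g + h + k = g + (h + k)" unfolding e fg_append[symmetric] by simp
 show "0 + g = g" "g + 0 = g" unfolding e zero_fg_def fg_append[symmetric] by simp_all
 show "- g + g = 0" unfolding e zero_fg_def fg_append[symmetric] fg_winv[symmetric] fg_eq_iff
  by (simp add: wval_winv_cancel0)
 show "g + - h = g - h" by (simp add: minus_fg_def)
qed

end

lemma fg_Nil: "fg [] = 0"
 by (simp add: zero_fg_def)

lemma fg_concat: "fg (concat ws) = (\<Sum>w\<leftarrow>ws. fg w)"
 by (induction ws) (simp_all add: fg_append fg_Nil)

lemma fg_replicate: "fg (concat (replicate n w)) = gp (fg w) n"
 by (induction n) (simp_all add: fg_append fg_Nil)

lemma inv_letter_simp: "inv_letter (x, s) = (x, \<not> s)"
 by (simp add: inv_letter_def)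

lemma rr_rword: "rr (fg [(a, True)]) (fg [(b, True)]) m = fg (rword a b m)"
proof -
 define A where "A = fg [(a, True)]"
 define B where "B = fg [(b, True)]"
 have neg: "fg [(a, False)] = - A" "fg [(b, False)] = - B"
  using fg_winv[of "[(a, True)]"] fg_winv[of "[(b, True)]"] by (simp_all add: A_def B_def winv_def inv_letter_simp)
 have rep: "fg (replicate m (b, True)) = gp B m" "fg (replicate m (b, False)) = gp (- B) m"
  using fg_replicate[of m "[(b, True)]"] fg_replicate[of m "[(b, False)]"] neg
  by (simp_all add: B_def)
 have "rword a b m = [(a, True)] @ [(b, True)] @ [(a, False)] @ [(b, False)] @ [(a, True)] @
   replicate m (b, False) @ [(a, False)] @ replicate m (b, True)" by (simp add: rword_def)
 then have "fg (rword a b m) = A + B + - A + - B + A + gp (- B) m + - A + gp B m"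
  by (simp only: fg_append rep neg A_def[symmetric] B_def[symmetric] add.assoc)
 moreover have "rr A B m = A + B + - A + - B + A + gp (- B) m + - A + gp B m"
 proof -
  have "- gp (A + B + - A) m = A + gp (- B) m + - A" unfolding gp_conj gp_uminus by (simp add: gs del: add_uminus_conv_diff)
  then show ?thesis by (simp add: rr_def ux_def gs del: add_uminus_conv_diff)
 qed
 ultimately show ?thesis by (simp add: A_def B_def)
qed

definition comm_word :: "'s word \<times> 's word \<Rightarrow> 's word" where
 "comm_word p = fst p @ snd p @ winv (fst p) @ winv (snd p)"

lemma fg_comm_word: "fg (comm_word (u, v)) = cmt (fg u) (fg v)"
 by (simp add: comm_word_def cmt_def fg_append fg_winv add.assoc del: add_uminus_conv_diff)

lemma clle_word:
 assumes "clle n (fg w)"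
 shows "\<exists>cs. length cs \<le> n \<and> wval w = wval (concat (map comm_word cs))"
proof -
 obtain cs where cs: "length cs \<le> n" "fg w = (\<Sum>(x, y)\<leftarrow>cs. cmt x y)" using assms by (auto simp: clle_def)
 have "(\<Sum>(x, y)\<leftarrow>cs. cmt x y) = fg (concat (map comm_word (map (\<lambda>(x, y). (fg_word x, fg_word y)) cs)))"
  unfolding fg_concat by (induction cs) (auto simp: fg_comm_word)
 then show ?thesis using cs unfolding fg_eq_iff[symmetric]
  by (intro exI[of _ "map (\<lambda>(x, y). (fg_word x, fg_word y)) cs"]) simp
qed

lemma pos_rel:
 assumes "pos (- fg r) n (fg w)"
 shows "rel r (- int n) w"
proof -
 obtain cs where cs: "length cs = n" "fg w = (\<Sum>c\<leftarrow>cs. c + - fg r + - c)" using assms by (auto simp: pos_def)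
 define qs where "qs = map (\<lambda>c. (fg_word c, False)) cs"
 have "(\<Sum>c\<leftarrow>cs. c + - fg r + - c) = fg (concat (map (conj_word r) qs))"
  unfolding fg_concat qs_def
  by (induction cs) (simp_all add: conj_word_def fg_append fg_winv add.assoc del: add_uminus_conv_diff)
 moreover have "degree qs = - int n"
  unfolding qs_def cs(1)[symmetric] degree_def by (induction cs) simp_all
 ultimately show ?thesis using cs(2) unfolding rel_def fg_eq_iff[symmetric] by metis
qed

lemma free_group_simps:
 "x \<in> carrier (free_group S) \<longleftrightarrow> reduced x \<and> over S x"
 "reduced y \<Longrightarrow> x \<otimes>\<^bsub>free_group S\<^esub> y = wval (x @ y)"
 "\<one>\<^bsub>free_group S\<^esub> = []"
 by (auto simp: free_group_def wval_append wval_reduced)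

lemma set_wval: "over S w \<Longrightarrow> over S (wval w)"
 unfolding wval_def by (rule set_foldr) simp_all

lemma set_winv: "fst ` set (winv w) = fst ` set w"
 by (simp add: winv_def image_image)

lemma reduced_winv: "reduced w \<Longrightarrow> reduced (winv w)"
 by (simp add: winv_def reduced_rev_inv)

lemma inv_free_group:
 assumes "x \<in> carrier (free_group S)"
 shows "inv\<^bsub>free_group S\<^esub> x = winv x"
proof (rule group.inv_equality[OF group_free_group])
 show "winv x \<in> carrier (free_group S)"
  using assms by (auto simp: free_group_simps set_winv reduced_winv)
 show "winv x \<otimes>\<^bsub>free_group S\<^esub> x = \<one>\<^bsub>free_group S\<^esub>"
  using assms by (simp add: free_group_simps wval_winv_cancel0)
qed fact

lemma wval_append_wval: "wval (wval u @ v) = wval (u @ v)" "wval (u @ wval v) = wval (u @ v)"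
 by (intro wval_append_cong; simp)+

lemma commutator_free_group:
 assumes "x \<in> carrier (free_group S)" "y \<in> carrier (free_group S)"
 shows "commutator (free_group S) x y = wval (comm_word (x, y))"
proof -
 have "reduced (winv x)" "reduced (winv y)" "reduced y"
  using assms by (auto simp: free_group_simps(1) reduced_winv)
 then show ?thesis
  using assms by (simp add: commutator_def inv_free_group free_group_simps(2) comm_word_def wval_append_wval)
qed

lemma pow_free_group:
 assumes "x \<in> carrier (free_group S)"
 shows "x [^]\<^bsub>free_group S\<^esub> (n :: nat) = wval (concat (replicate n x))"
proof (induction n)
 case (Suc n)
 interpret group "free_group S" by (rule group_free_group)
 have "x [^]\<^bsub>free_group S\<^esub> Suc n = x \<otimes>\<^bsub>free_group S\<^esub> x [^]\<^bsub>free_group S\<^esub> n"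
  using assms by (rule nat_pow_Suc2)
 then show ?case by (simp add: Suc free_group_simps wval_append_wval)
qed (simp add: free_group_simps)

lemma reduced_rword:
 assumes "a \<noteq> b" "m \<ge> 1"
 shows "reduced (rword a b m)"
proof -
 have "rword a b m ! Suc i \<noteq> inv_letter (rword a b m ! i)" if "Suc i < 2 * m + 6" for i
  using that assms unfolding rword_nth[OF that] rword_nth[OF Suc_lessD[OF that]]
  by (auto simp: inv_letter_simp)
 then show ?thesis unfolding reduced_def successively_conv_nth by simp
qed

lemma relator_eq_rword:
 assumes ab: "a \<noteq> b" and m: "m \<ge> 1"
 defines "F \<equiv> free_group {a, b}"
 shows "commutator F (gen a) (gen b) \<otimes>\<^bsub>F\<^esub> commutator F (gen a) (gen b [^]\<^bsub>F\<^esub> (- int m)) = rword a b m"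
  and "rword a b m \<in> carrier F"
proof -
 interpret group F unfolding F_def by (rule group_free_group)
 have g: "gen a \<in> carrier F" "gen b \<in> carrier F"
  by (simp_all add: F_def free_group_simps gen_def reduced_def)
 have p: "gen b [^]\<^bsub>F\<^esub> m = replicate m (b, True)"
  using g(2) unfolding F_def
  by (simp add: pow_free_group gen_def concat_replicate_single)
   (rule wval_reduced, simp add: reduced_def successively_conv_nth inv_letter_simp)
 have pc: "replicate m (b, True) \<in> carrier F" unfolding p[symmetric] using g(2) by (rule nat_pow_closed)
 have "gen b [^]\<^bsub>F\<^esub> (- int m) = inv\<^bsub>F\<^esub> (gen b [^]\<^bsub>F\<^esub> m)"
  using int_pow_neg[OF g(2), of "int m"] by (simp add: int_pow_int)
 also have "\<dots> = replicate m (b, False)"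
  unfolding p using pc unfolding F_def by (simp add: inv_free_group winv_def inv_letter_simp)
 finally have q: "gen b [^]\<^bsub>F\<^esub> (- int m) = replicate m (b, False)" .
 have qc: "replicate m (b, False) \<in> carrier F" unfolding q[symmetric] using g(2) by (rule int_pow_closed)
 have w: "winv (replicate m (b, False)) = replicate m (b, True)" by (simp add: winv_def inv_letter_simp)
 have "commutator F (gen a) (gen b) \<otimes>\<^bsub>F\<^esub> commutator F (gen a) (gen b [^]\<^bsub>F\<^esub> (- int m))
   = wval (comm_word (gen a, gen b) @ comm_word (gen a, replicate m (b, False)))"
  using g qc unfolding q unfolding F_def by (simp add: commutator_free_group free_group_simps(2) wval_append_wval)
 also have "comm_word (gen a, gen b) @ comm_word (gen a, replicate m (b, False)) = rword a b m"
  unfolding comm_word_def fst_conv snd_conv w by (simp add: gen_def winv_def inv_letter_simp rword_def)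
 finally show "commutator F (gen a) (gen b) \<otimes>\<^bsub>F\<^esub> commutator F (gen a) (gen b [^]\<^bsub>F\<^esub> (- int m)) = rword a b m"
  using wval_reduced[OF reduced_rword[OF ab m]] by simp
 have "over {a, b} (rword a b m)" by (auto simp: rword_def)
 then show "rword a b m \<in> carrier F" unfolding F_def by (simp add: free_group_simps reduced_rword[OF ab m])
qed

text \<open>Deleting the letters outside of \<open>S\<close> is a homomorphism of free groups: it
  turns a cancelling pair into a cancelling pair or into nothing.\<close>

lemma wval_filter: "wval (filter (\<lambda>l. fst l \<in> S) (wval w)) = wval (filter (\<lambda>l. fst l \<in> S) w)"
proof (induction w)
 case (Cons x w)
 let ?f = "filter (\<lambda>l. fst l \<in> S)"
 have c: "wval (?f (cons_cancel x v)) = wval (?f (x # v))" for v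
 proof (cases "v \<noteq> [] \<and> hd v = inv_letter x")
  case True
  then obtain u where "v = inv_letter x # u" by (cases v) auto
  then show ?thesis using wval_cancel[of "[]" x "?f u"] by (simp add: cons_cancel_def)
 next
  case False
  then show ?thesis unfolding cons_cancel_def by (simp only: if_False)
 qed
 have "wval (x # ?f (wval w)) = wval (x # ?f w)"
  using wval_append_cong[OF refl Cons, of "[x]"] by simp
 then show ?case using c[of "wval w"] Cons by (simp add: wval_def)
qed simp

lemma filter_winv: "filter (\<lambda>l. fst l \<in> S) (winv w) = winv (filter (\<lambda>l. fst l \<in> S) w)"
 by (induction w) (simp_all add: winv_Cons)

lemma wval_concat_cong: "(\<And>w. w \<in> set ws \<Longrightarrow> wval (f w) = wval (g w)) \<Longrightarrow>
  wval (concat (map f ws)) = wval (concat (map g ws))"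
proof (induction ws)
 case (Cons w ws)
 have "wval (f w) = wval (g w)" "wval (concat (map f ws)) = wval (concat (map g ws))"
  using Cons by simp_all
 then have "wval (f w @ concat (map f ws)) = wval (g w @ concat (map g ws))" by (rule wval_append_cong)
 then show ?case by simp
qed simp

text \<open>The commutators provided by \<open>clle\<close> may use letters outside of
  \<open>S\<close>; the retraction \<open>pr\<close> moves them into \<open>free_group S\<close>.
  Thereby the set in the definition of the commutator length is nonempty, so that its least element
  is attained, which is the second claim.\<close>

lemma commutator_length_le:
 fixes w :: "'s word"
 assumes w: "w \<in> carrier (free_group S)" and cl: "clle n (fg w)"
 shows "commutator_length (free_group S) w \<le> n"
  and "\<exists>cs. length cs = commutator_length (free_group S) w \<and> w = wval (concat (map comm_word cs))"
proof -
 define Q where "Q k \<longleftrightarrow> (\<exists>cs. length cs = k \<and>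
    (\<forall>c \<in> set cs. \<exists>x \<in> carrier (free_group S). \<exists>y \<in> carrier (free_group S). c = commutator (free_group S) x y) \<and>
    w = foldr (monoid.mult (free_group S)) cs \<one>\<^bsub>free_group S\<^esub>)" for k
 have clw: "commutator_length (free_group S) w = (LEAST k. Q k)" by (simp add: commutator_length_def Q_def)
 have fold: "foldr (monoid.mult (free_group S)) cs \<one>\<^bsub>free_group S\<^esub> = wval (concat cs)" for cs
  by (induction cs) (simp_all add: free_group_simps wval_append_wval)
 obtain cs where cs: "length cs \<le> n" "wval w = wval (concat (map comm_word cs))" using clle_word[OF cl] by blast
 let ?f = "filter (\<lambda>l. fst l \<in> S)"
 define pr where "pr u = wval (?f u)" for u
 have prc: "pr u \<in> carrier (free_group S)" for u
  unfolding pr_def free_group_simps using set_wval[of "?f u" S] by auto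
 define cs' where "cs' = map (\<lambda>(x, y). commutator (free_group S) (pr x) (pr y)) cs"
 have "?f w = w" using w by (auto simp: free_group_simps filter_id_conv)
 then have "w = wval (?f (concat (map comm_word cs)))"
  using w wval_filter[of S w] wval_filter[of S "concat (map comm_word cs)"] cs(2) wval_reduced[of w]
  by (simp add: free_group_simps(1))
 also have "?f (concat (map comm_word cs)) = concat (map (\<lambda>p. ?f (comm_word p)) cs)"
  by (simp add: filter_concat comp_def)
 also have "wval \<dots> = wval (concat (map (\<lambda>(x, y). commutator (free_group S) (pr x) (pr y)) cs))"
 proof (rule wval_concat_cong)
  fix p :: "'s word \<times> 's word"
  obtain x y where p: "p = (x, y)" by (cases p)
  have "wval (comm_word (pr x, pr y)) = wval (comm_word (?f x, ?f y))"
   unfolding comm_word_def fst_conv snd_conv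
   by (intro wval_append_cong wval_winv_cong) (simp_all add: pr_def)
  then show "wval (?f (comm_word p)) = wval (case p of (x, y) \<Rightarrow> commutator (free_group S) (pr x) (pr y))"
   by (simp add: p commutator_free_group prc) (simp add: comm_word_def filter_winv)
 qed
 finally have "w = foldr (monoid.mult (free_group S)) cs' \<one>\<^bsub>free_group S\<^esub>"
  unfolding fold cs'_def .
 moreover have "\<forall>c \<in> set cs'. \<exists>x \<in> carrier (free_group S). \<exists>y \<in> carrier (free_group S). c = commutator (free_group S) x y"
  using prc by (auto simp: cs'_def)
 ultimately have Q: "Q (length cs)" unfolding Q_def by (intro exI[of _ cs']) (simp add: cs'_def)
 then show "commutator_length (free_group S) w \<le> n"
  unfolding clw using Least_le[of Q, OF Q] cs(1) by linarith
 have "Q (LEAST k. Q k)" using Q by (rule LeastI)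
 then obtain ds where ds: "length ds = (LEAST k. Q k)"
  "\<forall>c \<in> set ds. \<exists>x \<in> carrier (free_group S). \<exists>y \<in> carrier (free_group S). c = commutator (free_group S) x y"
  "w = wval (concat ds)" unfolding Q_def fold by blast
 have "\<forall>c \<in> set ds. \<exists>p. wval c = wval (comm_word p)"
 proof
  fix c assume "c \<in> set ds"
  then obtain x y where "c = wval (comm_word (x, y))" using ds(2) commutator_free_group by metis
  then have "wval c = wval (comm_word (x, y))" by simp
  then show "\<exists>p. wval c = wval (comm_word p)" by blast
 qed
 then obtain h where "\<And>c. c \<in> set ds \<Longrightarrow> wval c = wval (comm_word (h c))" by metis
 then have "wval (concat (map (\<lambda>c. c) ds)) = wval (concat (map (\<lambda>c. comm_word (h c)) ds))"
  by (rule wval_concat_cong)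
 then have "w = wval (concat (map comm_word (map h ds)))" using ds(3) by (simp add: comp_def)
 then show "\<exists>cs. length cs = commutator_length (free_group S) w \<and> w = wval (concat (map comm_word cs))"
  unfolding clw ds(1)[symmetric] by (intro exI[of _ "map h ds"]) simp
qed

lemma scl_rword:
 assumes ab: "a \<noteq> b" and m: "m \<ge> 2"
 shows "scl (free_group {a, b}) (rword a b m) = (2 * real m - 3) / (2 * real m - 2)"
proof -
 define F where "F = free_group {a, b}"
 define r where "r = rword a b m"
 define \<sigma> where "\<sigma> = (2 * real m - 3) / (2 * real m - 2)"
 interpret group F unfolding F_def by (rule group_free_group)
 have rF: "r \<in> carrier F" unfolding r_def F_def by (rule relator_eq_rword[OF ab]) (use m in simp)
 have rn: "r [^]\<^bsub>F\<^esub> n = wval (concat (replicate n r))" for n :: nat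
  using rF unfolding F_def by (rule pow_free_group)
 have fgr: "fg (r [^]\<^bsub>F\<^esub> n) = gp (fg r) n" for n :: nat
  unfolding rn fg_replicate[symmetric] fg_eq_iff by simp
 define c where "c n = commutator_length F (r [^]\<^bsub>F\<^esub> n)" for n :: nat
 define A where "A = fg [(a, True)]"
 define B where "B = fg [(b, True)]"
 have rr: "fg r = rr A B m" by (simp add: r_def rr_rword A_def B_def)
 have two: "clle (2 * j) (gp (fg r) j)" for j
 proof (induction j)
  case (Suc j)
  have "fg r = cmt A B + cmt A (gp (- B) m)"
   unfolding rr rr_def ux_def cmt_def gp_conj gp_uminus by (simp add: gs del: add_uminus_conv_diff)
  then have "clle (Suc 0 + Suc 0 + 2 * j) (fg r + gp (fg r) j)"
   using clle_add[OF clle_add[OF clle_cmt clle_cmt] Suc, of A B A "gp (- B) m"] by simp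
  then show ?case by simp
 qed simp
 define d2 where "d2 = 2 * (m - 1)"
 have d2: "d2 > 0" "real d2 = 2 * real m - 2" using m by (auto simp: d2_def)
 \<comment> \<open>The exponent is divided by \<open>d2\<close> with remainder. The remainder costs
   at most two commutators for each relator, which is a bounded contribution.\<close>
 have up: "clle ((n div d2) * (2 * m - 3) + 2 * m + 5 + 2 * d2) (gp (fg r) n)" for n
 proof -
  have "gp (fg r) n = gp (fg r) ((n div d2) * d2) + gp (fg r) (n mod d2)"
   by (simp add: gp_add[symmetric])
  moreover have "clle ((n div d2) * (2 * m - 3) + 2 * m + 5) (gp (fg r) ((n div d2) * d2))"
   unfolding rr d2_def using clle_rr_power[OF m] .
  moreover have "clle (2 * (n mod d2)) (gp (fg r) (n mod d2))" by (rule two)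
  ultimately have "clle ((n div d2) * (2 * m - 3) + 2 * m + 5 + 2 * (n mod d2)) (gp (fg r) n)"
   using clle_add by metis
  then show ?thesis by (rule clle_mono) (use mod_less_divisor[OF d2(1), of n] in simp)
 qed
 define C where "C = real (2 * m + 5 + 2 * d2)"
 have upper: "real (c n) \<le> \<sigma> * real n + C" for n
 proof -
  have "c n \<le> (n div d2) * (2 * m - 3) + 2 * m + 5 + 2 * d2"
   unfolding c_def F_def
   by (rule commutator_length_le(1)) (use up fgr rF in \<open>auto simp: F_def[symmetric]\<close>)
  then have "real (c n) \<le> real ((n div d2) * (2 * m - 3) + 2 * m + 5 + 2 * d2)" by (rule of_nat_mono)
  also have "\<dots> = real (n div d2) * (2 * real m - 3) + C" using m by (simp add: C_def of_nat_diff)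
  also have "real (n div d2) * (2 * real m - 3) \<le> (real n / real d2) * (2 * real m - 3)"
  proof (rule mult_right_mono)
   have "real (n div d2) * real d2 \<le> real n" unfolding of_nat_mult[symmetric] of_nat_le_iff by simp
   then show "real (n div d2) \<le> real n / real d2" using d2(1) by (simp add: pos_le_divide_eq)
  qed (use m in simp)
  also have "\<dots> = \<sigma> * real n" by (simp add: \<sigma>_def d2(2))
  finally show ?thesis by simp
 qed
 \<comment> \<open>The inverse of a shortest product of commutators followed by the power of the
   relator is trivial, which is the situation of \<open>commutator_bound\<close>.\<close>
 have lower: "\<sigma> * real n \<le> real (c n)" for n
 proof -
  have "\<exists>cs. length cs = commutator_length (free_group {a, b}) (r [^]\<^bsub>F\<^esub> n) \<and> r [^]\<^bsub>F\<^esub> n = wval (concat (map comm_word cs))"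
   by (rule commutator_length_le(2)) (use two fgr rF in \<open>auto simp: F_def[symmetric]\<close>)
  then obtain cs where cs: "length cs = c n" "r [^]\<^bsub>F\<^esub> n = wval (concat (map comm_word cs))"
   by (auto simp: c_def F_def)
  have w: "winv (concat (map comm_word cs)) = concat (map (\<lambda>(x, y). y @ x @ winv y @ winv x) (rev cs))" for cs :: "('a word \<times> 'a word) list"
   by (induction cs) (auto simp: winv_append comm_word_def)
  have "wval (winv (concat (map comm_word cs)) @ concat (replicate n r)) =
    wval (winv (concat (map comm_word cs)) @ concat (map comm_word cs))"
   by (rule wval_append_cong[OF refl]) (use cs(2) rn in simp)
  then have "wval (concat (map (\<lambda>(x, y). y @ x @ winv y @ winv x) (rev cs)) @ concat (replicate n (rword a b m))) = []"
   using wval_winv_cancel0(2)[of "concat (map comm_word cs)"] unfolding w r_def by simp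
  then have "n * (2 - 1 / (real m - 1)) \<le> 2 * length (rev cs)" by (rule commutator_bound[OF m ab])
  then have "real n * (2 - 1 / (real m - 1)) \<le> 2 * real (c n)" using cs(1) by simp
  moreover have "2 - 1 / (real m - 1) = 2 * \<sigma>" using m by (simp add: \<sigma>_def field_simps)
  ultimately show ?thesis by (simp add: mult.commute)
 qed
 have "(\<lambda>n. real (c n) / real n) \<longlonglongrightarrow> \<sigma>"
 proof (rule tendsto_sandwich)
  show "\<forall>\<^sub>F n in sequentially. \<sigma> \<le> real (c n) / real n"
   using eventually_gt_at_top[of 0]
  proof eventually_elim
   case (elim n)
   then show ?case using lower[of n] by (simp add: pos_le_divide_eq)
  qed
  show "\<forall>\<^sub>F n in sequentially. real (c n) / real n \<le> \<sigma> + C / real n"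
   using eventually_gt_at_top[of 0]
  proof eventually_elim
   case (elim n)
   then have "\<sigma> + C / real n = (\<sigma> * real n + C) / real n" by (simp add: field_simps)
   moreover have "real (c n) / real n \<le> (\<sigma> * real n + C) / real n" by (rule divide_right_mono[OF upper]) simp
   ultimately show ?case by simp
  qed
  show "(\<lambda>n. \<sigma> + C / real n) \<longlonglongrightarrow> \<sigma>"
   using tendsto_add[OF tendsto_const lim_const_over_n, of \<sigma> C] by simp
 qed simp
 then show ?thesis unfolding scl_def c_def F_def r_def \<sigma>_def by (rule limI)
qed

section \<open>The presentation complex\<close>

text \<open>In contrast to \<open>word_loop\<close> every letter takes unit time, so no rescaling
  occurs when words are concatenated. Outside of its domain the path rests at the vertex, which
  makes it continuous on the whole line.\<close>

definition wp :: "'s word \<Rightarrow> real \<Rightarrow> 's pc_point" where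
 "wp w t = (if 0 \<le> t \<and> t < length w then letter_path (w ! nat \<lfloor>t\<rfloor>) (frac t) else Vertex)"

lemma letter_path_ends: "t \<le> 0 \<or> 1 \<le> t \<Longrightarrow> letter_path x t = Vertex"
 by (auto simp: letter_path_def edge_map_def)

lemma letter_path_inv: "letter_path (inv_letter x) t = letter_path x (1 - t)"
 by (simp add: letter_path_def inv_letter_def)

lemma word_loop_wp: "word_loop w t = wp w (t * length w)"
 by (cases "w = []") (auto simp: word_loop_def wp_def zero_le_mult_iff)

lemma wp_outside: "t \<le> 0 \<or> real (length w) \<le> t \<Longrightarrow> wp w t = Vertex"
 by (auto simp: wp_def letter_path_ends)

lemma wp_Nil [simp]: "wp [] t = Vertex"
 by (auto simp: wp_def)

lemma wp_single: "wp [x] t = letter_path x t"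
proof (cases "0 \<le> t \<and> t < 1")
 case True
 then have "\<lfloor>t\<rfloor> = 0" by linarith
 then show ?thesis using True by (simp add: wp_def frac_def)
next
 case False
 then show ?thesis using letter_path_ends[of t x] by (auto simp: wp_def)
qed

lemma wp_append1: "t \<le> real (length u) \<Longrightarrow> wp (u @ v) t = wp u t"
proof (cases "0 \<le> t \<and> t < length u")
 case True
 then have "nat \<lfloor>t\<rfloor> < length u" by linarith
 then show ?thesis using True by (simp add: wp_def nth_append)
next
 case False
 moreover assume "t \<le> real (length u)"
 ultimately consider "t < 0" | "t = length u" by linarith
 then show ?thesis by cases (auto simp: wp_def letter_path_ends frac_def)
qed

lemma wp_append2: "0 \<le> t \<Longrightarrow> wp (u @ v) (real (length u) + t) = wp v t"
proof (cases "t < length v")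
 case True
 assume t: "0 \<le> t"
 have "nat \<lfloor>real (length u) + t\<rfloor> = length u + nat \<lfloor>t\<rfloor>" using t by (simp add: floor_add_int nat_add_distrib)
 moreover have "frac (real (length u) + t) = frac t" by (simp add: frac_def)
 ultimately show ?thesis using t True by (simp add: wp_def nth_append)
qed (simp add: wp_def)

lemma wp_Cons: "wp (x # w) t = (if t \<le> 1 then letter_path x t else wp w (t - 1))"
 using wp_append1[of t "[x]" w] wp_append2[of "t - 1" "[x]" w] by (auto simp: wp_single)

lemma wp_winv: "wp (winv w) t = wp w (real (length w) - t)"
proof (induction w arbitrary: t)
 case (Cons x w)
 have l: "length (winv w) = length w" by simp
 show ?case
 proof (cases "t \<le> real (length w)")
  case True
  then have "wp (winv (x # w)) t = wp w (real (length w) - t)"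
   using wp_append1[of t "winv w" "[inv_letter x]"] Cons by (simp add: winv_Cons)
  moreover have "wp (x # w) (real (length (x # w)) - t) = wp w (real (length w) - t)"
   using wp_append2[of "real (length w) - t" "[x]" w] True by (simp add: algebra_simps)
  ultimately show ?thesis by simp
 next
  case False
  then have "wp (winv (x # w)) t = letter_path x (1 - (t - real (length w)))"
   using wp_append2[of "t - real (length w)" "winv w" "[inv_letter x]"]
   by (simp add: winv_Cons wp_single letter_path_inv)
  moreover have "wp (x # w) (real (length (x # w)) - t) = letter_path x (real (length (x # w)) - t)"
   using False by (simp add: wp_Cons)
  ultimately show ?thesis by (simp add: algebra_simps)
 qed
qed simp

lemma wp_skeleton: "over S w \<Longrightarrow> wp w t \<in> pc_skeleton S"
proof (induction w arbitrary: t)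
 case (Cons x w)
 then show ?case by (auto simp: wp_Cons letter_path_def edge_map_def pc_skeleton_def)
qed (simp add: pc_skeleton_def)

lemma continuous_map_wp:
 assumes e: "\<And>s. s \<in> S \<Longrightarrow> continuous_map (top_of_set {0..1}) T (edge_map s)"
  and V: "Vertex \<in> topspace T" and w: "over S w"
 shows "continuous_map euclideanreal T (wp w)"
 using w
proof (induction w)
 case Nil
 have "wp [] = (\<lambda>_. Vertex :: 'a pc_point)" by (rule ext) simp
 then show ?case using V by simp
next
 case (Cons x w)
 have s: "fst x \<in> S" using Cons.prems by simp
 have E: "continuous_map euclideanreal T (edge_map (fst x))"
 proof -
  \<comment> \<open>Outside of the unit interval \<open>edge_map\<close> is constantly the vertex,
    so it factors through the retraction onto the interval.\<close>
  have "continuous_map euclideanreal (top_of_set {0..1::real}) (\<lambda>t. max 0 (min 1 t))"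
   by (auto simp: continuous_map_in_subtopology intro!: continuous_intros)
  then have "continuous_map euclideanreal T (edge_map (fst x) \<circ> (\<lambda>t. max 0 (min 1 t)))"
   using e[OF s] by (rule continuous_map_compose)
  moreover have "edge_map (fst x) \<circ> (\<lambda>t. max 0 (min 1 t)) = edge_map (fst x)"
   by (auto simp: edge_map_def fun_eq_iff)
  ultimately show ?thesis by simp
 qed
 have L: "continuous_map euclideanreal T (letter_path x)"
 proof (cases "snd x")
  case True
  then have "letter_path x = edge_map (fst x)" by (auto simp: letter_path_def)
  then show ?thesis using E by simp
 next
  case False
  then have "letter_path x = edge_map (fst x) \<circ> (\<lambda>t. 1 - t)" by (auto simp: letter_path_def)
  moreover have "continuous_map euclideanreal euclideanreal (\<lambda>t::real. 1 - t)"
   by (simp add: continuous_intros)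
  ultimately show ?thesis using E continuous_map_compose by metis
 qed
 have W: "continuous_map euclideanreal T (\<lambda>t. wp w (t - 1))"
 proof -
  have "continuous_map euclideanreal euclideanreal (\<lambda>t::real. t - 1)"
   by (simp add: continuous_intros)
  then have "continuous_map euclideanreal T (wp w \<circ> (\<lambda>t. t - 1))"
   using Cons by (intro continuous_map_compose) auto
  then show ?thesis by (simp add: comp_def)
 qed
 have "continuous_map euclideanreal T (\<lambda>t. if t \<le> 1 then letter_path x t else wp w (t - 1))"
 proof (rule continuous_map_cases_le)
  fix t :: real assume "t = 1"
  then show "letter_path x t = wp w (t - 1)" by (simp add: letter_path_ends wp_outside)
 qed (auto intro: continuous_map_from_subtopology L W)
 then show ?case by (simp add: wp_Cons[abs_def])
qed

text \<open>The final topology for the 1-cells alone. It describes the 1-skeleton without reference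
  to the 2-cell and is convenient for its homology.\<close>

definition graph_topology :: "'s set \<Rightarrow> 's pc_point topology" where
 "graph_topology S = topology (\<lambda>U. U \<subseteq> pc_skeleton S \<and>
   (\<forall>s \<in> S. openin (top_of_set {0..1}) {t \<in> {0..1}. edge_map s t \<in> U}))"

lemma openin_graph_topology:
 "openin (graph_topology S) U \<longleftrightarrow> U \<subseteq> pc_skeleton S \<and>
   (\<forall>s \<in> S. openin (top_of_set {0..1}) {t \<in> {0..1}. edge_map s t \<in> U})"
proof -
 have "istopology (\<lambda>U. U \<subseteq> A \<and> (\<forall>s \<in> S. P s U))"
  if P: "\<And>s. istopology (P s)" for A :: "'s pc_point set" and P
  unfolding istopology_def
 proof (intro conjI allI impI)
  fix U V assume U: "U \<subseteq> A \<and> (\<forall>s \<in> S. P s U)" and V: "V \<subseteq> A \<and> (\<forall>s \<in> S. P s V)"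
  show "U \<inter> V \<subseteq> A" using U by blast
  show "\<forall>s \<in> S. P s (U \<inter> V)" using U V P unfolding istopology_def by blast
 next
  fix K assume K: "\<forall>U \<in> K. U \<subseteq> A \<and> (\<forall>s \<in> S. P s U)"
  show "\<Union>K \<subseteq> A" using K by blast
  show "\<forall>s \<in> S. P s (\<Union>K)"
  proof
   fix s assume "s \<in> S"
   then have "\<forall>U \<in> K. P s U" using K by blast
   then show "P s (\<Union>K)" using P[of s] unfolding istopology_def by simp
  qed
 qed
 from this[OF istopology_preimage] have "istopology (\<lambda>U. U \<subseteq> pc_skeleton S \<and>
   (\<forall>s \<in> S. openin (top_of_set {0..1}) {t \<in> {0..1}. edge_map s t \<in> U}))" .
 then show ?thesis by (simp only: graph_topology_def topology_inverse')
qed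

lemma topspace_graph_topology [simp]: "topspace (graph_topology S) = pc_skeleton S"
proof -
 have "edge_map s t \<in> pc_skeleton S" if "s \<in> S" for s t
  using that by (auto simp: edge_map_def pc_skeleton_def)
 then have "{t \<in> {0..1}. edge_map s t \<in> pc_skeleton S} = {0..1}" if "s \<in> S" for s using that by auto
 then have "openin (graph_topology S) (pc_skeleton S)" by (simp add: openin_graph_topology)
 then show ?thesis using openin_subset[of "graph_topology S"] openin_topspace[of "graph_topology S"]
  unfolding openin_graph_topology by (intro subset_antisym) blast+
qed

lemma continuous_map_edge_map:
 assumes s: "s \<in> S"
 shows "continuous_map (top_of_set {0..1}) (graph_topology S) (edge_map s)"
  and "r \<in> carrier (free_group S) \<Longrightarrow> continuous_map (top_of_set {0..1}) (presentation_complex S r) (edge_map s)"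
proof -
 have "edge_map s t \<in> pc_skeleton S" for t using s by (auto simp: edge_map_def pc_skeleton_def)
 then show "continuous_map (top_of_set {0..1}) (graph_topology S) (edge_map s)"
  using s by (auto simp: continuous_map_def openin_graph_topology)
 show "continuous_map (top_of_set {0..1}) (presentation_complex S r) (edge_map s)" if "r \<in> carrier (free_group S)"
  using s edge_map_in_points[OF s] that
  by (auto simp: continuous_map_def topspace_presentation_complex openin_presentation_complex)
qed

lemma cis_Arg2pi_sgn: "z \<noteq> 0 \<Longrightarrow> cis (Arg2pi z) = sgn z"
proof -
 assume "z \<noteq> 0"
 then have "complex_of_real (norm z) \<noteq> 0" by simp
 moreover have "z = complex_of_real (norm z) * cis (Arg2pi z)"
  using Arg2pi_eq[of z] by (simp add: cis_conv_exp)
 ultimately show ?thesis by (metis nonzero_mult_div_cancel_left sgn_eq)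
qed

lemma face_map_cis:
 assumes "0 \<le> t" "t \<le> 1"
 shows "face_map r (cis (2 * pi * t)) = wp r (t * length r)"
proof (cases "t = 1")
 case True
 then show ?thesis using Arg2pi_unique[of 1 0 1] by (simp add: face_map_def word_loop_wp wp_outside)
next
 case False
 then have "Arg2pi (cis (2 * pi * t)) = 2 * pi * t"
  using assms by (intro Arg2pi_unique[of 1]) (auto simp: cis_conv_exp mult_less_cancel_left)
 then show ?thesis by (simp add: face_map_def word_loop_wp)
qed

text \<open>An open set of the graph is extended to the complex by adding the whole open 2-cell. The
  preimage in the closed disc of what is left out, the set \<open>C\<close>, is the image of a
  compact set of parameters, hence closed.\<close>

lemma graph_subtopology:
 assumes r: "r \<in> carrier (free_group S)"
 shows "subtopology (presentation_complex S r) (pc_skeleton S) = graph_topology S"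
proof (rule topology_eq[THEN iffD2], intro allI)
 fix G
 have rS: "over S r" using r by (simp add: free_group_simps)
 show "openin (subtopology (presentation_complex S r) (pc_skeleton S)) G = openin (graph_topology S) G"
 proof
  assume "openin (subtopology (presentation_complex S r) (pc_skeleton S)) G"
  then obtain U where U: "openin (presentation_complex S r) U" "G = U \<inter> pc_skeleton S"
   by (auto simp: openin_subtopology)
  have "edge_map s t \<in> pc_skeleton S" if "s \<in> S" for s t
   using that by (auto simp: edge_map_def pc_skeleton_def)
  then have "{t \<in> {0..1}. edge_map s t \<in> G} = {t \<in> {0..1}. edge_map s t \<in> U}" if "s \<in> S" for s
   using that U(2) by auto
  then show "openin (graph_topology S) G"
   using U by (auto simp: openin_graph_topology openin_presentation_complex)
 next
  assume G: "openin (graph_topology S) G"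
  define L where "L = real (length r)"
  define C where "C = pc_skeleton S - G"
  have GP: "G \<subseteq> pc_skeleton S" using G by (simp add: openin_graph_topology)
  have nF: "Face z \<notin> pc_skeleton S" for z by (auto simp: pc_skeleton_def)
  have "continuous_map euclideanreal (graph_topology S) (wp r)"
   by (rule continuous_map_wp[OF continuous_map_edge_map(1) _ rS]) (simp_all add: pc_skeleton_def)
  then have "open {t. wp r t \<in> G}" using openin_continuous_map_preimage[OF _ G] by fastforce
  moreover have "{t. wp r (t * L) \<in> G} = (\<lambda>t. t * L) -` {t. wp r t \<in> G}" by auto
  ultimately have o: "open {t. wp r (t * L) \<in> G}"
   using open_vimage[of "{t. wp r t \<in> G}" "\<lambda>t. t * L"] by (simp add: continuous_intros)
  define T where "T = {0..1} - {t. wp r (t * L) \<in> G}"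
  have "compact T" unfolding T_def using o by (intro compact_diff) auto
  define K where "K = (\<lambda>t. cis (2 * pi * t)) ` T"
  have "compact K" unfolding K_def
   by (rule compact_continuous_image[OF _ \<open>compact T\<close>]) (auto intro!: continuous_intros)
  then have K: "closed K" by (rule compact_imp_closed)
  have key: "face_map r z \<in> C \<longleftrightarrow> z \<in> K" if "norm z \<le> 1" for z
  proof
   assume z: "face_map r z \<in> C"
   then have n: "norm z = 1" using that nF[of z] by (auto simp: face_map_def C_def split: if_splits)
   define t where "t = Arg2pi z / (2 * pi)"
   have t: "0 \<le> t" "t < 1" "Arg2pi z = 2 * pi * t"
    using Arg2pi_ge_0[of z] Arg2pi_lt_2pi[of z] by (auto simp: t_def field_simps)
   have "z \<noteq> 0" using n by auto
   then have "z = cis (2 * pi * t)" using cis_Arg2pi_sgn[of z] t(3) n by (simp add: sgn_eq)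
   then show "z \<in> K" using z t face_map_cis[of t r] by (auto simp: K_def T_def C_def L_def)
  next
   assume "z \<in> K"
   then obtain t where "t \<in> T" "z = cis (2 * pi * t)" unfolding K_def by blast
   moreover from this have "0 \<le> t" "t \<le> 1" "wp r (t * L) \<notin> G" by (auto simp: T_def)
   ultimately show "face_map r z \<in> C"
    using face_map_cis[of t r] wp_skeleton[OF rS, of "t * L"] by (simp add: C_def L_def)
  qed
  have "openin (presentation_complex S r) (pc_points S - C)"
   unfolding openin_presentation_complex
  proof (intro conjI ballI)
   fix s assume s: "s \<in> S"
   have "edge_map s t \<in> pc_points S - C \<longleftrightarrow> edge_map s t \<in> G" for t
    using s GP by (auto simp: C_def edge_map_def pc_points_def pc_skeleton_def)
   then show "openin (top_of_set {0..1}) {t \<in> {0..1}. edge_map s t \<in> pc_points S - C}"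
    using G s by (simp add: openin_graph_topology)
  next
   have "face_map r z \<in> pc_points S" for z
    using word_loop_in_points[OF rS] by (simp add: face_map_def) (simp add: pc_points_def)
   then have "{z \<in> cball 0 1. face_map r z \<in> pc_points S - C} = cball 0 1 \<inter> - K" using key by auto
   then show "openin (top_of_set (cball 0 1)) {z \<in> cball 0 1. face_map r z \<in> pc_points S - C}"
    using K by (simp add: openin_open_Int open_Compl)
  qed auto
  moreover have "G = (pc_points S - C) \<inter> pc_skeleton S" using GP by (auto simp: C_def pc_points_def)
  ultimately show "openin (subtopology (presentation_complex S r) (pc_skeleton S)) G"
   by (auto simp: openin_subtopology)
 qed
qed

lemma continuous_map_face_map:
 assumes r: "r \<in> carrier (free_group S)"
 shows "continuous_map (top_of_set (cball 0 1)) (presentation_complex S r) (face_map r)"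
proof -
 have "face_map r z \<in> pc_points S" for z
  using assms word_loop_in_points[of r S]
  by (simp add: face_map_def free_group_simps) (simp add: pc_points_def)
 then show ?thesis
  using r by (auto simp: continuous_map_def topspace_presentation_complex openin_presentation_complex)
qed

lemma continuous_map_wp_pc:
 assumes "r \<in> carrier (free_group S)" "over S w"
 shows "continuous_map euclideanreal (presentation_complex S r) (wp w)"
  "continuous_map euclideanreal (subtopology (presentation_complex S r) (pc_skeleton S)) (wp w)"
proof -
 show "continuous_map euclideanreal (subtopology (presentation_complex S r) (pc_skeleton S)) (wp w)"
  unfolding graph_subtopology[OF assms(1)]
  by (rule continuous_map_wp[OF continuous_map_edge_map(1) _ assms(2)]) (simp_all add: pc_skeleton_def)
 then show "continuous_map euclideanreal (presentation_complex S r) (wp w)"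
  by (simp add: continuous_map_in_subtopology)
qed

section \<open>Filling discs\<close>

lemma standard_simplexD:
 assumes "x \<in> standard_simplex p"
 shows "0 \<le> x i" "x i \<le> 1" "p < i \<Longrightarrow> x i = 0" "(\<Sum>i\<le>p. x i) = 1"
 using assms by (auto simp: standard_simplex_def)

lemma standard_simplexI:
 assumes "\<And>i. 0 \<le> x i" "\<And>i. p < i \<Longrightarrow> x i = 0" "(\<Sum>i\<le>p. x i) = 1"
 shows "x \<in> standard_simplex p"
proof -
 have "x i \<le> 1" for i
 proof (cases "i \<le> p")
  case True
  then have "x i \<le> (\<Sum>i\<le>p. x i)" using assms(1) by (intro member_le_sum) auto
  then show ?thesis using assms(3) by simp
 next
  case False
  then show ?thesis using assms(2)[of i] by simp
 qed
 then show ?thesis using assms by (auto simp: standard_simplex_def)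
qed

text \<open>The inverse of \<open>simplical_face p\<close> on the face where the coordinate
  \<open>p\<close> vanishes.\<close>

definition drop_coord :: "nat \<Rightarrow> (nat \<Rightarrow> real) \<Rightarrow> nat \<Rightarrow> real" where
 "drop_coord p y n = (if n < p then y n else y (Suc n))"

lemma simplical_face_drop_coord: "y p = 0 \<Longrightarrow> simplical_face p (drop_coord p y) = y"
 by (rule ext) (auto simp: simplical_face_def drop_coord_def)

lemma drop_coord_simplical_face: "drop_coord p (simplical_face p y) = y"
 by (rule ext) (auto simp: simplical_face_def drop_coord_def)

lemma drop_coord_in:
 assumes "y \<in> standard_simplex (Suc q)" "y p = 0" "p \<le> Suc q"
 shows "drop_coord p y \<in> standard_simplex q"
proof (rule standard_simplexI)
 note y = standard_simplexD[OF assms(1)]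
 show "0 \<le> drop_coord p y i" for i using y by (simp add: drop_coord_def)
 show "drop_coord p y i = 0" if "q < i" for i using that y(3) assms(3) by (simp add: drop_coord_def)
 have bij: "bij_betw (\<lambda>i. if i < p then i else Suc i) {..q} ({..Suc q} - {p})"
  using assms(3) by (intro bij_betw_byWitness[where f' = "\<lambda>i. if i < p then i else i - 1"]) auto
 have "(\<Sum>i\<le>q. drop_coord p y i) = (\<Sum>i\<le>q. y (if i < p then i else Suc i))"
  by (rule sum.cong) (auto simp: drop_coord_def)
 also have "\<dots> = (\<Sum>i\<in>{..Suc q} - {p}. y i)" by (rule sum.reindex_bij_betw[OF bij])
 also have "\<dots> = 1" using y(4) assms(2,3) by (subst (asm) sum.remove[of _ p]) auto
 finally show "(\<Sum>i\<le>q. drop_coord p y i) = 1" .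
qed

lemma simplical_face_comp:
 "j < k \<Longrightarrow> simplical_face k (simplical_face j z) = simplical_face j (simplical_face (k - 1) z)"
 by (rule ext) (auto simp: simplical_face_def)

lemma singular_face_face:
 assumes "j < k" "k \<le> Suc q" "1 \<le> q"
 shows "singular_face q j (singular_face (Suc q) k f) = singular_face q (k - 1) (singular_face (Suc q) j f)"
proof (rule ext)
 fix z :: "nat \<Rightarrow> real"
 show "singular_face q j (singular_face (Suc q) k f) z = singular_face q (k - 1) (singular_face (Suc q) j f) z"
 proof (cases "z \<in> standard_simplex (q - 1)")
  case True
  have "simplical_face j z \<in> standard_simplex q" "simplical_face (k - 1) z \<in> standard_simplex q"
   using simplical_face_in_standard_simplex[of q j z] simplical_face_in_standard_simplex[of q "k - 1" z] True assms by auto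
  then show ?thesis using True simplical_face_comp[OF assms(1), of z] by (simp add: singular_face_def)
 qed (simp add: singular_face_def)
qed

text \<open>The matching condition for two faces of a horn, translated from an equation between
  edges into an equation at the points that lie on both faces. This is the form needed for
  pasting.\<close>

lemma simplices_agree:
 assumes pq: "p < q" "q \<le> 3" and eq: "singular_face 2 p g = singular_face 2 (q - 1) f"
  and y: "y \<in> standard_simplex 3" "y p = 0" "y q = 0"
 shows "f (drop_coord p y) = g (drop_coord q y)"
proof -
 define z where "z = drop_coord p (drop_coord q y)"
 have 1: "drop_coord q y \<in> standard_simplex 2" "drop_coord p y \<in> standard_simplex 2"
  using drop_coord_in[of y 2] y pq by (auto simp: numeral_eq_Suc)
 have 2: "drop_coord q y p = 0" "drop_coord p y (q - 1) = 0" using pq y by (auto simp: drop_coord_def)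
 have z': "z = drop_coord (q - 1) (drop_coord p y)" using pq by (auto simp: z_def drop_coord_def fun_eq_iff)
 have z1: "z \<in> standard_simplex 1"
  unfolding z_def using drop_coord_in[of "drop_coord q y" 1 p] 1 2 pq by (auto simp: numeral_eq_Suc)
 have "singular_face 2 p g z = g (drop_coord q y)"
  using z1 simplical_face_drop_coord[where y = "drop_coord q y" and p = p, OF 2(1)] by (simp add: singular_face_def z_def)
 moreover have "singular_face 2 (q - 1) f z = f (drop_coord p y)"
  using z1 simplical_face_drop_coord[where y = "drop_coord p y" and p = "q - 1", OF 2(2)] by (simp add: singular_face_def z')
 ultimately show ?thesis using eq by simp
qed

text \<open>The 3-simplex retracts onto its horn: subtract the minimum of the coordinates other than \<open>k\<close>
 from each of them and add it to the \<open>k\<close>-th one.\<close>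

lemma fill_horn:
 fixes f :: "nat \<Rightarrow> (nat \<Rightarrow> real) \<Rightarrow> 'x"
 assumes k: "k \<le> 3" and f: "\<And>p. p \<le> 3 \<Longrightarrow> p \<noteq> k \<Longrightarrow> singular_simplex 2 X (f p)"
  and agree: "\<And>p q. p < q \<Longrightarrow> q \<le> 3 \<Longrightarrow> p \<noteq> k \<Longrightarrow> q \<noteq> k \<Longrightarrow> singular_face 2 p (f q) = singular_face 2 (q - 1) (f p)"
 shows "\<exists>\<tau>. singular_simplex 3 X \<tau> \<and> (\<forall>p \<le> 3. p \<noteq> k \<longrightarrow> singular_face 3 p \<tau> = f p)"
proof -
 define J where "J = {..3} - {k}"
 have J: "finite J" "J \<noteq> {}" "k \<notin> J" "card J = 3" "\<And>p. p \<in> J \<longleftrightarrow> p \<le> 3 \<and> p \<noteq> k"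
 proof -
  show "card J = 3" using k by (simp add: J_def)
  then show "J \<noteq> {}" by auto
 qed (auto simp: J_def)
 define a where "a x = Min (x ` J)" for x :: "nat \<Rightarrow> real"
 define \<rho> where "\<rho> x n = (if n = k then x n + 3 * a x else if n \<le> 3 then x n - a x else 0)" for x n
 have a: "a x \<le> x p" if "p \<in> J" for x p using J that by (simp add: a_def)
 have a': "\<exists>p \<in> J. a x = x p" for x
 proof -
  have "a x \<in> x ` J" unfolding a_def using J by (intro Min_in) auto
  then show ?thesis by blast
 qed
 have \<rho>0: "\<rho> x p = x p - a x" if "p \<in> J" for x p using that by (auto simp: \<rho>_def J(5))
 have \<rho>S: "\<rho> x \<in> standard_simplex 3" if x: "x \<in> standard_simplex 3" for x
 proof (rule standard_simplexI)
  note xs = standard_simplexD[OF x]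
  have "0 \<le> a x" using a'[of x] xs(1) by auto
  then show "0 \<le> \<rho> x n" for n using a[of n x] xs(1)[of n] by (auto simp: \<rho>_def J(5))
  show "\<rho> x n = 0" if "3 < n" for n using that k by (simp add: \<rho>_def)
  have split: "(\<Sum>n\<le>3. g n) = g k + sum g J" for g :: "nat \<Rightarrow> real"
   unfolding J_def using k by (intro sum.remove) auto
  have "sum (\<rho> x) J = sum x J - 3 * a x" by (simp add: \<rho>0 sum_subtractf J(4))
  then show "(\<Sum>n\<le>3. \<rho> x n) = 1" using xs(4) unfolding split by (simp add: \<rho>_def)
 qed
 \<comment> \<open>At a point of the horn some coordinate other than \<open>k\<close> vanishes, so
   the minimum is 0 and the point stays fixed.\<close>
 have \<rho>id: "\<rho> x = x" if x: "x \<in> standard_simplex 3" "p \<in> J" "x p = 0" for x p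
 proof -
  obtain q where "a x = x q" using a'[of x] by blast
  then have "a x = 0" using a[OF x(2), of x] standard_simplexD(1)[OF x(1), of q] x(3) by linarith
  then show ?thesis using standard_simplexD(3)[OF x(1)] by (auto simp: \<rho>_def fun_eq_iff)
 qed
 define T where "T = subtopology (powertop_real UNIV) (standard_simplex 3)"
 define Z where "Z p = {y \<in> standard_simplex 3. y p = 0}" for p
 define H where "H = subtopology T (\<Union>p\<in>J. Z p)"
 have tH: "topspace H = (\<Union>p\<in>J. Z p)" by (auto simp: H_def T_def Z_def)
 have pr: "continuous_map (subtopology T A) euclideanreal (\<lambda>x. x n)" "continuous_map T euclideanreal (\<lambda>x. x n)" for n A
  unfolding T_def by (intro continuous_map_from_subtopology continuous_map_product_projection; simp)+
 have "\<exists>g. continuous_map H X g \<and> (\<forall>x p. p \<in> J \<longrightarrow> x \<in> topspace H \<inter> Z p \<longrightarrow> g x = f p (drop_coord p x))"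
 proof (rule pasting_lemma_exists_closed[of J H Z X "\<lambda>p y. f p (drop_coord p y)"])
  show "closedin H (Z p)" if "p \<in> J" for p
  proof -
   have "closedin H {x \<in> topspace H. x p \<in> {0}}"
    unfolding H_def by (rule closedin_continuous_map_preimage[where f = "\<lambda>x. x p", OF pr(1)]) simp
   moreover have "{x \<in> topspace H. x p \<in> {0}} = Z p" using that by (auto simp: tH) (auto simp: Z_def)
   ultimately show ?thesis by simp
  qed
  show "continuous_map (subtopology H (Z p)) X (\<lambda>y. f p (drop_coord p y))" if p: "p \<in> J" for p
  proof -
   have "continuous_map (subtopology H (Z p)) (subtopology (powertop_real UNIV) (standard_simplex 2)) (drop_coord p)"
    unfolding continuous_map_in_subtopology
   proof
    show "continuous_map (subtopology H (Z p)) (powertop_real UNIV) (drop_coord p)"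
     unfolding continuous_map_componentwise_UNIV H_def drop_coord_def
     using pr(1) by (auto simp: subtopology_subtopology)
    show "drop_coord p \<in> topspace (subtopology H (Z p)) \<rightarrow> standard_simplex 2"
     using drop_coord_in[of _ 2 p] p by (auto simp: Z_def J(5) numeral_eq_Suc)
   qed
   moreover have "continuous_map (subtopology (powertop_real UNIV) (standard_simplex 2)) X (f p)"
    using f p by (simp add: singular_simplex_def J(5))
   ultimately have "continuous_map (subtopology H (Z p)) X (f p \<circ> drop_coord p)" by (rule continuous_map_compose)
   then show ?thesis by (simp add: comp_def)
  qed
  fix p q x assume pq: "p \<in> J" "q \<in> J" "x \<in> topspace H \<inter> Z p \<inter> Z q"
  have *: "f p (drop_coord p x) = f q (drop_coord q x)" if "p < q" "p \<in> J" "q \<in> J" "x \<in> Z p" "x \<in> Z q" for p q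
   by (rule simplices_agree[OF that(1) _ agree]) (use that in \<open>auto simp: Z_def J(5)\<close>)
  have pq3: "x \<in> Z p" "x \<in> Z q" using pq(3) by blast+
  show "f p (drop_coord p x) = f q (drop_coord q x)"
   using *[OF _ pq(1,2) pq3] *[OF _ pq(2,1) pq3(2,1), symmetric] by (cases p q rule: linorder_cases) blast+
 qed (use J(1) tH in auto)
 then obtain g where g: "continuous_map H X g" "\<And>x p. p \<in> J \<Longrightarrow> x \<in> Z p \<Longrightarrow> g x = f p (drop_coord p x)"
  unfolding tH by blast
 have "continuous_map T euclideanreal (\<lambda>x. Min (x ` A))" if "finite A" "A \<noteq> {}" for A
  using that by (induction rule: finite_ne_induct) (simp_all add: continuous_map_real_min pr)
 then have ca: "continuous_map T euclideanreal a" unfolding a_def[abs_def] using J by blast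
 have "continuous_map T euclideanreal (\<lambda>x. \<rho> x n)" for n
  unfolding \<rho>_def
  by (cases "n = k"; cases "n \<le> 3") (auto intro!: continuous_map_add continuous_map_diff continuous_map_real_mult_left pr ca)
 then have "continuous_map T (powertop_real UNIV) \<rho>" by (simp add: continuous_map_componentwise_UNIV)
 moreover have "\<rho> x \<in> (\<Union>p\<in>J. Z p)" if x: "x \<in> standard_simplex 3" for x
  using a'[of x] \<rho>S[OF x] \<rho>0 by (force simp: Z_def)
 ultimately have "continuous_map T H \<rho>"
  using \<rho>S unfolding H_def T_def continuous_map_in_subtopology by (auto simp: T_def)
 from continuous_map_compose[OF this g(1)] have "continuous_map T X (restrict (g \<circ> \<rho>) (standard_simplex 3))"
  by (rule continuous_map_eq) (simp add: T_def)
 then have 1: "singular_simplex 3 X (restrict (g \<circ> \<rho>) (standard_simplex 3))"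
  by (simp add: singular_simplex_def T_def)
 have 2: "singular_face 3 p (restrict (g \<circ> \<rho>) (standard_simplex 3)) = f p" if p: "p \<in> J" for p
 proof (rule ext)
  fix z
  show "singular_face 3 p (restrict (g \<circ> \<rho>) (standard_simplex 3)) z = f p z"
  proof (cases "z \<in> standard_simplex 2")
   case True
   then have z: "simplical_face p z \<in> standard_simplex 3"
    using simplical_face_in_standard_simplex[of 3 p z] p by (simp add: J(5))
   moreover have z0: "simplical_face p z p = 0" by (simp add: simplical_face_def)
   ultimately show ?thesis
    using True \<rho>id[OF z p z0] g(2)[OF p, of "simplical_face p z"]
    by (simp add: singular_face_def drop_coord_simplical_face Z_def)
  next
   case False
   then show ?thesis using f p by (simp add: singular_face_def singular_simplex_def extensional_def J(5))
  qed
 qed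
 from 1 2 show ?thesis using J(5) by blast
qed

text \<open>The constant map is homotopic to the identity and sends the cycle to one in a single
  point, where cycles of positive degree bound.\<close>

lemma null_homotopic_cycle:
 assumes X: "homotopic_with (\<lambda>h. True) X X id (\<lambda>x. a)" and c: "singular_relcycle p X {} c" and p: "1 \<le> p"
 shows "singular_relboundary p X {} c"
proof (cases "topspace X = {}")
 case True
 then have "c = 0" using c by (simp add: singular_cycle singular_chain_empty)
 then show ?thesis by simp
next
 case False
 have cont: "continuous_map X X (\<lambda>x. a)" using X homotopic_with_imp_continuous_maps by blast
 then have a: "a \<in> topspace X" using False by (auto simp: continuous_map_def)
 have "homologous_rel p X {} (chain_map p id c) (chain_map p (\<lambda>x. a) c)"
  by (rule homotopic_imp_homologous_rel_chain_maps[OF _ c]) (use X in simp)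
 moreover have "chain_map p id c = c"
  using c by (intro chain_map_ident[of p X]) (simp add: singular_cycle)
 moreover have "singular_relboundary p X {} (chain_map p (\<lambda>x. a) c)"
 proof -
  have "continuous_map X (subtopology X {a}) (\<lambda>x. a)"
   using a by (simp add: continuous_map_in_subtopology)
  then have "singular_relcycle p (subtopology X {a}) {} (chain_map p (\<lambda>x. a) c)"
   by (rule singular_relcycle_chain_map[OF c]) simp
  then have "singular_relboundary p (subtopology X {a}) {} (chain_map p (\<lambda>x. a) c)"
   using singular_boundary_eq_cycle_singleton[of "subtopology X {a}" a p] a p by simp
  then show ?thesis using singular_boundary_mono[of "{a}" "topspace X" p X] a by simp
 qed
 ultimately have "singular_relboundary p X {} ((c - chain_map p (\<lambda>x. a) c) + chain_map p (\<lambda>x. a) c)"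
  unfolding homologous_rel_def by (metis singular_relboundary_add)
 then show ?thesis by simp
qed

lemma convex_null_homotopic:
 fixes C :: "'v::real_normed_vector set"
 assumes "convex C" "a \<in> C"
 shows "homotopic_with (\<lambda>h. True) (top_of_set C) (top_of_set C) id (\<lambda>x. a)"
 by (rule homotopic_with_linear) (use assms in \<open>auto simp: closed_segment_subset continuous_on_id'\<close>)

definition es :: "'s word \<Rightarrow> (nat \<Rightarrow> real) \<Rightarrow> 's pc_point" where
 "es w = restrict (\<lambda>x. wp w (x 1 * real (length w))) (standard_simplex 1)"

text \<open>An affine map from the triangle to the time axis, with the vertices at \<open>i\<close>,
  \<open>j\<close>, \<open>k\<close>, followed by the path of \<open>w\<close>. Such triangles lie
  in the 1-skeleton, so they do not change the relative class.\<close>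

definition tri :: "'s word \<Rightarrow> nat \<Rightarrow> nat \<Rightarrow> nat \<Rightarrow> (nat \<Rightarrow> real) \<Rightarrow> 's pc_point" where
 "tri w i j k = restrict (\<lambda>x. wp w (x 0 * real i + x 1 * real j + x 2 * real k)) (standard_simplex 2)"

lemma simplex1: "x \<in> standard_simplex 1 \<Longrightarrow> x 0 = 1 - x 1 \<and> 0 \<le> x 1 \<and> x 1 \<le> 1"
 using standard_simplexD[of x 1] by auto

lemma face_values:
 "simplical_face 2 x 0 = x 0" "simplical_face 2 x 1 = x 1" "simplical_face 2 x 2 = 0"
 "simplical_face 1 x 0 = x 0" "simplical_face 1 x 1 = 0" "simplical_face 1 x 2 = x 1"
 "simplical_face 0 x 0 = 0" "simplical_face 0 x 1 = x 0" "simplical_face 0 x 2 = x (1 :: nat)"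
 by (simp_all add: simplical_face_def)

lemma tri_faces:
 "singular_face 2 2 (tri w i j k) = restrict (\<lambda>x. wp w (x 0 * i + x 1 * j)) (standard_simplex 1)"
 "singular_face 2 0 (tri w i j k) = restrict (\<lambda>x. wp w (x 0 * j + x 1 * k)) (standard_simplex 1)"
 "singular_face 2 1 (tri w i j k) = restrict (\<lambda>x. wp w (x 0 * i + x 1 * k)) (standard_simplex 1)"
proof -
 have "simplical_face p x \<in> standard_simplex 2" if "p \<le> 2" "x \<in> standard_simplex 1" for p x
  using simplical_face_in_standard_simplex[of 2 p x] that by simp
 then show "singular_face 2 2 (tri w i j k) = restrict (\<lambda>x. wp w (x 0 * i + x 1 * j)) (standard_simplex 1)"
  "singular_face 2 0 (tri w i j k) = restrict (\<lambda>x. wp w (x 0 * j + x 1 * k)) (standard_simplex 1)"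
  "singular_face 2 1 (tri w i j k) = restrict (\<lambda>x. wp w (x 0 * i + x 1 * k)) (standard_simplex 1)"
  by (auto simp: singular_face_def tri_def face_values[unfolded One_nat_def] fun_eq_iff)
qed

lemma tri_pos_faces:
 defines "d \<equiv> \<lambda>u v. tri (u @ v) 0 (length u) (length u + length v)"
 shows "singular_face 2 2 (d u v) = es u" "singular_face 2 0 (d u v) = es v" "singular_face 2 1 (d u v) = es (u @ v)"
proof -
 have m: "x * real n \<le> real n" if "x \<le> 1" for x :: real and n using that mult_right_mono[of x 1 "real n"] by simp
 show "singular_face 2 2 (d u v) = es u"
  unfolding d_def tri_faces es_def using simplex1 m by (auto simp: fun_eq_iff wp_append1)
 show "singular_face 2 0 (d u v) = es v"
 proof (rule ext)
  fix x
  show "singular_face 2 0 (d u v) x = es v x"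
  proof (cases "x \<in> standard_simplex 1")
   case True
   note x = simplex1[OF True]
   have "x 0 * length u + x 1 * (length u + length v) = length u + x 1 * length v"
   proof -
    have e: "x 0 = 1 - x 1" using x by simp
    show ?thesis unfolding e by (simp add: algebra_simps)
   qed
   then show ?thesis
    unfolding d_def tri_faces es_def using True x wp_append2[of "x 1 * length v" u v] by simp
  qed (simp add: d_def tri_faces es_def)
 qed
 show "singular_face 2 1 (d u v) = es (u @ v)"
  unfolding d_def tri_faces es_def by (auto simp: fun_eq_iff)
qed

text \<open>The second vertex is the latest in time, so the edge from it to the third runs backwards
  along \<open>winv x\<close> and is the simplex of \<open>x\<close> itself. This lets both
  directions of \<open>x\<close> share one edge simplex.\<close>

lemma tri_neg_faces:
 defines "d \<equiv> \<lambda>q x. tri (q @ winv x) 0 (length q + length x) (length q)"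
 shows "singular_face 2 2 (d q x) = es (q @ winv x)" "singular_face 2 0 (d q x) = es x" "singular_face 2 1 (d q x) = es q"
proof -
 have m: "x * real n \<le> real n" if "x \<le> 1" for x :: real and n using that mult_right_mono[of x 1 "real n"] by simp
 show "singular_face 2 2 (d q x) = es (q @ winv x)"
  unfolding d_def tri_faces es_def by (auto simp: fun_eq_iff)
 show "singular_face 2 1 (d q x) = es q"
  unfolding d_def tri_faces es_def using simplex1 m by (auto simp: fun_eq_iff wp_append1)
 show "singular_face 2 0 (d q x) = es x"
 proof (rule ext)
  fix z
  show "singular_face 2 0 (d q x) z = es x z"
  proof (cases "z \<in> standard_simplex 1")
   case True
   note z = simplex1[OF True]
   have e: "z 0 * (length q + length x) + z 1 * length q = length q + z 0 * length x"
   proof -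
    have e: "z 0 = 1 - z 1" using z by simp
    show ?thesis unfolding e by (simp add: algebra_simps)
   qed
   have "wp (q @ winv x) (length q + z 0 * length x) = wp x (real (length x) - z 0 * length x)"
    using wp_append2[of "z 0 * length x" q "winv x"] z by (simp add: wp_winv)
   also have "real (length x) - z 0 * length x = z 1 * length x"
   proof -
    have e: "z 0 = 1 - z 1" using z by simp
    show ?thesis unfolding e by (simp add: algebra_simps)
   qed
   finally show ?thesis
    unfolding d_def tri_faces es_def using True e by simp
  qed (simp add: d_def tri_faces es_def)
 qed
qed

text \<open>A singular disc for the relation x y = z together with its degree over the 2-cell. A
  single 2-simplex is required, so that a relation costs one simplex however many relators it
  contains.\<close>

definition fills :: "'s set \<Rightarrow> 's word \<Rightarrow> 's word \<Rightarrow> 's word \<Rightarrow> 's word \<Rightarrow> int \<Rightarrow> bool" where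
 "fills S r x y z n \<longleftrightarrow> (\<exists>d. singular_simplex 2 (presentation_complex S r) d \<and>
   singular_face 2 2 d = es x \<and> singular_face 2 0 d = es y \<and> singular_face 2 1 d = es z \<and>
   homologous_rel 2 (presentation_complex S r) (pc_skeleton S) (frag_of d) (frag_cmul n (frag_of (face_simplex r))))"

lemma coordinate_continuous: "continuous_map (subtopology (powertop_real UNIV) (standard_simplex p)) euclideanreal (\<lambda>x. x n)"
 by (intro continuous_map_from_subtopology continuous_map_product_projection) simp

lemma tri_simplex:
 assumes "r \<in> carrier (free_group S)" "over S w"
 shows "singular_simplex 2 (subtopology (presentation_complex S r) (pc_skeleton S)) (tri w i j k)"
proof -
 have "continuous_map (subtopology (powertop_real UNIV) (standard_simplex 2)) euclideanreal
   (\<lambda>x. x 0 * real i + x 1 * real j + x 2 * real k)"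
  by (intro continuous_map_add continuous_map_real_mult_right coordinate_continuous)
 from continuous_map_compose[OF this continuous_map_wp_pc(2)[OF assms]]
 have "continuous_map (subtopology (powertop_real UNIV) (standard_simplex 2))
   (subtopology (presentation_complex S r) (pc_skeleton S)) (tri w i j k)"
  by (rule continuous_map_eq) (simp add: tri_def)
 then show ?thesis by (simp add: singular_simplex_def tri_def)
qed

lemma skeleton_homologous:
 assumes "singular_simplex 2 (subtopology (presentation_complex S r) (pc_skeleton S)) d"
 shows "homologous_rel 2 (presentation_complex S r) (pc_skeleton S) (frag_of d) 0"
 unfolding homologous_rel_def using assms by (simp add: singular_chain_imp_relboundary singular_chain_of)

lemma fills_tri:
 assumes r: "r \<in> carrier (free_group S)" and w: "over S w"
  and f: "singular_face 2 2 (tri w i j k) = es x" "singular_face 2 0 (tri w i j k) = es y" "singular_face 2 1 (tri w i j k) = es z"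
 shows "fills S r x y z 0"
 unfolding fills_def using tri_simplex[OF r w] skeleton_homologous[OF tri_simplex[OF r w]] f
 by (intro exI[of _ "tri w i j k"]) (auto simp: singular_simplex_subtopology)

lemma fills_append:
 assumes "r \<in> carrier (free_group S)" "over S u" "over S v"
 shows "fills S r u v (u @ v) 0"
 by (rule fills_tri[OF assms(1) _ tri_pos_faces]) (use assms in auto)

lemma fills_winv:
 assumes "r \<in> carrier (free_group S)" "over S u"
 shows "fills S r u (winv u) [] 0"
 using fills_tri[OF assms(1) _ tri_neg_faces, of "[]" "winv u"] assms by simp

lemma boundary_2: "chain_boundary 2 (frag_of f) = frag_of (singular_face 2 0 f) - frag_of (singular_face 2 1 f) + frag_of (singular_face 2 2 f)"
 by (simp add: chain_boundary_of numeral_2_eq_2)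

lemma boundary_3: "chain_boundary 3 (frag_of f) = frag_of (singular_face 3 0 f) - frag_of (singular_face 3 1 f)
  + frag_of (singular_face 3 2 f) - frag_of (singular_face 3 3 f)"
 by (simp add: chain_boundary_of numeral_3_eq_3 numeral_2_eq_2)

lemma boundary_3_homologous:
 assumes "singular_simplex 3 X f"
 shows "homologous_rel 2 X A (frag_of (singular_face 3 0 f) + frag_of (singular_face 3 2 f))
   (frag_of (singular_face 3 1 f) + frag_of (singular_face 3 3 f))"
proof -
 have "singular_relboundary 2 X A (chain_boundary 3 (frag_of f))"
  unfolding singular_relboundary_def using assms
  by (intro exI[of _ "frag_of f"]) (simp add: singular_chain_of numeral_3_eq_3)
 then show ?thesis unfolding homologous_rel_def boundary_3 by (simp add: algebra_simps)
qed

text \<open>The indices are the vertices of a tetrahedron with edges \<open>x01\<close> to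
  \<open>x23\<close>. The given triangles are the faces opposite to the vertices 0, 2 and 3; filling
  the horn yields the face opposite to 1, and the boundary of the tetrahedron yields its
  degree.\<close>

lemma fills_023:
 assumes "fills S r x12 x23 x13 n0" "fills S r x01 x13 x03 n2" "fills S r x01 x12 x02 n3"
 shows "fills S r x02 x23 x03 (n0 + n2 - n3)"
proof -
 let ?P = "presentation_complex S r" and ?F = "frag_of (face_simplex r)"
 let ?h = "homologous_rel 2 ?P (pc_skeleton S)"
 obtain f0 where f0: "singular_simplex 2 ?P f0" "singular_face 2 2 f0 = es x12" "singular_face 2 0 f0 = es x23"
  "singular_face 2 1 f0 = es x13" "?h (frag_of f0) (frag_cmul n0 ?F)" using assms(1) by (auto simp: fills_def)
 obtain f2 where f2: "singular_simplex 2 ?P f2" "singular_face 2 2 f2 = es x01" "singular_face 2 0 f2 = es x13"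
  "singular_face 2 1 f2 = es x03" "?h (frag_of f2) (frag_cmul n2 ?F)" using assms(2) by (auto simp: fills_def)
 obtain f3 where f3: "singular_simplex 2 ?P f3" "singular_face 2 2 f3 = es x01" "singular_face 2 0 f3 = es x12"
  "singular_face 2 1 f3 = es x02" "?h (frag_of f3) (frag_cmul n3 ?F)" using assms(3) by (auto simp: fills_def)
 have "\<exists>\<tau>. singular_simplex 3 ?P \<tau> \<and> (\<forall>p \<le> 3. p \<noteq> 1 \<longrightarrow> singular_face 3 p \<tau> = (if p = 0 then f0 else if p = 2 then f2 else f3))"
 proof (rule fill_horn)
  show "singular_face 2 p' (if q' = 0 then f0 else if q' = 2 then f2 else f3) =
   singular_face 2 (q' - 1) (if p' = 0 then f0 else if p' = 2 then f2 else f3)"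
   if "p' < q'" "q' \<le> 3" "p' \<noteq> 1" "q' \<noteq> 1" for p' q' :: nat
  proof -
   have "p' = 0 \<and> q' = 2 \<or> p' = 0 \<and> q' = 3 \<or> p' = 2 \<and> q' = 3" using that by linarith
   then show ?thesis using f0 f2 f3 by auto
  qed
 qed (use f0 f2 f3 in simp_all)
 then obtain \<tau> where \<tau>: "singular_simplex 3 ?P \<tau>" "singular_face 3 0 \<tau> = f0" "singular_face 3 2 \<tau> = f2" "singular_face 3 3 \<tau> = f3"
  by auto
 define f1 where "f1 = singular_face 3 1 \<tau>"
 note sf = singular_face_face[where q = 2 and f = \<tau>, simplified]
 have "?h (frag_of f0 + frag_of f2) (frag_of f1 + frag_of f3)"
  using boundary_3_homologous[OF \<tau>(1)] \<tau> by (simp add: f1_def)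
 then have "?h (frag_of f1 + frag_of f3) (frag_of f0 + frag_of f2)" by (simp add: homologous_rel_sym)
 then have "?h (frag_of f1 + frag_of f3) (frag_cmul n0 ?F + frag_cmul n2 ?F)"
  using homologous_rel_trans[OF homologous_rel_add[OF f0(5) f2(5)]] by blast
 from homologous_rel_diff[OF this f3(5)]
 have "?h (frag_of f1) (frag_cmul (n0 + n2 - n3) ?F)"
  by (simp add: frag_cmul_distrib frag_cmul_diff_distrib)
 moreover have "singular_simplex 2 ?P f1"
  unfolding f1_def using singular_simplex_singular_face[OF \<tau>(1), of 1] by simp
 moreover have "singular_face 2 2 f1 = es x02"
  using sf[of 1 3] \<tau> f3 by (simp add: f1_def)
 moreover have "singular_face 2 1 f1 = es x03"
  using sf[of 1 2] \<tau> f2 by (simp add: f1_def)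
 moreover have "singular_face 2 0 f1 = es x23"
  using sf[of 0 1] \<tau> f0 by (simp add: f1_def)
 ultimately show ?thesis unfolding fills_def by blast
qed

lemma fills_013:
 assumes "fills S r x12 x23 x13 n0" "fills S r x02 x23 x03 n1" "fills S r x01 x12 x02 n3"
 shows "fills S r x01 x13 x03 (n1 + n3 - n0)"
proof -
 let ?P = "presentation_complex S r" and ?F = "frag_of (face_simplex r)"
 let ?h = "homologous_rel 2 ?P (pc_skeleton S)"
 obtain f0 where f0: "singular_simplex 2 ?P f0" "singular_face 2 2 f0 = es x12" "singular_face 2 0 f0 = es x23"
  "singular_face 2 1 f0 = es x13" "?h (frag_of f0) (frag_cmul n0 ?F)" using assms(1) by (auto simp: fills_def)
 obtain f1 where f1: "singular_simplex 2 ?P f1" "singular_face 2 2 f1 = es x02" "singular_face 2 0 f1 = es x23"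
  "singular_face 2 1 f1 = es x03" "?h (frag_of f1) (frag_cmul n1 ?F)" using assms(2) by (auto simp: fills_def)
 obtain f3 where f3: "singular_simplex 2 ?P f3" "singular_face 2 2 f3 = es x01" "singular_face 2 0 f3 = es x12"
  "singular_face 2 1 f3 = es x02" "?h (frag_of f3) (frag_cmul n3 ?F)" using assms(3) by (auto simp: fills_def)
 have "\<exists>\<tau>. singular_simplex 3 ?P \<tau> \<and> (\<forall>p \<le> 3. p \<noteq> 2 \<longrightarrow> singular_face 3 p \<tau> = (if p = 0 then f0 else if p = 1 then f1 else f3))"
 proof (rule fill_horn)
  show "singular_face 2 p' (if q' = 0 then f0 else if q' = 1 then f1 else f3) =
   singular_face 2 (q' - 1) (if p' = 0 then f0 else if p' = 1 then f1 else f3)"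
   if "p' < q'" "q' \<le> 3" "p' \<noteq> 2" "q' \<noteq> 2" for p' q' :: nat
  proof -
   have "p' = 0 \<and> q' = 1 \<or> p' = 0 \<and> q' = 3 \<or> p' = 1 \<and> q' = 3" using that by linarith
   then show ?thesis using f0 f1 f3 by auto
  qed
 qed (use f0 f1 f3 in simp_all)
 then obtain \<tau> where \<tau>: "singular_simplex 3 ?P \<tau>" "singular_face 3 0 \<tau> = f0" "singular_face 3 1 \<tau> = f1" "singular_face 3 3 \<tau> = f3"
  by auto
 define f2 where "f2 = singular_face 3 2 \<tau>"
 note sf = singular_face_face[where q = 2 and f = \<tau>, simplified]
 have "?h (frag_of f0 + frag_of f2) (frag_of f1 + frag_of f3)"
  using boundary_3_homologous[OF \<tau>(1)] \<tau> by (simp add: f2_def)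
 then have "?h (frag_of f0 + frag_of f2) (frag_cmul n1 ?F + frag_cmul n3 ?F)"
  using homologous_rel_trans[OF homologous_rel_add[OF f1(5) f3(5)]] by blast
 from homologous_rel_diff[OF this f0(5)]
 have "?h (frag_of f2) (frag_cmul (n1 + n3 - n0) ?F)"
  by (simp add: frag_cmul_distrib frag_cmul_diff_distrib)
 moreover have "singular_simplex 2 ?P f2"
  unfolding f2_def using singular_simplex_singular_face[OF \<tau>(1), of 2] by simp
 moreover have "singular_face 2 2 f2 = es x01"
  using sf[of 2 3] \<tau> f3 by (simp add: f2_def)
 moreover have "singular_face 2 1 f2 = es x03"
  using sf[of 1 2] \<tau> f1 by (simp add: f2_def)
 moreover have "singular_face 2 0 f2 = es x13"
  using sf[of 0 2] \<tau> f0 by (simp add: f2_def)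
 ultimately show ?thesis unfolding fills_def by blast
qed

section \<open>Two parametrisations of the disc by a triangle\<close>

definition unit_path :: "(real \<Rightarrow> 'v) \<Rightarrow> (nat \<Rightarrow> real) \<Rightarrow> 'v" where
 "unit_path g = restrict (\<lambda>x. g (x 1)) (standard_simplex 1)"

lemma unit_path_simplex:
 assumes "continuous_on {0..1} g" "g ` {0..1} \<subseteq> C"
 shows "singular_simplex 1 (top_of_set C) (unit_path g)"
proof -
 have "continuous_map (subtopology (powertop_real UNIV) (standard_simplex 1)) (top_of_set {0..1}) (\<lambda>x. x 1)"
  unfolding continuous_map_in_subtopology
 proof
  show "(\<lambda>x. x 1) \<in> topspace (subtopology (powertop_real UNIV) (standard_simplex 1)) \<rightarrow> {0..1::real}"
  proof
   fix x assume "x \<in> topspace (subtopology (powertop_real UNIV) (standard_simplex 1))"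
   then have "x \<in> standard_simplex 1" by simp
   then have "x 0 = 1 - x 1 \<and> 0 \<le> x 1 \<and> x 1 \<le> 1" by (rule simplex1)
   then show "x 1 \<in> {0..1}" by simp
  qed
 qed (rule coordinate_continuous)
 moreover have "continuous_map (top_of_set {0..1}) (top_of_set C) g"
  using assms by (auto simp: continuous_map_in_subtopology)
 ultimately have "continuous_map (subtopology (powertop_real UNIV) (standard_simplex 1)) (top_of_set C) (g \<circ> (\<lambda>x. x 1))"
  by (rule continuous_map_compose)
 then have "continuous_map (subtopology (powertop_real UNIV) (standard_simplex 1)) (top_of_set C) (unit_path g)"
  by (rule continuous_map_eq) (simp add: unit_path_def)
 then show ?thesis by (simp add: singular_simplex_def unit_path_def)
qed

definition point0 :: "'v \<Rightarrow> (nat \<Rightarrow> real) \<Rightarrow> 'v" where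
 "point0 v = restrict (\<lambda>x. v) (standard_simplex 0)"

lemma unit_path_boundary: "chain_boundary 1 (frag_of (unit_path g)) = frag_of (point0 (g 1)) - frag_of (point0 (g 0))"
proof -
 have e: "x \<in> standard_simplex 0 \<Longrightarrow> x = (\<lambda>j. if j = 0 then 1 else 0)" for x by (simp add: standard_simplex_0)
 have "simplical_face 0 x \<in> standard_simplex 1" "simplical_face 1 x \<in> standard_simplex 1"
  "simplical_face 0 x 1 = 1" "simplical_face 1 x 1 = 0" if "x \<in> standard_simplex 0" for x
  using that simplical_face_in_standard_simplex[of 1 0 x] simplical_face_in_standard_simplex[of 1 1 x] e[OF that]
  by (auto simp: simplical_face_def)
 then have "singular_face 1 0 (unit_path g) = point0 (g 1)" "singular_face 1 1 (unit_path g) = point0 (g 0)"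
  by (auto simp: singular_face_def unit_path_def point0_def fun_eq_iff)
 then show ?thesis by (simp add: chain_boundary_of)
qed

lemma chain_map_unit_path: "chain_map 1 h (frag_of (unit_path g)) = frag_of (unit_path (h \<circ> g))"
 by (simp add: simplex_map_def unit_path_def) (auto intro!: arg_cong[of _ _ frag_of])

definition root3 :: complex where "root3 = cis (2 * pi / 3)"

lemma root3: "Re root3 = - 1 / 2" "Im root3 = sqrt 3 / 2" "root3 * root3 = cis (4 * pi / 3)" "root3 * root3 * root3 = 1"
proof -
 show "Re root3 = - 1 / 2" "Im root3 = sqrt 3 / 2" by (simp_all add: root3_def cos_120 sin_120)
 show 1: "root3 * root3 = cis (4 * pi / 3)" by (simp add: root3_def cis_mult field_simps)
 have "4 * pi / 3 + 2 * pi / 3 = 2 * pi" by simp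
 then show "root3 * root3 * root3 = 1" unfolding 1 by (simp add: root3_def cis_mult complex_eq_iff)
qed

text \<open>The angle along the side from 1 to \<open>root3\<close> of the inscribed triangle.
  Together with its translates it lifts the boundary of \<open>simplex_to_disk\<close> from the
  circle to the real line.\<close>

definition edge_angle :: "real \<Rightarrow> real" where
 "edge_angle t = Arg (complex_of_real (1 - t) + complex_of_real t * root3)"

lemma edge_angle:
 assumes "0 \<le> t" "t \<le> 1"
 shows "sgn (complex_of_real (1 - t) + complex_of_real t * root3) = cis (edge_angle t)"
  and "complex_of_real (1 - t) + complex_of_real t * root3 \<notin> \<real>\<^sub>\<le>\<^sub>0"
proof -
 let ?z = "complex_of_real (1 - t) + complex_of_real t * root3"
 show n: "?z \<notin> \<real>\<^sub>\<le>\<^sub>0"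
 proof
  assume "?z \<in> \<real>\<^sub>\<le>\<^sub>0"
  then have "Im ?z = 0" "Re ?z \<le> 0" by (simp_all add: complex_nonpos_Reals_iff)
  then have "t = 0" "1 - t - t / 2 \<le> 0" by (simp_all add: root3)
  then show False by simp
 qed
 then have "?z \<noteq> 0" by auto
 then show "sgn ?z = cis (edge_angle t)" unfolding edge_angle_def by (simp add: cis_Arg)
qed

lemma edge_angle_ends: "edge_angle 0 = 0" "edge_angle 1 = 2 * pi / 3"
proof -
 show "edge_angle 0 = 0" by (simp add: edge_angle_def)
 have "Arg root3 = 2 * pi / 3" unfolding root3_def
  by (rule Arg_cis) (use pi_gt_zero in auto)
 then show "edge_angle 1 = 2 * pi / 3" by (simp add: edge_angle_def)
qed

lemma continuous_edge_angle: "continuous_on {0..1} edge_angle"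
 unfolding edge_angle_def
proof (rule continuous_on_compose2[of "- \<real>\<^sub>\<le>\<^sub>0" Arg])
 show "continuous_on (- \<real>\<^sub>\<le>\<^sub>0) Arg"
  by (rule continuous_at_imp_continuous_on) (simp add: continuous_at_Arg)
 show "continuous_on {0..1} (\<lambda>t. complex_of_real (1 - t) + complex_of_real t * root3)"
  by (intro continuous_intros)
 show "(\<lambda>t. complex_of_real (1 - t) + complex_of_real t * root3) ` {0..1} \<subseteq> - \<real>\<^sub>\<le>\<^sub>0"
  using edge_angle(2) by auto
qed

text \<open>The convex combination of the point 1 with a loop around the circle: the side opposite
  to vertex 2 runs once around, and the other two sides are constantly 1. This is the boundary that
  \<open>fills\<close> expects for a closed word.\<close>

definition cone_disk :: "(nat \<Rightarrow> real) \<Rightarrow> complex" where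
 "cone_disk x = complex_of_real (x 2) + complex_of_real (x 0 + x 1) * cis (2 * pi * (x 1 / (x 0 + x 1)))"

definition sD :: "(nat \<Rightarrow> real) \<Rightarrow> complex" where "sD = restrict simplex_to_disk (standard_simplex 2)"
definition kD :: "(nat \<Rightarrow> real) \<Rightarrow> complex" where "kD = restrict cone_disk (standard_simplex 2)"

lemma simplex2: "x \<in> standard_simplex 2 \<Longrightarrow> x 0 + x 1 + x 2 = 1 \<and> 0 \<le> x 0 \<and> 0 \<le> x 1 \<and> 0 \<le> x 2"
 using standard_simplexD[of x 2] by (auto simp: numeral_2_eq_2)

lemma continuous_map_of_real: "continuous_map X euclideanreal f \<Longrightarrow> continuous_map X euclidean (\<lambda>x. complex_of_real (f x))"
proof -
 assume "continuous_map X euclideanreal f"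
 moreover have "continuous_map euclideanreal euclidean complex_of_real"
  by (simp add: continuous_on_of_real)
 ultimately have "continuous_map X euclidean (complex_of_real \<circ> f)" by (rule continuous_map_compose)
 then show ?thesis by (simp add: comp_def)
qed

lemma kD_simplex: "singular_simplex 2 (top_of_set (cball 0 1)) kD"
proof -
 define T where "T = subtopology (powertop_real UNIV) (standard_simplex 2)"
 have c: "continuous_map T euclideanreal (\<lambda>x. x n)" for n unfolding T_def by (rule coordinate_continuous)
 \<comment> \<open>The quotient is undefined only where \<open>u + v\<close> is 0, at the vertex 2;
   there the factor \<open>u + v\<close> enforces continuity.\<close>
 define f where "f = (\<lambda>(u, v). complex_of_real (u + v) * cis (2 * pi * (v / (u + v))) :: complex)"
 define Q where "Q = {p :: real \<times> real. 0 \<le> fst p \<and> 0 \<le> snd p}"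
 have "continuous_on Q f"
  unfolding continuous_on_eq_continuous_within
 proof
  fix p assume p: "p \<in> Q"
  show "continuous (at p within Q) f"
  proof (cases "fst p + snd p = 0")
   case False
   then have "isCont (\<lambda>p. complex_of_real (fst p + snd p) * cis (2 * pi * (snd p / (fst p + snd p)))) p"
    unfolding isCont_def by (intro tendsto_intros) (use False in auto)
   then show ?thesis unfolding f_def case_prod_beta by (rule continuous_at_imp_continuous_at_within)
  next
   case True
   have e0: "complex_of_real (fst p + snd p) = 0" unfolding True by simp
   have f0: "f p = 0" unfolding f_def case_prod_beta e0 by simp
   have "((\<lambda>p. complex_of_real (fst p + snd p)) \<longlongrightarrow> complex_of_real (fst p + snd p)) (at p within Q)"
    by (intro tendsto_intros)
   then have "((\<lambda>p. complex_of_real (fst p + snd p)) \<longlongrightarrow> 0) (at p within Q)" unfolding e0 .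
   then have "((\<lambda>p. norm (complex_of_real (fst p + snd p))) \<longlongrightarrow> 0) (at p within Q)"
    by (simp only: tendsto_norm_zero_iff)
   then have "(f \<longlongrightarrow> 0) (at p within Q)"
    by (rule Lim_null_comparison[rotated]) (simp add: f_def case_prod_beta norm_mult)
   then show ?thesis using f0 by (simp add: continuous_within)
  qed
 qed
 then have "continuous_map (top_of_set Q) euclidean f" by simp
 moreover have "continuous_map T (top_of_set Q) (\<lambda>x. (x 0, x 1))"
  unfolding continuous_map_in_subtopology
  using simplex2 continuous_map_pairedI[OF c[of 0] c[of 1], unfolded euclidean_product_topology] by (auto simp: T_def Q_def)
 ultimately have "continuous_map T euclidean (f \<circ> (\<lambda>x. (x 0, x 1)))" by (rule continuous_map_compose[rotated])
 then have "continuous_map T euclidean cone_disk"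
  unfolding cone_disk_def[abs_def] f_def comp_def
  by (intro continuous_map_add continuous_map_of_real c) simp
 moreover have "norm (cone_disk x) \<le> 1" if "x \<in> standard_simplex 2" for x
 proof -
  note x = simplex2[OF that]
  have "norm (cone_disk x) \<le> norm (complex_of_real (x 2)) + norm (complex_of_real (x 0 + x 1) * cis (2 * pi * (x 1 / (x 0 + x 1))))"
   unfolding cone_disk_def by (rule norm_triangle_ineq)
  also have "\<dots> = 1" using x by (simp add: norm_mult del: of_real_add)
  finally show ?thesis .
 qed
 ultimately have "continuous_map T (top_of_set (cball 0 1)) cone_disk"
  by (auto simp: continuous_map_in_subtopology T_def)
 then have "continuous_map T (top_of_set (cball 0 1)) kD"
  by (rule continuous_map_eq) (simp add: kD_def T_def)
 then show ?thesis by (simp add: singular_simplex_def kD_def T_def)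
qed

lemma kD_faces:
 "singular_face 2 2 kD = unit_path (cis \<circ> (\<lambda>t. 2 * pi * t))"
 "singular_face 2 0 kD = unit_path (cis \<circ> (\<lambda>t. 0))"
 "singular_face 2 1 kD = unit_path (cis \<circ> (\<lambda>t. 0))"
proof -
 have in2: "simplical_face p x \<in> standard_simplex 2" if "p \<le> 2" "x \<in> standard_simplex 1" for p x
  using simplical_face_in_standard_simplex[of 2 p x] that by simp
 have "cone_disk (simplical_face 2 x) = cis (2 * pi * x 1)" if "x \<in> standard_simplex 1" for x
 proof -
  have "x 0 + x 1 = 1" using simplex1[OF that] by simp
  then show ?thesis by (simp add: cone_disk_def face_values[unfolded One_nat_def] del: of_real_add)
 qed
 then show "singular_face 2 2 kD = unit_path (cis \<circ> (\<lambda>t. 2 * pi * t))"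
  using in2 by (auto simp: singular_face_def kD_def unit_path_def fun_eq_iff)
 have "cone_disk (simplical_face 0 x) = 1" if "x \<in> standard_simplex 1" for x
 proof (cases "x 0 = 0")
  case False
  then show ?thesis using simplex1[OF that] by (simp add: cone_disk_def face_values[unfolded One_nat_def] del: of_real_diff flip: of_real_add)
 next
  case True
  then show ?thesis using simplex1[OF that] by (simp add: cone_disk_def face_values[unfolded One_nat_def])
 qed
 then show "singular_face 2 0 kD = unit_path (cis \<circ> (\<lambda>t. 0))"
  using in2 by (auto simp: singular_face_def kD_def unit_path_def fun_eq_iff)
 have "cone_disk (simplical_face 1 x) = 1" if "x \<in> standard_simplex 1" for x
  using simplex1[OF that] by (simp add: cone_disk_def face_values[unfolded One_nat_def] flip: of_real_add)
 then show "singular_face 2 1 kD = unit_path (cis \<circ> (\<lambda>t. 0))"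
  using in2 by (auto simp: singular_face_def kD_def unit_path_def fun_eq_iff)
qed

lemma simplex_to_disk_sum:
 "(\<Sum>j\<le>2. x j *\<^sub>R cis (2 * pi * real j / 3)) = complex_of_real (x 0) + complex_of_real (x 1) * root3 + complex_of_real (x 2) * (root3 * root3)"
 unfolding root3(3) by (simp add: numeral_2_eq_2 scaleR_conv_of_real root3_def)

lemma sgn_mult_norm1: "norm (u :: complex) = 1 \<Longrightarrow> sgn (u * z) = u * sgn z"
 by (simp add: sgn_mult) (simp add: sgn_div_norm)

lemma sD_faces:
 "singular_face 2 2 sD = unit_path (cis \<circ> edge_angle)"
 "singular_face 2 0 sD = unit_path (cis \<circ> (\<lambda>t. 2 * pi / 3 + edge_angle t))"
 "singular_face 2 1 sD = unit_path (cis \<circ> (\<lambda>t. 4 * pi / 3 + edge_angle (1 - t)))"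
proof -
 have in2: "simplical_face p x \<in> standard_simplex 2" if "p \<le> 2" "x \<in> standard_simplex 1" for p x
  using simplical_face_in_standard_simplex[of 2 p x] that by simp
 have n: "norm root3 = 1" by (simp add: root3_def)
 have A: "simplex_to_disk (simplical_face 2 x) = cis (edge_angle (x 1))" if "x \<in> standard_simplex 1" for x
  using simplex1[OF that] edge_angle(1)[of "x 1"] unfolding simplex_to_disk_def simplex_to_disk_sum
  by (simp add: face_values[unfolded One_nat_def])
 have B: "simplex_to_disk (simplical_face 0 x) = cis (2 * pi / 3 + edge_angle (x 1))" if "x \<in> standard_simplex 1" for x
 proof -
  have "complex_of_real (x 0) * root3 + complex_of_real (x 1) * (root3 * root3) = root3 * (complex_of_real (1 - x 1) + complex_of_real (x 1) * root3)"
  proof -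
   have e: "x 0 = 1 - x 1" using simplex1[OF that] by simp
   show ?thesis unfolding e by (simp add: algebra_simps)
  qed
  then show ?thesis
   using simplex1[OF that] edge_angle(1)[of "x 1"] sgn_mult_norm1[OF n] unfolding simplex_to_disk_def simplex_to_disk_sum
   by (simp add: face_values[unfolded One_nat_def] cis_mult[symmetric] root3_def[symmetric])
 qed
 have C: "simplex_to_disk (simplical_face 1 x) = cis (4 * pi / 3 + edge_angle (1 - x 1))" if "x \<in> standard_simplex 1" for x
 proof -
  have "(root3 * root3) * (complex_of_real (1 - (1 - x 1)) + complex_of_real (1 - x 1) * root3) =
    complex_of_real (x 1) * (root3 * root3) + complex_of_real (1 - x 1) * (root3 * root3 * root3)"
   by (simp add: algebra_simps)
  then have e: "complex_of_real (x 0) + complex_of_real (x 1) * (root3 * root3) =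
    (root3 * root3) * (complex_of_real (1 - (1 - x 1)) + complex_of_real (1 - x 1) * root3)"
  proof -
   have e: "x 0 = 1 - x 1" using simplex1[OF that] by simp
   assume h: "(root3 * root3) * (complex_of_real (1 - (1 - x 1)) + complex_of_real (1 - x 1) * root3) =
    complex_of_real (x 1) * (root3 * root3) + complex_of_real (1 - x 1) * (root3 * root3 * root3)"
   show ?thesis unfolding h unfolding e root3(4) by simp
  qed
  have "norm (root3 * root3) = 1" using n by (simp add: norm_mult)
  then show ?thesis
   using simplex1[OF that] edge_angle(1)[of "1 - x 1"] sgn_mult_norm1[of "root3 * root3"] e unfolding simplex_to_disk_def simplex_to_disk_sum
   by (simp add: face_values[unfolded One_nat_def] cis_mult[symmetric] root3(3)[symmetric])
 qed
 show "singular_face 2 2 sD = unit_path (cis \<circ> edge_angle)"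
  "singular_face 2 0 sD = unit_path (cis \<circ> (\<lambda>t. 2 * pi / 3 + edge_angle t))"
  "singular_face 2 1 sD = unit_path (cis \<circ> (\<lambda>t. 4 * pi / 3 + edge_angle (1 - t)))"
  using in2 A B C by (auto simp: singular_face_def sD_def unit_path_def fun_eq_iff)
qed

lemma sD_simplex: "singular_simplex 2 (top_of_set (cball 0 1)) sD"
proof -
 define T where "T = subtopology (powertop_real UNIV) (standard_simplex 2)"
 have c: "continuous_map T euclideanreal (\<lambda>x. x n)" for n unfolding T_def by (rule coordinate_continuous)
 define z where "z x = complex_of_real (x 0) + complex_of_real (x 1) * root3 + complex_of_real (x 2) * (root3 * root3)" for x :: "nat \<Rightarrow> real"
 define \<mu> where "\<mu> x = 1 - 3 * min (x 0) (min (x 1) (x 2))" for x :: "nat \<Rightarrow> real"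
 have std: "simplex_to_disk x = \<mu> x *\<^sub>R sgn (z x)" for x
  unfolding simplex_to_disk_def simplex_to_disk_sum by (simp add: \<mu>_def z_def)
 have cz: "continuous_map T euclidean z"
 proof -
  have *: "continuous_map T euclidean (\<lambda>x. complex_of_real (x n) * q)" for n q
  proof -
   have "continuous_map euclidean euclidean (\<lambda>w::complex. w * q)" by (simp add: continuous_intros)
   from continuous_map_compose[OF continuous_map_of_real[OF c] this] show ?thesis by (simp add: comp_def)
  qed
  show ?thesis unfolding z_def[abs_def] by (intro continuous_map_add continuous_map_of_real c *)
 qed
 have c\<mu>: "continuous_map T euclideanreal \<mu>"
  unfolding \<mu>_def[abs_def] by (intro continuous_map_diff continuous_map_real_mult_left continuous_map_real_min c) simp
 define f where "f = (\<lambda>(s :: real, w :: complex). s *\<^sub>R sgn w)"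
 \<comment> \<open>The direction \<open>sgn w\<close> is discontinuous only at 0, the image of the
   barycentre. On \<open>Q\<close> the radius tends to 0 there, so the product is
   continuous.\<close>
 define Q where "Q = {p :: real \<times> complex. \<bar>fst p\<bar> \<le> 4 * norm (snd p)}"
 have "continuous_on Q f"
  unfolding continuous_on_eq_continuous_within
 proof
  fix p assume p: "p \<in> Q"
  show "continuous (at p within Q) f"
  proof (cases "snd p = 0")
   case False
   then have "isCont (\<lambda>p. fst p *\<^sub>R sgn (snd p)) p"
    by (intro continuous_intros) auto
   then show ?thesis unfolding f_def case_prod_beta by (rule continuous_at_imp_continuous_at_within)
  next
   case True
   then have f0: "f p = 0" by (simp add: f_def case_prod_beta)
   have "fst p = 0" using True p by (simp add: Q_def)
   have "((\<lambda>p. fst p) \<longlongrightarrow> fst p) (at p within Q)" by (intro tendsto_intros)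
   then have "((\<lambda>p. norm (fst p)) \<longlongrightarrow> 0) (at p within Q)"
    using \<open>fst p = 0\<close> by (simp only: tendsto_norm_zero_iff)
   then have "(f \<longlongrightarrow> 0) (at p within Q)"
    by (rule Lim_null_comparison[rotated]) (simp add: f_def case_prod_beta norm_sgn)
   then show ?thesis using f0 by (simp add: continuous_within)
  qed
 qed
 then have "continuous_map (top_of_set Q) euclidean f" by simp
 moreover have bound: "0 \<le> \<mu> x \<and> \<mu> x \<le> 1 \<and> \<mu> x \<le> 4 * norm (z x)" if "x \<in> standard_simplex 2" for x
 proof -
  note x = simplex2[OF that]
  have im: "\<bar>Im (z x)\<bar> = sqrt 3 / 2 * \<bar>x 1 - x 2\<bar>"
  proof -
   have "Im (z x) = sqrt 3 / 2 * (x 1 - x 2)" by (simp add: z_def root3(1,2) algebra_simps)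
   then show ?thesis by (simp only: abs_mult) simp
  qed
  have re: "Re (z x) = x 0 - x 1 / 2 - x 2 / 2"
   by (simp add: z_def root3(1,2) algebra_simps)
  have n1: "\<bar>Re (z x)\<bar> \<le> norm (z x)" "\<bar>Im (z x)\<bar> \<le> norm (z x)" by (rule abs_Re_le_cmod, rule abs_Im_le_cmod)
  have "sqrt 3 / 2 \<ge> (1 / 2 :: real)" by (simp add: real_le_rsqrt)
  then have "1 / 2 * \<bar>x 1 - x 2\<bar> \<le> \<bar>Im (z x)\<bar>" unfolding im by (rule mult_right_mono) simp
  moreover have "A \<le> 2 * N" if "1 / 2 * A \<le> I" "I \<le> N" for A I N :: real using that by simp
  ultimately have "\<bar>x 1 - x 2\<bar> \<le> 2 * norm (z x)" using n1(2) by blast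
  moreover have "\<bar>x 0 - x 1 / 2 - x 2 / 2\<bar> \<le> norm (z x)" using n1 re by simp
  ultimately show ?thesis using x by (auto simp: \<mu>_def min_def abs_if split: if_splits)
 qed
 have "continuous_map T (top_of_set Q) (\<lambda>x. (\<mu> x, z x))"
  unfolding continuous_map_in_subtopology
  using bound continuous_map_pairedI[OF c\<mu> cz, unfolded euclidean_product_topology] by (auto simp: T_def Q_def)
 ultimately have "continuous_map T euclidean (f \<circ> (\<lambda>x. (\<mu> x, z x)))" using continuous_map_compose by blast
 then have "continuous_map T euclidean simplex_to_disk" by (simp add: f_def comp_def std[abs_def])
 moreover have "norm (simplex_to_disk x) \<le> 1" if "x \<in> standard_simplex 2" for x
  using bound[OF that] by (simp add: std norm_sgn)
 ultimately have "continuous_map T (top_of_set (cball 0 1)) simplex_to_disk"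
  by (auto simp: continuous_map_in_subtopology T_def)
 then have "continuous_map T (top_of_set (cball 0 1)) sD"
  by (rule continuous_map_eq) (simp add: sD_def T_def)
 then show ?thesis by (simp add: singular_simplex_def sD_def T_def)
qed

text \<open>Both boundaries lift to chains in the real line from 0 to 2 pi. The difference
  \<open>c\<close> of the lifts is a cycle and bounds in the line, and the image \<open>y'\<close>
  of a bounding chain lies in the circle. Corrected by \<open>y'\<close>, the difference of the two
  simplices is a cycle in the disc, which is contractible.\<close>

lemma disk_homologous: "homologous_rel 2 (top_of_set (cball 0 1)) (sphere 0 1) (frag_of kD) (frag_of sD)"
proof -
 let ?D = "top_of_set (cball (0 :: complex) 1)"
 define e :: "real \<Rightarrow> real" where "e = edge_angle"
 define g0 g1 where "g0 = (\<lambda>t. 2 * pi / 3 + e t)" and "g1 = (\<lambda>t. 4 * pi / 3 + e (1 - t))"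
 define l where "l = (\<lambda>t. 2 * pi * t)"
 define c where "c = frag_of (unit_path l) - (frag_of (unit_path g0) - frag_of (unit_path g1) + frag_of (unit_path e))"
 have ce: "continuous_on {0..1} e" unfolding e_def by (rule continuous_edge_angle)
 have ce': "continuous_on {0..1} (\<lambda>t. e (1 - t))"
  by (rule continuous_on_compose2[OF ce]) (auto intro!: continuous_intros)
 have "singular_simplex 1 (top_of_set UNIV) (unit_path h)" if "continuous_on {0..1} h" for h :: "real \<Rightarrow> real"
  using that by (rule unit_path_simplex) simp
 then have s: "singular_simplex 1 (top_of_set UNIV) (unit_path l)" "singular_simplex 1 (top_of_set UNIV) (unit_path g0)"
  "singular_simplex 1 (top_of_set UNIV) (unit_path g1)" "singular_simplex 1 (top_of_set UNIV) (unit_path e)"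
  by (simp_all add: l_def g0_def g1_def continuous_on_add ce ce' continuous_on_mult_left)
 have "chain_boundary 1 c = 0"
  by (simp add: c_def chain_boundary_diff chain_boundary_add unit_path_boundary[unfolded One_nat_def] g0_def g1_def e_def l_def edge_angle_ends)
 then have "singular_relcycle 1 (top_of_set UNIV) {} c"
  unfolding singular_cycle c_def using s by (auto intro!: singular_chain_diff singular_chain_add simp: singular_chain_of)
 then have "singular_relboundary 1 (top_of_set (UNIV :: real set)) {} c"
  by (rule null_homotopic_cycle[OF convex_null_homotopic[OF convex_UNIV UNIV_I]]) simp
 then obtain y where y: "singular_chain 2 (top_of_set (UNIV :: real set)) y" "chain_boundary 2 y = c"
  by (auto simp: singular_boundary numeral_2_eq_2)
 define y' where "y' = chain_map 2 cis y"
 have cis: "continuous_map (top_of_set UNIV) (subtopology ?D (sphere 0 1)) cis"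
  by (auto simp: continuous_map_in_subtopology subtopology_subtopology intro: continuous_intros)
 have y'1: "singular_chain 2 (subtopology ?D (sphere 0 1)) y'"
  unfolding y'_def by (rule singular_chain_chain_map[OF y(1) cis])
 have "chain_boundary 2 y' = chain_map 1 cis c"
  unfolding y'_def using chain_boundary_chain_map[OF y(1), of cis] y(2) by simp
 also have "\<dots> = chain_boundary 2 (frag_of kD - frag_of sD)"
  unfolding c_def chain_map_diff chain_map_add chain_map_unit_path chain_boundary_diff boundary_2 kD_faces sD_faces
  by (simp add: g0_def g1_def l_def e_def)
 finally have by': "chain_boundary 2 y' = chain_boundary 2 (frag_of kD - frag_of sD)" .
 have "singular_chain 2 ?D y'" using y'1 by (simp add: singular_chain_subtopology)
 then have "singular_relcycle 2 ?D {} (frag_of kD - frag_of sD - y')"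
  unfolding singular_cycle using kD_simplex sD_simplex by'
  by (auto intro!: singular_chain_diff simp: singular_chain_of chain_boundary_diff)
 then have "singular_relboundary 2 ?D {} (frag_of kD - frag_of sD - y')"
  by (rule null_homotopic_cycle[OF convex_null_homotopic[OF convex_cball centre_in_cball[THEN iffD2]], rotated]) simp_all
 then obtain d where d: "singular_chain (Suc 2) ?D d" "chain_boundary (Suc 2) d = frag_of kD - frag_of sD - y'"
  by (auto simp: singular_boundary)
 show ?thesis
  unfolding homologous_rel_def singular_relboundary using d y'1 by (intro exI[of _ d] exI[of _ y']) simp
qed

lemma fills_relator:
 assumes r: "r \<in> carrier (free_group S)"
 shows "fills S r r [] [] 1"
proof -
 let ?P = "presentation_complex S r"
 let ?D = "top_of_set (cball (0 :: complex) 1)"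
 define d where "d = simplex_map 2 (face_map r) kD"
 have rS: "over S r" using r by (simp add: free_group_simps)
 have cf: "continuous_map ?D ?P (face_map r)" by (rule continuous_map_face_map[OF r])
 have 1: "singular_simplex 2 ?P d" unfolding d_def by (rule singular_simplex_simplex_map[OF kD_simplex cf])
 note fm = face_map_cis
 have fd: "singular_face 2 k d = simplex_map 1 (face_map r) (singular_face 2 k kD)" if "k \<le> 2" for k
  unfolding d_def using simplical_face_in_standard_simplex[of 2 k] that
  by (auto simp: simplex_map_def singular_face_def fun_eq_iff)
 have c: "simplex_map 1 (face_map r) (unit_path (cis \<circ> (\<lambda>t. 0))) = es []"
  using fm[of 0 r] by (auto simp: simplex_map_def unit_path_def es_def wp_outside fun_eq_iff)
 from 1 have "singular_simplex 2 ?P d" .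
 moreover have "singular_face 2 2 d = es r"
  unfolding fd[OF order_refl] kD_faces using fm simplex1 by (auto simp: simplex_map_def unit_path_def es_def fun_eq_iff)
 moreover have "singular_face 2 0 d = es []" "singular_face 2 1 d = es []"
  using fd[of 0] fd[of 1] c by (simp_all add: kD_faces[unfolded One_nat_def])
 moreover have "homologous_rel 2 ?P (pc_skeleton S) (frag_of d) (frag_cmul 1 (frag_of (face_simplex r)))"
 proof -
  have "singular_relboundary 2 ?P (pc_skeleton S) (chain_map 2 (face_map r) (frag_of kD - frag_of sD))"
  proof (rule singular_relboundary_chain_map[OF disk_homologous[unfolded homologous_rel_def] cf])
   show "face_map r \<in> sphere 0 1 \<rightarrow> pc_skeleton S"
    using wp_skeleton[OF rS] by (auto simp: face_map_def word_loop_wp)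
  qed
  moreover have "simplex_map 2 (face_map r) sD = face_simplex r"
   by (auto simp: simplex_map_def sD_def face_simplex_def fun_eq_iff)
  ultimately show ?thesis
   by (simp add: homologous_rel_def chain_map_diff d_def)
 qed
 ultimately show ?thesis unfolding fills_def by blast
qed

section \<open>Discs for products of conjugates of the relator\<close>

context
 fixes S :: "'s set" and r :: "'s word"
 assumes r: "r \<in> carrier (free_group S)"
begin

lemma fills_const: "fills S r [] [] [] 0"
 using fills_append[OF r, of "[]" "[]"] by simp

lemma fills_right: "over S u \<Longrightarrow> fills S r u [] u 0"
 using fills_append[OF r, of u "[]"] by simp

lemma fills_left: "over S u \<Longrightarrow> fills S r [] u u 0"
 using fills_append[OF r, of "[]" u] by simp

text \<open>\<open>fills S r u [] [] n\<close> means that the loop \<open>u\<close> bounds a disc of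
  degree \<open>n\<close>, and below \<open>fills S r y [] z 0\<close> serves as a homotopy of
  degree 0 between \<open>y\<close> and \<open>z\<close>. All rules are horn fillings with suitable
  constant edges.\<close>

lemma fills_mult: "fills S r u [] [] n \<Longrightarrow> fills S r v [] [] k \<Longrightarrow> over S u \<Longrightarrow> over S v \<Longrightarrow> fills S r (u @ v) [] [] (n + k)"
 using fills_023[of S r v "[]" "[]" k u "[]" n "u @ v" 0] fills_append[OF r, of u v] by (simp add: add.commute)

lemma fills_inverse: "fills S r u [] [] n \<Longrightarrow> over S u \<Longrightarrow> fills S r (winv u) [] [] (- n)"
 using fills_013[of S r u "[]" "[]" n "[]" "[]" 0 "winv u" 0] fills_winv[OF r, of "winv u"] fills_const
 by (simp add: set_winv)

lemma fills_conj:
 assumes u: "fills S r u [] [] n" "over S u" "over S p"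
 shows "fills S r (p @ u @ winv p) [] [] n"
proof -
 have w: "over S (winv p)" using u by (simp add: set_winv)
 have 1: "fills S r (p @ u) [] p n"
  using fills_023[OF u(1) fills_right[OF u(3)] fills_append[OF r u(3,2)]] by simp
 have 2: "fills S r (p @ u) (winv p) [] n"
  using fills_013[OF fills_left[OF w] fills_winv[OF r u(3)] 1] by simp
 have "over S (p @ u)" using u by auto
 then show ?thesis
  using fills_023[OF fills_right[OF w] 2 fills_append[OF r _ w, of "p @ u"]] by simp
qed

lemma fills_sym: "fills S r y [] z 0 \<Longrightarrow> over S y \<Longrightarrow> fills S r z [] y 0"
 using fills_023[OF fills_const fills_right, of y z 0] by simp

lemma fills_trans: "fills S r y [] z 0 \<Longrightarrow> fills S r z [] u n \<Longrightarrow> fills S r y [] u n"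
 using fills_013[OF fills_const, of z u n y 0] by simp

lemma fills_cong_left: "fills S r y [] z 0 \<Longrightarrow> over S p \<Longrightarrow> over S y \<Longrightarrow> over S z \<Longrightarrow> fills S r (p @ y) [] (p @ z) 0"
 using fills_023[OF _ fills_append[OF r, of p z] fills_append[OF r, of p y], of "[]" 0] by simp

lemma fills_cong_right:
 assumes "fills S r y [] z 0" "over S q" "over S y" "over S z"
 shows "fills S r (y @ q) [] (z @ q) 0"
proof -
 have "fills S r y q (z @ q) 0"
  using fills_013[OF fills_left[OF assms(2)] fills_append[OF r assms(4,2)] assms(1)] by simp
 then show ?thesis
  using fills_023[OF fills_right[OF assms(2)] _ fills_append[OF r assms(3,2)]] by simp
qed

lemma fills_wval: "over S w \<Longrightarrow> fills S r w [] (wval w) 0"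
proof (induction w)
 case (Cons x w)
 have w: "over S w" "over S [x]" "over S (wval w)" using Cons.prems set_wval[of w S] by auto
 have 1: "fills S r (x # w) [] (x # wval w) 0"
  using fills_cong_left[OF Cons.IH, of "[x]"] w by simp
 have "fills S r (x # wval w) [] (cons_cancel x (wval w)) 0"
 proof (cases "wval w \<noteq> [] \<and> hd (wval w) = inv_letter x")
  case True
  then obtain v where v: "wval w = inv_letter x # v" by (cases "wval w") auto
  have o: "over S [inv_letter x]" "over S v" using w by (auto simp: v)
  have i: "winv [x] = [inv_letter x]" by (simp add: winv_def)
  have "fills S r ([x] @ [inv_letter x]) [] [] 0"
   using fills_023[OF fills_right[OF o(1)] _ fills_append[OF r w(2) o(1)]] fills_winv[OF r w(2)] by (simp add: i)
  then have "fills S r (([x] @ [inv_letter x]) @ v) [] ([] @ v) 0"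
   by (rule fills_cong_right) (use o w in auto)
  then show ?thesis using v by (simp add: cons_cancel_def)
 next
  case False
  then have "cons_cancel x (wval w) = x # wval w" unfolding cons_cancel_def by (rule if_not_P)
  then show ?thesis using fills_right[of "x # wval w"] w by simp
 qed
 then show ?case using fills_trans[OF 1] by (simp add: wval_def)
qed (use fills_const in simp)

text \<open>The conjugates are filled one by one, after letters outside of \<open>S\<close> are
  deleted from the conjugators. The result is carried over to \<open>w\<close> along free
  reductions, which have degree 0.\<close>

lemma fills_rel:
 assumes rel: "rel r n w" and w: "over S w"
 shows "fills S r w [] [] n"
proof -
 let ?f = "filter (\<lambda>l. fst l \<in> S)"
 obtain qs where qs: "wval w = wval (concat (map (conj_word r) qs))" "n = degree qs"
  using rel by (auto simp: rel_def)
 have rS: "over S r" "?f r = r" using r by (auto simp: free_group_simps filter_id_conv)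
 have ov: "over S (?f u)" for u by auto
 have *: "fills S r (?f (concat (map (conj_word r) qs))) [] [] (degree qs)" for qs
 proof (induction qs)
  case (Cons q qs)
  have s: "fills S r (if snd q then r else winv r) [] [] (if snd q then 1 else -1)" "over S (if snd q then r else winv r)"
   using fills_relator[OF r] fills_inverse[OF fills_relator[OF r] rS(1)] rS(1) by (auto simp: set_winv)
  have e: "?f (conj_word r q) = ?f (fst q) @ (if snd q then r else winv r) @ winv (?f (fst q))"
   by (simp add: conj_word_def filter_winv rS)
  have "fills S r (?f (conj_word r q)) [] [] (if snd q then 1 else -1)"
   unfolding e by (rule fills_conj[OF s ov])
  then have "fills S r (?f (conj_word r q) @ ?f (concat (map (conj_word r) qs))) [] [] ((if snd q then 1 else -1) + degree qs)"
   by (rule fills_mult[OF _ Cons ov ov])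
  then show ?case by (simp add: degree_def)
 qed (simp add: degree_def fills_const)
 have fw: "?f w = w" using w by (auto simp: filter_id_conv)
 let ?v = "?f (concat (map (conj_word r) qs))"
 have "wval w = wval ?v"
  using wval_filter[of S w] wval_filter[of S "concat (map (conj_word r) qs)"] qs(1) fw by simp
 moreover have "fills S r (wval ?v) [] ?v 0" by (rule fills_sym[OF fills_wval[OF ov] ov])
 ultimately have "fills S r w [] ?v 0" using fills_trans[OF fills_wval[OF w]] by simp
 then show ?thesis using fills_trans[OF _ *[of qs]] qs(2) by simp
qed

end

section \<open>The second homology of the 1-skeleton\<close>

definition acyclic_at :: "nat \<Rightarrow> 'v topology \<Rightarrow> bool" where
 "acyclic_at p X \<longleftrightarrow> (\<forall>c. singular_relcycle p X {} c \<longrightarrow> singular_relboundary p X {} c)"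

text \<open>A fragment of the Mayer-Vietoris sequence, derived from excision: modulo
  \<open>A\<close> the cycle may be replaced by a chain \<open>c'\<close> in \<open>B\<close>. The
  boundary of \<open>c'\<close> lies in the intersection and bounds a chain \<open>y\<close> there,
  so \<open>c' - y\<close> is a cycle in \<open>B\<close>.\<close>

lemma acyclic_at_union:
 assumes o: "openin X A" "openin X B" "topspace X = A \<union> B"
  and a: "acyclic_at (Suc p) (subtopology X A)" "acyclic_at (Suc p) (subtopology X B)" "acyclic_at p (subtopology X (A \<inter> B))"
 shows "acyclic_at (Suc p) X"
 unfolding acyclic_at_def
proof (intro allI impI)
 fix c assume c: "singular_relcycle (Suc p) X {} c"
 define U where "U = topspace X - B"
 have U: "topspace X - U = B" "A - U = A \<inter> B" using o(3) by (auto simp: U_def)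
 have "closedin X U" unfolding U_def using o(2) by blast
 then have cl: "X closure_of U \<subseteq> X interior_of A" using o by (auto simp: closure_of_closedin interior_of_openin U_def)
 have ct: "singular_relcycle (Suc p) (subtopology X (topspace X)) A c"
  using c[unfolded singular_cycle] unfolding singular_relcycle by simp
 have "A \<subseteq> topspace X" using o(3) by blast
 from excised_relcycle_exists[OF cl this ct]
 obtain c' where c': "singular_relcycle (Suc p) (subtopology X B) (A \<inter> B) c'" and h: "homologous_rel (Suc p) X A c c'"
  unfolding U by (metis subtopology_topspace)
 have b: "subtopology (subtopology X B) (A \<inter> B) = subtopology X (A \<inter> B)"
  by (simp add: subtopology_subtopology Int_absorb1 Int_ac)
 have "singular_relcycle p (subtopology X (A \<inter> B)) {} (chain_boundary (Suc p) c')"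
  unfolding singular_cycle using c'[unfolded singular_relcycle] b chain_boundary_boundary_alt[of p "subtopology X B" c'] by simp
 then obtain y where y: "singular_chain (Suc p) (subtopology X (A \<inter> B)) y" "chain_boundary (Suc p) y = chain_boundary (Suc p) c'"
  using a(3) by (auto simp: acyclic_at_def singular_boundary)
 have "singular_chain (Suc p) (subtopology X B) y" by (rule singular_chain_mono[OF y(1)]) simp
 then have "singular_relcycle (Suc p) (subtopology X B) {} (c' - y)"
  unfolding singular_cycle using c'[unfolded singular_relcycle] y(2) by (simp add: chain_boundary_diff singular_chain_diff)
 then obtain e where e: "singular_chain (Suc (Suc p)) (subtopology X B) e" "chain_boundary (Suc (Suc p)) e = c' - y"
  using a(2) by (auto simp: acyclic_at_def singular_boundary)
 obtain d w where d: "singular_chain (Suc (Suc p)) X d" "singular_chain (Suc p) (subtopology X A) w"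
   "chain_boundary (Suc (Suc p)) d = c - c' + w"
  using h unfolding homologous_rel_def singular_relboundary_alt by blast
 have eX: "singular_chain (Suc (Suc p)) X e" using e(1) by (simp add: singular_chain_subtopology)
 \<comment> \<open>Up to boundaries the given cycle has been moved into \<open>A\<close>.\<close>
 have eq: "c = chain_boundary (Suc (Suc p)) (d + e) + (y - w)"
  unfolding chain_boundary_add d(3) e(2) by simp
 have "singular_chain (Suc p) (subtopology X A) y" by (rule singular_chain_mono[OF y(1)]) simp
 moreover have "chain_boundary (Suc p) (y - w) = 0"
 proof -
  have "chain_boundary (Suc p) c = 0" using c by (simp add: singular_cycle)
  moreover have "chain_boundary (Suc p) (chain_boundary (Suc (Suc p)) (d + e)) = 0"
   using d(1) eX by (intro chain_boundary_boundary_alt singular_chain_add)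
  ultimately show ?thesis using arg_cong[OF eq, of "chain_boundary (Suc p)"] by (simp add: chain_boundary_add)
 qed
 ultimately have "singular_relcycle (Suc p) (subtopology X A) {} (y - w)"
  using d(2) by (simp add: singular_cycle singular_chain_diff)
 then obtain f where f: "singular_chain (Suc (Suc p)) (subtopology X A) f" "chain_boundary (Suc (Suc p)) f = y - w"
  using a(1) by (auto simp: acyclic_at_def singular_boundary)
 have "singular_chain (Suc (Suc p)) X f" using f(1) by (simp add: singular_chain_subtopology)
 then show "singular_relboundary (Suc p) X {} c"
  unfolding singular_boundary using d(1) eX f(2) eq
  by (intro exI[of _ "d + e + f"]) (simp add: singular_chain_add chain_boundary_add)
qed

lemma acyclic_at_disjoint_union:
 assumes o: "openin X A" "openin X B" "A \<inter> B = {}"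
  and a: "acyclic_at (Suc p) (subtopology X A)" "acyclic_at (Suc p) (subtopology X B)"
 shows "acyclic_at (Suc p) (subtopology X (A \<union> B))"
proof (rule acyclic_at_union[of _ A B])
 show "openin (subtopology X (A \<union> B)) A" "openin (subtopology X (A \<union> B)) B"
  using o by (auto simp: openin_open_subtopology openin_Un)
 show "topspace (subtopology X (A \<union> B)) = A \<union> B" using o openin_subset by auto
 show "acyclic_at p (subtopology (subtopology X (A \<union> B)) (A \<inter> B))"
  unfolding o(3) acyclic_at_def by (auto simp: singular_cycle singular_chain_empty)
qed (use a in \<open>auto simp: subtopology_subtopology Int_absorb1\<close>)

text \<open>The identity of \<open>X\<close> factors through \<open>Y\<close>, hence so does the
  identity of its homology.\<close>

lemma acyclic_at_retract:
 assumes k: "continuous_map X Y k" and g: "continuous_map Y X g" and gk: "\<And>x. x \<in> topspace X \<Longrightarrow> g (k x) = x"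
  and Y: "acyclic_at p Y"
 shows "acyclic_at p X"
 unfolding acyclic_at_def
proof (intro allI impI)
 fix c assume c: "singular_relcycle p X {} c"
 have "singular_relcycle p Y {} (chain_map p k c)" by (rule singular_relcycle_chain_map[OF c k]) simp
 then have "singular_relboundary p Y {} (chain_map p k c)" using Y by (simp add: acyclic_at_def)
 from singular_relboundary_chain_map[OF this g]
 have "singular_relboundary p X {} (chain_map p (g \<circ> k) c)" by (simp add: chain_map_compose)
 moreover have "chain_map p (g \<circ> k) c = c"
  by (rule chain_map_id_gen[of p X]) (use c gk in \<open>auto simp: singular_cycle\<close>)
 ultimately show "singular_relboundary p X {} c" by simp
qed

lemma openin_open_edge:
 assumes "s \<in> S" "open J" "J \<subseteq> {0<..<1}"
 shows "openin (graph_topology S) (Edge s ` J)"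
 unfolding openin_graph_topology
proof (intro conjI ballI)
 show "Edge s ` J \<subseteq> pc_skeleton S" using assms by (auto simp: pc_skeleton_def)
 fix s' assume "s' \<in> S"
 have "{t \<in> {0..1}. edge_map s' t \<in> Edge s ` J} = {0..1} \<inter> (if s' = s then J else {})"
  using assms(3) by (auto simp: edge_map_def)
 then show "openin (top_of_set {0..1}) {t \<in> {0..1}. edge_map s' t \<in> Edge s ` J}"
  using assms(2) by (auto simp: openin_open)
qed

lemma acyclic_at_open_edge:
 assumes s: "s \<in> S" and J: "convex J" "J \<subseteq> {0<..<1}" "J \<noteq> {}" and p: "1 \<le> p"
 shows "acyclic_at p (subtopology (graph_topology S) (Edge s ` J))"
proof -
 let ?E = "subtopology (graph_topology S) (Edge s ` J)"
 define k where "k x = (case x of Edge s t \<Rightarrow> t | _ \<Rightarrow> 0)" for x :: "'a pc_point"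
 obtain t0 where t0: "t0 \<in> J" using J(3) by blast
 have ts: "topspace ?E = Edge s ` J" using s J(2) by (auto simp: pc_skeleton_def)
 have "continuous_map ?E euclideanreal k"
  unfolding continuous_map_def
 proof (intro conjI allI impI)
  fix W assume "openin euclideanreal W"
  then have W: "open W" by simp
  then have "openin (graph_topology S) (Edge s ` (W \<inter> {0<..<1}))" by (intro openin_open_edge[OF s]) auto
  moreover have "{x \<in> topspace ?E. k x \<in> W} = Edge s ` (W \<inter> {0<..<1}) \<inter> (Edge s ` J)"
   unfolding ts using J(2) by (auto simp: k_def)
  ultimately show "openin ?E {x \<in> topspace ?E. k x \<in> W}" unfolding openin_subtopology by blast
 qed simp
 then have k: "continuous_map ?E (top_of_set J) k"
  unfolding continuous_map_in_subtopology ts by (auto simp: k_def)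
 have "continuous_map (subtopology (top_of_set {0..1}) J) (graph_topology S) (edge_map s)"
  by (rule continuous_map_from_subtopology[OF continuous_map_edge_map(1)[OF s]])
 moreover have "subtopology (top_of_set {0..1}) J = top_of_set J"
  using J(2) by (auto simp: subtopology_subtopology intro!: arg_cong[of _ _ top_of_set])
 ultimately have g: "continuous_map (top_of_set J) ?E (edge_map s)"
  using J(2) by (auto simp: continuous_map_in_subtopology edge_map_def)
 show ?thesis
 proof (rule acyclic_at_retract[OF k g])
  show "edge_map s (k x) = x" if "x \<in> topspace ?E" for x
   using that J(2) unfolding ts by (auto simp: k_def edge_map_def)
  show "acyclic_at p (top_of_set J)"
   unfolding acyclic_at_def using null_homotopic_cycle[OF convex_null_homotopic[OF J(1) t0]] p by blast
 qed
qed

text \<open>The star of the vertex is identified with the cross \<open>{(x, y). x * y = 0}\<close> in the plane.\<close>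

lemma acyclic_at_vertex_star:
 assumes ab: "a \<noteq> b" and p: "1 \<le> p"
 shows "acyclic_at p (subtopology (graph_topology {a, b}) (pc_skeleton {a, b} - {Edge a (1/2), Edge b (1/2)}))"
proof -
 let ?G = "graph_topology {a, b}" and ?V = "pc_skeleton {a, b} - {Edge a (1/2), Edge b (1/2)}"
 let ?T = "subtopology ?G ?V"
 define Y :: "(real \<times> real) set" where "Y = {(x, y). x * y = 0 \<and> \<bar>x\<bar> < 1/2 \<and> \<bar>y\<bar> < 1/2}"
 \<comment> \<open>The second half of each loop is placed on the negative half of its axis.\<close>
 define q where "q t = (if t < 1/2 then t else t - 1)" for t :: real
 define k where "k z = (case z of Edge s t \<Rightarrow> if s = a then (q t, 0) else (0, q t) | _ \<Rightarrow> (0, 0))" for z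
 \<comment> \<open>The loop is run through twice and parametrised around time 1, where it passes
   through the vertex. So \<open>arm s\<close> is continuous at 0, with the end of the loop on the
   negative side and its beginning on the positive side.\<close>
 define arm where "arm s x = wp [(s, True), (s, True)] (1 + x)" for s :: 'a and x
 define g where "g = (\<lambda>z. if \<bar>snd z\<bar> \<le> \<bar>fst z\<bar> then arm a (fst z) else arm b (snd z))"
 have ts: "topspace ?T = ?V" by auto
 have arm: "arm s x = (if 0 < x then Edge s x else if x < 0 then Edge s (1 + x) else Vertex)" if "\<bar>x\<bar> < 1/2" for s x
  using that by (auto simp: arm_def wp_Cons letter_path_def edge_map_def)
 have k: "continuous_map ?T (top_of_set Y) k"
  unfolding continuous_map_in_subtopology
 proof
  show "k \<in> topspace ?T \<rightarrow> Y" unfolding ts using ab by (auto simp: k_def Y_def pc_skeleton_def q_def split: if_splits)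
  show "continuous_map ?T euclidean k"
   unfolding continuous_map_def
  proof (intro conjI allI impI)
   fix W :: "(real \<times> real) set" assume "openin euclidean W"
   then have W: "open W" by simp
   have cq: "continuous_on ({0..1} - {1/2}) q"
   proof -
    have "continuous_on ({0..<1/2} \<union> {1/2<..1}) q"
     unfolding q_def
    proof (rule continuous_on_cases_local_open)
     show "openin (top_of_set ({0..<1/2} \<union> {1/2<..1})) {0..<(1::real)/2}"
      unfolding openin_open by (intro exI[of _ "{..<1/2}"]) auto
     show "openin (top_of_set ({0..<1/2} \<union> {1/2<..1})) {(1::real)/2<..1}"
      unfolding openin_open by (intro exI[of _ "{1/2<..}"]) auto
    qed (auto intro!: continuous_intros)
    moreover have "{0..1} - {1/2} = {0..<1/2} \<union> {(1::real)/2<..1}" by auto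
    ultimately show ?thesis by simp
   qed
   have "openin ?G {x \<in> ?V. k x \<in> W}"
    unfolding openin_graph_topology
   proof (intro conjI ballI)
    fix s assume s: "s \<in> {a, b}"
    define f where "f t = (if s = a then (q t, 0) else (0, q t))" for t
    have "continuous_on ({0..1} - {1/2}) f"
     unfolding f_def by (cases "s = a") (auto intro!: continuous_intros cq)
    then obtain U where U: "open U" "f -` W \<inter> ({0..1} - {1/2}) = U \<inter> ({0..1} - {1/2})"
     using continuous_on_open_invariant[of "{0..1} - {1/2}" f] W by metis
    have "{t \<in> {0..1}. edge_map s t \<in> {x \<in> ?V. k x \<in> W}} = f -` W \<inter> ({0..1} - {1/2})"
    proof -
     have h1: "edge_map s t \<in> ?V \<longleftrightarrow> t \<noteq> 1/2" for t
      using s by (cases "0 < t \<and> t < 1") (auto simp: edge_map_def pc_skeleton_def)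
     have h2: "k (edge_map s t) = f t" if "0 \<le> t" "t \<le> 1" for t
     proof (cases "0 < t \<and> t < 1")
      case True
      then have "edge_map s t = Edge s t" by (simp add: edge_map_def)
      then show ?thesis by (simp add: k_def f_def)
     next
      case False
      then have "t = 0 \<or> t = 1" using that by linarith
      then have "edge_map s t = Vertex" "q t = 0" by (auto simp: edge_map_def q_def)
      then show ?thesis by (simp add: k_def f_def)
     qed
     have "{t \<in> I. e t \<in> {x \<in> U. h x \<in> O'}} = g -` O' \<inter> (I - {v})"
      if "\<And>t. e t \<in> U \<longleftrightarrow> t \<noteq> v" "\<And>t. t \<in> I \<Longrightarrow> h (e t) = g t"
      for e :: "real \<Rightarrow> 'a pc_point" and U h g I v and O' :: "(real \<times> real) set"
     proof (rule Set.set_eqI)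
      fix t
      show "t \<in> {t \<in> I. e t \<in> {x \<in> U. h x \<in> O'}} \<longleftrightarrow> t \<in> g -` O' \<inter> (I - {v})"
       using that(1)[of t] that(2)[of t] by (cases "t \<in> I"; cases "t = v") simp_all
     qed
     note * = this[of "edge_map s" ?V "1/2" "{0..1}" k f W]
     show ?thesis
     proof (rule *)
      show "edge_map s t \<in> ?V \<longleftrightarrow> t \<noteq> 1/2" for t by (rule h1)
      show "k (edge_map s t) = f t" if "t \<in> {0..1}" for t using h2[of t] that by simp
     qed
    qed
    also have "\<dots> = {0..1} \<inter> (U \<inter> - {1/2})" unfolding U(2) by auto
    finally have eq: "{t \<in> {0..1}. edge_map s t \<in> {x \<in> ?V. k x \<in> W}} = {0..1} \<inter> (U \<inter> - {1/2})" .
    show "openin (top_of_set {0..1}) {t \<in> {0..1}. edge_map s t \<in> {x \<in> ?V. k x \<in> W}}"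
     unfolding eq by (intro openin_open_Int open_Int U(1) open_Compl) simp
   qed auto
   moreover have "{x \<in> topspace ?T. k x \<in> W} = {x \<in> ?V. k x \<in> W} \<inter> ?V" unfolding ts by auto
   ultimately show "openin ?T {x \<in> topspace ?T. k x \<in> W}" unfolding openin_subtopology by blast
  qed simp
 qed
 have cs: "continuous_on X (\<lambda>z :: real \<times> real. \<bar>fst z\<bar>)" "continuous_on X (\<lambda>z :: real \<times> real. \<bar>snd z\<bar>)" for X
  by (intro continuous_intros)+
 have carm: "continuous_map euclideanreal ?G (arm s)" if "s \<in> {a, b}" for s
 proof -
  have "continuous_map euclideanreal ?G (wp [(s, True), (s, True)])"
  proof (rule continuous_map_wp[of "{a, b}"])
   show "continuous_map (top_of_set {0..1}) ?G (edge_map t)" if "t \<in> {a, b}" for t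
    using that by (rule continuous_map_edge_map(1))
  qed (use that in \<open>auto simp: pc_skeleton_def\<close>)
  moreover have "continuous_map euclideanreal euclideanreal (\<lambda>x. 1 + x)" by (simp add: continuous_on_add)
  ultimately have "continuous_map euclideanreal ?G (wp [(s, True), (s, True)] \<circ> (\<lambda>x. 1 + x))" by (rule continuous_map_compose[rotated])
  then show ?thesis by (simp add: arm_def[abs_def] comp_def)
 qed
 have "continuous_map (top_of_set Y) ?G g"
  unfolding g_def
 proof (rule continuous_map_cases_le)
  have fs: "continuous_map (subtopology (top_of_set Y) X) euclideanreal fst" "continuous_map (subtopology (top_of_set Y) X) euclideanreal snd" for X
   by (simp_all add: subtopology_subtopology continuous_on_fst continuous_on_snd continuous_on_id)
  show "continuous_map (subtopology (top_of_set Y) X) ?G (\<lambda>z. arm a (fst z))" for X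
   using continuous_map_compose[OF fs(1) carm[of a]] by (simp add: comp_def)
  show "continuous_map (subtopology (top_of_set Y) X) ?G (\<lambda>z. arm b (snd z))" for X
   using continuous_map_compose[OF fs(2) carm[of b]] by (simp add: comp_def)
  show "arm a (fst z) = arm b (snd z)" if "z \<in> topspace (top_of_set Y)" "\<bar>snd z\<bar> = \<bar>fst z\<bar>" for z
   using that by (auto simp: Y_def arm)
 qed (use cs in auto)
 moreover have gV: "g z \<in> ?V" if "z \<in> Y" for z
 proof -
  have "arm s x \<in> ?V" if "\<bar>x\<bar> < 1/2" "s \<in> {a, b}" for s x
   using that(2) unfolding arm[OF that(1)] using that(1) by (auto simp: pc_skeleton_def)
  moreover have "\<bar>fst z\<bar> < 1/2" "\<bar>snd z\<bar> < 1/2" using that by (auto simp: Y_def)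
  ultimately show ?thesis unfolding g_def by simp
 qed
 ultimately have g: "continuous_map (top_of_set Y) ?T g"
  by (simp add: continuous_map_in_subtopology image_subset_iff Pi_iff)
 show ?thesis
 proof (rule acyclic_at_retract[OF k g])
  show "g (k x) = x" if x: "x \<in> topspace ?T" for x
  proof (cases x)
   case (Edge s t)
   have t: "0 < t" "t < 1" "t \<noteq> 1/2" "s \<in> {a, b}" using x unfolding ts Edge by (auto simp: pc_skeleton_def)
   have qt: "q t \<noteq> 0" "arm s (q t) = Edge s t"
    using t arm[of "q t" s] by (cases "t < 1/2"; simp add: q_def)+
   show ?thesis using qt t(4) ab by (cases "s = a") (auto simp: Edge k_def g_def)
  next
   case Vertex
   then show ?thesis using arm[of 0 a] by (simp add: k_def g_def)
  qed (use x in \<open>auto simp: pc_skeleton_def\<close>)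
  \<comment> \<open>The cross is star-shaped with respect to the origin.\<close>
  have "homotopic_with (\<lambda>h. True) (top_of_set Y) (top_of_set Y) id (\<lambda>x. (0, 0))"
  proof (rule homotopic_with_linear)
   fix x assume x: "x \<in> Y"
   show "closed_segment (id x) (0, 0) \<subseteq> Y"
   proof
    fix y assume "y \<in> closed_segment (id x) (0, 0)"
    then obtain u where u: "0 \<le> u" "u \<le> 1" "y = (1 - u) *\<^sub>R x" by (auto simp: in_segment zero_prod_def[symmetric])
    have "\<bar>1 - u\<bar> * \<bar>v\<bar> < 1/2" if "\<bar>v\<bar> < 1/2" for v :: real
     using that u mult_left_le_one_le[of "\<bar>v\<bar>" "\<bar>1 - u\<bar>"] by simp
    then show "y \<in> Y" using x u(3) by (auto simp: Y_def abs_mult)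
   qed
  qed (auto intro: continuous_on_id')
  from null_homotopic_cycle[OF this _ p] show "acyclic_at p (top_of_set Y)" unfolding acyclic_at_def by blast
 qed
qed

text \<open>The star of the vertex and the two open 1-cells cover the graph, and they meet in four
  open half-edges. All pieces are disjoint unions of contractible sets.\<close>

lemma acyclic_at_graph:
 assumes ab: "a \<noteq> b"
 shows "acyclic_at 2 (graph_topology {a, b})"
proof -
 let ?G = "graph_topology {a, b}" and ?V = "pc_skeleton {a, b} - {Edge a (1/2), Edge b (1/2)}"
 define E where "E s = Edge s ` {0<..<1::real}" for s :: 'a
 define H where "H s = Edge s ` {0<..<1/2::real} \<union> Edge s ` {1/2<..<1}" for s :: 'a
 have oE: "openin ?G (E s)" if "s \<in> {a, b}" for s unfolding E_def by (rule openin_open_edge[OF that]) auto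
 have oH: "openin ?G (Edge s ` {0<..<1/2})" "openin ?G (Edge s ` {1/2<..<1})" "openin ?G (H s)" if "s \<in> {a, b}" for s
  unfolding H_def by (intro openin_Un openin_open_edge[OF that]; auto)+
 have aH: "acyclic_at 1 (subtopology ?G (H s))" if "s \<in> {a, b}" for s
  unfolding H_def One_nat_def
  by (rule acyclic_at_disjoint_union) (use oH[OF that] in \<open>auto intro!: acyclic_at_open_edge[OF that]\<close>)
 have aE: "acyclic_at 2 (subtopology ?G (E s))" if "s \<in> {a, b}" for s
  unfolding E_def by (rule acyclic_at_open_edge[OF that]) auto
 show ?thesis
  unfolding numeral_2_eq_2
 proof (rule acyclic_at_union)
  show "openin ?G ?V"
   unfolding openin_graph_topology
  proof (intro conjI ballI)
   fix s assume "s \<in> {a, b}"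
   then have "{t \<in> {0..1}. edge_map s t \<in> ?V} = {0..1} \<inter> - {1/2}"
    by (auto simp: edge_map_def pc_skeleton_def)
   then show "openin (top_of_set {0..1}) {t \<in> {0..1}. edge_map s t \<in> ?V}" by (auto simp: openin_open)
  qed auto
  show "openin ?G (E a \<union> E b)" using oE by auto
  show "topspace ?G = ?V \<union> (E a \<union> E b)" by (auto simp: pc_skeleton_def E_def)
  show "acyclic_at (Suc (Suc 0)) (subtopology ?G ?V)" by (rule acyclic_at_vertex_star[OF ab]) simp
  show "acyclic_at (Suc (Suc 0)) (subtopology ?G (E a \<union> E b))"
   by (rule acyclic_at_disjoint_union) (use oE aE[unfolded numeral_2_eq_2] ab in \<open>auto simp: E_def\<close>)
  have "?V \<inter> (E a \<union> E b) = H a \<union> H b"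
   using ab by (auto simp: pc_skeleton_def E_def H_def image_iff)
  moreover have "acyclic_at (Suc 0) (subtopology ?G (H a \<union> H b))"
   by (rule acyclic_at_disjoint_union) (use oH aH[unfolded One_nat_def] ab in \<open>auto simp: H_def\<close>)
  ultimately show "acyclic_at (Suc 0) (subtopology ?G (?V \<inter> (E a \<union> E b)))" by simp
 qed
qed

text \<open>A relative homology between two absolute cycles leaves a cycle in the 1-skeleton as its
  error, and that cycle bounds by \<open>acyclic_at_graph\<close>.\<close>

lemma pc_absolute_homologous:
 assumes ab: "a \<noteq> b" and r: "r \<in> carrier (free_group {a, b})"
  and z: "singular_relcycle 2 (presentation_complex {a, b} r) {} z" "singular_relcycle 2 (presentation_complex {a, b} r) {} z'"
  and h: "homologous_rel 2 (presentation_complex {a, b} r) (pc_skeleton {a, b}) z z'"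
 shows "homologous_rel 2 (presentation_complex {a, b} r) {} z z'"
proof -
 let ?P = "presentation_complex {a, b} r" and ?A = "pc_skeleton {a, b}"
 obtain d w where d: "singular_chain (Suc 2) ?P d" "singular_chain 2 (subtopology ?P ?A) w" "chain_boundary (Suc 2) d = z - z' + w"
  using h unfolding homologous_rel_def singular_relboundary_alt by blast
 have "Suc 2 = (3 :: nat)" by simp
 note d = d[unfolded this]
 have "chain_boundary 2 (chain_boundary 3 d) = 0"
  using chain_boundary_boundary[of 3 ?P d] d(1) by simp
 then have "chain_boundary 2 w = 0" unfolding d(3) using z by (simp add: chain_boundary_add chain_boundary_diff singular_cycle)
 then have "singular_relcycle 2 (graph_topology {a, b}) {} w" using d(2) by (simp add: singular_cycle graph_subtopology[OF r])
 then have "singular_relboundary 2 (subtopology ?P ?A) {} w"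
  using acyclic_at_graph[OF ab] by (simp add: acyclic_at_def graph_subtopology[OF r])
 then obtain y where y: "singular_chain 3 (subtopology ?P ?A) y" "chain_boundary 3 y = w"
  by (auto simp: singular_boundary numeral_3_eq_3 numeral_2_eq_2)
 have "singular_chain 3 ?P y" using y(1) by (simp add: singular_chain_subtopology)
 then have "singular_chain 3 ?P (d - y)" "chain_boundary 3 (d - y) = z - z'"
  using d y by (simp_all add: singular_chain_diff chain_boundary_diff)
 then show ?thesis unfolding homologous_rel_def singular_boundary by (metis numeral_3_eq_3 numeral_2_eq_2)
qed

lemma pc_fundamental_class_eq:
 assumes ab: "a \<noteq> b" and r: "r \<in> carrier (free_group {a, b})"
  and z: "singular_relcycle 2 (presentation_complex {a, b} r) {} z"
  and h: "homologous_rel 2 (presentation_complex {a, b} r) (pc_skeleton {a, b}) z (frag_of (face_simplex r))"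
 shows "pc_fundamental_class {a, b} r = homologous_rel_set 2 (presentation_complex {a, b} r) {} z"
proof -
 let ?P = "presentation_complex {a, b} r" and ?A = "pc_skeleton {a, b}"
 have carr: "carrier (homology_group 2 ?P) = homologous_rel_set 2 ?P {} ` singular_relcycle_set 2 ?P {}"
  using carrier_relative_homology_group[of 2 ?P "{}"] by simp
 have ind: "hom_induced 2 ?P {} ?P ?A id (homologous_rel_set 2 ?P {} c) = homologous_rel_set 2 ?P ?A c"
  if "singular_relcycle 2 ?P {} c" for c
 proof -
  have "chain_map 2 id c = c" by (rule chain_map_id_gen[of 2 ?P]) (use that in \<open>auto simp: singular_cycle\<close>)
  then show ?thesis using hom_induced_chain_map[OF continuous_map_id _ that, of ?A] by simp
 qed
 show ?thesis
  unfolding pc_fundamental_class_def Let_def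
 proof (rule the_equality)
  show "homologous_rel_set 2 ?P {} z \<in> carrier (homology_group 2 ?P) \<and>
   hom_induced 2 ?P {} ?P ?A id (homologous_rel_set 2 ?P {} z) = homologous_rel_set 2 ?P ?A (frag_of (face_simplex r))"
   unfolding carr ind[OF z] homologous_rel_set_eq using z h by blast
  fix \<alpha> assume \<alpha>: "\<alpha> \<in> carrier (homology_group 2 ?P) \<and>
   hom_induced 2 ?P {} ?P ?A id \<alpha> = homologous_rel_set 2 ?P ?A (frag_of (face_simplex r))"
  then obtain c where c: "\<alpha> = homologous_rel_set 2 ?P {} c" "singular_relcycle 2 ?P {} c" unfolding carr by blast
  then have "homologous_rel 2 ?P ?A c (frag_of (face_simplex r))" using \<alpha> ind[OF c(2)] by (simp add: homologous_rel_set_eq)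
  then have "homologous_rel 2 ?P ?A c z" using h homologous_rel_trans homologous_rel_sym by blast
  then show "\<alpha> = homologous_rel_set 2 ?P {} z"
   unfolding c(1) homologous_rel_set_eq by (rule pc_absolute_homologous[OF ab r c(2) z])
 qed
qed

section \<open>The upper bound for the simplicial volume\<close>

abbreviation "lookup \<equiv> Poly_Mapping.lookup"
abbreviation "keys \<equiv> Poly_Mapping.keys"

definition real_chain :: "'x chain \<Rightarrow> 'x real_chain" where
 "real_chain z = Poly_Mapping.map real_of_int z"

definition scale_chain :: "real \<Rightarrow> 'x real_chain \<Rightarrow> 'x real_chain" where
 "scale_chain s z = Poly_Mapping.map ((*) s) z"

lemma lookup_real_chain: "lookup (real_chain z) f = real_of_int (lookup z f)"
 by (simp add: real_chain_def Poly_Mapping.map.rep_eq when_def)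

lemma lookup_scale_chain: "lookup (scale_chain s z) f = s * lookup z f"
 by (simp add: scale_chain_def Poly_Mapping.map.rep_eq when_def)

lemma real_chain_add: "real_chain (y + z) = real_chain y + real_chain z"
 by (rule poly_mapping_eqI) (simp add: lookup_real_chain lookup_add)

lemma real_chain_diff: "real_chain (y - z) = real_chain y - real_chain z"
 by (rule poly_mapping_eqI) (simp add: lookup_real_chain lookup_minus)

lemma keys_real_chain: "keys (real_chain z) = keys z"
 by (auto simp: in_keys_iff lookup_real_chain)

lemma keys_scale_chain: "keys (scale_chain s z) \<subseteq> keys z"
 by (auto simp: in_keys_iff lookup_scale_chain)

lemma l1_norm_superset:
 assumes "finite A" "keys d \<subseteq> A"
 shows "l1_norm d = (\<Sum>f\<in>A. \<bar>lookup d f\<bar>)"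
 unfolding l1_norm_def using assms by (intro sum.mono_neutral_left) (auto simp: in_keys_iff)

lemma l1_norm_add: "l1_norm (y + z) \<le> l1_norm y + l1_norm z"
proof -
 define A where "A = keys y \<union> keys z"
 have A: "finite A" "keys y \<subseteq> A" "keys z \<subseteq> A" "keys (y + z) \<subseteq> A"
  using Poly_Mapping.keys_add[of y z] by (auto simp: A_def)
 show ?thesis
  unfolding l1_norm_superset[OF A(1,2)] l1_norm_superset[OF A(1,3)] l1_norm_superset[OF A(1,4)] sum.distrib[symmetric]
  by (intro sum_mono) (simp add: lookup_add abs_triangle_ineq)
qed

lemma l1_norm_scale: "l1_norm (scale_chain s z) = \<bar>s\<bar> * l1_norm z"
 using l1_norm_superset[OF finite_keys keys_scale_chain[of s z]]
 by (simp add: l1_norm_def lookup_scale_chain abs_mult sum_distrib_left)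

lemma l1_norm_uminus: "l1_norm (- z) = l1_norm z"
 by (simp add: l1_norm_def)

lemma l1_norm_diff: "l1_norm (y - z) \<le> l1_norm y + l1_norm z"
 using l1_norm_add[of y "- z"] by (simp add: l1_norm_uminus)

lemma l1_norm_frag_of: "l1_norm (real_chain (frag_of f)) = 1"
 by (simp add: l1_norm_def keys_real_chain lookup_real_chain)

lemma lookup_real_chain_boundary:
 assumes "finite A" "keys d \<subseteq> A"
 shows "lookup (real_chain_boundary p d) g =
  (\<Sum>f\<in>A. lookup d f * real_of_int (lookup (chain_boundary p (frag_of f)) g))"
proof -
 have "lookup (real_chain_boundary p d) g =
  (\<Sum>f\<in>keys d. lookup d f * real_of_int (lookup (chain_boundary p (frag_of f)) g))"
  unfolding real_chain_boundary_def lookup_sum by (intro sum.cong refl) (simp add: Poly_Mapping.map.rep_eq when_def)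
 also have "\<dots> = (\<Sum>f\<in>A. lookup d f * real_of_int (lookup (chain_boundary p (frag_of f)) g))"
  using assms by (intro sum.mono_neutral_left) (auto simp: in_keys_iff)
 finally show ?thesis .
qed

lemma real_chain_boundary_scale: "real_chain_boundary p (scale_chain s d) = scale_chain s (real_chain_boundary p d)"
proof (rule poly_mapping_eqI)
 fix g
 show "lookup (real_chain_boundary p (scale_chain s d)) g = lookup (scale_chain s (real_chain_boundary p d)) g"
  unfolding lookup_scale_chain lookup_real_chain_boundary[OF finite_keys keys_scale_chain[of s d]]
   lookup_real_chain_boundary[OF finite_keys order_refl[of "keys d"]]
  by (simp add: sum_distrib_left mult.assoc)
qed

lemma chain_boundary_sum:
 "chain_boundary p z = (\<Sum>f\<in>keys z. frag_cmul (lookup z f) (chain_boundary p (frag_of f)))"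
proof -
 have "frag_extend b z = (\<Sum>f\<in>keys z. frag_cmul (lookup z f) (frag_extend b (frag_of f)))"
  for b :: "((nat \<Rightarrow> real) \<Rightarrow> 'a) \<Rightarrow> 'a chain"
  by (simp add: frag_extend_def)
 then show ?thesis unfolding chain_boundary_def by simp
qed

lemma real_chain_boundary_real_chain: "real_chain_boundary p (real_chain z) = real_chain (chain_boundary p z)"
proof (rule poly_mapping_eqI)
 fix g
 have "lookup (chain_boundary p z) g =
   (\<Sum>f\<in>keys z. lookup z f * lookup (chain_boundary p (frag_of f)) g)"
  by (subst chain_boundary_sum) (simp add: lookup_sum)
 moreover have "lookup (real_chain_boundary p (real_chain z)) g =
   (\<Sum>f\<in>keys z. real_of_int (lookup z f) * real_of_int (lookup (chain_boundary p (frag_of f)) g))"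
  by (subst lookup_real_chain_boundary[of "keys z"]) (simp_all add: keys_real_chain lookup_real_chain)
 ultimately show "lookup (real_chain_boundary p (real_chain z)) g = lookup (real_chain (chain_boundary p z)) g"
  by (simp add: lookup_real_chain)
qed

text \<open>A polygon is triangulated by the diagonals from its first corner, and \<open>q\<close>
  is the word along the current diagonal. A backward side yields a triangle with coefficient - 1, so
  that its boundary contains the forward edge of the same word with a negative sign.\<close>

fun fan :: "'s word \<Rightarrow> ('s word \<times> bool) list \<Rightarrow> 's pc_point chain" where
 "fan q [] = 0"
| "fan q ((x, s) # ls) =
  (if s then frag_of (tri (q @ x) 0 (length q) (length q + length x)) + fan (q @ x) ls
   else fan (q @ winv x) ls - frag_of (tri (q @ winv x) 0 (length q + length x) (length q)))"

definition letter_val :: "'s word \<times> bool \<Rightarrow> 's word" where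
 "letter_val l = (if snd l then fst l else winv (fst l))"

definition comm_letters :: "'s word \<times> 's word \<Rightarrow> ('s word \<times> bool) list" where
 "comm_letters p = [(fst p, True), (snd p, True), (fst p, False), (snd p, False)]"

lemma concat_comm_letters: "concat (map letter_val (concat (map comm_letters cs))) = concat (map comm_word cs)"
 by (induction cs) (simp_all add: comm_letters_def comm_word_def letter_val_def)

text \<open>The diagonals telescope, and only the sides and the first and last diagonals
  remain.\<close>

lemma fan_boundary:
 "chain_boundary 2 (fan q ls) = (\<Sum>l\<leftarrow>ls. if snd l then frag_of (es (fst l)) else - frag_of (es (fst l)))
   + frag_of (es q) - frag_of (es (q @ concat (map letter_val ls)))"
proof (induction q ls rule: fan.induct)
 case (2 q x s ls)
 then show ?case
  by (cases s) (simp_all add: letter_val_def chain_boundary_add chain_boundary_diff boundary_2 tri_pos_faces[of q x]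
   tri_neg_faces[of q x] del: One_nat_def)
qed simp

lemma fan_chain:
 assumes r: "r \<in> carrier (free_group S)"
 shows "over S q \<Longrightarrow> (\<And>l. l \<in> set ls \<Longrightarrow> over S (fst l)) \<Longrightarrow>
  singular_chain 2 (subtopology (presentation_complex S r) (pc_skeleton S)) (fan q ls)"
proof (induction q ls rule: fan.induct)
 case (2 q x s ls)
 have "over S x" using "2.prems"(2)[of "(x, s)"] by simp
 then have o: "over S (q @ x)" "over S (q @ winv x)"
  using "2.prems"(1) set_winv[of x] by (simp_all add: image_Un)
 have ls: "over S (fst l)" if "l \<in> set ls" for l using "2.prems"(2)[of l] that by simp
 have "singular_chain 2 (subtopology (presentation_complex S r) (pc_skeleton S)) (fan (q @ letter_val (x, s)) ls)"
  using "2.IH"[OF _ _ ls] o by (cases s) (simp_all only: letter_val_def fst_conv snd_conv if_True if_False simp_thms)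
 moreover have "singular_chain 2 (subtopology (presentation_complex S r) (pc_skeleton S)) (frag_of (tri (q @ x) i j k))"
  "singular_chain 2 (subtopology (presentation_complex S r) (pc_skeleton S)) (frag_of (tri (q @ winv x) i j k))" for i j k
  using tri_simplex[OF r o(1)] tri_simplex[OF r o(2)] by (simp_all add: singular_chain_of)
 ultimately show ?case by (cases s) (simp_all add: letter_val_def singular_chain_add singular_chain_diff)
qed simp

lemma l1_norm_fan:
 fixes g :: "'s pc_point \<Rightarrow> 'x"
 shows "l1_norm (real_chain (chain_map 2 g (fan q ls))) \<le> real (length ls)"
proof (induction q ls rule: fan.induct)
 case (1 q)
 then show ?case by (simp add: l1_norm_def keys_real_chain)
next
 case (2 q x s ls)
 have 1: "l1_norm (y + real_chain (frag_of f)) \<le> l1_norm y + 1" "l1_norm (real_chain (frag_of f) + y) \<le> 1 + l1_norm y"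
  "l1_norm (y - real_chain (frag_of f)) \<le> l1_norm y + 1" for y :: "'x real_chain" and f
  using l1_norm_add[of y "real_chain (frag_of f)"] l1_norm_add[of "real_chain (frag_of f)" y] l1_norm_diff[of y "real_chain (frag_of f)"]
  by (simp_all add: l1_norm_frag_of)
 show ?case
  using 2 by (cases s) (auto simp: chain_map_add chain_map_diff real_chain_add real_chain_diff intro: order_trans[OF 1(2)] order_trans[OF 1(3)])
qed

text \<open>The simplex \<open>d\<close> is a disc for the product of the commutators and the fan is
  the polygon with the same boundary word, whose sides cancel in each commutator. The constant
  triangle cancels the constant edge that is left. The number of simplices does not depend on the
  degree of \<open>d\<close>.\<close>

definition comm_cycle :: "((nat \<Rightarrow> real) \<Rightarrow> 's pc_point) \<Rightarrow> ('s word \<times> 's word) list \<Rightarrow> 's pc_point chain" where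
 "comm_cycle d cs = frag_of d + fan [] (concat (map comm_letters cs)) - frag_of (tri [] 0 0 0)"

lemma comm_cycle:
 fixes r :: "'s word"
 assumes r: "r \<in> carrier (free_group S)"
  and cs: "\<And>p. p \<in> set cs \<Longrightarrow> over S (fst p) \<and> over S (snd p)"
  and d: "singular_simplex 2 (presentation_complex S r) d"
   "singular_face 2 2 d = es (concat (map comm_word cs))" "singular_face 2 0 d = es []" "singular_face 2 1 d = es []"
   "homologous_rel 2 (presentation_complex S r) (pc_skeleton S) (frag_of d) (frag_cmul n (frag_of (face_simplex r)))"
 shows "singular_relcycle 2 (presentation_complex S r) {} (comm_cycle d cs)"
  and "homologous_rel 2 (presentation_complex S r) (pc_skeleton S) (comm_cycle d cs) (frag_cmul n (frag_of (face_simplex r)))"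
proof -
 let ?P = "presentation_complex S r" and ?A = "pc_skeleton S"
 define ls where "ls = concat (map comm_letters cs)"
 have f: "singular_chain 2 (subtopology ?P ?A) (fan [] ls)"
 proof (rule fan_chain[OF r])
  fix l assume "l \<in> set ls"
  then show "over S (fst l)" using cs unfolding ls_def comm_letters_def by fastforce
 qed simp
 have t: "singular_chain 2 (subtopology ?P ?A) (frag_of (tri [] 0 0 0))"
  using tri_simplex[OF r, of "[]" 0 0 0] by (simp add: singular_chain_of)
 have ft: "singular_chain 2 (subtopology ?P ?A) (fan [] ls - frag_of (tri [] 0 0 0))"
  using f t by (rule singular_chain_diff)
 have z: "comm_cycle d cs = frag_of d + (fan [] ls - frag_of (tri [] 0 0 0))"
  by (simp add: comm_cycle_def ls_def)
 have "(\<Sum>l\<leftarrow>ls. if snd l then frag_of (es (fst l)) else - frag_of (es (fst l))) = 0"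
  unfolding ls_def by (induction cs) (simp_all add: comm_letters_def)
 then have "chain_boundary 2 (fan [] ls) = frag_of (es []) - frag_of (es (concat (map comm_word cs)))"
  using fan_boundary[of "[]" ls] by (simp add: concat_comm_letters[symmetric] ls_def)
 moreover have "chain_boundary 2 (frag_of (tri [] 0 0 0)) = frag_of (es [] :: _ \<Rightarrow> 's pc_point)"
  unfolding boundary_2 using tri_pos_faces[of "[] :: 's word" "[]"] by (simp del: One_nat_def)
 ultimately have "chain_boundary 2 (comm_cycle d cs) = 0"
  unfolding z chain_boundary_add chain_boundary_diff boundary_2[of d] d by simp
 moreover have "singular_chain 2 ?P (comm_cycle d cs)"
  unfolding z using d(1) ft by (intro singular_chain_add) (simp_all add: singular_chain_of singular_chain_subtopology)
 ultimately show "singular_relcycle 2 ?P {} (comm_cycle d cs)" by (simp add: singular_cycle)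
 have "homologous_rel 2 ?P ?A (fan [] ls - frag_of (tri [] 0 0 0)) 0"
  unfolding homologous_rel_def using ft by (simp add: singular_chain_imp_relboundary)
 from homologous_rel_add[OF d(5) this]
 show "homologous_rel 2 ?P ?A (comm_cycle d cs) (frag_cmul n (frag_of (face_simplex r)))" by (simp add: z)
qed

lemma l1_norm_comm_cycle:
 fixes g :: "'s pc_point \<Rightarrow> 'x"
 shows "l1_norm (real_chain (chain_map 2 g (comm_cycle d cs))) \<le> 4 * real (length cs) + 2"
proof -
 have "length (concat (map comm_letters cs)) = 4 * length cs" by (induction cs) (simp_all add: comm_letters_def)
 then have "l1_norm (real_chain (chain_map 2 g (fan [] (concat (map comm_letters cs))))) \<le> 4 * real (length cs)"
  using l1_norm_fan[of g "[]" "concat (map comm_letters cs)"] by simp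
 moreover have "l1_norm (y + z - u) \<le> l1_norm y + l1_norm z + l1_norm u" for y z u :: "'x real_chain"
  using l1_norm_diff[of "y + z" u] l1_norm_add[of y z] by linarith
 note this[of "real_chain (frag_of (simplex_map 2 g d))" "real_chain (chain_map 2 g (fan [] (concat (map comm_letters cs))))"
   "real_chain (frag_of (simplex_map 2 g (tri [] 0 0 0)))"]
 ultimately show ?thesis
  unfolding comm_cycle_def chain_map_diff chain_map_add real_chain_diff real_chain_add chain_map_of l1_norm_frag_of by linarith
qed

lemma filter_comm_word:
 "filter (\<lambda>l. fst l \<in> S) (concat (map comm_word cs)) =
   concat (map comm_word (map (\<lambda>p. (filter (\<lambda>l. fst l \<in> S) (fst p), filter (\<lambda>l. fst l \<in> S) (snd p))) cs))"
 by (induction cs) (simp_all add: comm_word_def filter_winv)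

lemma rel_filter:
 assumes r: "over S r" and rel: "rel r n w"
 shows "rel r n (filter (\<lambda>l. fst l \<in> S) w)"
proof -
 let ?f = "filter (\<lambda>l. fst l \<in> S)"
 obtain qs where qs: "wval w = wval (concat (map (conj_word r) qs))" "n = degree qs"
  using rel by (auto simp: rel_def)
 have fr: "?f r = r" using r by (auto simp: filter_id_conv)
 define ps where "ps = map (\<lambda>q. (?f (fst q), snd q)) qs"
 have "?f (conj_word r q) = conj_word r (?f (fst q), snd q)" for q
  by (simp add: conj_word_def filter_winv fr)
 then have "?f (concat (map (conj_word r) qs)) = concat (map (conj_word r) ps)"
  unfolding ps_def by (induction qs) simp_all
 moreover have "degree ps = n" unfolding ps_def qs(2) degree_def by (simp add: comp_def)
 ultimately show ?thesis
  using wval_filter[of S w] wval_filter[of S "concat (map (conj_word r) qs)"] qs(1) unfolding rel_def by metis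
qed

text \<open>The relator as a product of two commutators; the cycle \<open>comm_cycle\<close> built
  from it, with a disc of degree 1, represents the fundamental class.\<close>

definition relator_pairs :: "'s \<Rightarrow> 's \<Rightarrow> nat \<Rightarrow> ('s word \<times> 's word) list" where
 "relator_pairs a b m = [([(a, True)], [(b, True)]), ([(a, True)], replicate m (b, False))]"

lemma relator_pairs: "concat (map comm_word (relator_pairs a b m)) = rword a b m"
 by (simp add: relator_pairs_def comm_word_def rword_def winv_def inv_letter_def)

context
 fixes a b :: 's and m :: nat and r :: "'s word" and X :: "'x topology" and c :: "'s pc_point \<Rightarrow> 'x"
 assumes ab: "a \<noteq> b" and m: "m \<ge> 2" and r_def: "r = rword a b m"
  and cont: "continuous_map (presentation_complex {a, b} r) X c"
begin

lemma relator_carrier: "r \<in> carrier (free_group {a, b})"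
 unfolding r_def by (rule relator_eq_rword(2)[OF ab]) (use m in simp)

lemma fundamental_class_eq:
 assumes z: "singular_relcycle 2 (presentation_complex {a, b} r) {} z"
  "homologous_rel 2 (presentation_complex {a, b} r) (pc_skeleton {a, b}) z (frag_of (face_simplex r))"
 shows "fundamental_class {a, b} r X c = homologous_rel_set 2 X {} (chain_map 2 c z)"
 unfolding fundamental_class_def pc_fundamental_class_eq[OF ab relator_carrier z]
 using hom_induced_chain_map[OF cont _ z(1), of "{}"] by simp

lemma relator_cycle:
 obtains d where "singular_face 2 2 d = es r" "singular_face 2 0 d = es []" "singular_face 2 1 d = es []"
  "singular_relcycle 2 (presentation_complex {a, b} r) {} (comm_cycle d (relator_pairs a b m))"
  "homologous_rel 2 (presentation_complex {a, b} r) (pc_skeleton {a, b})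
    (comm_cycle d (relator_pairs a b m)) (frag_of (face_simplex r))"
proof -
 define cs where "cs = relator_pairs a b m"
 have e: "concat (map comm_word cs) = r" by (simp add: cs_def relator_pairs r_def)
 obtain d where d: "singular_simplex 2 (presentation_complex {a, b} r) d"
   "singular_face 2 2 d = es r" "singular_face 2 0 d = es []" "singular_face 2 1 d = es []"
   "homologous_rel 2 (presentation_complex {a, b} r) (pc_skeleton {a, b}) (frag_of d) (frag_cmul 1 (frag_of (face_simplex r)))"
  using fills_relator[OF relator_carrier] unfolding fills_def by blast
 have "over {a, b} (fst p) \<and> over {a, b} (snd p)" if "p \<in> set cs" for p
  using that by (auto simp: cs_def relator_pairs_def)
 note * = comm_cycle[where S = "{a, b}" and cs = cs and n = 1 and d = d, OF relator_carrier this d(1) _ d(3-5), unfolded e, OF _ d(2)]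
 show ?thesis using that[OF d(2-4)] * unfolding cs_def by simp
qed

lemma simplicial_volume_upper: "simplicial_volume {a, b} r X c \<le> (2 * real m - 4) / (real m - 1)"
proof -
 let ?P = "presentation_complex {a, b} r" and ?S = "{a, b}"
 let ?A = "pc_skeleton ?S"
 have rS: "over ?S r" using relator_carrier by (simp add: free_group_simps)
 obtain d1 where d1: "singular_relcycle 2 ?P {} (comm_cycle d1 (relator_pairs a b m))"
  "homologous_rel 2 ?P ?A (comm_cycle d1 (relator_pairs a b m)) (frag_of (face_simplex r))"
  by (rule relator_cycle)
 define z1 where "z1 = comm_cycle d1 (relator_pairs a b m)"
 note z1 = d1[folded z1_def]
 define N where "N k = k * (2 * (m - 1))" for k
 have bound: "simplicial_volume ?S r X c \<le> (4 * real (k * (m - 2) + 5) + 2) / real (N k)" if k: "k > 0" for k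
 proof -
  have Nk: "N k > 0" using k m by (simp add: N_def)
  obtain w where w: "clle (k * (m - 2) + 5) w" "pos (- fg r) (N k) w"
   using pos_clle[OF m, of k "fg [(a, True)]" "fg [(b, True)]"] unfolding rr_rword r_def N_def by blast
  have w': "clle (k * (m - 2) + 5) (fg (fg_word w))" "pos (- fg r) (N k) (fg (fg_word w))" using w by simp_all
  obtain cs where cs: "length cs \<le> k * (m - 2) + 5" "wval (fg_word w) = wval (concat (map comm_word cs))"
   using clle_word[OF w'(1)] by blast
  define cs' where "cs' = map (\<lambda>p. (filter (\<lambda>l. fst l \<in> ?S) (fst p), filter (\<lambda>l. fst l \<in> ?S) (snd p))) cs"
  have "filter (\<lambda>l. fst l \<in> ?S) (concat (map comm_word cs)) = concat (map comm_word cs')"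
   unfolding cs'_def by (rule filter_comm_word)
  moreover have "rel r (- int (N k)) (concat (map comm_word cs))"
   using pos_rel[OF w'(2)] rel_cong[OF cs(2)] by blast
  ultimately have rel: "rel r (- int (N k)) (concat (map comm_word cs'))"
   using rel_filter[OF rS] by metis
  have S': "over ?S (fst p) \<and> over ?S (snd p)" if "p \<in> set cs'" for p
   using that by (auto simp: cs'_def)
  have "over ?S (concat (map comm_word cs'))"
  proof -
   have "over ?S (comm_word p)" if "p \<in> set cs'" for p
    using S'[OF that] set_winv[of "fst p"] set_winv[of "snd p"] by (simp add: comm_word_def image_Un)
   then show ?thesis by fastforce
  qed
  then have "fills ?S r (concat (map comm_word cs')) [] [] (- int (N k))"
   by (rule fills_rel[OF relator_carrier rel])
  then obtain d where d: "singular_simplex 2 ?P d" "singular_face 2 2 d = es (concat (map comm_word cs'))"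
   "singular_face 2 0 d = es []" "singular_face 2 1 d = es []"
   "homologous_rel 2 ?P ?A (frag_of d) (frag_cmul (- int (N k)) (frag_of (face_simplex r)))"
   unfolding fills_def by blast
  define z where "z = comm_cycle d cs'"
  have z: "singular_relcycle 2 ?P {} z" "homologous_rel 2 ?P ?A z (frag_cmul (- int (N k)) (frag_of (face_simplex r)))"
   unfolding z_def using comm_cycle[OF relator_carrier S' d] by blast+
  have "homologous_rel 2 ?P {} z (frag_cmul (- int (N k)) z1)"
  proof (rule pc_absolute_homologous[OF ab relator_carrier z(1)])
   show "singular_relcycle 2 ?P {} (frag_cmul (- int (N k)) z1)" by (rule singular_relcycle_cmul[OF z1(1)])
   have dist: "frag_cmul n (x - y) = frag_cmul n x - frag_cmul n y" for n and x y :: "'s pc_point chain"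
    by (rule poly_mapping_eqI) (simp add: lookup_minus algebra_simps)
   have "homologous_rel 2 ?P ?A (frag_cmul (- int (N k)) z1) (frag_cmul (- int (N k)) (frag_of (face_simplex r)))"
    using z1(2) singular_relboundary_cmul[of 2 ?P ?A "z1 - frag_of (face_simplex r)" "- int (N k)"]
    unfolding homologous_rel_def dist by simp
   then show "homologous_rel 2 ?P ?A z (frag_cmul (- int (N k)) z1)"
    using z(2) homologous_rel_sym homologous_rel_trans by blast
  qed
  then obtain e where e: "singular_chain 3 ?P e" "chain_boundary 3 e = z - frag_cmul (- int (N k)) z1"
   unfolding homologous_rel_def singular_boundary by (metis Suc_numeral semiring_norm(5))
  define e' where "e' = chain_map 3 c e"
  have e': "singular_chain 3 X e'" "chain_boundary 3 e' = chain_map 2 c z - frag_cmul (- int (N k)) (chain_map 2 c z1)"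
   unfolding e'_def using singular_chain_chain_map[OF e(1) cont] chain_boundary_chain_map[OF e(1), of c] e(2)
   by (simp_all add: chain_map_diff chain_map_cmul)
  \<comment> \<open>The cycle \<open>z\<close> has degree \<open>- N k\<close>, so this factor turns
    it into a real representative of the fundamental class.\<close>
  define s where "s = - 1 / real (N k)"
  define D where "D = scale_chain s (real_chain (chain_map 2 c z))"
  have zX: "singular_chain 2 X (chain_map 2 c z)" "chain_boundary 2 (chain_map 2 c z) = 0"
   using z(1) singular_relcycle_chain_map[OF z(1) cont, of "{}"] by (simp_all add: singular_cycle)
  have "D \<in> change_of_coefficients 2 X (fundamental_class ?S r X c)"
   unfolding change_of_coefficients_def fundamental_class_eq[OF z1]
  proof (intro CollectI conjI bexI[of _ "chain_map 2 c z1"] exI[of _ "scale_chain s (real_chain e')"])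
   show "real_singular_chain 2 X D"
    unfolding real_singular_chain_def D_def using keys_scale_chain zX(1)
    by (fastforce simp: keys_real_chain singular_chain_def)
   show "real_chain_boundary 2 D = 0"
    unfolding D_def real_chain_boundary_scale real_chain_boundary_real_chain zX(2)
    by (rule poly_mapping_eqI) (simp add: lookup_scale_chain lookup_real_chain)
   show "real_singular_chain (Suc 2) X (scale_chain s (real_chain e'))"
    unfolding real_singular_chain_def using keys_scale_chain e'(1)
    by (fastforce simp: keys_real_chain singular_chain_def)
   show "D - Poly_Mapping.map real_of_int (chain_map 2 c z1) = real_chain_boundary (Suc 2) (scale_chain s (real_chain e'))"
    unfolding real_chain_boundary_scale real_chain_boundary_real_chain real_chain_def[symmetric] D_def
   proof (rule poly_mapping_eqI)
    fix g
    have "real_of_int (lookup (chain_boundary 3 e') g) =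
      real_of_int (lookup (chain_map 2 c z) g) + real (N k) * real_of_int (lookup (chain_map 2 c z1) g)"
     unfolding e'(2) by (simp add: lookup_minus)
    moreover have "s * u - v = s * (u + real (N k) * v)" for u v :: real
     using Nk by (simp add: s_def field_simps)
    ultimately show "lookup (scale_chain s (real_chain (chain_map 2 c z)) - real_chain (chain_map 2 c z1)) g =
      lookup (scale_chain s (real_chain (chain_boundary (Suc 2) e'))) g"
     by (simp add: lookup_minus lookup_scale_chain lookup_real_chain)
   qed
   show "homologous_rel 2 X {} (chain_map 2 c z1) (chain_map 2 c z1)" by (rule homologous_rel_refl)
  qed
  then have "simplicial_volume ?S r X c \<le> l1_norm D"
   unfolding simplicial_volume_def l1_seminorm_def
   by (intro cINF_lower) (auto intro!: bdd_belowI[of _ 0] simp: l1_norm_def sum_nonneg)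
  also have "\<dots> \<le> \<bar>s\<bar> * (4 * real (length cs') + 2)"
   unfolding D_def l1_norm_scale z_def by (intro mult_left_mono l1_norm_comm_cycle) simp
  also have "\<dots> \<le> \<bar>s\<bar> * (4 * real (k * (m - 2) + 5) + 2)"
  proof (intro mult_left_mono add_mono order_refl)
   show "real (length cs') \<le> real (k * (m - 2) + 5)" using cs(1) by (simp only: of_nat_le_iff cs'_def length_map)
  qed simp_all
  finally show ?thesis using Nk by (simp add: s_def)
 qed
 \<comment> \<open>Division by the degree makes the additive constants vanish in the limit, where
   four simplices for each commutator remain.\<close>
 have "(\<lambda>k. (4 * real (Suc k * (m - 2) + 5) + 2) / real (N (Suc k))) \<longlonglongrightarrow> 4 * real (m - 2) / real (2 * (m - 1))"
 proof -
  have "(\<lambda>k. 4 * real (m - 2) / real (2 * (m - 1)) + 22 / real (2 * (m - 1)) * inverse (real (Suc k))) \<longlonglongrightarrow>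
    4 * real (m - 2) / real (2 * (m - 1)) + 22 / real (2 * (m - 1)) * 0"
   by (intro tendsto_intros LIMSEQ_inverse_real_of_nat)
  moreover have "(4 * real (Suc k * (m - 2) + 5) + 2) / real (N (Suc k)) =
    4 * real (m - 2) / real (2 * (m - 1)) + 22 / real (2 * (m - 1)) * inverse (real (Suc k))" for k
  proof -
   define K where "K = real (Suc k)"
   define M where "M = real (m - 1)"
   have "K > 0" "M > 0" using m by (simp_all add: K_def M_def)
   then have "(4 * (K * real (m - 2) + 5) + 2) / (K * (2 * M)) = 4 * real (m - 2) / (2 * M) + 22 / (2 * M) * inverse K"
    by (simp add: field_simps)
   moreover have "real (Suc k * (m - 2) + 5) = K * real (m - 2) + 5" "real (N (Suc k)) = K * (2 * M)" "real (2 * (m - 1)) = 2 * M"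
    by (simp_all only: K_def M_def N_def of_nat_add of_nat_mult of_nat_numeral)
   ultimately show ?thesis unfolding K_def by simp
  qed
  ultimately show ?thesis by simp
 qed
 then have "simplicial_volume ?S r X c \<le> 4 * real (m - 2) / real (2 * (m - 1))"
  by (rule LIMSEQ_le_const) (use bound in blast)
 also have "\<dots> = (2 * real m - 4) / (real m - 1)" using m by (simp add: of_nat_diff field_simps)
 finally show ?thesis .
qed

end

section \<open>The fundamental groupoid\<close>

definition path_equiv :: "'x topology \<Rightarrow> (real \<Rightarrow> 'x) \<Rightarrow> (real \<Rightarrow> 'x) \<Rightarrow> bool" where
 "path_equiv X p q \<longleftrightarrow> homotopic_with (\<lambda>h. h 0 = p 0 \<and> h 1 = p 1) (top_of_set {0..1}) X p q"

definition path_from_to :: "'x topology \<Rightarrow> 'x \<Rightarrow> 'x \<Rightarrow> (real \<Rightarrow> 'x) \<Rightarrow> bool" where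
 "path_from_to X x y p \<longleftrightarrow> pathin X p \<and> p 0 = x \<and> p 1 = y"

lemma path_equiv_ends: "path_equiv X p q \<Longrightarrow> q 0 = p 0 \<and> q 1 = p 1"
 unfolding path_equiv_def by (drule homotopic_with_imp_property) simp

lemma path_equiv_eq: "pathin X p \<Longrightarrow> (\<And>t. 0 \<le> t \<Longrightarrow> t \<le> 1 \<Longrightarrow> q t = p t) \<Longrightarrow> path_equiv X p q"
 unfolding path_equiv_def by (rule homotopic_with_equal) (simp_all add: pathin_def)

lemma path_equiv_refl: "pathin X p \<Longrightarrow> path_equiv X p p"
 by (rule path_equiv_eq) simp_all

lemma path_equiv_sym: "path_equiv X p q \<Longrightarrow> path_equiv X q p"
 using path_equiv_ends[of X p q] unfolding path_equiv_def by (simp add: homotopic_with_symD)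

lemma path_equiv_trans: "path_equiv X p q \<Longrightarrow> path_equiv X q u \<Longrightarrow> path_equiv X p u"
 using path_equiv_ends[of X p q] unfolding path_equiv_def by (auto intro: homotopic_with_trans)

lemma path_equiv_pathin: "path_equiv X p q \<Longrightarrow> pathin X q"
 unfolding path_equiv_def pathin_def by (drule homotopic_with_imp_continuous_maps) simp

lemma path_equiv_path: "path_equiv X p q \<Longrightarrow> path_from_to X x y p \<Longrightarrow> path_from_to X x y q"
 using path_equiv_ends[of X p q] path_equiv_pathin[of X p q] by (simp add: path_from_to_def)

text \<open>The straight-line homotopy in \<open>C\<close>. Reparametrisation, cancellation of a
  path against its inverse and the relation of a triangle are all instances.\<close>

lemma path_equiv_convex:
 fixes C :: "'v::real_normed_vector set"
 assumes C: "convex C" and h: "continuous_map (top_of_set C) X h"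
  and f: "continuous_on {0..1} f" "f ` {0..1} \<subseteq> C" and g: "continuous_on {0..1} g" "g ` {0..1} \<subseteq> C"
  and ends: "f 0 = g 0" "f 1 = g 1"
 shows "path_equiv X (h \<circ> f) (h \<circ> g)"
proof -
 define k where "k = (\<lambda>z :: real \<times> real. (1 - fst z) *\<^sub>R f (snd z) + fst z *\<^sub>R g (snd z))"
 have "continuous_on ({0..1} \<times> {0..1}) (\<lambda>z. f (snd z))" "continuous_on ({0..1} \<times> {0..1}) (\<lambda>z. g (snd z))"
  by (rule continuous_on_compose2[OF f(1)] continuous_on_compose2[OF g(1)]; auto intro!: continuous_intros)+
 then have "continuous_on ({0..1} \<times> {0..1}) k" unfolding k_def by (intro continuous_intros)
 moreover have "k z \<in> C" if "z \<in> {0..1} \<times> {0..1}" for z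
  unfolding k_def using that f(2) g(2) by (intro convexD[OF C]) auto
 ultimately have "continuous_map (top_of_set ({0..1} \<times> {0..1})) (top_of_set C) k"
  by (auto simp: continuous_map_in_subtopology)
 then have "continuous_map (top_of_set ({0..1} \<times> {0..1})) X (h \<circ> k)" using h by (rule continuous_map_compose)
 moreover have "prod_topology (top_of_set {0..1::real}) (top_of_set {0..1::real}) = top_of_set ({0..1} \<times> {0..1})"
  by (simp add: prod_topology_subtopology subtopology_subtopology euclidean_product_topology) (simp add: Times_Int_Times)
 ultimately have "continuous_map (prod_topology (top_of_set {0..1}) (top_of_set {0..1})) X (h \<circ> k)" by simp
 moreover have "k (0, t) = f t" "k (1, t) = g t" for t by (simp_all add: k_def)
 moreover have "k (t, 0) = f 0" "k (t, 1) = f 1" for t by (simp_all add: k_def ends flip: scaleR_add_left)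
 ultimately show ?thesis unfolding path_equiv_def homotopic_with_def by (intro exI[of _ "h \<circ> k"]) simp
qed

lemma path_equiv_reparametrize:
 assumes h: "pathin X h" and f: "continuous_on {0..1} f" "\<And>t. 0 \<le> t \<Longrightarrow> t \<le> 1 \<Longrightarrow> 0 \<le> f t \<and> f t \<le> 1" "f 0 = 0" "f 1 = 1"
 shows "path_equiv X (h \<circ> f) h"
proof -
 have "path_equiv X (h \<circ> f) (h \<circ> (\<lambda>t. t))"
  by (rule path_equiv_convex[of "{0..1 :: real}"]) (use assms in \<open>auto simp: pathin_def\<close>)
 then show ?thesis by (simp add: comp_def)
qed

lemma path_equiv_concat:
 assumes p: "path_equiv X p p'" and q: "path_equiv X q q'" and pq: "p 1 = q 0"
 shows "path_equiv X (concat_path p q) (concat_path p' q')"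
proof -
 let ?I = "top_of_set {0..1 :: real}"
 obtain h where h: "continuous_map (prod_topology ?I ?I) X h" "\<And>t. h (0, t) = p t" "\<And>t. h (1, t) = p' t"
   "\<And>s. s \<in> {0..1} \<Longrightarrow> h (s, 0) = p 0 \<and> h (s, 1) = p 1"
  using p unfolding path_equiv_def homotopic_with_def by auto
 obtain k where k: "continuous_map (prod_topology ?I ?I) X k" "\<And>t. k (0, t) = q t" "\<And>t. k (1, t) = q' t"
   "\<And>s. s \<in> {0..1} \<Longrightarrow> k (s, 0) = q 0 \<and> k (s, 1) = q 1"
  using q unfolding path_equiv_def homotopic_with_def by auto
 have I: "prod_topology ?I ?I = top_of_set ({0..1} \<times> {0..1})"
  by (simp add: prod_topology_subtopology subtopology_subtopology euclidean_product_topology) (simp add: Times_Int_Times)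
 define K where "K = (\<lambda>z. if snd z \<le> 1/2 then (h \<circ> (\<lambda>z. (fst z, 2 * snd z))) z else (k \<circ> (\<lambda>z. (fst z, 2 * snd z - 1))) z)"
 have "continuous_map (top_of_set ({0..1} \<times> {0..1})) X K"
  unfolding K_def
 proof (rule continuous_map_cases_le)
  have "continuous_map (subtopology (top_of_set ({0..1} \<times> {0..1})) {x \<in> topspace (top_of_set ({0..1} \<times> {0..1})). snd x \<le> 1/2})
    (top_of_set ({0..1} \<times> {0..1})) (\<lambda>z :: real \<times> real. (fst z, 2 * snd z))"
   by (auto simp: continuous_map_in_subtopology subtopology_subtopology intro!: continuous_intros)
  then show "continuous_map (subtopology (top_of_set ({0..1} \<times> {0..1})) {x \<in> topspace (top_of_set ({0..1} \<times> {0..1})). snd x \<le> 1/2})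
    X (h \<circ> (\<lambda>z. (fst z, 2 * snd z)))"
   using h(1) unfolding I by (rule continuous_map_compose)
  have "continuous_map (subtopology (top_of_set ({0..1} \<times> {0..1})) {x \<in> topspace (top_of_set ({0..1} \<times> {0..1})). 1/2 \<le> snd x})
    (top_of_set ({0..1} \<times> {0..1})) (\<lambda>z :: real \<times> real. (fst z, 2 * snd z - 1))"
   by (auto simp: continuous_map_in_subtopology subtopology_subtopology intro!: continuous_intros)
  then show "continuous_map (subtopology (top_of_set ({0..1} \<times> {0..1})) {x \<in> topspace (top_of_set ({0..1} \<times> {0..1})). 1/2 \<le> snd x})
    X (k \<circ> (\<lambda>z. (fst z, 2 * snd z - 1)))"
   using k(1) unfolding I by (rule continuous_map_compose)
  show "(h \<circ> (\<lambda>z. (fst z, 2 * snd z))) z = (k \<circ> (\<lambda>z. (fst z, 2 * snd z - 1))) z"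
   if "z \<in> topspace (top_of_set ({0..1} \<times> {0..1}))" "snd z = 1/2" for z
  proof -
   have e: "2 * snd z = 1" "fst z \<in> {0..1}" using that by auto
   show ?thesis using h(4)[OF e(2)] k(4)[OF e(2)] pq by (simp add: e(1))
  qed
 qed (auto intro!: continuous_intros)
 moreover have "K (0, t) = concat_path p q t" "K (1, t) = concat_path p' q' t" for t
  by (simp_all add: K_def concat_path_def h(2,3) k(2,3))
 moreover have "K (s, 0) = concat_path p q 0" "K (s, 1) = concat_path p q 1" if "s \<in> {0..1}" for s
  using h(4)[OF that] k(4)[OF that] by (simp_all add: K_def concat_path_def)
 ultimately show ?thesis unfolding path_equiv_def homotopic_with_def I by (intro exI[of _ K]) simp
qed

lemma path_concat:
 assumes "path_from_to X x y p" "path_from_to X y z q"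
 shows "path_from_to X x z (concat_path p q)"
proof -
 have "path_equiv X (concat_path p q) (concat_path p q)"
  using assms by (intro path_equiv_concat path_equiv_refl) (auto simp: path_from_to_def)
 then show ?thesis using assms path_equiv_pathin by (auto simp: path_from_to_def concat_path_def)
qed

lemma path_const: "x \<in> topspace X \<Longrightarrow> path_from_to X x x (\<lambda>_. x)"
 by (simp add: path_from_to_def pathin_def)

lemma path_reverse: "path_from_to X x y p \<Longrightarrow> path_from_to X y x (\<lambda>t. p (1 - t))"
proof -
 assume p: "path_from_to X x y p"
 have "continuous_map (top_of_set {0..1}) (top_of_set {0..1}) (\<lambda>t :: real. 1 - t)"
  by (auto simp: continuous_map_in_subtopology intro!: continuous_intros)
 moreover have "continuous_map (top_of_set {0..1}) X p" using p by (simp add: path_from_to_def pathin_def)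
 ultimately have "continuous_map (top_of_set {0..1}) X (p \<circ> (\<lambda>t. 1 - t))" by (rule continuous_map_compose)
 then show ?thesis using p by (simp add: path_from_to_def pathin_def comp_def)
qed

lemma path_equiv_concat_cong:
 assumes "path_from_to X x y p" "path_from_to X y z q" "path_equiv X p p'" "path_equiv X q q'"
 shows "path_equiv X (concat_path p q) (concat_path p' q')"
 using assms by (intro path_equiv_concat) (auto simp: path_from_to_def)

lemma path_equiv_assoc:
 assumes "path_from_to X x y p" "path_from_to X y z q" "path_from_to X z u s"
 shows "path_equiv X (concat_path (concat_path p q) s) (concat_path p (concat_path q s))"
proof -
 \<comment> \<open>The piecewise linear reparametrisation with breaks at 1/4 and 1/2, written as a
   minimum so that its continuity is immediate.\<close>
 define f where "f t = min (2 * t) (min (t + 1/4) ((1 + t) / 2))" for t :: real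
 have "path_from_to X x u (concat_path p (concat_path q s))" using assms path_concat by metis
 then have "path_equiv X (concat_path p (concat_path q s) \<circ> f) (concat_path p (concat_path q s))"
  unfolding f_def by (intro path_equiv_reparametrize) (auto simp: path_from_to_def min_le_iff_disj intro!: continuous_intros)
 moreover have "concat_path p (concat_path q s) \<circ> f = concat_path (concat_path p q) s"
 proof
  fix t :: real
  consider "t \<le> 1/4" | "1/4 < t" "t \<le> 1/2" | "1/2 < t" by linarith
  then show "(concat_path p (concat_path q s) \<circ> f) t = concat_path (concat_path p q) s t"
  proof cases
   case 1
   then have "f t = 2 * t" by (simp add: f_def min_def)
   then show ?thesis using 1 by (simp add: concat_path_def)
  next
   case 2
   then have "f t = t + 1/4" by (simp add: f_def min_def)
   then show ?thesis using 2 by (simp add: concat_path_def field_simps)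
  next
   case 3
   then have "f t = (1 + t) / 2" by (simp add: f_def min_def)
   then show ?thesis using 3 by (simp add: concat_path_def field_simps)
  qed
 qed
 ultimately show ?thesis by simp
qed

lemma path_equiv_const_left:
 assumes "path_from_to X x y p"
 shows "path_equiv X (concat_path (\<lambda>_. x) p) p"
proof -
 have "path_equiv X (p \<circ> (\<lambda>t. max 0 (2 * t - 1))) p"
  using assms by (intro path_equiv_reparametrize) (auto simp: path_from_to_def intro!: continuous_intros)
 moreover have "p \<circ> (\<lambda>t. max 0 (2 * t - 1)) = concat_path (\<lambda>_. x) p"
 proof -
  have "max 0 (2 * t - 1) = (if t \<le> 1/2 then 0 else 2 * t - 1)" for t :: real by auto
  then show ?thesis using assms by (simp add: fun_eq_iff concat_path_def path_from_to_def)
 qed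
 ultimately show ?thesis by simp
qed

lemma path_equiv_const_right:
 assumes "path_from_to X x y p"
 shows "path_equiv X (concat_path p (\<lambda>_. y)) p"
proof -
 have "path_equiv X (p \<circ> (\<lambda>t. min (2 * t) 1)) p"
  using assms by (intro path_equiv_reparametrize) (auto simp: path_from_to_def intro!: continuous_intros)
 moreover have "p \<circ> (\<lambda>t. min (2 * t) 1) = concat_path p (\<lambda>_. y)"
 proof -
  have "min (2 * t) 1 = (if t \<le> 1/2 then 2 * t else 1)" for t :: real by auto
  then show ?thesis using assms by (simp add: fun_eq_iff concat_path_def path_from_to_def)
 qed
 ultimately show ?thesis by simp
qed

lemma path_equiv_cancel:
 assumes "path_from_to X x y p"
 shows "path_equiv X (concat_path (\<lambda>t. p (1 - t)) p) (\<lambda>_. y)"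
proof -
 have 1: "path_equiv X (p \<circ> (\<lambda>t. \<bar>2 * t - 1\<bar>)) (p \<circ> (\<lambda>t. 1))"
  by (rule path_equiv_convex[of "{0..1 :: real}"])
   (use assms in \<open>auto simp: path_from_to_def pathin_def intro!: continuous_intros\<close>)
 have 2: "p \<circ> (\<lambda>t. \<bar>2 * t - 1\<bar>) = concat_path (\<lambda>t. p (1 - t)) p"
 proof -
  have "\<bar>2 * t - 1\<bar> = (if t \<le> 1/2 then 1 - 2 * t else 2 * t - 1)" for t :: real by auto
  then show ?thesis by (simp add: fun_eq_iff concat_path_def)
 qed
 have 3: "p \<circ> (\<lambda>t. 1) = (\<lambda>_. y)" using assms by (auto simp: path_from_to_def)
 from 1 show ?thesis unfolding 2 3 .
qed

text \<open>\<open>(g p h\<^sup>-\<^sup>1) (h q k\<^sup>-\<^sup>1) = g (p q) k\<^sup>-\<^sup>1\<close>\<close>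

lemma path_equiv_whiskers:
 assumes g: "path_from_to X x u g" and p: "path_from_to X u v p" and h: "path_from_to X x v h"
  and q: "path_from_to X v w q" and k: "path_from_to X w x k" and pq: "path_equiv X (concat_path p q) s"
 shows "path_equiv X (concat_path (concat_path g (concat_path p (\<lambda>t. h (1 - t)))) (concat_path h (concat_path q k)))
  (concat_path g (concat_path s k))"
proof -
 note h' = path_reverse[OF h]
 let ?h' = "\<lambda>t. h (1 - t)" and ?c = "concat_path"
 note pq' = path_concat[OF p q] and qk = path_concat[OF q k]
 note refl = path_equiv_refl
 have pin: "pathin X p" "pathin X g" "pathin X k" "pathin X h" "pathin X (?c q k)" "pathin X ?h'"
  using p g k h qk h' by (auto simp: path_from_to_def)
 have 1: "path_equiv X (?c ?h' (?c h (?c q k))) (?c q k)"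
 proof -
  have "path_equiv X (?c (?c ?h' h) (?c q k)) (?c (\<lambda>_. v) (?c q k))"
   by (rule path_equiv_concat_cong[OF path_concat[OF h' h] qk path_equiv_cancel[OF h] refl[OF pin(5)]])
  from path_equiv_trans[OF path_equiv_sym[OF path_equiv_assoc[OF h' h qk]] path_equiv_trans[OF this path_equiv_const_left[OF qk]]]
  show ?thesis .
 qed
 have hqk: "path_from_to X x x (?c h (?c q k))" by (rule path_concat[OF h qk])
 have "path_equiv X (?c (?c p ?h') (?c h (?c q k))) (?c p (?c q k))"
  by (rule path_equiv_trans[OF path_equiv_assoc[OF p h' hqk] path_equiv_concat_cong[OF p path_concat[OF h' hqk] refl[OF pin(1)] 1]])
 also note path_equiv_sym[OF path_equiv_assoc[OF p q k]]
 finally (path_equiv_trans) have 2: "path_equiv X (?c (?c p ?h') (?c h (?c q k))) (?c (?c p q) k)" .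
 have 3: "path_equiv X (?c (?c p q) k) (?c s k)" by (rule path_equiv_concat_cong[OF pq' k pq refl[OF pin(3)]])
 note 4 = path_equiv_trans[OF 2 3]
 show ?thesis
  by (rule path_equiv_trans[OF path_equiv_assoc[OF g path_concat[OF p h'] hqk]
    path_equiv_concat_cong[OF g path_concat[OF path_concat[OF p h'] hqk] refl[OF pin(2)] 4]])
qed

lemma loop_class_eq:
 assumes "path_from_to X x x p"
 shows "loop_class X x p = {q. path_equiv X p q}"
 using assms by (simp add: loop_class_def path_equiv_def path_from_to_def)

lemma loop_class_cong:
 assumes "path_from_to X x x p" "path_equiv X p q"
 shows "loop_class X x p = loop_class X x q"
 unfolding loop_class_eq[OF assms(1)] loop_class_eq[OF path_equiv_path[OF assms(2,1)]]
 using path_equiv_trans path_equiv_sym assms(2) by blast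

text \<open>The product in \<open>fundamental_group\<close> is a union over all representatives;
  since concatenation respects homotopy, every member of the union is the same class.\<close>

lemma loop_class_mult:
 assumes "path_from_to X x x p" "path_from_to X x x q"
 shows "loop_class X x p \<otimes>\<^bsub>fundamental_group X x\<^esub> loop_class X x q = loop_class X x (concat_path p q)"
proof -
 have "loop_class X x (concat_path p' q') = loop_class X x (concat_path p q)"
  if "p' \<in> loop_class X x p" "q' \<in> loop_class X x q" for p' q'
  using that path_equiv_concat_cong[OF assms, of p' q'] loop_class_cong[OF path_concat[OF assms]]
  unfolding loop_class_eq[OF assms(1)] loop_class_eq[OF assms(2)] by auto
 moreover have "p \<in> loop_class X x p" "q \<in> loop_class X x q"
  unfolding loop_class_eq[OF assms(1)] loop_class_eq[OF assms(2)]
  using assms path_equiv_refl by (auto simp: path_from_to_def)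
 moreover have "(\<Union>u\<in>A. \<Union>v\<in>B. g u v) = c" if gc: "\<And>u v. u \<in> A \<Longrightarrow> v \<in> B \<Longrightarrow> g u v = c" and pq: "p \<in> A" "q \<in> B"
  for A B c and g :: "_ \<Rightarrow> _ \<Rightarrow> (real \<Rightarrow> 'a) set"
 proof (rule SUP_eq_const)
  show "A \<noteq> {}" using pq(1) by blast
  show "(\<Union>v\<in>B. g u v) = c" if u: "u \<in> A" for u
  proof (rule SUP_eq_const)
   show "B \<noteq> {}" using pq(2) by blast
  qed (rule gc[OF u])
 qed
 ultimately show ?thesis unfolding fundamental_group_def monoid.simps by blast
qed

section \<open>Singular simplices as paths\<close>

definition edge_point :: "real \<Rightarrow> nat \<Rightarrow> real" where
 "edge_point t i = (if i = 0 then 1 - t else if i = 1 then t else 0)"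

definition simplex_path :: "((nat \<Rightarrow> real) \<Rightarrow> 'x) \<Rightarrow> real \<Rightarrow> 'x" where
 "simplex_path e t = e (edge_point t)"

lemma simplex_path_triangle:
 assumes s: "singular_simplex 2 X s"
 shows "path_equiv X (concat_path (simplex_path (singular_face 2 2 s)) (simplex_path (singular_face 2 0 s)))
   (simplex_path (singular_face 2 1 s))"
  and "simplex_path (singular_face 2 2 s) 1 = simplex_path (singular_face 2 0 s) 0"
  and "simplex_path (singular_face 2 1 s) 0 = simplex_path (singular_face 2 2 s) 0"
  and "simplex_path (singular_face 2 1 s) 1 = simplex_path (singular_face 2 0 s) 1"
proof -
 define C where "C = {z :: real \<times> real. 0 \<le> fst z \<and> 0 \<le> snd z \<and> fst z + snd z \<le> 1}"
 define k where "k z i = (if i = 0 then 1 - fst z - snd z else if i = 1 then fst z else if i = 2 then snd z else 0)"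
  for z :: "real \<times> real" and i :: nat
 define h where "h = s \<circ> k"
 have "C = {z. (1, 0) \<bullet> z \<ge> 0} \<inter> {z. (0, 1) \<bullet> z \<ge> 0} \<inter> {z. (1, 1) \<bullet> z \<le> 1}"
  by (auto simp: C_def)
 then have C: "convex C" by (simp only:) (intro convex_Int convex_halfspace_ge convex_halfspace_le)
 have kC: "k z \<in> standard_simplex 2" if "z \<in> C" for z
  using that by (auto simp: C_def k_def standard_simplex_def numeral_2_eq_2)
 have "continuous_on C (\<lambda>z. k z i)" for i
  by (cases "i = 0"; cases "i = 1"; cases "i = 2") (auto simp: k_def intro!: continuous_intros)
 then have "continuous_map (top_of_set C) (powertop_real UNIV) k"
  by (simp add: continuous_map_componentwise_UNIV)
 then have "continuous_map (top_of_set C) (subtopology (powertop_real UNIV) (standard_simplex 2)) k"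
  using kC by (auto simp: continuous_map_in_subtopology)
 moreover have "continuous_map (subtopology (powertop_real UNIV) (standard_simplex 2)) X s"
  using s by (simp add: singular_simplex_def)
 ultimately have h: "continuous_map (top_of_set C) X h" unfolding h_def by (rule continuous_map_compose)
 have e: "edge_point t \<in> standard_simplex 1" if "0 \<le> t" "t \<le> 1" for t
  using that by (auto simp: edge_point_def standard_simplex_def)
 have v: "simplical_face 2 (edge_point t) = k (t, 0)" "simplical_face 0 (edge_point t) = k (1 - t, t)"
  "simplical_face 1 (edge_point t) = k (0, t)" for t
  by (auto simp: fun_eq_iff simplical_face_def edge_point_def k_def numeral_2_eq_2 split: nat.splits)
 have f: "simplex_path (singular_face 2 2 s) t = h (t, 0)" "simplex_path (singular_face 2 0 s) t = h (1 - t, t)"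
  "simplex_path (singular_face 2 1 s) t = h (0, t)" if "0 \<le> t" "t \<le> 1" for t
  using e[OF that] by (simp_all add: simplex_path_def singular_face_def v[unfolded One_nat_def] h_def)
 show "simplex_path (singular_face 2 2 s) 1 = simplex_path (singular_face 2 0 s) 0"
  "simplex_path (singular_face 2 1 s) 0 = simplex_path (singular_face 2 2 s) 0"
  "simplex_path (singular_face 2 1 s) 1 = simplex_path (singular_face 2 0 s) 1"
  using f[of 0] f[of 1] by simp_all
 \<comment> \<open>In the barycentric coordinates of the vertices 1 and 2 this path follows the
   sides from 0 to 1 and from 1 to 2. It is contracted inside the triangle to the side from 0 to
   2.\<close>
 define f where "f t = (min (2 * t) (2 - 2 * t), max 0 (2 * t - 1))" for t :: real
 have "path_equiv X (h \<circ> f) (h \<circ> (\<lambda>t. (0, t)))"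
  by (rule path_equiv_convex[OF C h]) (auto simp: f_def C_def intro!: continuous_intros)
 moreover have "path_equiv X (h \<circ> f) (concat_path (simplex_path (singular_face 2 2 s)) (simplex_path (singular_face 2 0 s)))"
 proof (rule path_equiv_eq)
  show "pathin X (h \<circ> f)" by (rule path_equiv_pathin[OF path_equiv_sym[OF calculation]])
  fix t :: real assume t: "0 \<le> t" "t \<le> 1"
  show "concat_path (simplex_path (singular_face 2 2 s)) (simplex_path (singular_face 2 0 s)) t = (h \<circ> f) t"
  proof -
   have "f t = (if t \<le> 1/2 then (2 * t, 0) else (2 - 2 * t, 2 * t - 1))" by (auto simp: f_def)
   then show ?thesis using t f(1)[of "2 * t"] f(2)[of "2 * t - 1"] by (simp add: concat_path_def)
  qed
 qed
 moreover have "path_equiv X (h \<circ> (\<lambda>t. (0, t))) (simplex_path (singular_face 2 1 s))"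
  by (rule path_equiv_eq[OF path_equiv_pathin[OF calculation(1)]]) (simp only: comp_def f(3))
 ultimately show "path_equiv X (concat_path (simplex_path (singular_face 2 2 s)) (simplex_path (singular_face 2 0 s)))
   (simplex_path (singular_face 2 1 s))"
  using path_equiv_trans path_equiv_sym by blast
qed

lemma pathin_simplex_path:
 assumes "singular_simplex 1 X e"
 shows "pathin X (simplex_path e)"
proof -
 have "continuous_map (top_of_set {0..1}) (powertop_real UNIV) edge_point"
 proof (simp add: continuous_map_componentwise_UNIV, intro allI)
  show "continuous_on {0..1} (\<lambda>t. edge_point t i)" for i
   by (cases "i = 0"; cases "i = 1") (auto simp: edge_point_def intro!: continuous_intros)
 qed
 then have "continuous_map (top_of_set {0..1}) (subtopology (powertop_real UNIV) (standard_simplex 1)) edge_point"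
  by (auto simp: continuous_map_in_subtopology edge_point_def standard_simplex_def)
 moreover have "continuous_map (subtopology (powertop_real UNIV) (standard_simplex 1)) X e"
  using assms by (simp add: singular_simplex_def)
 ultimately have "continuous_map (top_of_set {0..1}) X (e \<circ> edge_point)" by (rule continuous_map_compose)
 then show ?thesis by (simp add: pathin_def simplex_path_def[abs_def] comp_def)
qed

section \<open>The lower bound for the simplicial volume\<close>

lemma normal_normal_closure:
 fixes G (structure)
 assumes "group G" "R \<subseteq> carrier G"
 shows "normal_closure G R \<lhd> G"
proof -
 interpret group G by fact
 show ?thesis
  unfolding normal_closure_def
 proof (rule normal_generateI)
  show "{g \<otimes> x \<otimes> inv g | g x. g \<in> carrier G \<and> x \<in> R} \<subseteq> carrier G"
   using assms(2) by auto
  fix h k assume h: "h \<in> {g \<otimes> x \<otimes> inv g | g x. g \<in> carrier G \<and> x \<in> R}" and k: "k \<in> carrier G"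
  obtain g x where gx: "h = g \<otimes> x \<otimes> inv g" "g \<in> carrier G" "x \<in> R" using h by blast
  have "x \<in> carrier G" using gx(3) assms(2) by blast
  then have "k \<otimes> h \<otimes> inv k = (k \<otimes> g) \<otimes> x \<otimes> inv (k \<otimes> g)"
   using gx(2) k by (simp add: gx(1) inv_mult_group m_assoc)
  with gx(2,3) k show "k \<otimes> h \<otimes> inv k \<in> {g \<otimes> x \<otimes> inv g | g x. g \<in> carrier G \<and> x \<in> R}"
   by (intro CollectI) (rule exI[of _ "k \<otimes> g"], rule exI[of _ x], simp)
 qed
qed

lemma normal_closure_rel:
 assumes r: "r \<in> carrier (free_group S)" and w: "w \<in> normal_closure (free_group S) {r}"
 shows "\<exists>n. rel r n w"
proof -
 interpret group "free_group S" by (rule group_free_group)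
 let ?H = "{g \<otimes>\<^bsub>free_group S\<^esub> x \<otimes>\<^bsub>free_group S\<^esub> inv\<^bsub>free_group S\<^esub> g | g x. g \<in> carrier (free_group S) \<and> x \<in> {r}}"
 have H: "h \<in> carrier (free_group S) \<and> rel r 1 h" if hH: "h \<in> ?H" for h
 proof -
  obtain g where g: "h = g \<otimes>\<^bsub>free_group S\<^esub> r \<otimes>\<^bsub>free_group S\<^esub> inv\<^bsub>free_group S\<^esub> g" "g \<in> carrier (free_group S)" using hH by blast
  have "reduced (winv g)" "reduced r" using g(2) r by (simp_all add: free_group_simps(1) reduced_winv)
  then have "h = wval (g @ r @ winv g)"
   unfolding g(1) by (simp add: inv_free_group[OF g(2)] free_group_simps(2) wval_append_wval)
  then have "rel r 1 h" using rel_conj[OF rel_relator(1), of r g] rel_cong[of h "g @ r @ winv g"] by simp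
  then show ?thesis using g r by simp
 qed
 have "w \<in> carrier (free_group S) \<and> (\<exists>n. rel r n w)"
  using w unfolding normal_closure_def
 proof (induction rule: generate.induct)
  case one
  have "rel r 0 \<one>\<^bsub>free_group S\<^esub>" by (simp add: free_group_simps(3) rel_Nil wval_def)
  then show ?case by auto
 next
  case (incl h)
  then show ?case using H by blast
 next
  case (inv h)
  then show ?case using H[OF inv] rel_winv[of r 1 h] by (auto simp: inv_free_group simp flip: inv_free_group)
 next
  case (eng h k)
  then obtain n l where "rel r n h" "rel r l k" by blast
  then have "rel r (n + l) (h @ k)" by (rule rel_append)
  then have "rel r (n + l) (wval (h @ k))" using rel_cong[of "wval (h @ k)" "h @ k"] by simp
  moreover have "h \<otimes>\<^bsub>free_group S\<^esub> k = wval (h @ k)" using eng by (simp add: free_group_simps(1,2))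
  moreover have "h \<otimes>\<^bsub>free_group S\<^esub> k \<in> carrier (free_group S)" using eng by blast
  ultimately show ?case by metis
 qed
 then show ?thesis by blast
qed

lemma es_simplex:
 assumes "r \<in> carrier (free_group S)" "over S u"
 shows "singular_simplex 1 (presentation_complex S r) (es u)"
proof -
 have "singular_simplex 2 (presentation_complex S r) (tri u 0 (length u) (length u))"
  using tri_simplex[OF assms] by (simp add: singular_simplex_subtopology)
 then have "singular_simplex 1 (presentation_complex S r) (singular_face 2 2 (tri u 0 (length u) (length u)))"
  using singular_simplex_singular_face[of 2 _ _ 2] by simp
 then show ?thesis using tri_pos_faces(1)[of u "[]"] by simp
qed

lemma face_simplex_map: "k \<le> 2 \<Longrightarrow> singular_face 2 k (simplex_map 2 c s) = simplex_map 1 c (singular_face 2 k s)"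
 using simplical_face_in_standard_simplex[of 2 k] by (auto simp: simplex_map_def singular_face_def fun_eq_iff)

text \<open>Every edge is closed up to a loop by chosen paths from the base point, and the class of
  the loop is pulled back along \<open>\<phi>\<close> to a word. Around a triangle the loops
  multiply to the trivial class, so the word of the boundary lies in the normal closure and has a
  degree.\<close>

lemma exists_labels:
 assumes r: "r \<in> carrier (free_group S)" and cont: "continuous_map (presentation_complex S r) X c"
  and conn: "path_connected_space X"
  and \<phi>: "\<phi> \<in> iso (one_relator_group S r) (fundamental_group X (c Vertex))"
  and gens: "\<And>s. s \<in> S \<Longrightarrow> \<phi> (normal_closure (free_group S) {r} #>\<^bsub>free_group S\<^esub> gen s) = loop_class X (c Vertex) (c \<circ> edge_map s)"
 shows "\<exists>f. (\<forall>\<sigma>. singular_simplex 2 X \<sigma> \<longrightarrow>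
    (\<exists>n. rel r n (f (singular_face 2 2 \<sigma>) @ f (singular_face 2 0 \<sigma>) @ winv (f (singular_face 2 1 \<sigma>))))) \<and>
   (\<forall>s\<in>S. \<exists>n. rel r n (f (simplex_map 1 c (es [(s, True)])) @ winv [(s, True)]))"
proof -
 define F where "F = free_group S"
 define N where "N = normal_closure F {r}"
 define x0 where "x0 = c Vertex"
 interpret group F unfolding F_def by (rule group_free_group)
 have rF: "{r} \<subseteq> carrier F" using r by (simp add: F_def)
 interpret N: normal N F unfolding N_def by (rule normal_normal_closure[OF group_axioms rF])
 have sg: "subgroup N F" by (rule N.subgroup_axioms)
 have x0: "x0 \<in> topspace X"
  using continuous_map_image_subset_topspace[OF cont] topspace_presentation_complex[OF r]
  by (auto simp: x0_def pc_points_def pc_skeleton_def)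
 \<comment> \<open>The constant path at the base point ensures that a loop at the base point is
   labelled by its own class; this determines the labels of the 1-cells.\<close>
 define \<gamma> where "\<gamma> x = (if x = x0 then (\<lambda>_. x0) else (SOME g. path_from_to X x0 x g))" for x
 have \<gamma>: "path_from_to X x0 x (\<gamma> x)" if "x \<in> topspace X" for x
 proof (cases "x = x0")
  case True
  then show ?thesis using path_const[OF x0] by (simp add: \<gamma>_def)
 next
  case False
  have "\<exists>g. path_from_to X x0 x g"
   using conn x0 that unfolding path_connected_space_def path_from_to_def by blast
  then show ?thesis using False by (simp add: \<gamma>_def someI_ex[of "path_from_to X x0 x"])
 qed
 define L where "L e = concat_path (\<gamma> (simplex_path e 0)) (concat_path (simplex_path e) (\<lambda>t. \<gamma> (simplex_path e 1) (1 - t)))" for e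
 have sp: "path_from_to X (simplex_path e 0) (simplex_path e 1) (simplex_path e)" "simplex_path e 0 \<in> topspace X" "simplex_path e 1 \<in> topspace X"
  if "singular_simplex 1 X e" for e
  using pathin_simplex_path[OF that] by (auto simp: path_from_to_def pathin_def continuous_map_def Pi_iff)
 have L: "path_from_to X x0 x0 (L e)" if "singular_simplex 1 X e" for e
  unfolding L_def by (rule path_concat[OF \<gamma>[OF sp(2)[OF that]] path_concat[OF sp(1)[OF that] path_reverse[OF \<gamma>[OF sp(3)[OF that]]]]])
 have bij: "bij_betw \<phi> (carrier (F Mod N)) (carrier (fundamental_group X x0))"
  and hom: "\<phi> \<in> hom (F Mod N) (fundamental_group X x0)"
  using \<phi> by (simp_all add: iso_def one_relator_group_def F_def N_def x0_def)
 have rc: "carrier (F Mod N) = {N #>\<^bsub>F\<^esub> w | w. w \<in> carrier F}"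
  by (auto simp: FactGroup_def RCOSETS_def)
 have "\<exists>w. w \<in> carrier F \<and> \<phi> (N #>\<^bsub>F\<^esub> w) = loop_class X x0 (L e)" if "singular_simplex 1 X e" for e
 proof -
  have "loop_class X x0 (L e) \<in> carrier (fundamental_group X x0)"
   using L[OF that] by (auto simp: fundamental_group_def path_from_to_def)
  then have "loop_class X x0 (L e) \<in> \<phi> ` carrier (F Mod N)" using bij by (simp add: bij_betw_def)
  then show ?thesis unfolding rc by auto
 qed
 then obtain f where f: "f e \<in> carrier F" "\<phi> (N #>\<^bsub>F\<^esub> f e) = loop_class X x0 (L e)" if "singular_simplex 1 X e" for e by metis
 \<comment> \<open>As \<open>\<phi>\<close> is injective on cosets, words with the same image differ
   by an element of the normal closure, that is by a product of conjugates of the relator and its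
   inverse.\<close>
 have coset: "\<exists>n. rel r n (u @ winv v)" if uv: "u \<in> carrier F" "v \<in> carrier F" "\<phi> (N #>\<^bsub>F\<^esub> u) = \<phi> (N #>\<^bsub>F\<^esub> v)" for u v
 proof -
  have "N #>\<^bsub>F\<^esub> u \<in> carrier (F Mod N)" "N #>\<^bsub>F\<^esub> v \<in> carrier (F Mod N)" unfolding rc using uv by auto
  then have "N #>\<^bsub>F\<^esub> u = N #>\<^bsub>F\<^esub> v" using bij uv(3) by (auto simp: bij_betw_def dest: inj_onD)
  then have "u \<in> N #>\<^bsub>F\<^esub> v" using rcos_self[OF uv(1) sg] by simp
  then have "u \<otimes>\<^bsub>F\<^esub> inv\<^bsub>F\<^esub> v \<in> N" by (rule N.rcos_module_imp[OF group_axioms uv(2)])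
  moreover have "u \<otimes>\<^bsub>F\<^esub> inv\<^bsub>F\<^esub> v = wval (u @ winv v)"
   using uv(1,2) unfolding F_def by (simp add: inv_free_group free_group_simps(1,2) reduced_winv)
  ultimately obtain n where "rel r n (wval (u @ winv v))"
   using normal_closure_rel[OF r, folded F_def N_def] unfolding N_def F_def by auto
  then show ?thesis using rel_cong[of "wval (u @ winv v)" "u @ winv v"] by auto
 qed
 have "\<exists>n. rel r n (f (singular_face 2 2 \<sigma>) @ f (singular_face 2 0 \<sigma>) @ winv (f (singular_face 2 1 \<sigma>)))"
  if \<sigma>: "singular_simplex 2 X \<sigma>" for \<sigma>
 proof -
  have s: "singular_simplex 1 X (singular_face 2 k \<sigma>)" if "k \<le> 2" for k
   using singular_simplex_singular_face[OF \<sigma> _ that] by simp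
  let ?e = "\<lambda>k. singular_face 2 k \<sigma>"
  have s0: "singular_simplex 1 X (?e 0)" and s1: "singular_simplex 1 X (?e 1)" and s2: "singular_simplex 1 X (?e 2)"
   by (rule s; simp)+
  note tr = simplex_path_triangle[OF \<sigma>]
  have p0: "path_from_to X (simplex_path (?e 2) 1) (simplex_path (?e 0) 1) (simplex_path (?e 0))"
   using sp(1)[OF s0] tr(2) by simp
  have "path_equiv X (concat_path (L (?e 2)) (L (?e 0))) (L (?e 1))"
   unfolding L_def tr(2)[symmetric] tr(3) tr(4)
   by (rule path_equiv_whiskers[OF \<gamma>[OF sp(2)[OF s2]] sp(1)[OF s2] \<gamma>[OF sp(3)[OF s2]] p0 path_reverse[OF \<gamma>[OF sp(3)[OF s0]]] tr(1)])
  then have "loop_class X x0 (L (?e 2)) \<otimes>\<^bsub>fundamental_group X x0\<^esub> loop_class X x0 (L (?e 0)) = loop_class X x0 (L (?e 1))"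
   using loop_class_mult[OF L[OF s2] L[OF s0]] loop_class_cong[OF path_concat[OF L[OF s2] L[OF s0]]] by simp
  moreover have "\<phi> (N #>\<^bsub>F\<^esub> (f (?e 2) \<otimes>\<^bsub>F\<^esub> f (?e 0))) = \<phi> (N #>\<^bsub>F\<^esub> f (?e 2)) \<otimes>\<^bsub>fundamental_group X x0\<^esub> \<phi> (N #>\<^bsub>F\<^esub> f (?e 0))"
  proof -
   have "N #>\<^bsub>F\<^esub> f (?e 2) \<in> carrier (F Mod N)" "N #>\<^bsub>F\<^esub> f (?e 0) \<in> carrier (F Mod N)"
    unfolding rc using f(1)[OF s2] f(1)[OF s0] by auto
   moreover have "(N #>\<^bsub>F\<^esub> f (?e 2)) \<otimes>\<^bsub>F Mod N\<^esub> (N #>\<^bsub>F\<^esub> f (?e 0)) = N #>\<^bsub>F\<^esub> (f (?e 2) \<otimes>\<^bsub>F\<^esub> f (?e 0))"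
    using N.rcos_sum[OF f(1)[OF s2] f(1)[OF s0]] by (simp add: FactGroup_def)
   ultimately show ?thesis using hom_mult[OF hom] by metis
  qed
  ultimately have "\<phi> (N #>\<^bsub>F\<^esub> (f (?e 2) \<otimes>\<^bsub>F\<^esub> f (?e 0))) = \<phi> (N #>\<^bsub>F\<^esub> f (?e 1))"
   by (simp only: f(2)[OF s2] f(2)[OF s0] f(2)[OF s1])
  from coset[OF m_closed[OF f(1)[OF s2] f(1)[OF s0]] f(1)[OF s1] this]
  obtain n where n: "rel r n ((f (?e 2) \<otimes>\<^bsub>F\<^esub> f (?e 0)) @ winv (f (?e 1)))" by blast
  have "f (?e 2) \<otimes>\<^bsub>F\<^esub> f (?e 0) = wval (f (?e 2) @ f (?e 0))"
   using f(1)[OF s0] unfolding F_def by (simp add: free_group_simps(1,2))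
  then have "rel r n (wval (f (?e 2) @ f (?e 0)) @ winv (f (?e 1)))" using n by simp
  then show ?thesis using rel_cong[OF wval_append_wval(1)[of "f (?e 2) @ f (?e 0)" "winv (f (?e 1))"]] by auto
 qed
 moreover have "\<exists>n. rel r n (f (simplex_map 1 c (es [(s, True)])) @ winv [(s, True)])" if s: "s \<in> S" for s
 proof -
  define e where "e = simplex_map 1 c (es [(s, True)])"
  have e: "singular_simplex 1 X e"
   unfolding e_def by (rule singular_simplex_simplex_map[OF es_simplex[OF r] cont]) (use s in simp)
  have et: "simplex_path e t = (c \<circ> edge_map s) t" if "0 \<le> t" "t \<le> 1" for t
  proof -
   have "edge_point t \<in> standard_simplex 1" using that by (auto simp: edge_point_def standard_simplex_def)
   moreover have "edge_point t 1 = t" by (simp add: edge_point_def)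
   ultimately show ?thesis by (simp add: simplex_path_def e_def simplex_map_def es_def wp_single letter_path_def)
  qed
  have ends: "simplex_path e 0 = x0" "simplex_path e 1 = x0" using et[of 0] et[of 1] by (simp_all add: edge_map_def x0_def)
  have p: "path_from_to X x0 x0 (simplex_path e)" using sp(1)[OF e] by (simp add: ends)
  note pin = path_equiv_refl[of X "\<lambda>_. x0"]
  have Le: "L e = concat_path (\<lambda>_. x0) (concat_path (simplex_path e) (\<lambda>_. x0))"
   by (simp add: L_def ends \<gamma>_def)
  have "path_equiv X (L e) (simplex_path e)"
   unfolding Le by (rule path_equiv_trans[OF path_equiv_const_left[OF path_concat[OF p path_const[OF x0]]] path_equiv_const_right[OF p]])
  moreover have "path_equiv X (simplex_path e) (c \<circ> edge_map s)"
   by (rule path_equiv_eq[OF pathin_simplex_path[OF e]]) (simp only: et)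
  ultimately have "loop_class X x0 (L e) = loop_class X x0 (c \<circ> edge_map s)"
   using loop_class_cong[OF L[OF e]] path_equiv_trans by blast
  then have "\<phi> (N #>\<^bsub>F\<^esub> f e) = \<phi> (N #>\<^bsub>F\<^esub> gen s)"
   using gens[OF s] f(2)[OF e] by (simp add: N_def F_def x0_def)
  moreover have "gen s \<in> carrier F" using s by (simp add: F_def free_group_simps(1) gen_def reduced_def)
  ultimately have "\<exists>n. rel r n (f e @ winv (gen s))" using coset[OF f(1)[OF e]] by blast
  then show ?thesis by (simp add: e_def gen_def)
 qed
 ultimately show ?thesis by blast
qed

section \<open>Pairing real chains with cochains\<close>

definition evaluate :: "(((nat \<Rightarrow> real) \<Rightarrow> 'x) \<Rightarrow> real) \<Rightarrow> 'x real_chain \<Rightarrow> real" where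
 "evaluate q d = (\<Sum>s\<in>keys d. lookup d s * q s)"

lemma evaluate_superset:
 assumes "finite A" "keys d \<subseteq> A"
 shows "evaluate q d = (\<Sum>s\<in>A. lookup d s * q s)"
 unfolding evaluate_def using assms by (intro sum.mono_neutral_left) (auto simp: in_keys_iff)

lemma evaluate_add: "evaluate q (y + z) = evaluate q y + evaluate q z"
proof -
 define A where "A = keys y \<union> keys z"
 have A: "finite A" "keys y \<subseteq> A" "keys z \<subseteq> A" "keys (y + z) \<subseteq> A"
  using Poly_Mapping.keys_add[of y z] by (auto simp: A_def)
 show ?thesis
  unfolding evaluate_superset[OF A(1,2)] evaluate_superset[OF A(1,3)] evaluate_superset[OF A(1,4)]
  by (simp add: lookup_add sum.distrib algebra_simps)
qed

lemma evaluate_diff: "evaluate q (y - z) = evaluate q y - evaluate q z"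
 using evaluate_add[of q "y - z" z] by simp

lemma evaluate_frag_of: "evaluate q (real_chain (frag_of s)) = q s"
 by (simp add: evaluate_def keys_real_chain lookup_real_chain)

text \<open>The adjunction between boundary and coboundary.\<close>

lemma evaluate_boundary:
 "evaluate q (real_chain_boundary p e) = evaluate (\<lambda>s. evaluate q (real_chain (chain_boundary p (frag_of s)))) e"
proof -
 define A where "A = keys (real_chain_boundary p e) \<union> (\<Union>s\<in>keys e. keys (chain_boundary p (frag_of s)))"
 have A: "finite A" "keys (real_chain_boundary p e) \<subseteq> A" by (auto simp: A_def)
 have A': "evaluate q (real_chain (chain_boundary p (frag_of s))) = (\<Sum>g\<in>A. real_of_int (lookup (chain_boundary p (frag_of s)) g) * q g)"
  if "s \<in> keys e" for s
  by (subst evaluate_superset[OF A(1)]) (use that in \<open>auto simp: A_def keys_real_chain lookup_real_chain\<close>)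
 have "evaluate q (real_chain_boundary p e) =
   (\<Sum>g\<in>A. \<Sum>s\<in>keys e. lookup e s * real_of_int (lookup (chain_boundary p (frag_of s)) g) * q g)"
  unfolding evaluate_superset[OF A] lookup_real_chain_boundary[OF finite_keys order_refl[of "keys e"]]
  by (simp add: sum_distrib_right)
 also have "\<dots> = (\<Sum>s\<in>keys e. \<Sum>g\<in>A. lookup e s * real_of_int (lookup (chain_boundary p (frag_of s)) g) * q g)"
  by (rule sum.swap)
 also have "\<dots> = (\<Sum>s\<in>keys e. lookup e s * evaluate q (real_chain (chain_boundary p (frag_of s))))"
  by (intro sum.cong refl) (simp add: A' sum_distrib_left mult.assoc)
 finally show ?thesis by (simp add: evaluate_def)
qed

lemma evaluate_zero: "(\<And>s. s \<in> keys e \<Longrightarrow> q s = 0) \<Longrightarrow> evaluate q e = 0"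
 by (simp add: evaluate_def)

text \<open>The cup product of the exponent cocycles of \<open>a\<close> and \<open>b\<close>.\<close>

definition cup :: "'s \<Rightarrow> 's \<Rightarrow> (((nat \<Rightarrow> real) \<Rightarrow> 'x) \<Rightarrow> 's word) \<Rightarrow> ((nat \<Rightarrow> real) \<Rightarrow> 'x) \<Rightarrow> real" where
 "cup a b f s = real_of_int (expo a (f (singular_face 2 2 s)) * expo b (f (singular_face 2 0 s)))"

text \<open>The cup product of two cocycles is a cocycle; the hypotheses \<open>add\<close> are the
  cocycle conditions for the exponents of \<open>a\<close> and of \<open>b\<close>.\<close>

lemma cup_boundary:
 assumes s: "singular_simplex 3 X s"
  and add: "\<And>t. singular_simplex 2 X t \<Longrightarrow> expo a (f (singular_face 2 1 t)) = expo a (f (singular_face 2 2 t)) + expo a (f (singular_face 2 0 t))"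
   "\<And>t. singular_simplex 2 X t \<Longrightarrow> expo b (f (singular_face 2 1 t)) = expo b (f (singular_face 2 2 t)) + expo b (f (singular_face 2 0 t))"
 shows "evaluate (cup a b f) (real_chain (chain_boundary 3 (frag_of s))) = 0"
proof -
 have t: "singular_simplex 2 X (singular_face 3 k s)" if "k \<le> 3" for k
  using singular_simplex_singular_face[OF s _ that] by simp
 have sf: "singular_face 2 j (singular_face 3 k s) = singular_face 2 (k - 1) (singular_face 3 j s)" if "j < k" "k \<le> 3" for j k
  using singular_face_face[of j k 2 s] that by simp
 note e = sf[of 0 1] sf[of 0 2] sf[of 0 3] sf[of 1 2] sf[of 1 3] sf[of 2 3]
 show ?thesis
  unfolding boundary_3 real_chain_diff real_chain_add evaluate_diff evaluate_add evaluate_frag_of cup_def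
  using e add(1)[OF t[of 0]] add(1)[OF t[of 1]] add(1)[OF t[of 2]] add(1)[OF t[of 3]]
   add(2)[OF t[of 0]] add(2)[OF t[of 1]] add(2)[OF t[of 2]] add(2)[OF t[of 3]]
  by (simp add: algebra_simps flip: of_int_mult)
qed

context
 fixes a b :: 's and m :: nat and r :: "'s word" and X :: "'x topology" and c :: "'s pc_point \<Rightarrow> 'x"
  and f :: "((nat \<Rightarrow> real) \<Rightarrow> 'x) \<Rightarrow> 's word"
 assumes ab: "a \<noteq> b" and m: "m \<ge> 2" and r_def: "r = rword a b m"
  and cont: "continuous_map (presentation_complex {a, b} r) X c"
  and triangle: "\<And>s. singular_simplex 2 X s \<Longrightarrow>
    \<exists>n. rel r n (f (singular_face 2 2 s) @ f (singular_face 2 0 s) @ winv (f (singular_face 2 1 s)))"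
  and generator: "\<And>s. s \<in> {a, b} \<Longrightarrow> \<exists>n. rel r n (f (simplex_map 1 c (es [(s, True)])) @ winv [(s, True)])"
begin

lemma relator_mem: "r \<in> carrier (free_group {a, b})"
 unfolding r_def by (rule relator_eq_rword(2)[OF ab]) (use m in simp)

lemma expo_triangle:
 assumes "singular_simplex 2 X t" "s \<in> {a, b}"
 shows "expo s (f (singular_face 2 1 t)) = expo s (f (singular_face 2 2 t)) + expo s (f (singular_face 2 0 t))"
proof -
 obtain n where "rel (rword a b m) n (f (singular_face 2 2 t) @ f (singular_face 2 0 t) @ winv (f (singular_face 2 1 t)))"
  using triangle[OF assms(1)] unfolding r_def by blast
 from rel_expo(1,2)[OF ab this] show ?thesis using assms(2) by auto
qed

text \<open>The triangles \<open>tri\<close> force the exponents of the labels to be additive in the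
  word and to change sign under inversion. On the generators they are correct because all conjugates
  of the relator have exponents 0.\<close>

lemma expo_edges:
 assumes s: "s \<in> {a, b}" and u: "over {a, b} u"
 shows "expo s (f (simplex_map 1 c (es u))) = expo s u"
proof -
 let ?g = "\<lambda>u. expo s (f (simplex_map 1 c (es u)))"
 have tri: "singular_simplex 2 X (simplex_map 2 c (tri w i j k))" if "over {a, b} w" for w i j k
  using singular_simplex_simplex_map[OF _ cont, of 2] tri_simplex[OF relator_mem that] by (simp add: singular_simplex_subtopology)
 have pos: "?g (u @ v) = ?g u + ?g v" if "over {a, b} (u @ v)" for u v
  using expo_triangle[OF tri[OF that, of 0 "length u" "length u + length v"] s] tri_pos_faces[of u v]
  by (simp add: face_simplex_map[unfolded One_nat_def])
 have neg: "?g q = ?g (q @ winv x) + ?g x" if "over {a, b} (q @ winv x)" for q x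
  using expo_triangle[OF tri[OF that, of 0 "length q + length x" "length q"] s] tri_neg_faces[of q x]
  by (simp add: face_simplex_map[unfolded One_nat_def])
 have nil: "?g [] = 0" using pos[of "[]" "[]"] by simp
 from u show ?thesis
 proof (induction u)
  case (Cons x u)
  obtain y \<epsilon> where x: "x = (y, \<epsilon>)" by (cases x)
  have y: "y \<in> {a, b}" using Cons.prems by (simp add: x)
  have gen: "?g [(y, True)] = expo s [(y, True)]"
  proof -
   obtain n where "rel (rword a b m) n (f (simplex_map 1 c (es [(y, True)])) @ winv [(y, True)])"
    using generator[OF y] unfolding r_def by blast
   from rel_expo(1,2)[OF ab this] show ?thesis using s by (auto simp del: expo_simps(3))
  qed
  have inv: "winv [(y, True)] = [(y, False)]" by (simp add: winv_def inv_letter_def)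
  have "?g [x] = expo s [x]"
  proof (cases \<epsilon>)
   case False
   have "?g [(y, False)] = - expo s [(y, True)]"
    using neg[of "[]" "[(y, True)]"] nil gen y by (simp add: inv)
   then show ?thesis using False by (simp add: x)
  qed (use gen x in simp)
  then show ?case using pos[of "[x]" u] Cons by simp
 qed (use nil in simp)
qed

text \<open>\<open>heis\<close> fails to be additive by products of exponents, and these are the
  values of the cup product on the triangles of the fan.\<close>

lemma evaluate_fan:
 assumes "over {a, b} u" "\<And>l. l \<in> set ls \<Longrightarrow> over {a, b} (fst l)"
 shows "evaluate (cup a b f) (real_chain (chain_map 2 c (fan u ls))) = real_of_int (heis a b (u @ concat (map letter_val ls)) - heis a b u
   - (\<Sum>l\<leftarrow>ls. if snd l then heis a b (fst l) else - heis a b (fst l)))"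
 using assms
proof (induction u ls rule: fan.induct)
 case (1 u)
 then show ?case by (simp add: evaluate_def keys_real_chain)
next
 case (2 u x s ls)
 have x: "over {a, b} x" using "2.prems"(2)[of "(x, s)"] by simp
 have o: "over {a, b} (u @ x)" "over {a, b} (u @ winv x)"
  using "2.prems"(1) x set_winv[of x] by (simp_all add: image_Un)
 have ls: "over {a, b} (fst l)" if "l \<in> set ls" for l using "2.prems"(2)[of l] that by simp
 have ex: "expo s (f (simplex_map 1 c (es v))) = expo s v" if "s \<in> {a, b}" "over {a, b} v" for s v
  by (rule expo_edges[OF that])
 show ?case
 proof (cases s)
  case True
  have "cup a b f (simplex_map 2 c (tri (u @ x) 0 (length u) (length u + length x))) = real_of_int (expo a u * expo b x)"
   using ex[of a u] ex[of b x] "2.prems"(1) x unfolding cup_def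
   by (simp add: face_simplex_map[unfolded One_nat_def] tri_pos_faces[of u x, unfolded One_nat_def])
  then show ?thesis
   using "2.IH"(1)[OF True o(1) ls] True
   by (simp add: chain_map_add real_chain_add evaluate_add evaluate_frag_of letter_val_def heis_append[of a b u x])
 next
  case False
  have "cup a b f (simplex_map 2 c (tri (u @ winv x) 0 (length u + length x) (length u))) = real_of_int ((expo a u - expo a x) * expo b x)"
   using ex[of a "u @ winv x"] ex[of b x] o(2) x unfolding cup_def
   by (simp add: face_simplex_map[unfolded One_nat_def] tri_neg_faces[of u x, unfolded One_nat_def])
  then show ?thesis
   using "2.IH"(2)[OF False o(2) ls] False
   by (simp add: chain_map_diff real_chain_diff evaluate_diff evaluate_frag_of letter_val_def heis_append[of a b u "winv x"] heis_winv[OF ab] algebra_simps)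
 qed
qed

lemma simplicial_volume_lower: "simplicial_volume {a, b} r X c \<ge> (2 * real m - 4) / (real m - 1)"
proof -
 let ?P = "presentation_complex {a, b} r"
 define cs where "cs = relator_pairs a b m"
 have rcs: "concat (map comm_word cs) = r" by (simp add: cs_def relator_pairs r_def)
 obtain d1 where d1: "singular_face 2 2 d1 = es r" "singular_face 2 0 d1 = es []" "singular_face 2 1 d1 = es []"
  "singular_relcycle 2 ?P {} (comm_cycle d1 cs)"
  "homologous_rel 2 ?P (pc_skeleton {a, b}) (comm_cycle d1 cs) (frag_of (face_simplex r))"
  unfolding cs_def by (rule relator_cycle[OF ab m r_def cont])
 define z where "z = chain_map 2 c (comm_cycle d1 cs)"
 have fc: "fundamental_class {a, b} r X c = homologous_rel_set 2 X {} z"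
  unfolding z_def by (rule fundamental_class_eq[OF ab m r_def cont d1(4,5)])
 have zX: "singular_chain 2 X z" "chain_boundary 2 z = 0"
  unfolding z_def using singular_relcycle_chain_map[OF d1(4) cont, of "{}"] by (simp_all add: singular_cycle)
 let ?E = "evaluate (cup a b f)"
 have E3: "?E (real_chain_boundary 3 e) = 0" if "real_singular_chain 3 X e" for e
  unfolding evaluate_boundary
 proof (rule evaluate_zero)
  fix s assume "s \<in> keys e"
  then have "singular_simplex 3 X s" using that by (auto simp: real_singular_chain_def)
  then show "?E (real_chain (chain_boundary 3 (frag_of s))) = 0"
   by (rule cup_boundary) (use expo_triangle in simp_all)
 qed
 have rS: "over {a, b} r" using relator_mem by (simp add: free_group_simps)
 \<comment> \<open>Only the fan contributes: the cup product vanishes on the disc and on the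
   constant triangle, since their last edges are constant. The sum over the sides cancels, so the
   value is \<open>heis a b r\<close>.\<close>
 have Ez: "?E (real_chain z) = 1 - real m"
 proof -
  define ls where "ls = concat (map comm_letters cs)"
  have 1: "?E (real_chain (chain_map 2 c (fan [] ls))) = real_of_int (heis a b ([] @ concat (map letter_val ls)) - heis a b []
    - (\<Sum>l\<leftarrow>ls. if snd l then heis a b (fst l) else - heis a b (fst l)))"
   by (rule evaluate_fan) (auto simp: ls_def cs_def relator_pairs_def comm_letters_def)
  have 2: "(\<Sum>l\<leftarrow>ls. if snd l then heis a b (fst l) else - heis a b (fst l)) = 0"
   by (simp add: ls_def cs_def relator_pairs_def comm_letters_def)
  have 3: "concat (map letter_val ls) = r" unfolding ls_def concat_comm_letters rcs ..
  have "?E (real_chain (chain_map 2 c (fan [] (concat (map comm_letters cs))))) = real_of_int (heis a b r)"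
   unfolding ls_def[symmetric] 1 2 3 by simp
  moreover have "cup a b f (simplex_map 2 c d1) = 0" "cup a b f (simplex_map 2 c (tri [] 0 0 0)) = 0"
   using expo_edges[of b "[]"] tri_pos_faces[of "[] :: 's word" "[]"] by (simp_all add: cup_def face_simplex_map[unfolded One_nat_def] d1)
  ultimately show ?thesis
   unfolding z_def comm_cycle_def chain_map_diff chain_map_add real_chain_diff real_chain_add evaluate_diff evaluate_add
   using rword_expo(3)[OF ab, of m] by (simp add: evaluate_frag_of r_def)
 qed
 have bound: "(2 * real m - 4) / (real m - 1) \<le> l1_norm d"
  if dm: "d \<in> change_of_coefficients 2 X (fundamental_class {a, b} r X c)" for d
 proof -
  obtain z' e where d: "real_singular_chain 2 X d" "real_chain_boundary 2 d = 0" "homologous_rel 2 X {} z z'"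
    "real_singular_chain (Suc 2) X e" "d - real_chain z' = real_chain_boundary (Suc 2) e"
   using dm unfolding change_of_coefficients_def fc real_chain_def by blast
  obtain y where y: "singular_chain (Suc 2) X y" "chain_boundary (Suc 2) y = z - z'"
   using d(3) unfolding homologous_rel_def singular_boundary by blast
  have "Suc 2 = (3 :: nat)" by simp
  note d = d[unfolded this] and y = y[unfolded this]
  have "?E (real_chain (z - z')) = 0"
   using E3[of "real_chain y"] y by (simp add: real_chain_boundary_real_chain real_singular_chain_def keys_real_chain singular_chain_def)
  then have "?E (real_chain z') = 1 - real m" using Ez by (simp add: real_chain_diff evaluate_diff)
  moreover have "?E d - ?E (real_chain z') = 0" using E3[OF d(4)] unfolding d(5)[symmetric] evaluate_diff .
  ultimately have Ed: "?E d = 1 - real m" by simp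
  define T where "T = keys d"
  define l where "l = lookup d"
  have T: "finite T" "singular_simplex 2 X t" if "t \<in> T" for t using d(1) that by (auto simp: T_def real_singular_chain_def)
  have finT: "finite T" by (simp add: T_def)
  obtain n where n: "rel (rword a b m) (n t) (f (singular_face 2 2 t) @ f (singular_face 2 0 t) @ winv (f (singular_face 2 1 t)))"
   if "t \<in> T" for t
   using triangle[OF T(2)] unfolding r_def by metis
  have h: "(\<Sum>t\<in>T. l t * (h (singular_face 2 0 t) - h (singular_face 2 1 t) + h (singular_face 2 2 t))) = 0"
   for h :: "((nat \<Rightarrow> real) \<Rightarrow> 'x) \<Rightarrow> real"
  proof -
   have "evaluate h (real_chain_boundary 2 d) = 0" by (simp add: d(2) evaluate_def)
   then show ?thesis
    unfolding evaluate_boundary boundary_2 real_chain_diff real_chain_add evaluate_diff evaluate_add evaluate_frag_of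
    by (simp add: evaluate_def T_def l_def)
  qed
  have "2 * (1 - 1 / (real m - 1)) * \<bar>\<Sum>t\<in>T. l t * n t\<bar> \<le> (\<Sum>t\<in>T. \<bar>l t\<bar>)"
   by (rule real_cycle_bound[OF m ab finT n h])
  \<comment> \<open>By \<open>rel_triangle\<close>, \<open>(1 - m) * n\<close> is the cup product
    plus the coboundary of \<open>heis\<close>, and the latter vanishes on the cycle. So the degree
    times \<open>1 - m\<close> is the value of the cup product on the fundamental class, which is
    again \<open>1 - m\<close>.\<close>
  moreover have "(\<Sum>t\<in>T. l t * n t) = 1"
  proof -
   have "(1 - real m) * (\<Sum>t\<in>T. l t * n t) = (\<Sum>t\<in>T. l t * real_of_int ((1 - int m) * n t))"
    by (simp add: sum_distrib_left algebra_simps)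
   also have "\<dots> = (\<Sum>t\<in>T. l t * (real_of_int (heis a b (f (singular_face 2 0 t))) - real_of_int (heis a b (f (singular_face 2 1 t)))
     + real_of_int (heis a b (f (singular_face 2 2 t)))) + l t * cup a b f t)"
   proof (intro sum.cong refl)
    fix t assume "t \<in> T"
    have "real_of_int ((1 - int m) * n t) = real_of_int (heis a b (f (singular_face 2 0 t))) - real_of_int (heis a b (f (singular_face 2 1 t)))
     + real_of_int (heis a b (f (singular_face 2 2 t))) + cup a b f t"
     unfolding rel_triangle[OF ab n[OF \<open>t \<in> T\<close>]] by (simp add: cup_def)
    then show "l t * real_of_int ((1 - int m) * n t) = l t * (real_of_int (heis a b (f (singular_face 2 0 t)))
      - real_of_int (heis a b (f (singular_face 2 1 t))) + real_of_int (heis a b (f (singular_face 2 2 t)))) + l t * cup a b f t"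
     by (simp only: distrib_left)
   qed
   also have "\<dots> = ?E d" unfolding sum.distrib h[of "\<lambda>e. real_of_int (heis a b (f e))"] by (simp add: evaluate_def T_def l_def)
   finally have "(1 - real m) * (\<Sum>t\<in>T. l t * n t) = 1 - real m" using Ed by simp
   then show ?thesis using m by simp
  qed
  moreover have "(2 * real m - 4) / (real m - 1) = 2 * (1 - 1 / (real m - 1))" using m by (simp add: field_simps)
  ultimately show ?thesis by (simp add: l1_norm_def T_def l_def)
 qed
 have "real_chain z \<in> change_of_coefficients 2 X (fundamental_class {a, b} r X c)"
  unfolding change_of_coefficients_def fc
 proof (intro CollectI conjI bexI[of _ z] exI[of _ 0])
  show "real_singular_chain 2 X (real_chain z)" using zX(1) by (simp add: real_singular_chain_def keys_real_chain singular_chain_def)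
  show "real_chain_boundary 2 (real_chain z) = 0"
   unfolding real_chain_boundary_real_chain zX(2) by (rule poly_mapping_eqI) (simp add: lookup_real_chain)
  show "homologous_rel 2 X {} z z" by (rule homologous_rel_refl)
 qed (simp_all add: real_singular_chain_def real_chain_boundary_def real_chain_def)
 then show ?thesis
  unfolding simplicial_volume_def l1_seminorm_def by (intro cINF_greatest) (use bound in auto)
qed

end

lemma attaches_cells_above_continuous:
 assumes "attaches_cells_above k P X c"
 shows "continuous_map P X c"
proof -
 obtain Y where Y0: "homeomorphic_map P (Y k) c \<and> (\<forall>n \<ge> k. attaches_cells (Suc n) (Y n) (Y (Suc n))) \<and>
   topspace X = (\<Union>n \<in> {n. k \<le> n}. topspace (Y n)) \<and>
   (\<forall>C. closedin X C \<longleftrightarrow> C \<subseteq> topspace X \<and> (\<forall>n \<ge> k. closedin (Y n) (C \<inter> topspace (Y n))))"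
  using assms unfolding attaches_cells_above_def by (rule exE)
 note Y = conjunct1[OF Y0] conjunct1[OF conjunct2[OF conjunct2[OF Y0]]] conjunct2[OF conjunct2[OF conjunct2[OF Y0]], rule_format]
 have sub: "topspace (Y k) \<subseteq> topspace X" unfolding Y(2) by blast
 have "continuous_map (Y k) X id"
  unfolding continuous_map_closedin
 proof (intro conjI allI impI)
  show "closedin (Y k) {x \<in> topspace (Y k). id x \<in> C}" if "closedin X C" for C
  proof -
   have "{x \<in> topspace (Y k). id x \<in> C} = C \<inter> topspace (Y k)" by auto
   then show ?thesis using that Y(3) by simp
  qed
 qed (use sub in auto)
 from continuous_map_compose[OF homeomorphic_imp_continuous_map[OF Y(1)] this] show ?thesis by simp
qed

theorem proposition6p13:
  fixes a b :: 's and m :: nat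
  defines "F \<equiv> free_group {a, b}"
  defines "r \<equiv> commutator F (gen a) (gen b) \<otimes>\<^bsub>F\<^esub> commutator F (gen a) (gen b [^]\<^bsub>F\<^esub> (- int m))"
  assumes "a \<noteq> b" and "m \<ge> 2"
  shows "(2 * real m - 4) / (real m - 1) = 4 * (scl F r - 1 / 2) \<and>
    (\<forall>(X :: 'x topology) (c :: 's pc_point \<Rightarrow> 'x). one_relator_classifying_space {a, b} r X c \<longrightarrow>
      simplicial_volume {a, b} r X c \<le> (2 * real m - 4) / (real m - 1) \<and>
      (m \<in> {2, 3, 4} \<longrightarrow> simplicial_volume {a, b} r X c = (2 * real m - 4) / (real m - 1)) \<and>
      (m = 2 \<longrightarrow> simplicial_volume {a, b} r X c = 0) \<and>
      (m = 3 \<longrightarrow> simplicial_volume {a, b} r X c = 1) \<and>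
      (m = 4 \<longrightarrow> simplicial_volume {a, b} r X c = 4 / 3))"
proof -
 have m1: "m \<ge> 1" using assms(4) by simp
 have r: "r = rword a b m" unfolding r_def F_def by (rule relator_eq_rword(1)[OF assms(3) m1])
 have rF: "r \<in> carrier F" unfolding r F_def by (rule relator_eq_rword(2)[OF assms(3) m1])
 have "(2 * real m - 4) / (real m - 1) = 4 * (scl F r - 1 / 2)"
  unfolding r F_def scl_rword[OF assms(3,4)] using assms(4) by (simp add: field_simps)
 moreover have "simplicial_volume {a, b} r X c = (2 * real m - 4) / (real m - 1)"
  if X: "one_relator_classifying_space {a, b} r X c" for X :: "'x topology" and c :: "'s pc_point \<Rightarrow> 'x"
 proof -
  have cont: "continuous_map (presentation_complex {a, b} r) X c"
   using X attaches_cells_above_continuous by (auto simp: one_relator_classifying_space_def)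
  obtain \<phi> where "path_connected_space X" "\<phi> \<in> iso (one_relator_group {a, b} r) (fundamental_group X (c Vertex))"
   "\<And>s. s \<in> {a, b} \<Longrightarrow> \<phi> (normal_closure (free_group {a, b}) {r} #>\<^bsub>free_group {a, b}\<^esub> gen s) = loop_class X (c Vertex) (c \<circ> edge_map s)"
   using X by (auto simp: one_relator_classifying_space_def)
  from exists_labels[OF rF[unfolded F_def] cont this]
  obtain f where f: "\<And>s. singular_simplex 2 X s \<Longrightarrow>
    \<exists>n. rel r n (f (singular_face 2 2 s) @ f (singular_face 2 0 s) @ winv (f (singular_face 2 1 s)))"
   "\<And>s. s \<in> {a, b} \<Longrightarrow> \<exists>n. rel r n (f (simplex_map 1 c (es [(s, True)])) @ winv [(s, True)])"
   by blast
  show ?thesis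
   using simplicial_volume_upper[OF assms(3,4) r cont] simplicial_volume_lower[OF assms(3,4) r cont f] by simp
 qed
 ultimately show ?thesis by auto
qed

end
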